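(* Consider the Filippov system (with $0<\epsilon\ll 1$, upper signs for $v>0$, lower signs for $v<0$) $$\dot y=w,\quad \dot w=b(\theta,\phi)+p_\pm(\theta)F_N,\quad \dot\theta=\phi,\quad \dot\phi=c_\pm(\theta)F_N,\quad \dot v=a(\theta,\phi)+q_\pm(\theta)F_N,$$ with $F_N=\epsilon^{-1}[-\epsilon^{-1}y-\delta w]$, where the coefficients and the bracket $[\cdot]$ are as defined in the context. Let $(\theta_0,\phi_0)$ satisfy $$p_+(\theta_0)<0,\quad b(\theta_0,\phi_0)>0,\quad q_+(\theta_0)<0,\quad q_-(\theta_0)>0,\quad a(\theta_0,\phi_0)\neq0,$$ let $v_0>0$, and consider an initial condition $(y,w,\theta,\phi,v)=(0,\epsilon w_{10},\theta_0,\phi_0,v_0)$. Set $$w_{1*}\equiv-\lambda_-(\theta_0)\frac{b(\theta_0,\phi_0)}{p_+(\theta_0)}<0 .$$ (i) If $w_{10}<w_{1*}$, then the forward flow of the initial condition returns to $\{y=0\}$ after a time $\mathcal O(\epsilon\ln\epsilon^{-1})$ with $$w=e(\delta,\theta_0)v_0+o(1),\qquad \theta=\theta_0+o(1),$$ $$\phi=\phi_0+\left\{-\frac{c_+(\theta_0)}{q_+(\theta_0)}+\frac{S_\phi(\theta_0)}{S_w(\theta_0)}\left(e(\delta,\theta_0)+\frac{p_+(\theta_0)}{q_+(\theta_0)}\right)\right\}v_0+o(1),\qquad v=o(1),$$ as $\epsilon\to0$. During this time $y=\mathcal O(\epsilon)$ and $w=\mathcal O(1)$, so that $F_N=\mathcal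 O(\epsilon^{-1})$. The function $e(\delta,\theta_0)$ (defined in the context) is smooth and monotonic in $\delta$ and has the asymptotic expansions $$e(\delta,\theta_0)=\frac{p_-(\theta_0)-p_+(\theta_0)}{q_-(\theta_0)p_+(\theta_0)-q_+(\theta_0)p_-(\theta_0)}\,\delta^{-2}\left(1+\mathcal O(\delta^{-2}\ln\delta^{-1})\right)\quad\text{for }\delta\gg1,$$ $$e(\delta,\theta_0)=\sqrt{\frac{p_+(\theta_0)(p_-(\theta_0)-p_+(\theta_0))}{q_+(\theta_0)(q_-(\theta_0)-q_+(\theta_0))}}\left(1-\frac{\sqrt{S_w(\theta_0)}}{2}\left(\pi-\arctan\sqrt{-\frac{S_w(\theta_0)}{p_+(\theta_0)}}\right)\delta+\mathcal O(\delta^2)\right)\quad\text{for }\delta\ll1.$$ (ii) If $w_{10}>w_{1*}$, then lift-off (from $y=0$ into $y>0$) occurs directly after a time $\mathcal O(\epsilon)$ with $w=\mathcal O(\epsilon)$. During this period $y=\mathcal O(\epsilon^2)$, so $F_N=\mathcal O(1)$.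
   Context: Fixed parameters: $\alpha>0$, $\mu>0$, $\delta>0$. Coefficients: $a(\theta,\phi)=-\phi^2\cos\theta$, $b(\theta,\phi)=-1+\phi^2\sin\theta$, $q_\pm(\theta)=\alpha\sin\theta\cos\theta\mp\mu(1+\alpha\sin^2\theta)$, $p_\pm(\theta)=1+\alpha\cos^2\theta\mp\mu\alpha\sin\theta\cos\theta$, $c_\pm(\theta)=-\alpha(\cos\theta\mp\mu\sin\theta)$. Also $$S_w(\theta)=\frac{q_-p_+-q_+p_-}{q_--q_+}=\frac{1+\alpha}{1+\alpha\sin^2\theta},\qquad S_\phi(\theta)=\frac{q_-c_+-q_+c_-}{q_--q_+}=-\frac{\alpha\cos\theta}{1+\alpha\sin^2\theta},$$ $$\lambda_\pm(\theta)=-\frac{\delta p_+(\theta)}{2}\pm\frac12\sqrt{\delta^2p_+(\theta)^2-4p_+(\theta)}$$ (so $\lambda_-<0<\lambda_+$ when $p_+<0$). Bracket: for a function $f(y,w)$, $[f(y,w)]=0$ if $y>0$ and $[f(y,w)]=\max\{f(y,w),0\}$ if $y\le0$. The system is discontinuous across the switching manifold $\{v=0\}$; solutions are understood in the sense of Filippov (on $v=0$ the standard Filippov convex combination is used where the two vector fields both point towards $v=0$). Definition of $e$: at $\theta=\theta_0$ (argument suppressed) let $\xi_\pm=-\frac{\delta S_w}{2}\pm\frac12\sqrt{\delta^2S_w^2-4S_w}$ (possibly complex), let $\tau_s$ be the least positive solution of $e^{(\xi_+-\xi_-)\tau_s}=\dfrac{\xi_-^2(\lambda_+-\xi_+)}{\xi_+^2(\lambda_+-\xi_-)}$,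 and $$e(\delta,\theta_0)=\frac{\xi_+}{\xi_-}(\lambda_+-\xi_-)\frac{p_+}{q_+\lambda_+}e^{\xi_+\tau_s},$$ for $\delta\ne 2/\sqrt{S_w(\theta_0)}$, extended by continuity to $\delta=2/\sqrt{S_w(\theta_0)}$. *)

theory Defs
  imports "HOL-Analysis.Analysis" "HOL-Library.Landau_Symbols"
begin

text \<open>
  The parameter \<open>s\<close> encodes the subscript sign: \<open>s = 1\<close> gives the upper signs (subscript plus),
  \<open>s = -1\<close> the lower signs (subscript minus).
\<close>

definition coef_a :: "real \<Rightarrow> real \<Rightarrow> real" where
  "coef_a \<theta> \<phi> = - (\<phi>\<^sup>2 * cos \<theta>)"

definition coef_b :: "real \<Rightarrow> real \<Rightarrow> real" where
  "coef_b \<theta> \<phi> = - 1 + \<phi>\<^sup>2 * sin \<theta>"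

definition coef_q :: "real \<Rightarrow> real \<Rightarrow> real \<Rightarrow> real \<Rightarrow> real" where
  "coef_q \<alpha> \<mu> s \<theta> = \<alpha> * sin \<theta> * cos \<theta> - s * \<mu> * (1 + \<alpha> * (sin \<theta>)\<^sup>2)"

definition coef_p :: "real \<Rightarrow> real \<Rightarrow> real \<Rightarrow> real \<Rightarrow> real" where
  "coef_p \<alpha> \<mu> s \<theta> = 1 + \<alpha> * (cos \<theta>)\<^sup>2 - s * \<mu> * \<alpha> * sin \<theta> * cos \<theta>"

definition coef_c :: "real \<Rightarrow> real \<Rightarrow> real \<Rightarrow> real \<Rightarrow> real" where
  "coef_c \<alpha> \<mu> s \<theta> = - \<alpha> * (cos \<theta> - s * \<mu> * sin \<theta>)"

definition S_w :: "real \<Rightarrow> real \<Rightarrow> real \<Rightarrow> real" where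
  "S_w \<alpha> \<mu> \<theta> =
     (coef_q \<alpha> \<mu> (-1) \<theta> * coef_p \<alpha> \<mu> 1 \<theta> - coef_q \<alpha> \<mu> 1 \<theta> * coef_p \<alpha> \<mu> (-1) \<theta>)
     / (coef_q \<alpha> \<mu> (-1) \<theta> - coef_q \<alpha> \<mu> 1 \<theta>)"

definition S_phi :: "real \<Rightarrow> real \<Rightarrow> real \<Rightarrow> real" where
  "S_phi \<alpha> \<mu> \<theta> =
     (coef_q \<alpha> \<mu> (-1) \<theta> * coef_c \<alpha> \<mu> 1 \<theta> - coef_q \<alpha> \<mu> 1 \<theta> * coef_c \<alpha> \<mu> (-1) \<theta>)
     / (coef_q \<alpha> \<mu> (-1) \<theta> - coef_q \<alpha> \<mu> 1 \<theta>)"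

text \<open>In \<open>eigval\<close> the coefficient is always \<open>p\<^sub>+\<close>; the argument \<open>s\<close> is the sign of the root.\<close>

definition eigval :: "real \<Rightarrow> real \<Rightarrow> real \<Rightarrow> real \<Rightarrow> real \<Rightarrow> real" where
  "eigval \<alpha> \<mu> \<delta> s \<theta> = - (\<delta> * coef_p \<alpha> \<mu> 1 \<theta>) / 2
     + s * (1 / 2) * sqrt (\<delta>\<^sup>2 * (coef_p \<alpha> \<mu> 1 \<theta>)\<^sup>2 - 4 * coef_p \<alpha> \<mu> 1 \<theta>)"

definition w1_star :: "real \<Rightarrow> real \<Rightarrow> real \<Rightarrow> real \<Rightarrow> real \<Rightarrow> real" where
  "w1_star \<alpha> \<mu> \<delta> \<theta> \<phi> = - eigval \<alpha> \<mu> \<delta> (-1) \<theta> * (coef_b \<theta> \<phi> / coef_p \<alpha> \<mu> 1 \<theta>)"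

definition xi :: "real \<Rightarrow> real \<Rightarrow> real \<Rightarrow> real \<Rightarrow> real \<Rightarrow> complex" where
  "xi \<alpha> \<mu> \<delta> s \<theta> = complex_of_real (- (\<delta> * S_w \<alpha> \<mu> \<theta>) / 2)
     + complex_of_real (s / 2) * csqrt (complex_of_real (\<delta>\<^sup>2 * (S_w \<alpha> \<mu> \<theta>)\<^sup>2 - 4 * S_w \<alpha> \<mu> \<theta>))"

definition stick_time_eq :: "real \<Rightarrow> real \<Rightarrow> real \<Rightarrow> real \<Rightarrow> real \<Rightarrow> bool" where
  "stick_time_eq \<alpha> \<mu> \<delta> \<theta> \<tau> \<longleftrightarrow>
     (let xp = xi \<alpha> \<mu> \<delta> 1 \<theta>; xm = xi \<alpha> \<mu> \<delta> (-1) \<theta>;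
          lp = complex_of_real (eigval \<alpha> \<mu> \<delta> 1 \<theta>)
      in exp ((xp - xm) * complex_of_real \<tau>) = (xm\<^sup>2 * (lp - xp)) / (xp\<^sup>2 * (lp - xm)))"

definition tau_s :: "real \<Rightarrow> real \<Rightarrow> real \<Rightarrow> real \<Rightarrow> real" where
  "tau_s \<alpha> \<mu> \<delta> \<theta> = (LEAST \<tau>. 0 < \<tau> \<and> stick_time_eq \<alpha> \<mu> \<delta> \<theta> \<tau>)"

definition e_complex :: "real \<Rightarrow> real \<Rightarrow> real \<Rightarrow> real \<Rightarrow> complex" where
  "e_complex \<alpha> \<mu> \<delta> \<theta> =
     (let xp = xi \<alpha> \<mu> \<delta> 1 \<theta>; xm = xi \<alpha> \<mu> \<delta> (-1) \<theta>;
          lp = complex_of_real (eigval \<alpha> \<mu> \<delta> 1 \<theta>)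
      in xp / xm * (lp - xm)
         * (complex_of_real (coef_p \<alpha> \<mu> 1 \<theta>) / (complex_of_real (coef_q \<alpha> \<mu> 1 \<theta>) * lp))
         * exp (xp * complex_of_real (tau_s \<alpha> \<mu> \<delta> \<theta>)))"

text \<open>
  Away from \<open>\<delta> = 2 / sqrt S_w\<close> the expression \<open>e_complex\<close> is real (lemma \<open>e_complex_real\<close> below),
  so taking the real part only changes the type.
\<close>

definition e_fun :: "real \<Rightarrow> real \<Rightarrow> real \<Rightarrow> real \<Rightarrow> real" where
  "e_fun \<alpha> \<mu> \<delta> \<theta> =
     (if \<delta> = 2 / sqrt (S_w \<alpha> \<mu> \<theta>)
      then Lim (at \<delta>) (\<lambda>d. Re (e_complex \<alpha> \<mu> d \<theta>))
      else Re (e_complex \<alpha> \<mu> \<delta> \<theta>))"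

text \<open>Meaningful for open \<open>A\<close> only, where each iterated derivative on \<open>A\<close> depends on values in \<open>A\<close>.\<close>

definition smooth_on_open :: "real set \<Rightarrow> (real \<Rightarrow> real) \<Rightarrow> bool" where
  "smooth_on_open A f \<longleftrightarrow> open A \<and> (\<forall>n. \<forall>x\<in>A. (deriv ^^ n) f differentiable (at x))"

text \<open>
  \<open>X\<close> is the vector field on \<open>h > 0\<close> and \<open>Y\<close> the one on \<open>h < 0\<close>; on the switching manifold every convex
  combination is admissible.  Where \<open>X\<close> and \<open>Y\<close> both point towards \<open>h = 0\<close> this yields the sliding
  field, i.e. the convex combination tangent to \<open>h = 0\<close>; where they point to the same side it yields
  crossing.
\<close>

definition filippov_set ::
    "('a::euclidean_space \<Rightarrow> real) \<Rightarrow> ('a \<Rightarrow> 'a) \<Rightarrow> ('a \<Rightarrow> 'a) \<Rightarrow> 'a \<Rightarrow> 'a set" where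
  "filippov_set h X Y x =
     (if h x > 0 then {X x} else if h x < 0 then {Y x} else closed_segment (X x) (Y x))"

text \<open>
  An absolutely continuous curve is given as the indefinite Lebesgue integral of its
  (almost everywhere) derivative \<open>g\<close>.
\<close>

definition filippov_solution ::
    "('a::euclidean_space \<Rightarrow> real) \<Rightarrow> ('a \<Rightarrow> 'a) \<Rightarrow> ('a \<Rightarrow> 'a) \<Rightarrow> real \<Rightarrow> (real \<Rightarrow> 'a) \<Rightarrow> bool" where
  "filippov_solution h X Y L x \<longleftrightarrow>
     (\<exists>g. g absolutely_integrable_on {0..L}
        \<and> (\<forall>t\<in>{0..L}. x t = x 0 + integral {0..t} g)
        \<and> negligible {t\<in>{0..L}. g t \<notin> filippov_set h X Y (x t)})"

text \<open>States are \<open>(y, w, \<theta>, \<phi>, v)\<close>.\<close>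

type_synonym state = "real \<times> real \<times> real \<times> real \<times> real"

fun y_of :: "state \<Rightarrow> real" where "y_of (y, w, \<theta>, \<phi>, v) = y"
fun w_of :: "state \<Rightarrow> real" where "w_of (y, w, \<theta>, \<phi>, v) = w"
fun theta_of :: "state \<Rightarrow> real" where "theta_of (y, w, \<theta>, \<phi>, v) = \<theta>"
fun phi_of :: "state \<Rightarrow> real" where "phi_of (y, w, \<theta>, \<phi>, v) = \<phi>"
fun v_of :: "state \<Rightarrow> real" where "v_of (y, w, \<theta>, \<phi>, v) = v"

definition bracket :: "(real \<Rightarrow> real \<Rightarrow> real) \<Rightarrow> real \<Rightarrow> real \<Rightarrow> real" where
  "bracket f y w = (if y > 0 then 0 else max (f y w) 0)"

definition F_N :: "real \<Rightarrow> real \<Rightarrow> real \<Rightarrow> real \<Rightarrow> real" where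
  "F_N \<epsilon> \<delta> y w = (1 / \<epsilon>) * bracket (\<lambda>y w. - (1 / \<epsilon>) * y - \<delta> * w) y w"

fun vfield :: "real \<Rightarrow> real \<Rightarrow> real \<Rightarrow> real \<Rightarrow> real \<Rightarrow> state \<Rightarrow> state" where
  "vfield \<alpha> \<mu> \<delta> \<epsilon> s (y, w, \<theta>, \<phi>, v) =
     (w,
      coef_b \<theta> \<phi> + coef_p \<alpha> \<mu> s \<theta> * F_N \<epsilon> \<delta> y w,
      \<phi>,
      coef_c \<alpha> \<mu> s \<theta> * F_N \<epsilon> \<delta> y w,
      coef_a \<theta> \<phi> + coef_q \<alpha> \<mu> s \<theta> * F_N \<epsilon> \<delta> y w)"

definition forward_solution ::
    "real \<Rightarrow> real \<Rightarrow> real \<Rightarrow> real \<Rightarrow> state \<Rightarrow> real \<Rightarrow> (real \<Rightarrow> state) \<Rightarrow> bool" where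
  "forward_solution \<alpha> \<mu> \<delta> \<epsilon> x0 L x \<longleftrightarrow>
     x 0 = x0 \<and> filippov_solution v_of (vfield \<alpha> \<mu> \<delta> \<epsilon> 1) (vfield \<alpha> \<mu> \<delta> \<epsilon> (-1)) L x"

definition returns_at :: "real \<Rightarrow> (real \<Rightarrow> state) \<Rightarrow> real \<Rightarrow> bool" where
  "returns_at L x T \<longleftrightarrow>
     0 < T \<and> T \<le> L \<and> y_of (x T) = 0 \<and> (\<forall>t\<in>{0<..<T}. y_of (x t) < 0)"

text \<open>\<open>T = 0\<close> is allowed: it occurs when the initial \<open>w\<close> is nonnegative.\<close>

definition lifts_off_at :: "real \<Rightarrow> (real \<Rightarrow> state) \<Rightarrow> real \<Rightarrow> bool" where
  "lifts_off_at L x T \<longleftrightarrow>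
     0 \<le> T \<and> T < L \<and> y_of (x T) = 0 \<and> (\<forall>t\<in>{0..T}. y_of (x t) \<le> 0)
     \<and> (\<exists>s\<in>{T<..L}. \<forall>t\<in>{T<..s}. y_of (x t) > 0)"

lemma coef_q_diff: "coef_q \<alpha> \<mu> (-1) \<theta> - coef_q \<alpha> \<mu> 1 \<theta> = 2 * \<mu> * (1 + \<alpha> * (sin \<theta>)\<^sup>2)"
  by (simp add: coef_q_def)

lemma one_plus_pos: "0 < \<alpha> \<Longrightarrow> 0 < 1 + \<alpha> * (sin \<theta>)\<^sup>2" for \<alpha> \<theta> :: real
  by (simp add: add_pos_nonneg)

lemma S_w_eq:
  assumes "0 < \<alpha>" "0 < \<mu>"
  shows "S_w \<alpha> \<mu> \<theta> = (1 + \<alpha>) / (1 + \<alpha> * (sin \<theta>)\<^sup>2)"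
proof -
  have B: "0 < 1 + \<alpha> * (sin \<theta>)\<^sup>2" using assms one_plus_pos by blast
  have c: "(cos \<theta>)\<^sup>2 = 1 - (sin \<theta>)\<^sup>2" by (simp add: cos_squared_eq)
  have "coef_q \<alpha> \<mu> (-1) \<theta> * coef_p \<alpha> \<mu> 1 \<theta> - coef_q \<alpha> \<mu> 1 \<theta> * coef_p \<alpha> \<mu> (-1) \<theta>
      = 2 * \<mu> * ((1 + \<alpha> * (cos \<theta>)\<^sup>2) * (1 + \<alpha> * (sin \<theta>)\<^sup>2) - \<alpha>\<^sup>2 * (sin \<theta>)\<^sup>2 * (cos \<theta>)\<^sup>2)"
    unfolding coef_q_def coef_p_def by (simp add: power2_eq_square algebra_simps)
  also have "\<dots> = 2 * \<mu> * (1 + \<alpha>)"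
    unfolding c by (simp add: power2_eq_square algebra_simps)
  finally show ?thesis
    unfolding S_w_def coef_q_diff using B assms by (simp add: divide_simps)
qed

lemma S_phi_eq:
  assumes "0 < \<alpha>" "0 < \<mu>"
  shows "S_phi \<alpha> \<mu> \<theta> = - (\<alpha> * cos \<theta>) / (1 + \<alpha> * (sin \<theta>)\<^sup>2)"
proof -
  have B: "0 < 1 + \<alpha> * (sin \<theta>)\<^sup>2" using assms one_plus_pos by blast
  have "coef_q \<alpha> \<mu> (-1) \<theta> * coef_c \<alpha> \<mu> 1 \<theta> - coef_q \<alpha> \<mu> 1 \<theta> * coef_c \<alpha> \<mu> (-1) \<theta>
      = 2 * \<mu> * (- (\<alpha> * cos \<theta>))"
    unfolding coef_q_def coef_c_def by (simp add: power2_eq_square algebra_simps)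
  then show ?thesis
    unfolding S_phi_def coef_q_diff using B assms by (simp add: divide_simps)
qed

lemma S_w_pos: "0 < \<alpha> \<Longrightarrow> 0 < \<mu> \<Longrightarrow> 0 < S_w \<alpha> \<mu> \<theta>"
  by (simp add: S_w_eq one_plus_pos)

lemma eigval_pos:
  assumes "0 < \<delta>" "coef_p \<alpha> \<mu> 1 \<theta> < 0"
  shows "0 < eigval \<alpha> \<mu> \<delta> 1 \<theta>"
proof -
  have "0 < - (\<delta> * coef_p \<alpha> \<mu> 1 \<theta>)" using assms by (simp add: mult_pos_neg)
  moreover have "0 \<le> sqrt (\<delta>\<^sup>2 * (coef_p \<alpha> \<mu> 1 \<theta>)\<^sup>2 - 4 * coef_p \<alpha> \<mu> 1 \<theta>)"
  proof -
    have "0 \<le> \<delta>\<^sup>2 * (coef_p \<alpha> \<mu> 1 \<theta>)\<^sup>2" by simp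
    then have "0 \<le> \<delta>\<^sup>2 * (coef_p \<alpha> \<mu> 1 \<theta>)\<^sup>2 - 4 * coef_p \<alpha> \<mu> 1 \<theta>"
      using assms(2) by linarith
    then show ?thesis by simp
  qed
  ultimately show ?thesis unfolding eigval_def by linarith
qed

lemma least_exp_real:
  fixes k r :: real
  assumes "0 < k" "1 < r"
  shows "\<exists>\<tau>>0. exp (complex_of_real k * complex_of_real \<tau>) = complex_of_real r
     \<and> (\<forall>\<sigma>>0. exp (complex_of_real k * complex_of_real \<sigma>) = complex_of_real r \<longrightarrow> \<tau> \<le> \<sigma>)"
proof -
  have E: "exp (complex_of_real k * complex_of_real \<tau>) = complex_of_real r
      \<longleftrightarrow> exp (k * \<tau>) = r" for \<tau>
    by (metis exp_of_real of_real_eq_iff of_real_mult)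
  show ?thesis
  proof (intro exI[of _ "ln r / k"] conjI allI impI)
    show "0 < ln r / k" using assms by simp
    show "exp (complex_of_real k * complex_of_real (ln r / k)) = complex_of_real r"
      unfolding E using assms by simp
    fix \<sigma> assume "exp (complex_of_real k * complex_of_real \<sigma>) = complex_of_real r"
    then have "k * \<sigma> = ln r" unfolding E by (metis ln_exp)
    then show "ln r / k \<le> \<sigma>" using assms by (simp add: divide_simps mult.commute)
  qed
qed

lemma least_exp_imag:
  fixes k :: real and r :: complex
  assumes "0 < k" "norm r = 1"
  shows "\<exists>\<tau>>0. exp (\<i> * complex_of_real k * complex_of_real \<tau>) = r
     \<and> (\<forall>\<sigma>>0. exp (\<i> * complex_of_real k * complex_of_real \<sigma>) = r \<longrightarrow> \<tau> \<le> \<sigma>)"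
proof -
  define \<beta> where "\<beta> = (if Arg2pi r = 0 then 2 * pi else Arg2pi r)"
  have \<beta>: "0 < \<beta>" "\<beta> \<le> 2 * pi"
    using Arg2pi_ge_0[of r] Arg2pi_lt_2pi[of r] by (auto simp: \<beta>_def)
  have "r = exp (\<i> * complex_of_real (Arg2pi r))"
    using Arg2pi_eq[of r] assms by simp
  then have r: "r = exp (\<i> * complex_of_real \<beta>)"
    by (auto simp: \<beta>_def exp_eq_polar split: if_splits)
  show ?thesis
  proof (intro exI[of _ "\<beta> / k"] conjI allI impI)
    show "0 < \<beta> / k" using assms \<beta> by simp
    show "exp (\<i> * complex_of_real k * complex_of_real (\<beta> / k)) = r"
      unfolding r using assms by simp
    fix \<sigma> :: real assume \<sigma>: "0 < \<sigma>"
      and "exp (\<i> * complex_of_real k * complex_of_real \<sigma>) = r"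
    then obtain n :: int where
      "\<i> * complex_of_real k * complex_of_real \<sigma> = \<i> * complex_of_real \<beta> + (of_int (2 * n) * pi) * \<i>"
      unfolding r exp_eq by blast
    then have "Im (\<i> * complex_of_real k * complex_of_real \<sigma>)
        = Im (\<i> * complex_of_real \<beta> + (of_int (2 * n) * pi) * \<i>)" by simp
    then have n: "k * \<sigma> = \<beta> + 2 * real_of_int n * pi" by simp
    have "0 < k * \<sigma>" using assms \<sigma> by simp
    then have "0 < 2 * pi * (1 + real_of_int n)" using n \<beta> by (simp add: algebra_simps)
    then have "0 < 1 + real_of_int n" by (simp add: zero_less_mult_iff)
    then have "0 \<le> n" by linarith
    then have "\<beta> \<le> k * \<sigma>" using n by simp
    then show "\<beta> / k \<le> \<sigma>" using assms by (simp add: divide_simps mult.commute)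
  qed
qed

lemma xi_cases:
  assumes S: "0 < S_w \<alpha> \<mu> \<theta>" and d: "0 < \<delta>" "\<delta> \<noteq> 2 / sqrt (S_w \<alpha> \<mu> \<theta>)"
  obtains
    (real_roots) x z where "xi \<alpha> \<mu> \<delta> 1 \<theta> = complex_of_real x" "xi \<alpha> \<mu> \<delta> (-1) \<theta> = complex_of_real z"
      "z < x" "x < 0"
  | (conj_roots) h \<omega> where "xi \<alpha> \<mu> \<delta> 1 \<theta> = Complex (- h) \<omega>" "xi \<alpha> \<mu> \<delta> (-1) \<theta> = Complex (- h) (- \<omega>)"
      "0 < h" "0 < \<omega>"
proof -
  define S D where "S = S_w \<alpha> \<mu> \<theta>" and "D = \<delta>\<^sup>2 * S\<^sup>2 - 4 * S"
  have S0: "0 < S" using S by (simp add: S_def)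
  have xi: "xi \<alpha> \<mu> \<delta> s \<theta> = complex_of_real (- (\<delta> * S) / 2)
      + complex_of_real (s / 2) * csqrt (complex_of_real D)" for s
    by (simp add: xi_def S_def D_def)
  have "D \<noteq> 0"
  proof
    assume "D = 0"
    then have "S * (\<delta>\<^sup>2 * S - 4) = 0" by (simp add: D_def power2_eq_square algebra_simps)
    then have "\<delta>\<^sup>2 * S = 4" using S0 by simp
    then have "(\<delta> * sqrt S)\<^sup>2 = 2\<^sup>2" using S0 by (simp add: power_mult_distrib)
    then have "\<delta> * sqrt S = 2" using S0 d(1) power2_eq_imp_eq[of "\<delta> * sqrt S" 2] by simp
    then show False using d S0 by (simp add: S_def field_simps)
  qed
  then consider "0 < D" | "D < 0" by linarith
  then show thesis
  proof cases
    case 1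
    have "D < (\<delta> * S)\<^sup>2" using S0 by (simp add: D_def power_mult_distrib)
    then have "sqrt D < \<delta> * S" using S0 d(1) by (simp add: real_less_lsqrt)
    then show thesis
      using 1 by (intro real_roots[of "- (\<delta> * S) / 2 + sqrt D / 2" "- (\<delta> * S) / 2 - sqrt D / 2"])
        (auto simp: xi complex_eq_iff simp del: csqrt.simps)
  next
    case 2
    then have "csqrt (complex_of_real D) = \<i> * complex_of_real (sqrt (- D))"
      by (simp del: csqrt.simps)
    then show thesis
      using 2 S0 d(1)
      by (intro conj_roots[of "\<delta> * S / 2" "sqrt (- D) / 2"])
        (auto simp: xi complex_eq_iff simp del: csqrt.simps)
  qed
qed

lemma tau_s_exists:
  assumes "0 < \<alpha>" "0 < \<mu>" "0 < \<delta>" "coef_p \<alpha> \<mu> 1 \<theta> < 0" "\<delta> \<noteq> 2 / sqrt (S_w \<alpha> \<mu> \<theta>)"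
  shows "\<exists>\<tau>>0. stick_time_eq \<alpha> \<mu> \<delta> \<theta> \<tau> \<and> (\<forall>\<sigma>>0. stick_time_eq \<alpha> \<mu> \<delta> \<theta> \<sigma> \<longrightarrow> \<tau> \<le> \<sigma>)"
proof -
  define l where "l = eigval \<alpha> \<mu> \<delta> 1 \<theta>"
  have l: "0 < l" using eigval_pos assms by (simp add: l_def)
  have S: "0 < S_w \<alpha> \<mu> \<theta>" using S_w_pos assms by simp
  from S assms(3) assms(5) show ?thesis
  proof (cases rule: xi_cases)
    case (real_roots x z)
    define r where "r = z\<^sup>2 * (l - x) / (x\<^sup>2 * (l - z))"
    have "x\<^sup>2 * l < z\<^sup>2 * l"
      using real_roots l by (simp add: abs_le_square_iff[symmetric] not_le[symmetric])
    moreover have "0 < x * z * (x - z)" using real_roots by (simp add: mult_neg_neg)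
    ultimately have "x\<^sup>2 * (l - z) < z\<^sup>2 * (l - x)"
      by (simp add: power2_eq_square algebra_simps)
    moreover have "0 < x\<^sup>2 * (l - z)" using real_roots l by simp
    ultimately have "1 < r" by (simp add: r_def)
    then show ?thesis
      using least_exp_real[of "x - z" r] real_roots
      by (simp add: stick_time_eq_def Let_def l_def[symmetric] r_def)
  next
    case (conj_roots h \<omega>)
    define r where "r = ((Complex (- h) (- \<omega>))\<^sup>2 * (complex_of_real l - Complex (- h) \<omega>))
        / ((Complex (- h) \<omega>)\<^sup>2 * (complex_of_real l - Complex (- h) (- \<omega>)))"
    have "cmod (complex_of_real l - Complex (- h) \<omega>) = cmod (complex_of_real l - Complex (- h) (- \<omega>))"
      by (simp add: cmod_def)
    moreover have "cmod (Complex (- h) \<omega>) = cmod (Complex (- h) (- \<omega>))" by (simp add: cmod_def)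
    moreover have "complex_of_real l - Complex (- h) (- \<omega>) \<noteq> 0" "Complex (- h) (- \<omega>) \<noteq> 0"
      using conj_roots by (auto simp: complex_eq_iff)
    ultimately have "cmod r = 1" by (simp add: r_def norm_mult norm_divide norm_power)
    moreover have "Complex (- h) \<omega> - Complex (- h) (- \<omega>) = \<i> * complex_of_real (2 * \<omega>)"
      by (simp add: complex_eq_iff)
    ultimately show ?thesis
      using least_exp_imag[of "2 * \<omega>" r] conj_roots
      by (simp add: stick_time_eq_def Let_def l_def[symmetric] r_def)
  qed
qed

lemma tau_s_solves:
  assumes "0 < \<alpha>" "0 < \<mu>" "0 < \<delta>" "coef_p \<alpha> \<mu> 1 \<theta> < 0" "\<delta> \<noteq> 2 / sqrt (S_w \<alpha> \<mu> \<theta>)"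
  shows "0 < tau_s \<alpha> \<mu> \<delta> \<theta> \<and> stick_time_eq \<alpha> \<mu> \<delta> \<theta> (tau_s \<alpha> \<mu> \<delta> \<theta>)"
proof -
  obtain \<tau> where "0 < \<tau>" "stick_time_eq \<alpha> \<mu> \<delta> \<theta> \<tau>"
    "\<forall>\<sigma>>0. stick_time_eq \<alpha> \<mu> \<delta> \<theta> \<sigma> \<longrightarrow> \<tau> \<le> \<sigma>"
    using tau_s_exists[OF assms] by blast
  moreover from this have "tau_s \<alpha> \<mu> \<delta> \<theta> = \<tau>"
    unfolding tau_s_def by (intro Least_equality) auto
  ultimately show ?thesis by simp
qed

lemma e_complex_real:
  assumes "0 < \<alpha>" "0 < \<mu>" "0 < \<delta>" "coef_p \<alpha> \<mu> 1 \<theta> < 0" "\<delta> \<noteq> 2 / sqrt (S_w \<alpha> \<mu> \<theta>)"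
  shows "e_complex \<alpha> \<mu> \<delta> \<theta> \<in> \<real>"
proof -
  define l where "l = complex_of_real (eigval \<alpha> \<mu> \<delta> 1 \<theta>)"
  define t where "t = complex_of_real (tau_s \<alpha> \<mu> \<delta> \<theta>)"
  define K where "K = complex_of_real (coef_p \<alpha> \<mu> 1 \<theta>) / (complex_of_real (coef_q \<alpha> \<mu> 1 \<theta>) * l)"
  have S: "0 < S_w \<alpha> \<mu> \<theta>" using S_w_pos assms by simp
  from S assms(3) assms(5) show ?thesis
  proof (cases rule: xi_cases)
    case (real_roots x z)
    then show ?thesis by (simp add: e_complex_def Let_def flip: exp_of_real of_real_mult)
  next
    case (conj_roots h \<omega>)
    define x z where "x = Complex (- h) \<omega>" and "z = Complex (- h) (- \<omega>)"
    have cnj: "cnj x = z" "cnj z = x" "cnj l = l" "cnj t = t" "cnj K = K"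
      by (simp_all add: x_def z_def l_def t_def K_def complex_eq_iff)
    have nz: "x \<noteq> 0" "z \<noteq> 0" "l - z \<noteq> 0" "l - x \<noteq> 0"
      using conj_roots by (auto simp: x_def z_def l_def complex_eq_iff)
    have "exp ((x - z) * t) = (z\<^sup>2 * (l - x)) / (x\<^sup>2 * (l - z))"
      using tau_s_solves[OF assms] conj_roots
      by (simp add: stick_time_eq_def Let_def x_def z_def l_def t_def)
    then have "exp (x * t) = exp (z * t) * ((z\<^sup>2 * (l - x)) / (x\<^sup>2 * (l - z)))"
      by (simp add: left_diff_distrib exp_diff field_simps)
    then have *: "x / z * (l - z) * exp (x * t) = z / x * (l - x) * exp (z * t)"
      using nz by (simp add: power2_eq_square field_simps)
    have e: "e_complex \<alpha> \<mu> \<delta> \<theta> = K * (x / z * (l - z) * exp (x * t))"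
      unfolding e_complex_def Let_def conj_roots(1,2) x_def[symmetric] z_def[symmetric]
        l_def[symmetric] t_def[symmetric] K_def[symmetric]
      by (simp only: mult_ac)
    have "cnj (K * (x / z * (l - z) * exp (x * t))) = K * (z / x * (l - x) * exp (z * t))"
      by (simp add: cnj exp_cnj)
    then show ?thesis by (simp only: Reals_cnj_iff e *)
  qed
qed

end

theory Submission
  imports Defs "HOL-Complex_Analysis.Complex_Analysis" "HOL-Real_Asymp.Real_Asymp"
begin

text \<open>In the fast time \<open>t / \<epsilon>\<close> with \<open>Y = y / \<epsilon>\<close> the coefficients freeze at \<open>\<theta>\<^sub>0\<close> and the
  contact force becomes \<open>max (- Y - \<delta> w) 0\<close>. While \<open>v > 0\<close> the pair \<open>(Y, w)\<close> sees a saddle with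
  eigenvalues \<open>\<lambda>\<^sub>\<plusminus>\<close> and a forcing \<open>\<epsilon> b\<close>; \<open>w\<^sub>1\<^sub>*\<close> marks its stable manifold. Below it the orbit needs a time
  of order \<open>ln (1 / \<epsilon>)\<close> to leave along \<open>w = \<lambda>\<^sub>+ Y\<close>, and as \<open>w - (p\<^sub>+ / q\<^sub>+) v\<close> and \<open>\<phi> - (c\<^sub>+ / q\<^sub>+) v\<close> are
  almost conserved, \<open>v\<close> vanishes when \<open>w\<close> is near \<open>- (p\<^sub>+ / q\<^sub>+) v\<^sub>0\<close>. From then on the opposite signs of \<open>q\<^sub>\<plusminus>\<close>
  trap \<open>v\<close> near \<open>0\<close>, so the combination \<open>w - \<kappa> v\<close>, in which the sign of the friction cancels, follows the linear
  sticking motion \<open>w' = S\<^sub>w max (- Y - \<delta> w) 0\<close> up to a Gronwall error. The ratio \<open>z = - w / Y\<close> of this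
  motion solves a Riccati equation with no equilibrium in the relevant range; its transit time yields a
  formula for \<open>e\<close> that is free of complex roots and hence uniform in \<open>\<delta>\<close>. Above \<open>w\<^sub>1\<^sub>*\<close> the unstable
  coordinate grows instead and turns \<open>w\<close> positive after a time of order \<open>\<epsilon>\<close>.\<close>

section \<open>The restitution function\<close>

text \<open>The slip phase lasts a fast time of order ln (1 / epsilon), so perturbations must be
  controlled on long intervals. All of them carry a factor epsilon or come from the drift of theta;
  one number \<open>et\<close>, which only has to exceed a multiple of epsilon times the fast
  duration plus 1, dominates them, and each phase is compared with a frozen motion up to an error
  \<open>C * et\<close>. The Filippov weight on v = 0 is merely measurable and the claims concern
  every solution, so the estimates use only its range and its relation to the sign of v. Existence
  meets a second discontinuity: the bracket jumps across y = 0 where w < 0. It agrees with a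
  continuous function on states with y \<le> 0 or w \<ge> 0, and truncation makes the field bounded.
  The estimates are proved for the truncated problem; they show both that its solutions are genuine
  and that every genuine solution behaves as claimed. The integral formula for e extends
  holomorphically in delta, and smoothness is read off from this extension.\<close>

definition quad :: "real \<Rightarrow> real \<Rightarrow> real \<Rightarrow> real" where
  "quad S d z = z^2 - d * S * z + S"

text \<open>\<open>quad\<close> is the product (z + xi_+) (z + xi_-), and the integral is the time
  that z' = quad needs to go from -l to z. The start -l is where slip ends, on w = l Y; at z = 1 / d
  the contact force - Y (1 - d z) vanishes.\<close>

definition stick_clock :: "real \<Rightarrow> real \<Rightarrow> real \<Rightarrow> real \<Rightarrow> real" where
  "stick_clock S d l z = integral {- l..z} (\<lambda>x. 1 / quad S d x)"

text \<open>Up to the end of contact the Riccati equation has no equilibrium: \<open>quad\<close> is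
  z^2 plus S (1 - d z), two nonnegative terms that do not vanish together. No discriminant is
  involved, so all damping regimes are covered.\<close>

lemma quad_pos:
  assumes "0 < S" "0 < d" "z \<le> 1 / d"
  shows "0 < quad S d z"
proof -
  have "d * z \<le> 1" using assms by (simp add: field_simps)
  then have "0 \<le> S * (1 - d * z)" using assms by simp
  moreover have "quad S d z = z^2 + S * (1 - d * z)" by (simp add: quad_def algebra_simps)
  moreover have "z^2 > 0 \<or> z = 0" by simp
  ultimately show ?thesis using assms by (metis add_pos_nonneg less_eq_real_def mult_zero_right add_0 diff_zero mult.right_neutral power_zero_numeral)
qed

lemma continuous_on_quad_inverse:
  assumes "0 < S" "0 < d"
  shows "continuous_on {a..1 / d} (\<lambda>x. 1 / quad S d x)"
proof -
  have "quad S d x \<noteq> 0" if "x \<in> {a..1/d}" for x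
    using quad_pos[OF assms, of x] that by auto
  then show ?thesis unfolding quad_def by (intro continuous_intros) auto
qed

lemma stick_clock_deriv:
  assumes "0 < S" "0 < d" "z \<in> {- l..1 / d}"
  shows "(stick_clock S d l has_real_derivative 1 / quad S d z) (at z within {- l..1 / d})"
  using integral_has_real_derivative[OF continuous_on_quad_inverse[OF assms(1,2)] assms(3)]
  by (simp add: stick_clock_def[abs_def])

lemma quad_deriv: "(quad S d has_real_derivative 2 * z - d * S) (at z within A)"
  unfolding quad_def[abs_def] by (auto intro!: derivative_eq_intros)

text \<open>This is the exponentiated partial fraction integral of 1 / quad. Stated as the constancy
  of a function, it needs no complex logarithm and no choice of branch, and does not distinguish
  real from conjugate roots.\<close>

lemma exp_stick_clock:
  fixes x1 x2 :: complex
  assumes S: "0 < S" "0 < d" and z: "z \<in> {- l..1 / d}"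
    and sum: "x1 + x2 = - of_real (d * S)" and prod: "x1 * x2 = of_real S"
  shows "exp (x1 * of_real (stick_clock S d l z)) * (x2 - of_real l) * of_real (sqrt (quad S d z))
    = (of_real z + x2) * of_real (exp (- (d * S / 2) * stick_clock S d l z) * sqrt (quad S d (- l)))"
proof -
  let ?T = "stick_clock S d l" and ?Q = "quad S d" and ?A = "{- l..1 / d}"
  \<comment> \<open>With Q = (z + x1) (z + x2), the logarithmic derivative of \<open>f\<close> is (-
    (x1 + d S / 2) + (z + x1) - (z - d S / 2)) / Q, which is 0.\<close>
  define f where "f = (\<lambda>z. exp (- (x1 + of_real (d * S / 2)) * of_real (?T z)) * ((of_real z + x2) * of_real (1 / sqrt (?Q z))))"
  have "(f has_vector_derivative 0) (at z within ?A)" if "z \<in> ?A" for z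
  proof -
    define Q where "Q = ?Q z"
    have Q: "0 < Q" using quad_pos[OF S] that by (auto simp: Q_def)
    have Qc: "(of_real Q :: complex) = (of_real z + x1) * (of_real z + x2)"
    proof -
      have "(of_real z + x1) * (of_real z + x2) = (of_real z)^2 + (x1 + x2) * of_real z + x1 * x2"
        by (simp add: power2_eq_square algebra_simps)
      also have "\<dots> = of_real Q" unfolding sum prod Q_def quad_def by simp
      finally show ?thesis by simp
    qed
    have Td: "(?T has_real_derivative 1 / Q) (at z within ?A)"
      using stick_clock_deriv[OF S that] by (simp add: Q_def)
    have "((\<lambda>z. of_real (?T z)) has_vector_derivative (of_real (1 / Q) :: complex)) (at z within ?A)"
      by (rule has_vector_derivative_of_real[OF Td])
    then have "((\<lambda>z. - (x1 + of_real (d * S / 2)) * of_real (?T z)) has_vector_derivative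
        (- (x1 + of_real (d * S / 2)) * of_real (1 / Q))) (at z within ?A)"
      by (rule has_vector_derivative_mult_right)
    from field_vector_diff_chain_within[OF this DERIV_subset[OF DERIV_exp subset_UNIV]]
    have d1: "((\<lambda>z. exp (- (x1 + of_real (d * S / 2)) * of_real (?T z))) has_vector_derivative
        (- (x1 + of_real (d * S / 2)) * of_real (1 / Q)) * exp (- (x1 + of_real (d * S / 2)) * of_real (?T z))) (at z within ?A)"
      by (simp add: o_def)
    have "((\<lambda>z. 1 / sqrt (?Q z)) has_real_derivative (- (2 * z - d * S) / (2 * Q * sqrt Q))) (at z within ?A)"
      using Q unfolding Q_def
      by (auto intro!: derivative_eq_intros quad_deriv simp: field_simps)
    then have d2: "((\<lambda>z. of_real (1 / sqrt (?Q z))) has_vector_derivative (of_real (- (2 * z - d * S) / (2 * Q * sqrt Q)) :: complex)) (at z within ?A)"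
      by (rule has_vector_derivative_of_real)
    have "((\<lambda>z. of_real z) has_vector_derivative (of_real 1 :: complex)) (at z within ?A)"
      by (intro has_vector_derivative_of_real) auto
    then have d3: "((\<lambda>z. of_real z + x2) has_vector_derivative (1 :: complex)) (at z within ?A)"
      using has_vector_derivative_add[OF _ has_vector_derivative_const[of x2]] by fastforce
    have sq: "of_real Q = (of_real (sqrt Q) :: complex) * of_real (sqrt Q)"
      using Q by (simp flip: of_real_mult)
    have sq0: "(of_real (sqrt Q) :: complex) \<noteq> 0" using Q by simp
    have x1e: "x1 = - of_real (d * S) - x2" using sum by (simp add: algebra_simps eq_neg_iff_add_eq_0)
    let ?E = "exp (- (x1 + of_real (d * S / 2)) * of_real (?T z))"
    have "(- (x1 + of_real (d * S / 2)) * of_real (1 / Q)) * ((of_real z + x2) * of_real (1 / sqrt Q))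
       + (of_real z + x2) * of_real (- (2 * z - d * S) / (2 * Q * sqrt Q)) + of_real (1 / sqrt Q)
       = (of_real Q - (of_real z + x1) * (of_real z + x2)) / (of_real Q * of_real (sqrt Q))"
      using Q by (simp add: field_simps)
    also have "\<dots> = 0" using Qc by simp
    finally have zero: "(- (x1 + of_real (d * S / 2)) * of_real (1 / Q)) * ((of_real z + x2) * of_real (1 / sqrt Q))
       + (of_real z + x2) * of_real (- (2 * z - d * S) / (2 * Q * sqrt Q)) + of_real (1 / sqrt Q) = 0" .
    have "(f has_vector_derivative ?E * ((of_real z + x2) * of_real (- (2 * z - d * S) / (2 * Q * sqrt Q)) + 1 * of_real (1 / sqrt Q))
        + ((- (x1 + of_real (d * S / 2)) * of_real (1 / Q)) * ?E) * ((of_real z + x2) * of_real (1 / sqrt Q))) (at z within ?A)"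
      unfolding f_def Q_def
      by (rule has_vector_derivative_mult[OF d1[unfolded Q_def] has_vector_derivative_mult[OF d3 d2[unfolded Q_def]]])
    also have "?E * ((of_real z + x2) * of_real (- (2 * z - d * S) / (2 * Q * sqrt Q)) + 1 * of_real (1 / sqrt Q))
        + ((- (x1 + of_real (d * S / 2)) * of_real (1 / Q)) * ?E) * ((of_real z + x2) * of_real (1 / sqrt Q))
      = ?E * ((- (x1 + of_real (d * S / 2)) * of_real (1 / Q)) * ((of_real z + x2) * of_real (1 / sqrt Q))
       + (of_real z + x2) * of_real (- (2 * z - d * S) / (2 * Q * sqrt Q)) + of_real (1 / sqrt Q))"
      by (simp only: distrib_left distrib_right mult_1_left mult_ac add_ac)
    also have "\<dots> = 0" unfolding zero by simp
    finally show ?thesis .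
  qed
  then obtain c where c: "\<And>x. x \<in> ?A \<Longrightarrow> f x = c"
    using has_vector_derivative_zero_constant[of ?A f] by auto
  have "- l \<in> ?A" using z by auto
  then have "f z = f (- l)" using c z by metis
  moreover have "f (- l) = (x2 - of_real l) * of_real (1 / sqrt (?Q (- l)))"
    by (simp add: f_def stick_clock_def)
  ultimately have *: "f z = (x2 - of_real l) * of_real (1 / sqrt (?Q (- l)))" by simp
  have Qz: "0 < ?Q z" "0 < ?Q (- l)" using quad_pos[OF S] z by auto
  have "exp (x1 * of_real (?T z)) * (exp (- (x1 + of_real (d * S / 2)) * of_real (?T z))) = of_real (exp (- (d * S / 2) * ?T z))"
    by (simp flip: exp_add exp_of_real add: algebra_simps)
  then have **: "exp (x1 * of_real (?T z)) * f z = of_real (exp (- (d * S / 2) * ?T z)) * ((of_real z + x2) * of_real (1 / sqrt (?Q z)))"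
    unfolding f_def by (simp only: mult.assoc[symmetric])
  show ?thesis
    using ** Qz unfolding * by (simp add: field_simps)
qed

section \<open>Root relations for the eigenvalues and for xi\<close>

lemma eigval_square:
  assumes "coef_p al mu 1 th < 0"
  shows "(eigval al mu d 1 th)^2 = - coef_p al mu 1 th * (1 + d * eigval al mu d 1 th)"
proof -
  define p where "p = coef_p al mu 1 th"
  have "0 \<le> d^2 * p^2 - 4 * p" using assms by (simp add: p_def) (smt (verit) zero_le_power2 mult_nonneg_nonneg)
  then have "(sqrt (d^2 * p^2 - 4 * p))^2 = d^2 * p^2 - 4 * p" by simp
  then show ?thesis unfolding eigval_def p_def[symmetric]
    by (simp add: power2_eq_square field_simps)
qed

lemma xi_sum: "xi al mu d 1 th + xi al mu d (-1) th = - of_real (d * S_w al mu th)"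
  by (simp add: xi_def del: csqrt.simps)

lemma xi_diff_square:
  "(xi al mu d 1 th - xi al mu d (-1) th)^2 = of_real (d^2 * (S_w al mu th)^2 - 4 * S_w al mu th)"
proof -
  have "xi al mu d 1 th - xi al mu d (-1) th = csqrt (of_real (d^2 * (S_w al mu th)^2 - 4 * S_w al mu th))"
    by (simp add: xi_def del: csqrt.simps)
  then show ?thesis by (simp only: power2_csqrt)
qed

lemma xi_prod: "xi al mu d 1 th * xi al mu d (-1) th = of_real (S_w al mu th)"
proof -
  have "4 * (xi al mu d 1 th * xi al mu d (-1) th)
    = (xi al mu d 1 th + xi al mu d (-1) th)^2 - (xi al mu d 1 th - xi al mu d (-1) th)^2"
    by (simp add: power2_eq_square algebra_simps)
  also have "\<dots> = 4 * of_real (S_w al mu th)"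
    unfolding xi_sum xi_diff_square by (simp add: power_mult_distrib)
  finally show ?thesis by simp
qed

lemma xi_distinct:
  assumes "0 < S_w al mu th" "0 < d" "d \<noteq> 2 / sqrt (S_w al mu th)"
  shows "xi al mu d 1 th \<noteq> xi al mu d (-1) th"
proof
  define S where "S = S_w al mu th"
  assume "xi al mu d 1 th = xi al mu d (-1) th"
  then have "of_real (d^2 * S^2 - 4 * S) = (0 :: complex)"
    using xi_diff_square[of al mu d th] by (simp add: S_def)
  then have "S * (d^2 * S - 4) = 0" by (simp only: of_real_eq_0_iff) (simp add: power2_eq_square algebra_simps)
  then have "d^2 * S = 4" using assms by (simp add: S_def)
  then have "(d * sqrt S)^2 = 2^2" using assms by (simp add: power_mult_distrib S_def)
  then have "d * sqrt S = 2" using assms power2_eq_imp_eq[of "d * sqrt S" 2] by (simp add: S_def)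
  then show False using assms by (simp add: S_def field_simps)
qed

text \<open>At -l the damping enters only through 1 + d l, which the eigenvalue equation expresses
  by l^2. This value at the start of the clock produces the square root in
  \<open>e_real\<close>.\<close>

lemma quad_neg_root:
  assumes "l^2 = - p * (1 + d * l)" "p < (0::real)"
  shows "quad S d (- l) = (S - p) / (- p) * l^2"
proof -
  have "1 + d * l = l^2 / (- p)" using assms by (simp add: field_simps)
  moreover have "quad S d (- l) = l^2 + S * (1 + d * l)" by (simp add: quad_def algebra_simps)
  ultimately show ?thesis using assms(2) by (simp add: diff_divide_distrib left_diff_distrib)
qed

lemma continuous_on_stick_clock:
  assumes "0 < S" "0 < d"
  shows "continuous_on {- l..1 / d} (stick_clock S d l)"
  by (rule DERIV_continuous_on[OF stick_clock_deriv[OF assms]])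

lemma stick_clock_strict_mono:
  assumes "0 < S" "0 < d" "- l \<le> a" "a < b" "b \<le> 1 / d"
  shows "stick_clock S d l a < stick_clock S d l b"
proof (rule DERIV_pos_imp_increasing_open[OF assms(4)])
  fix x assume x: "a < x" "x < b"
  then have "x \<in> {- l<..<1 / d}" using assms by auto
  then have "(stick_clock S d l has_real_derivative 1 / quad S d x) (at x)"
    using stick_clock_deriv[OF assms(1,2), of x l] at_within_interior[of x "{- l..1 / d}"] by auto
  then show "\<exists>y. (stick_clock S d l has_real_derivative y) (at x) \<and> 0 < y"
    using quad_pos[OF assms(1,2), of x] x assms by force
next
  show "continuous_on {a..b} (stick_clock S d l)"
    by (rule continuous_on_subset[OF continuous_on_stick_clock[OF assms(1,2)]]) (use assms in auto)
qed

lemma stick_clock_start: "stick_clock S d l (- l) = 0"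
  by (simp add: stick_clock_def)

text \<open>Dividing \<open>exp_stick_clock\<close> for x1 by the same identity for x2 removes the
  real factors and leaves a Moebius expression in z. Equating it with the given quotient reduces to
  (x1 - x2) (S - d S z) = 0, so the end of contact is the only solution on the clock's
  range.\<close>

lemma stick_time_eq_clock:
  fixes x1 x2 :: complex
  assumes S: "0 < S" "0 < d" "0 < l" and z: "z \<in> {- l..1 / d}"
    and sum: "x1 + x2 = - of_real (d * S)" and prod: "x1 * x2 = of_real S" and ne: "x1 \<noteq> x2"
  shows "exp ((x1 - x2) * of_real (stick_clock S d l z))
      = (x2^2 * (of_real l - x1)) / (x1^2 * (of_real l - x2)) \<longleftrightarrow> z = 1 / d"
proof -
  let ?l = "of_real l :: complex" and ?z = "of_real z :: complex" and ?T = "of_real (stick_clock S d l z) :: complex"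
  have Q: "of_real (quad S d t) = (of_real t + x1) * (of_real t + x2)" for t
  proof -
    have "(of_real t + x1) * (of_real t + x2) = (of_real t)^2 + (x1 + x2) * of_real t + x1 * x2"
      by (simp add: power2_eq_square algebra_simps)
    then show ?thesis unfolding sum prod by (simp add: quad_def)
  qed
  have pos: "0 < quad S d z" "0 < quad S d (- l)"
    using quad_pos[OF S(1,2)] z by auto
  have nz: "?z + x1 \<noteq> 0" "?z + x2 \<noteq> 0" "?l - x1 \<noteq> 0" "?l - x2 \<noteq> 0" "x1 \<noteq> 0" "x2 \<noteq> 0"
    using Q[of z] Q[of "- l"] pos prod S by (auto simp: add_eq_0_iff eq_diff_eq)
  define R where "R = (of_real (exp (- (d * S / 2) * stick_clock S d l z) * sqrt (quad S d (- l))) :: complex)"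
  define s where "s = (of_real (sqrt (quad S d z)) :: complex)"
  have Rs: "R \<noteq> 0" "s \<noteq> 0" using pos by (auto simp: R_def s_def)
  have e1: "exp (x1 * ?T) * (x2 - ?l) * s = (?z + x2) * R"
    unfolding R_def s_def by (rule exp_stick_clock[OF S(1,2) z sum prod])
  have e2: "exp (x2 * ?T) * (x1 - ?l) * s = (?z + x1) * R"
    unfolding R_def s_def by (rule exp_stick_clock[OF S(1,2) z]) (use sum prod in \<open>simp_all add: add.commute mult.commute\<close>)
  have "exp ((x1 - x2) * ?T) = exp (x1 * ?T) / exp (x2 * ?T)" by (simp add: left_diff_distrib exp_diff)
  also have "\<dots> = ((?z + x2) * R / ((x2 - ?l) * s)) / ((?z + x1) * R / ((x1 - ?l) * s))"
  proof -
    have "exp (x1 * ?T) = (?z + x2) * R / ((x2 - ?l) * s)" using e1 nz Rs by (simp add: field_simps)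
    moreover have "exp (x2 * ?T) = (?z + x1) * R / ((x1 - ?l) * s)" using e2 nz Rs by (simp add: field_simps)
    ultimately show ?thesis by simp
  qed
  also have "\<dots> = ((?z + x2) * (?l - x1)) / ((?z + x1) * (?l - x2))"
  proof -
    have "(a * R / (b * s)) / (c * R / (e * s)) = (a * e) / (c * b)" for a b c e :: complex
      using Rs by simp
    then show ?thesis by (simp add: minus_diff_eq[of x1, symmetric] minus_diff_eq[of x2, symmetric] del: minus_diff_eq)
  qed
  finally have E: "exp ((x1 - x2) * ?T) = ((?z + x2) * (?l - x1)) / ((?z + x1) * (?l - x2))" .
  have "exp ((x1 - x2) * ?T) = (x2^2 * (?l - x1)) / (x1^2 * (?l - x2))
      \<longleftrightarrow> (?z + x2) * x1^2 = x2^2 * (?z + x1)"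
  proof -
    have "(a * b) / (c * e) = (f * b) / (g * e) \<longleftrightarrow> a * g = f * c"
      if "b \<noteq> 0" "c \<noteq> 0" "e \<noteq> 0" "g \<noteq> 0" for a b c e f g :: complex
      using that by (simp add: field_simps)
    then show ?thesis unfolding E using nz by simp
  qed
  also have "\<dots> \<longleftrightarrow> (x1 - x2) * ((x1 + x2) * ?z + x1 * x2) = 0"
    by (simp add: power2_eq_square algebra_simps)
  also have "\<dots> \<longleftrightarrow> of_real (S * (1 - d * z)) = (0 :: complex)"
  proof -
    have "- complex_of_real (d * S) * ?z + of_real S = of_real (S * (1 - d * z))"
      by (simp add: algebra_simps)
    then show ?thesis unfolding sum prod using ne by (simp only: mult_eq_0_iff right_minus_eq simp_thms)
  qed
  also have "\<dots> \<longleftrightarrow> z = 1 / d" using S by (simp only: of_real_eq_0_iff) (auto simp: field_simps)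
  finally show ?thesis .
qed

text \<open>Any smaller positive time is by the intermediate value theorem the clock time of some z
  < 1 / d, where the equation fails. This selects the right solution also for conjugate roots, where
  the equation has infinitely many.\<close>

lemma tau_s_eq_clock:
  assumes par: "0 < al" "0 < mu" "0 < d" "coef_p al mu 1 th < 0" "d \<noteq> 2 / sqrt (S_w al mu th)"
  shows "tau_s al mu d th = stick_clock (S_w al mu th) d (eigval al mu d 1 th) (1 / d)"
proof -
  define S l where "S = S_w al mu th" and "l = eigval al mu d 1 th"
  have S: "0 < S" "0 < d" "0 < l" using S_w_pos eigval_pos par by (auto simp: S_def l_def)
  have eq: "stick_time_eq al mu d th (stick_clock S d l z) \<longleftrightarrow> z = 1 / d" if "z \<in> {- l..1 / d}" for z
    using stick_time_eq_clock[OF S that, of "xi al mu d 1 th" "xi al mu d (-1) th"] xi_distinct[of al mu th d] par S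
    by (simp add: stick_time_eq_def Let_def S_def l_def xi_sum xi_prod)
  have ld: "- l < 1 / d" using S by (smt (verit) divide_pos_pos)
  show ?thesis unfolding tau_s_def S_def[symmetric] l_def[symmetric]
  proof (rule Least_equality)
    show "0 < stick_clock S d l (1 / d) \<and> stick_time_eq al mu d th (stick_clock S d l (1 / d))"
      using eq[of "1 / d"] ld stick_clock_strict_mono[OF S(1,2), of l "- l" "1 / d"] stick_clock_start[of S d l] by auto
    fix s assume s: "0 < s \<and> stick_time_eq al mu d th s"
    show "stick_clock S d l (1 / d) \<le> s"
    proof (rule ccontr)
      assume less: "\<not> ?thesis"
      then obtain z where z: "- l \<le> z" "z \<le> 1 / d" "stick_clock S d l z = s"
        using IVT'[of "stick_clock S d l" "- l" s "1 / d"] continuous_on_stick_clock[OF S(1,2), of l] stick_clock_start[of S d l] ld s by auto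
      then have "z = 1 / d" using eq[of z] s by auto
      then show False using z less by simp
    qed
  qed
qed

text \<open>The square root is sqrt (quad (-l)) / l. In the exponent, d multiplies the clock time;
  this product is the quantity whose monotonicity and holomorphic extension are proved
  below.\<close>

definition e_real :: "real \<Rightarrow> real \<Rightarrow> real \<Rightarrow> real \<Rightarrow> real \<Rightarrow> real" where
  "e_real S p q l d = p / q * sqrt ((S - p) / (- p)) * exp (- (S / 2) * (d * stick_clock S d l (1 / d)))"

text \<open>At z = 1 / d the quadratic has the value 1 / d^2, and the root relations turn x1 (1 + d
  x2) into - x2. This cancels the prefactor x1 / x2 and leaves real factors only.\<close>

lemma e_complex_eq:
  assumes par: "0 < al" "0 < mu" "0 < d" "coef_p al mu 1 th < 0" "d \<noteq> 2 / sqrt (S_w al mu th)"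
  shows "e_complex al mu d th
    = of_real (e_real (S_w al mu th) (coef_p al mu 1 th) (coef_q al mu 1 th) (eigval al mu d 1 th) d)"
proof -
  define S l p q where "S = S_w al mu th" and "l = eigval al mu d 1 th"
    and "p = coef_p al mu 1 th" and "q = coef_q al mu 1 th"
  define x1 x2 where "x1 = xi al mu d 1 th" and "x2 = xi al mu d (-1) th"
  have S: "0 < S" "0 < d" "0 < l" using S_w_pos eigval_pos par by (auto simp: S_def l_def)
  have sum: "x1 + x2 = - of_real (d * S)" and prod: "x1 * x2 = of_real S"
    by (simp_all add: x1_def x2_def S_def xi_sum xi_prod)
  have x0: "x1 \<noteq> 0" "x2 \<noteq> 0" using prod S by auto
  let ?T = "stick_clock S d l (1 / d)"
  define M where "M = exp (- (d * S / 2) * ?T)"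
  have "- l \<le> 1 / d" using S by (smt (verit) divide_pos_pos)
  then have "exp (x1 * of_real ?T) * (x2 - of_real l) * of_real (sqrt (quad S d (1 / d)))
    = (of_real (1 / d) + x2) * of_real (M * sqrt (quad S d (- l)))"
    unfolding M_def using exp_stick_clock[OF S(1,2) _ sum prod, of "1 / d" l] by simp
  moreover have "quad S d (1 / d) = (1 / d)^2" using S by (simp add: quad_def power2_eq_square field_simps)
  moreover have "quad S d (- l) = (S - p) / (- p) * l^2"
    using eigval_square[OF par(4), of d] par by (intro quad_neg_root) (simp_all add: p_def l_def)
  moreover from this have "sqrt (quad S d (- l)) = sqrt ((S - p) / (- p)) * l"
    using S by (simp only: real_sqrt_mult real_sqrt_abs abs_of_pos)
  moreover from calculation have "sqrt (quad S d (1 / d)) = 1 / d" using S by simp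
  ultimately have *: "exp (x1 * of_real ?T) * (x2 - of_real l) * of_real (1 / d)
    = (of_real (1 / d) + x2) * of_real (M * (sqrt ((S - p) / (- p)) * l))"
    by metis
  have "exp (x1 * of_real ?T) * (of_real l - x2)
      = - of_real d * (exp (x1 * of_real ?T) * (x2 - of_real l) * of_real (1 / d))"
    using S by (simp add: algebra_simps)
  also have "\<dots> = - (1 + of_real d * x2) * of_real (M * (sqrt ((S - p) / (- p)) * l))"
    unfolding * using S by (simp add: algebra_simps)
  finally have h: "exp (x1 * of_real ?T) * (of_real l - x2)
     = - (1 + of_real d * x2) * of_real (M * (sqrt ((S - p) / (- p)) * l))" .
  have "x1 * (exp (x1 * of_real ?T) * (of_real l - x2))
     = - (x1 + of_real d * (x1 * x2)) * of_real (M * (sqrt ((S - p) / (- p)) * l))"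
    unfolding h by (simp add: algebra_simps)
  also have "\<dots> = x2 * of_real (M * (sqrt ((S - p) / (- p)) * l))"
  proof -
    have "x2 = - (x1 + of_real d * of_real S)" using sum by (simp add: algebra_simps eq_neg_iff_add_eq_0)
    then show ?thesis unfolding prod by simp
  qed
  finally have **: "x1 / x2 * (of_real l - x2) * exp (x1 * of_real ?T) = of_real (M * (sqrt ((S - p) / (- p)) * l))"
    using x0 by (simp add: field_simps)
  have "e_complex al mu d th = (x1 / x2 * (of_real l - x2) * exp (x1 * of_real ?T)) * (of_real p / (of_real q * of_real l))"
    unfolding e_complex_def Let_def tau_s_eq_clock[OF par] x1_def x2_def l_def S_def p_def q_def
    by (simp only: mult_ac)
  also have "\<dots> = of_real (p / q * sqrt ((S - p) / (- p)) * M)"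
    unfolding ** using S by (simp add: field_simps)
  finally show ?thesis
    unfolding e_real_def M_def S_def p_def q_def l_def by (simp add: mult_ac)
qed

text \<open>The affine substitution z = 1 / d - (1 / d + l) u fixes the interval of integration, and
  the eigenvalue equation cancels 1 + d l. Afterwards d occurs only through k = 1 / (d l), which can
  be made complex.\<close>

lemma stick_phase_eq:
  assumes S: "0 < S" "0 < d" "0 < l" and p: "p < 0" "l^2 = - p * (1 + d * l)"
  shows "d * stick_clock S d l (1 / d)
    = integral {0..1} (\<lambda>u. 1 / (- p * (1 / (d * l) * (1 - u) - u)^2 + S * u))"
proof -
  define z where "z u = 1 / d - (1 / d + l) * u" for u :: real
  have "((\<lambda>u. (1 + d * l) / quad S d (z u)) has_integral (- d * stick_clock S d l (z 1) - (- d * stick_clock S d l (z 0)))) {0..1}"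
  proof (rule fundamental_theorem_of_calculus)
    fix u :: real assume u: "u \<in> {0..1}"
    have zi: "z u \<in> {- l..1 / d}" if "u \<in> {0..1}" for u
    proof -
      have "0 \<le> (1 / d + l) * u" "(1 / d + l) * u \<le> (1 / d + l) * 1"
        using that S by (auto intro!: mult_nonneg_nonneg mult_left_le add_nonneg_nonneg)
      then show ?thesis by (auto simp: z_def algebra_simps)
    qed
    have zd: "(z has_real_derivative - (1 / d + l)) (at u within {0..1})"
      unfolding z_def[abs_def] by (auto intro!: derivative_eq_intros)
    have "((\<lambda>u. stick_clock S d l (z u)) has_real_derivative 1 / quad S d (z u) * - (1 / d + l)) (at u within {0..1})"
      using DERIV_image_chain[OF DERIV_subset[OF stick_clock_deriv[OF S(1,2) zi[OF u]]] zd] zi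
      by (simp add: o_def image_subset_iff)
    then have "((\<lambda>u. - d * stick_clock S d l (z u)) has_real_derivative - d * (1 / quad S d (z u) * - (1 / d + l))) (at u within {0..1})"
      by (rule DERIV_cmult)
    moreover have "- d * (1 / quad S d (z u) * - (1 / d + l)) = (1 + d * l) / quad S d (z u)"
      using S quad_pos[OF S(1,2), of "z u"] zi[OF u] by (simp add: field_simps)
    ultimately show "((\<lambda>u. - d * stick_clock S d l (z u)) has_vector_derivative (1 + d * l) / quad S d (z u)) (at u within {0..1})"
      by (simp add: has_real_derivative_iff_has_vector_derivative)
  qed simp
  moreover have "z 1 = - l" "z 0 = 1 / d" by (auto simp: z_def)
  ultimately have I: "((\<lambda>u. (1 + d * l) / quad S d (z u)) has_integral d * stick_clock S d l (1 / d)) {0..1}"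
    by (simp add: stick_clock_start)
  have "(1 + d * l) / quad S d (z u) = 1 / (- p * (1 / (d * l) * (1 - u) - u)^2 + S * u)" for u
  proof -
    have "z u = l * (1 / (d * l) * (1 - u) - u)" using S by (simp add: z_def field_simps)
    then have "(z u)^2 = l^2 * (1 / (d * l) * (1 - u) - u)^2" by (simp only: power_mult_distrib)
    moreover have "quad S d (z u) = (z u)^2 + S * (1 + d * l) * u" using S by (simp add: quad_def z_def field_simps)
    ultimately have "quad S d (z u) = (1 + d * l) * (- p * (1 / (d * l) * (1 - u) - u)^2 + S * u)"
      unfolding p(2) by (simp add: algebra_simps)
    moreover have "1 + d * l > 0" using S by (simp add: add_pos_pos)
    ultimately show ?thesis by (metis div_by_1 less_numeral_extra(3) mult_divide_mult_cancel_left_if mult.right_neutral)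
  qed
  then show ?thesis using integral_unique[OF I] by simp
qed

section \<open>Holomorphic extension in the damping parameter\<close>

definition phase_den :: "real \<Rightarrow> real \<Rightarrow> complex \<Rightarrow> real \<Rightarrow> complex" where
  "phase_den P S k u = of_real P * (k * (1 - of_real u) - of_real u)^2 + of_real (S * u)"

text \<open>For k off the real axis and u < 1, the imaginary part of the denominator vanishes only
  at u = Re k / (1 + Re k); the second condition says that the real part is positive there. The
  positive real axis lies in this open set.\<close>

definition phase_dom :: "real \<Rightarrow> real \<Rightarrow> complex set" where
  "phase_dom P S = {k. 0 < Re k \<and> P * (Im k)^2 < S * Re k * (1 + Re k)}"

definition phase_complex :: "real \<Rightarrow> real \<Rightarrow> complex \<Rightarrow> complex" where
  "phase_complex P S k = integral (cbox 0 1) (\<lambda>u. 1 / phase_den P S k u)"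

lemma open_phase_dom: "open (phase_dom P S)"
  unfolding phase_dom_def by (intro open_Collect_conj open_Collect_less continuous_intros)

lemma phase_den_nonzero:
  assumes P: "0 < P" "0 < S" and k: "k \<in> phase_dom P S" and u: "u \<in> cbox 0 1"
  shows "phase_den P S k u \<noteq> 0"
proof
  assume 0: "phase_den P S k u = 0"
  define c where "c = Re k * (1 - u) - u"
  have "Im (phase_den P S k u) = 2 * P * c * (Im k * (1 - u))"
    by (simp add: phase_den_def power2_eq_square c_def algebra_simps)
  then have i: "c * Im k * (1 - u) = 0" using 0 P by simp
  have r: "P * (c^2 - (Im k)^2 * (1 - u)^2) + S * u = 0"
  proof -
    have "Re (phase_den P S k u) = P * (c^2 - (Im k)^2 * (1 - u)^2) + S * u"
      by (simp add: phase_den_def power2_eq_square c_def algebra_simps)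
    then show ?thesis using 0 by simp
  qed
  have u01: "0 \<le> u" "u \<le> 1" using u by auto
  consider "u = 1" | "Im k = 0" | "c = 0" "u \<noteq> 1" using i by auto
  then show False
  proof cases
    case 1
    then show False using r P by (simp add: c_def)
  next
    case 2
    then have "P * c^2 + S * u = 0" using r by simp
    moreover have "0 \<le> P * c^2" "0 \<le> S * u" using P u01 by auto
    ultimately have "P * c^2 = 0" "S * u = 0" by linarith+
    then have "c = 0" "u = 0" using P by auto
    then show False using k by (simp add: c_def phase_dom_def)
  next
    case 3
    have uc: "u = Re k * (1 - u)" using 3 by (simp add: c_def)
    then have n: "1 = (1 + Re k) * (1 - u)" by (simp add: algebra_simps)
    have "0 < 1 - u" using 3 u01 by simp
    have "S * u = P * (Im k)^2 * (1 - u)^2" using r 3 by (simp add: algebra_simps)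
    also have "\<dots> < S * Re k * (1 + Re k) * (1 - u)^2"
      using k \<open>0 < 1 - u\<close> by (intro mult_strict_right_mono) (auto simp: phase_dom_def)
    also have "\<dots> = S * (Re k * (1 - u)) * ((1 + Re k) * (1 - u))" by (simp add: power2_eq_square)
    also have "\<dots> = S * u" using uc n by simp
    finally show False by simp
  qed
qed

lemma phase_complex_holomorphic:
  assumes P: "0 < P" "0 < S"
  shows "phase_complex P S holomorphic_on phase_dom P S"
proof -
  have "phase_complex P S field_differentiable (at k)" if k: "k \<in> phase_dom P S" for k
  proof -
    obtain r where r: "0 < r" "ball k r \<subseteq> phase_dom P S"
      using open_phase_dom k openE by blast
    have nz: "phase_den P S x t \<noteq> 0" if "x \<in> ball k r" "t \<in> cbox 0 1" for x t
      using phase_den_nonzero[OF P] r that by blast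
    define D where "D x t = - (of_real P * (2 * (x * (1 - of_real t) - of_real t) * (1 - of_real t))) / (phase_den P S x t)^2"
      for x :: complex and t :: real
    have cont: "continuous_on (ball k r \<times> cbox 0 1) (\<lambda>(x, t). phase_den P S x t)"
      unfolding phase_den_def split_def by (intro continuous_intros)
    have "phase_complex P S holomorphic_on ball k r"
      unfolding phase_complex_def[abs_def]
    proof (rule leibniz_rule_holomorphic[where fx = D])
      fix x t assume x: "x \<in> ball k r" and t: "t \<in> cbox (0::real) 1"
      have "((\<lambda>x. phase_den P S x t) has_field_derivative
          of_real P * (2 * (x * (1 - of_real t) - of_real t) * (1 - of_real t))) (at x within ball k r)"
        unfolding phase_den_def by (auto intro!: derivative_eq_intros)
      then show "((\<lambda>x. 1 / phase_den P S x t) has_field_derivative D x t) (at x within ball k r)"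
        using nz[OF x t] by (auto intro!: derivative_eq_intros simp: D_def power2_eq_square)
    next
      fix x assume x: "x \<in> ball k r"
      have "continuous_on (cbox 0 1) (\<lambda>t. 1 / phase_den P S x t)"
        using nz[OF x] unfolding phase_den_def by (intro continuous_intros) auto
      then show "(\<lambda>t. 1 / phase_den P S x t) integrable_on cbox 0 1"
        by (rule integrable_continuous)
    next
      show "continuous_on (ball k r \<times> cbox 0 1) (\<lambda>(x, t). D x t)"
        using cont nz unfolding D_def split_def by (intro continuous_intros) auto
    qed simp
    then show ?thesis using r by (simp add: holomorphic_on_open field_differentiable_def)
  qed
  then show ?thesis using field_differentiable_at_within unfolding holomorphic_on_def by blast
qed

text \<open>A root of P d^2 (k^2 + k) = 1. For real d > 0 it is 1 / (d l), by the eigenvalue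
  equation for l; the principal square root carries it over to complex d.\<close>

definition stick_k :: "real \<Rightarrow> complex \<Rightarrow> complex" where
  "stick_k P d = (csqrt (1 + 4 / (of_real P * d^2)) - 1) / 2"

definition e_holo :: "real \<Rightarrow> real \<Rightarrow> real \<Rightarrow> complex \<Rightarrow> complex" where
  "e_holo S p q d = of_real (p / q * sqrt ((S - p) / (- p)))
     * exp (- of_real (S / 2) * phase_complex (- p) S (stick_k (- p) d))"

definition e_dom :: "real \<Rightarrow> real \<Rightarrow> complex set" where
  "e_dom S p = {d. 0 < Re d} \<inter> stick_k (- p) -` phase_dom (- p) S"

text \<open>A radicand in (-infinity, 0] would make d^2 a negative real number, which is impossible
  for Re d > 0.\<close>

lemma stick_k_holomorphic:
  assumes "0 < P"
  shows "stick_k P holomorphic_on {d. 0 < Re d}"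
proof -
  have *: "1 + 4 / (of_real P * d^2) \<notin> \<real>\<^sub>\<le>\<^sub>0" if d: "0 < Re d" for d
  proof
    assume "1 + 4 / (of_real P * d^2) \<in> \<real>\<^sub>\<le>\<^sub>0"
    then obtain x where x: "1 + 4 / (of_real P * d^2) = of_real x" "x \<le> 0"
      by (auto elim: nonpos_Reals_cases)
    have "d \<noteq> 0" using d by auto
    then have "4 = of_real (x - 1) * (of_real P * d^2)" using x assms by (simp add: field_simps)
    then have "4 = of_real ((x - 1) * P) * d^2" by (simp add: mult.assoc)
    then have re: "4 = (x - 1) * P * ((Re d)^2 - (Im d)^2)" and im: "(x - 1) * P * (2 * Re d * Im d) = 0"
      by (auto simp: complex_eq_iff Re_power2 Im_power2)
    have neg: "(x - 1) * P < 0" using x assms by (simp add: mult_neg_pos)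
    then have "Im d = 0" using im d by auto
    then have "(x - 1) * P * ((Re d)^2 - (Im d)^2) < 0" using neg d by (simp add: mult_neg_pos)
    then show False using re by linarith
  qed
  show ?thesis unfolding stick_k_def[abs_def]
    using * assms by (intro holomorphic_intros) auto
qed

lemma open_e_dom:
  assumes "p < 0"
  shows "open (e_dom S p)"
  unfolding e_dom_def
  using stick_k_holomorphic[of "- p"] assms
  by (intro continuous_open_preimage holomorphic_on_imp_continuous_on open_phase_dom open_Collect_less continuous_intros) auto

lemma e_holo_holomorphic:
  assumes "p < 0" "0 < S"
  shows "e_holo S p q holomorphic_on e_dom S p"
proof -
  have k: "stick_k (- p) holomorphic_on e_dom S p"
    by (rule holomorphic_on_subset[OF stick_k_holomorphic]) (use assms in \<open>auto simp: e_dom_def\<close>)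
  have "(phase_complex (- p) S \<circ> stick_k (- p)) holomorphic_on e_dom S p"
    by (rule holomorphic_on_compose_gen[OF k phase_complex_holomorphic]) (use assms in \<open>auto simp: e_dom_def\<close>)
  then show ?thesis unfolding e_holo_def[abs_def] by (intro holomorphic_intros) (simp add: o_def)
qed

lemma stick_k_of_real:
  assumes l: "0 < l" "l^2 = - p * (1 + d * l)" and d: "0 < d" and p: "p < 0"
  shows "stick_k (- p) (of_real d) = of_real (1 / (d * l))"
proof -
  define x where "x = 1 / (d * l)"
  have x: "0 < x" using assms by (simp add: x_def)
  have "- p * d^2 * (x^2 + x) = 1"
  proof -
    have "- p * d^2 * (x^2 + x) = - p * (1 + d * l) / l^2"
      using l(1) d by (simp add: x_def power2_eq_square field_simps)
    also have "\<dots> = 1" using l(1) l(2)[symmetric] by simp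
    finally show ?thesis .
  qed
  then have "1 + 4 / (- p * d^2) = (2 * x + 1)^2"
    using p d by (simp add: power2_eq_square field_simps)
  moreover have "1 + 4 / (of_real (- p) * (of_real d)^2) = (of_real (1 + 4 / (- p * d^2)) :: complex)"
    by simp
  ultimately have "1 + 4 / (of_real (- p) * (of_real d)^2) = (of_real ((2 * x + 1)^2) :: complex)"
    by (simp only:)
  then have "csqrt (1 + 4 / (of_real (- p) * (of_real d)^2)) = of_real (2 * x + 1)"
    using x of_real_sqrt[of "(2 * x + 1)^2"] by simp
  then show ?thesis unfolding stick_k_def x_def[symmetric] by simp
qed

lemma of_real_in_e_dom:
  assumes l: "0 < l" "l^2 = - p * (1 + d * l)" and d: "0 < d" and p: "p < 0" and S: "0 < S"
  shows "complex_of_real d \<in> e_dom S p"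
  using stick_k_of_real[OF assms(1-4)] assms by (auto simp: e_dom_def phase_dom_def add_pos_pos)

lemma e_holo_of_real:
  assumes l: "0 < l" "l^2 = - p * (1 + d * l)" and d: "0 < d" and p: "p < 0" and S: "0 < S"
  shows "e_holo S p q (of_real d) = of_real (e_real S p q l d)"
proof -
  let ?f = "\<lambda>u. 1 / (- p * (1 / (d * l) * (1 - u) - u)^2 + S * u)"
  have c: "phase_den (- p) S (of_real (1 / (d * l))) u = of_real (- p * (1 / (d * l) * (1 - u) - u)^2 + S * u)" for u
    by (simp add: phase_den_def)
  have "continuous_on {0..1} ?f"
  proof -
    have "- p * (1 / (d * l) * (1 - u) - u)^2 + S * u \<noteq> 0" if "u \<in> {0..1}" for u
      using phase_den_nonzero[of "- p" S "of_real (1 / (d * l))" u] that assms c[of u]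
      by (auto simp: phase_dom_def add_pos_pos simp del: of_real_divide of_real_mult)
    then show ?thesis by (intro continuous_intros) auto
  qed
  then have "(?f has_integral integral {0..1} ?f) {0..1}"
    using integrable_continuous_real by blast
  from has_integral_linear[OF this bounded_linear_of_real]
  moreover have "1 / phase_den (- p) S (of_real (1 / (d * l))) u = of_real (?f u)" for u
    unfolding c by (simp only: of_real_divide of_real_1)
  ultimately have "((\<lambda>u. 1 / phase_den (- p) S (of_real (1 / (d * l))) u) has_integral of_real (integral {0..1} ?f)) (cbox 0 1)"
    by (simp only: o_def box_real)
  then have "phase_complex (- p) S (of_real (1 / (d * l))) = of_real (integral {0..1} ?f)"
    unfolding phase_complex_def by (rule integral_unique)
  then show ?thesis
    unfolding e_holo_def e_real_def stick_k_of_real[OF assms(1-4)] stick_phase_eq[OF S d l(1) p l(2)]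
    by (simp flip: exp_of_real)
qed

text \<open>At critical damping \<open>e_fun\<close> is a limit. The integral formula is continuous
  there, being the restriction of a holomorphic function, and it agrees with the complex expression
  at all other d > 0, so it equals this limit.\<close>

lemma e_fun_eq:
  assumes par: "0 < al" "0 < mu" "0 < d" "coef_p al mu 1 th < 0"
  shows "e_fun al mu d th = e_real (S_w al mu th) (coef_p al mu 1 th) (coef_q al mu 1 th) (eigval al mu d 1 th) d"
proof (cases "d = 2 / sqrt (S_w al mu th)")
  case False
  then show ?thesis using e_complex_eq[OF par False] by (simp add: e_fun_def)
next
  case True
  define S p q where "S = S_w al mu th" and "p = coef_p al mu 1 th" and "q = coef_q al mu 1 th"
  define E where "E x = e_real S p q (eigval al mu x 1 th) x" for x
  have S: "0 < S" "p < 0" using S_w_pos par by (auto simp: S_def p_def)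
  have l: "0 < eigval al mu x 1 th" "(eigval al mu x 1 th)^2 = - p * (1 + x * eigval al mu x 1 th)" if "0 < x" for x
    using eigval_pos[OF that par(4)] eigval_square[OF par(4)] by (auto simp: p_def)
  have eq: "E x = Re (e_holo S p q (of_real x))" if "0 < x" for x
    unfolding E_def using e_holo_of_real[OF l[OF that] that S(2,1)] by simp
  have "isCont (e_holo S p q) (of_real d)"
    using holomorphic_on_imp_continuous_on[OF e_holo_holomorphic[OF S(2,1)]] open_e_dom[OF S(2)]
      of_real_in_e_dom[OF l[OF par(3)] par(3) S(2,1)] continuous_on_eq_continuous_at by blast
  then have "isCont (\<lambda>x. Re (e_holo S p q (of_real x))) d"
    by (intro continuous_intros isCont_o2[of _ of_real]) auto
  then have "(\<lambda>x. Re (e_holo S p q (of_real x))) \<midarrow>d\<rightarrow> E d"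
    unfolding isCont_def by (simp only: eq[OF par(3)])
  moreover have "\<forall>\<^sub>F x in at d. Re (e_complex al mu x th) = Re (e_holo S p q (of_real x))"
  proof -
    have "\<forall>\<^sub>F x in at d. 0 < x \<and> x \<noteq> d"
      using par(3) eventually_at_in_open[of "{0<..}" d] by (auto elim: eventually_mono)
    then show ?thesis
    proof eventually_elim
      case (elim x)
      then show ?case using e_complex_eq[of al mu x th] par True eq[of x] by (simp add: E_def S_def p_def q_def)
    qed
  qed
  ultimately have "(\<lambda>x. Re (e_complex al mu x th)) \<midarrow>d\<rightarrow> E d"
    by (simp only: tendsto_cong)
  then have "Lim (at d) (\<lambda>x. Re (e_complex al mu x th)) = E d"
    by (intro tendsto_Lim) auto
  then show ?thesis using True by (simp add: e_fun_def E_def S_def p_def q_def)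
qed

text \<open>Along the real axis the derivative of Re g is Re g', so by induction all iterated real
  derivatives come from those of g. This replaces repeated differentiation under the integral
  sign.\<close>

lemma smooth_on_open_Re_holomorphic:
  assumes g: "g holomorphic_on U" "open U" and A: "open A" "\<And>x. x \<in> A \<Longrightarrow> complex_of_real x \<in> U"
    and f: "\<And>x. x \<in> A \<Longrightarrow> f x = Re (g (of_real x))"
  shows "smooth_on_open A f"
proof -
  have hol: "(deriv ^^ n) g holomorphic_on U" for n
    using g by (rule holomorphic_higher_deriv)
  have der: "((\<lambda>x. Re ((deriv ^^ n) g (of_real x))) has_real_derivative Re ((deriv ^^ Suc n) g (of_real x))) (at x)"
    if "x \<in> A" for n x
  proof -
    have "((deriv ^^ n) g has_field_derivative (deriv ^^ Suc n) g (of_real x)) (at (of_real x))"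
      using holomorphic_derivI[OF hol g(2) A(2)[OF that]] by simp
    then have "((\<lambda>x. (deriv ^^ n) g (of_real x)) has_vector_derivative (deriv ^^ Suc n) g (of_real x)) (at x)"
      by (rule has_vector_derivative_real_field)
    from bounded_linear.has_vector_derivative[OF bounded_linear_Re this]
    show ?thesis by (simp add: has_real_derivative_iff_has_vector_derivative)
  qed
  have eq: "\<forall>x\<in>A. (deriv ^^ n) f x = Re ((deriv ^^ n) g (of_real x))" for n
  proof (induction n)
    case 0
    then show ?case using f by simp
  next
    case (Suc n)
    show ?case
    proof
      fix x assume x: "x \<in> A"
      have "((deriv ^^ n) f has_real_derivative Re ((deriv ^^ Suc n) g (of_real x))) (at x)"
        by (rule has_field_derivative_transform_within_open[OF der[OF x] A(1) x]) (use Suc in auto)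
      then show "(deriv ^^ Suc n) f x = Re ((deriv ^^ Suc n) g (of_real x))"
        by (simp add: DERIV_imp_deriv)
    qed
  qed
  have "(deriv ^^ n) f differentiable (at x)" if "x \<in> A" for n x
  proof -
    have "((deriv ^^ n) f has_real_derivative Re ((deriv ^^ Suc n) g (of_real x))) (at x)"
      by (rule has_field_derivative_transform_within_open[OF der[OF that] A(1) that]) (use eq in auto)
    then show ?thesis using real_differentiable_def by blast
  qed
  then show ?thesis using A by (simp add: smooth_on_open_def)
qed

lemma e_fun_smooth:
  assumes par: "0 < al" "0 < mu" "coef_p al mu 1 th < 0"
  shows "smooth_on_open {0<..} (\<lambda>d. e_fun al mu d th)"
proof -
  define S p q where "S = S_w al mu th" and "p = coef_p al mu 1 th" and "q = coef_q al mu 1 th"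
  have S: "0 < S" "p < 0" using S_w_pos par by (auto simp: S_def p_def)
  have l: "0 < eigval al mu x 1 th" "(eigval al mu x 1 th)^2 = - p * (1 + x * eigval al mu x 1 th)" if "0 < x" for x
    using eigval_pos[OF that par(3)] eigval_square[OF par(3)] by (auto simp: p_def)
  show ?thesis
  proof (rule smooth_on_open_Re_holomorphic[OF e_holo_holomorphic[OF S(2,1)] open_e_dom[OF S(2)]])
    fix x :: real assume "x \<in> {0<..}"
    then have x: "0 < x" by simp
    show "complex_of_real x \<in> e_dom S p"
      by (rule of_real_in_e_dom[OF l[OF x] x S(2,1)])
    show "e_fun al mu x th = Re (e_holo S p q (of_real x))"
      using e_fun_eq[of al mu x th] par x e_holo_of_real[OF l[OF x] x S(2,1)] by (simp add: S_def p_def q_def)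
  qed simp
qed

section \<open>Monotonicity in the damping\<close>

lemma stick_phase_mono:
  assumes S: "0 < S" and d: "0 < d" "d \<le> e" and l: "0 < l" "l \<le> m"
  shows "d * stick_clock S d l (1 / d) \<le> e * stick_clock S e m (1 / e)"
proof -
  \<comment> \<open>The substitution x = d z removes d from the upper limit and from the linear
    term. What is left grows with d: the integrand because x^2 / d^2 decreases, the interval because
    d l increases.\<close>
  have sub: "((\<lambda>x. 1 / (x^2 / d^2 + S * (1 - x))) has_integral d * stick_clock S d l (1 / d)) {- d * l..1}"
    if d: "0 < d" and l: "0 < l" for d l :: real
  proof -
    have i: "- d * l \<le> 1" using d l by (smt (verit) mult_pos_pos mult_minus_left)
    have "((\<lambda>x. 1 / (x^2 / d^2 + S * (1 - x))) has_integral
        d * stick_clock S d l (1 / d) - d * stick_clock S d l (- d * l / d)) {- d * l..1}"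
    proof (rule fundamental_theorem_of_calculus[OF i])
      fix x assume x: "x \<in> {- d * l..1}"
      have zi: "y / d \<in> {- l..1 / d}" if "y \<in> {- d * l..1}" for y
        using that d by (auto simp: field_simps)
      have zd: "((\<lambda>x. x / d) has_real_derivative 1 / d) (at x within {- d * l..1})"
        using d by (auto intro!: derivative_eq_intros)
      have "((\<lambda>x. stick_clock S d l (x / d)) has_real_derivative 1 / quad S d (x / d) * (1 / d)) (at x within {- d * l..1})"
        using DERIV_image_chain[OF DERIV_subset[OF stick_clock_deriv[OF S d zi[OF x]]] zd] zi
        by (simp add: o_def image_subset_iff)
      then have "((\<lambda>x. d * stick_clock S d l (x / d)) has_real_derivative d * (1 / quad S d (x / d) * (1 / d))) (at x within {- d * l..1})"
        by (rule DERIV_cmult)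
      moreover have "d * (1 / quad S d (x / d) * (1 / d)) = 1 / (x^2 / d^2 + S * (1 - x))"
      proof -
        have "quad S d (x / d) = x^2 / d^2 + S * (1 - x)"
          using d by (simp add: quad_def power_divide algebra_simps)
        then show ?thesis using d by simp
      qed
      ultimately show "((\<lambda>x. d * stick_clock S d l (x / d)) has_vector_derivative 1 / (x^2 / d^2 + S * (1 - x))) (at x within {- d * l..1})"
        by (simp add: has_real_derivative_iff_has_vector_derivative)
    qed
    then show ?thesis using d by (simp add: stick_clock_start)
  qed
  have pos: "0 < x^2 / c^2 + S * (1 - x)" if "x \<le> 1" "0 < c" for x c :: real
  proof (cases "x = 1")
    case False
    then show ?thesis using that S by (intro add_nonneg_pos) auto
  qed (use that in auto)
  have e: "0 < e" "0 < m" using d l by auto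
  have "d * l \<le> e * m" using d l by (intro mult_mono) auto
  then have ss: "{- d * l..1} \<subseteq> {- e * m..1}" by auto
  let ?f = "\<lambda>x. 1 / (x^2 / d^2 + S * (1 - x))" and ?g = "\<lambda>x. 1 / (x^2 / e^2 + S * (1 - x))"
  have i: "?f integrable_on {- d * l..1}" "?g integrable_on {- e * m..1}"
    using sub[OF d(1) l(1)] sub[OF e] by blast+
  then have i2: "?g integrable_on {- d * l..1}" using ss integrable_on_subinterval by blast
  have "d * stick_clock S d l (1 / d) = integral {- d * l..1} ?f" using sub[OF d(1) l(1)] by (simp add: integral_unique)
  also have "\<dots> \<le> integral {- d * l..1} ?g"
  proof (rule integral_le[OF i(1) i2])
    fix x assume x: "x \<in> {- d * l..1}"
    have "x^2 / e^2 \<le> x^2 / d^2" using d by (intro divide_left_mono power_mono) auto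
    then show "?f x \<le> ?g x" using x pos[of x d] pos[of x e] d e by (intro divide_left_mono) (auto intro: mult_pos_pos)
  qed
  also have "\<dots> \<le> integral {- e * m..1} ?g"
  proof (rule integral_subset_le[OF ss i2 i(2)], rule ballI)
    fix x assume "x \<in> {- e * m..1}"
    then have "x \<le> 1" by simp
    then show "0 \<le> ?g x" using pos[of x e] e by (simp add: less_imp_le)
  qed
  also have "\<dots> = e * stick_clock S e m (1 / e)" using sub[OF e] by (simp add: integral_unique)
  finally show ?thesis .
qed

lemma eigval_mono:
  assumes "coef_p al mu 1 th < 0" "0 < d" "d \<le> e"
  shows "eigval al mu d 1 th \<le> eigval al mu e 1 th"
proof -
  define p where "p = coef_p al mu 1 th"
  have "d^2 * p^2 \<le> e^2 * p^2" using assms by (intro mult_right_mono power_mono) auto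
  then have "sqrt (d^2 * p^2 - 4 * p) \<le> sqrt (e^2 * p^2 - 4 * p)" by simp
  moreover have "- (d * p) \<le> - (e * p)" using assms by (simp add: p_def mult_right_mono_neg)
  ultimately show ?thesis unfolding eigval_def p_def[symmetric] by linarith
qed

lemma e_fun_antimono:
  assumes par: "0 < al" "0 < mu" "coef_p al mu 1 th < 0" "coef_q al mu 1 th < 0"
  shows "antimono_on {0<..} (\<lambda>d. e_fun al mu d th)"
proof (rule monotone_onI)
  fix d e :: real assume de: "d \<in> {0<..}" "e \<in> {0<..}" "d \<le> e"
  have S: "0 < S_w al mu th" using S_w_pos par by simp
  have "d * stick_clock (S_w al mu th) d (eigval al mu d 1 th) (1 / d) \<le> e * stick_clock (S_w al mu th) e (eigval al mu e 1 th) (1 / e)"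
    using de by (intro stick_phase_mono S eigval_pos eigval_mono par) auto
  then have "exp (- (S_w al mu th / 2) * (e * stick_clock (S_w al mu th) e (eigval al mu e 1 th) (1 / e)))
      \<le> exp (- (S_w al mu th / 2) * (d * stick_clock (S_w al mu th) d (eigval al mu d 1 th) (1 / d)))"
    using S by simp
  moreover have "0 \<le> coef_p al mu 1 th / coef_q al mu 1 th
      * sqrt ((S_w al mu th - coef_p al mu 1 th) / (- coef_p al mu 1 th))"
    using par S by (intro mult_nonneg_nonneg divide_nonpos_nonpos real_sqrt_ge_zero divide_nonneg_pos) auto
  ultimately show "e_fun al mu e th \<le> e_fun al mu d th"
    using de e_fun_eq[of al mu d th] e_fun_eq[of al mu e th] par
    unfolding e_real_def by (metis greaterThan_iff mult_left_mono)
qed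

section \<open>Expansion for large damping\<close>

lemma e_real_alt:
  assumes S: "0 < S" "0 < d" and l: "0 < l" "l^2 = - p * (1 + d * l)" and p: "p < 0"
  shows "e_real S p q l d = p / (q * l * d) * exp (- integral {- l..1 / d} (\<lambda>z. z / quad S d z))"
proof -
  let ?T = "stick_clock S d l (1 / d)"
  have ld: "- l \<le> 1 / d" using S l by (smt (verit) divide_pos_pos)
  have Q0: "0 < quad S d z" if "z \<in> {- l..1 / d}" for z using quad_pos[OF S] that by auto
  \<comment> \<open>Half the logarithm of \<open>quad\<close> has derivative z / quad - (d S / 2) /
    quad, so the clock can be traded for the integral of z / quad. The new prefactor p / (q l d)
    already has the size of d^-2 for large d, and the exponential stays bounded.\<close>
  have "((\<lambda>z. (2 * z - d * S) / (2 * quad S d z)) has_integral (ln (quad S d (1 / d)) / 2 - ln (quad S d (- l)) / 2)) {- l..1 / d}"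
  proof (rule fundamental_theorem_of_calculus[OF ld])
    fix z assume z: "z \<in> {- l..1 / d}"
    have "((\<lambda>z. ln (quad S d z) / 2) has_real_derivative (2 * z - d * S) / (2 * quad S d z)) (at z within {- l..1 / d})"
      using Q0[OF z] by (auto intro!: derivative_eq_intros quad_deriv simp: field_simps)
    then show "((\<lambda>z. ln (quad S d z) / 2) has_vector_derivative (2 * z - d * S) / (2 * quad S d z)) (at z within {- l..1 / d})"
      by (simp add: has_real_derivative_iff_has_vector_derivative)
  qed
  moreover have "((\<lambda>z. 1 / quad S d z) has_integral ?T) {- l..1 / d}"
    unfolding stick_clock_def using continuous_on_quad_inverse[OF S] integrable_continuous_real by blast
  then have "((\<lambda>z. d * S / 2 * (1 / quad S d z)) has_integral d * S / 2 * ?T) {- l..1 / d}"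
    by (rule has_integral_mult_right)
  ultimately have "((\<lambda>z. (2 * z - d * S) / (2 * quad S d z) + d * S / 2 * (1 / quad S d z)) has_integral
      ln (quad S d (1 / d)) / 2 - ln (quad S d (- l)) / 2 + d * S / 2 * ?T) {- l..1 / d}"
    by (rule has_integral_add)
  moreover have "(2 * z - d * S) / (2 * quad S d z) + d * S / 2 * (1 / quad S d z) = z / quad S d z" if "z \<in> {- l..1 / d}" for z
    using Q0[OF that] by (simp add: field_simps)
  ultimately have "((\<lambda>z. z / quad S d z) has_integral ln (quad S d (1 / d)) / 2 - ln (quad S d (- l)) / 2 + d * S / 2 * ?T) {- l..1 / d}"
    by (rule has_integral_eq[rotated])
  then have J: "integral {- l..1 / d} (\<lambda>z. z / quad S d z) = ln (quad S d (1 / d)) / 2 - ln (quad S d (- l)) / 2 + d * S / 2 * ?T"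
    by (rule integral_unique)
  have c: "0 < (S - p) / (- p)" using p S by (intro divide_pos_pos) auto
  have "quad S d (1 / d) = (1 / d)^2" using S by (simp add: quad_def power2_eq_square field_simps)
  then have l1: "ln (quad S d (1 / d)) / 2 = - ln d" using S by (simp add: ln_realpow ln_div)
  have "ln (quad S d (- l)) / 2 = ln (sqrt ((S - p) / (- p))) + ln l"
  proof -
    have "ln (k * l^2) / 2 = ln (sqrt k) + ln l" if "0 < k" for k
      using that l(1) by (simp add: ln_mult ln_realpow ln_sqrt)
    then show ?thesis unfolding quad_neg_root[OF l(2) p] using c by blast
  qed
  then have "exp (- integral {- l..1 / d} (\<lambda>z. z / quad S d z)) = d * (sqrt ((S - p) / (- p)) * l) * exp (- (S / 2) * (d * ?T))"
  proof -
    assume l2: "ln (quad S d (- l)) / 2 = ln (sqrt ((S - p) / (- p))) + ln l"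
    have "- integral {- l..1 / d} (\<lambda>z. z / quad S d z)
        = ln d + (ln (sqrt ((S - p) / (- p))) + ln l) + - (S / 2) * (d * ?T)"
      unfolding J l1 l2 by simp
    then show ?thesis using S l c real_sqrt_gt_zero[OF c] by (simp only: exp_add exp_ln)
  qed
  then show ?thesis unfolding e_real_def using S l by simp
qed

text \<open>The integral of z / quad is split at 0. Its negative part is ln (d S / (d S + l)) up to
  a small error, its positive part is an error altogether. The logarithm joins the prefactor to form
  \<open>1 - h\<close>, and \<open>(1 - h) * exp (- E)\<close> lies between 1 - h - E and 1.\<close>

lemma e_real_large:
  assumes S: "0 < S" "0 < d" "4 \<le> d^2 * S" and l: "0 < l" "l^2 = - p * (1 + d * l)" and p: "p < 0" and q: "q < 0"
  shows "\<bar>e_real S p q l d * d^2 / ((S - p) / (S * (- q))) - 1\<bar>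
     \<le> - S * p / (l^2 * (S - p)) + (ln (1 + d * l) / (d^2 * S) + 2 * ln (1 + S * d^2) / (d^2 * S))"
proof -
  define f where "f z = z / quad S d z" for z
  have ld: "- l \<le> 0" "0 \<le> 1 / d" using S l by auto
  have Q0: "0 < quad S d z" if "z \<le> 1 / d" for z using quad_pos[OF S(1,2)] that by auto
  have fint: "f integrable_on {- l..1 / d}"
  proof -
    have "continuous_on {- l..1 / d} (\<lambda>z. z * (1 / quad S d z))"
      by (intro continuous_intros continuous_on_quad_inverse S)
    then show ?thesis unfolding f_def by (simp add: integrable_continuous_real)
  qed
  have f1: "f integrable_on {- l..0}" "f integrable_on {0..1 / d}"
    by (rule integrable_on_subinterval[OF fint], use ld in simp)+
  have J: "integral {- l..1 / d} f = integral {- l..0} f + integral {0..1 / d} f"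
    using Henstock_Kurzweil_Integration.integral_combine[OF ld fint] by simp
  have a: "((\<lambda>z. 1 / (z - d * S)) has_integral (ln (d * S - 0) - ln (d * S - (- l)))) {- l..0}"
  proof (rule fundamental_theorem_of_calculus[OF ld(1)])
    fix z assume z: "z \<in> {- l..0}"
    have "0 < d * S" using S by simp
    then have "0 < d * S - z" using z by simp
    then have "((\<lambda>z. ln (d * S - z)) has_real_derivative 1 / (z - d * S)) (at z within {- l..0})"
      by (auto intro!: derivative_eq_intros simp: field_simps)
    then show "((\<lambda>z. ln (d * S - z)) has_vector_derivative 1 / (z - d * S)) (at z within {- l..0})"
      by (simp add: has_real_derivative_iff_has_vector_derivative)
  qed
  have b: "((\<lambda>z. 1 / (d * S * (1 - d * z))) has_integral (- ln (1 - d * 0) / (d^2 * S) - (- ln (1 - d * (- l)) / (d^2 * S)))) {- l..0}"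
  proof (rule fundamental_theorem_of_calculus[OF ld(1)])
    fix z assume z: "z \<in> {- l..0}"
    then have "d * z \<le> 0" using S by (auto intro: mult_nonneg_nonpos)
    then have "0 < 1 - d * z" by simp
    then have "((\<lambda>z. - ln (1 - d * z) / (d^2 * S)) has_real_derivative 1 / (d * S * (1 - d * z))) (at z within {- l..0})"
      using S by (auto intro!: derivative_eq_intros simp: field_simps power2_eq_square)
    then show "((\<lambda>z. - ln (1 - d * z) / (d^2 * S)) has_vector_derivative 1 / (d * S * (1 - d * z))) (at z within {- l..0})"
      by (simp add: has_real_derivative_iff_has_vector_derivative)
  qed
  \<comment> \<open>For z \<le> 0 the constant term S of \<open>quad\<close> is a perturbation of z
    (z - d S). It changes z / quad by S / (quad (d S - z)), and the lower bound S (1 - d z) for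
    \<open>quad\<close> makes this integrable in closed form.\<close>
  have cmp: "1 / (z - d * S) \<le> f z \<and> f z \<le> 1 / (z - d * S) + 1 / (d * S * (1 - d * z))" if z: "z \<in> {- l..0}" for z
  proof -
    have dS: "0 < d * S" using S by simp
    have dz: "d * z \<le> 0" using z S by (auto intro: mult_nonneg_nonpos)
    have Q: "0 < quad S d z" using Q0[OF order_trans[OF _ ld(2)]] z by simp
    have ds: "0 < d * S - z" using dS z by simp
    have "f z - 1 / (z - d * S) = S / (quad S d z * (d * S - z))"
    proof -
      have gen: "z / K + 1 / D = S / (K * D)" if "0 < K" "0 < D" "z * D + K = S" for K D
        using that by (simp add: field_simps)
      have "1 / (z - d * S) = - (1 / (d * S - z))" by (metis minus_diff_eq minus_divide_right)
      moreover have "z * (d * S - z) + quad S d z = S" by (simp add: quad_def power2_eq_square algebra_simps)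
      ultimately show ?thesis using gen[OF Q ds] by (simp add: f_def)
    qed
    moreover have "0 \<le> S / (quad S d z * (d * S - z))" using S Q ds by simp
    moreover have "S / (quad S d z * (d * S - z)) \<le> S / ((S * (1 - d * z)) * (d * S))"
    proof (rule divide_left_mono)
      have "S * (1 - d * z) \<le> quad S d z" by (simp add: quad_def algebra_simps)
      then show "S * (1 - d * z) * (d * S) \<le> quad S d z * (d * S - z)"
        using S dz z dS Q by (intro mult_mono) auto
    qed (use S dz dS Q ds in auto)
    moreover have "S / ((S * (1 - d * z)) * (d * S)) = 1 / (d * S * (1 - d * z))"
      using S dz by (simp add: field_simps)
    ultimately show ?thesis by linarith
  qed
  have Jm1: "ln (d * S) - ln (d * S + l) \<le> integral {- l..0} f"
    using has_integral_le[OF a integrable_integral[OF f1(1)]] cmp by simp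
  have Jm2: "integral {- l..0} f \<le> ln (d * S) - ln (d * S + l) + ln (1 + d * l) / (d^2 * S)"
    using has_integral_le[OF integrable_integral[OF f1(1)] has_integral_add[OF a b]] cmp by simp
  have Jp1: "0 \<le> integral {0..1 / d} f"
    using Q0 by (intro integral_nonneg f1) (auto simp: f_def less_imp_le)
  \<comment> \<open>Dropping the square (z - 1 / d)^2 from \<open>quad\<close> leaves the linear
    function (1 - d z) m + 1 / d^2. The hypothesis 4 \<le> d^2 S gives m \<ge> S / 2.\<close>
  define m where "m = S - 2 / d^2"
  have m: "S / 2 \<le> m" "m \<le> S" "0 < m" using S by (auto simp: m_def field_simps)
  have c: "((\<lambda>z. 1 / d * (1 / ((1 - d * z) * m + 1 / d^2))) has_integral
     (- ln ((1 - d * (1 / d)) * m + 1 / d^2) / (d^2 * m) - (- ln ((1 - d * 0) * m + 1 / d^2) / (d^2 * m)))) {0..1 / d}"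
  proof (rule fundamental_theorem_of_calculus[OF ld(2)])
    fix z assume z: "z \<in> {0..1 / d}"
    then have "d * z \<le> 1" using S by (simp add: field_simps)
    then have "0 < (1 - d * z) * m + 1 / d^2" using m S by (intro add_nonneg_pos mult_nonneg_nonneg) auto
    then have "((\<lambda>z. - ln ((1 - d * z) * m + 1 / d^2)) has_real_derivative - (- d * m / ((1 - d * z) * m + 1 / d^2))) (at z within {0..1 / d})"
      by (auto intro!: derivative_eq_intros)
    from DERIV_cdivide[OF this, of "d^2 * m"]
    have "((\<lambda>z. - ln ((1 - d * z) * m + 1 / d^2) / (d^2 * m)) has_real_derivative - (- d * m / ((1 - d * z) * m + 1 / d^2)) / (d^2 * m)) (at z within {0..1 / d})" .
    moreover have "- (- d * m / X) / (d^2 * m) = 1 / d * (1 / X)" for X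
      using S m by (simp add: power2_eq_square)
    ultimately show "((\<lambda>z. - ln ((1 - d * z) * m + 1 / d^2) / (d^2 * m)) has_vector_derivative 1 / d * (1 / ((1 - d * z) * m + 1 / d^2))) (at z within {0..1 / d})"
      by (simp add: has_real_derivative_iff_has_vector_derivative)
  qed
  have cmp2: "f z \<le> 1 / d * (1 / ((1 - d * z) * m + 1 / d^2))" if z: "z \<in> {0..1 / d}" for z
  proof -
    have dz: "d * z \<le> 1" using z S by (simp add: field_simps)
    have pos: "0 < (1 - d * z) * m + 1 / d^2" using m S dz by (intro add_nonneg_pos mult_nonneg_nonneg) auto
    have "0 \<le> (z - 1 / d)^2" by simp
    also have "(z - 1 / d)^2 = quad S d z - ((1 - d * z) * m + 1 / d^2)"
      using S by (simp add: m_def quad_def power2_eq_square field_simps)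
    finally have "(1 - d * z) * m + 1 / d^2 \<le> quad S d z" by simp
    then have "1 / quad S d z \<le> 1 / ((1 - d * z) * m + 1 / d^2)" using pos by (intro divide_left_mono) auto
    then have "z * (1 / quad S d z) \<le> 1 / d * (1 / ((1 - d * z) * m + 1 / d^2))"
      using z Q0[of z] S by (intro mult_mono) auto
    then show ?thesis by (simp add: f_def)
  qed
  have Jp2: "integral {0..1 / d} f \<le> 2 * ln (1 + S * d^2) / (d^2 * S)"
  proof -
    have "integral {0..1 / d} f \<le> ln (m + 1 / d^2) / (d^2 * m) - ln (1 / d^2) / (d^2 * m)"
      using has_integral_le[OF integrable_integral[OF f1(2)] c] cmp2 S by simp
    also have "\<dots> = ln (1 + m * d^2) / (d^2 * m)"
    proof -
      have "ln (m + 1 / d^2) - ln (1 / d^2) = ln ((m + 1 / d^2) / (1 / d^2))"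
      proof -
        have "0 < m + 1 / d^2" "0 < 1 / d^2" using m S by (auto intro: add_pos_pos)
        then show ?thesis by (metis ln_divide_pos)
      qed
      also have "(m + 1 / d^2) / (1 / d^2) = 1 + m * d^2" using S by (simp add: field_simps)
      finally show ?thesis by (simp add: diff_divide_distrib[symmetric])
    qed
    also have "\<dots> \<le> ln (1 + S * d^2) / (d^2 * (S / 2))"
    proof (rule frac_le)
      have "0 \<le> m * d^2" "m * d^2 \<le> S * d^2" using m by (auto intro: mult_right_mono)
      then show "0 \<le> ln (1 + S * d^2)" "ln (1 + m * d^2) \<le> ln (1 + S * d^2)" by auto
      show "0 < d^2 * (S / 2)" using S by simp
      show "d^2 * (S / 2) \<le> d^2 * m" using m by (intro mult_left_mono) auto
    qed
    also have "\<dots> = 2 * ln (1 + S * d^2) / (d^2 * S)" using S by (simp add: field_simps)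
    finally show ?thesis .
  qed
  \<comment> \<open>The exponent that remains after the leading logarithm has been taken out. It is
    nonnegative, so its exponential contributes at most 1.\<close>
  define E where "E = integral {- l..1 / d} f + ln ((d * S + l) / (d * S))"
  have dSl: "0 < d * S + l" "0 < d * S" using S l by (auto intro: add_pos_pos)
  then have "ln ((d * S + l) / (d * S)) = ln (d * S + l) - ln (d * S)" by (rule ln_divide_pos)
  then have E: "0 \<le> E" "E \<le> ln (1 + d * l) / (d^2 * S) + 2 * ln (1 + S * d^2) / (d^2 * S)"
    using Jm1 Jm2 Jp1 Jp2 unfolding E_def J by linarith+
  have "e_real S p q l d = p / (q * l * d) * ((d * S + l) / (d * S) * exp (- E))"
  proof -
    have "- integral {- l..1 / d} (\<lambda>z. z / quad S d z) = ln ((d * S + l) / (d * S)) + (- E)"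
      by (simp add: E_def f_def[abs_def])
    then have "exp (- integral {- l..1 / d} (\<lambda>z. z / quad S d z)) = (d * S + l) / (d * S) * exp (- E)"
      using dSl by (simp only: exp_add) simp
    then show ?thesis using e_real_alt[OF S(1,2) l p] by simp
  qed
  then have "e_real S p q l d * d^2 / ((S - p) / (S * (- q))) = (- p * (d * S + l) / (l * (S - p))) * exp (- E)"
  proof -
    have gen: "p / (q * l * d) * ((d * S + l) / (d * S) * X) * d^2 / (Y / (S * (- q))) = (- p * (d * S + l) / (l * Y)) * X"
      if "Y \<noteq> 0" for X Y :: real
      using S l(1) p q that by (simp add: field_simps power2_eq_square)
    have "S - p \<noteq> 0" using S p by simp
    moreover assume "e_real S p q l d = p / (q * l * d) * ((d * S + l) / (d * S) * exp (- E))"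
    ultimately show ?thesis using gen by simp
  qed
  moreover define h where "h = - S * p / (l^2 * (S - p))"
  have hh: "- p * (d * S + l) / (l * (S - p)) = 1 - h"
  proof -
    have "- p * (d * S + l) * l = S * (- p * (1 + d * l)) + S * p + (- p) * l^2"
      by (simp add: algebra_simps power2_eq_square)
    also have "\<dots> = l^2 * (S - p) + S * p" unfolding l(2)[symmetric] by (simp add: algebra_simps)
    finally have x: "- p * (d * S + l) * l = l^2 * (S - p) + S * p" .
    have "- p * (d * S + l) / (l * (S - p)) = (- p * (d * S + l) * l) / (l^2 * (S - p))"
      using l(1) by (simp add: power2_eq_square)
    also have "\<dots> = 1 - h"
    proof -
      have "(X + S * p) / X = 1 - (- S * p / X)" if "X \<noteq> 0" for X using that by (simp add: field_simps)
      then show ?thesis unfolding x h_def using l(1) p S by simp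
    qed
    finally show ?thesis .
  qed
  ultimately have R: "e_real S p q l d * d^2 / ((S - p) / (S * (- q))) = (1 - h) * exp (- E)" by (simp only:)
  have h0: "0 \<le> h" using S p l(1) unfolding h_def by (intro divide_nonneg_pos mult_pos_pos) (auto simp: mult_nonneg_nonpos mult_nonpos_nonneg)
  have h1: "0 \<le> 1 - h" unfolding hh[symmetric] using p S l(1) dSl by (intro divide_nonneg_pos mult_nonneg_nonneg mult_pos_pos) auto
  have "(1 - h) * exp (- E) \<le> 1 * 1" using h0 h1 E by (intro mult_mono) auto
  moreover have "(1 - h) * (1 - E) \<le> (1 - h) * exp (- E)"
    using h1 exp_ge_add_one_self[of "- E"] by (intro mult_left_mono) auto
  moreover have "1 - h - E \<le> (1 - h) * (1 - E)" using h0 E by (simp add: algebra_simps)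
  ultimately have "\<bar>(1 - h) * exp (- E) - 1\<bar> \<le> h + E" by linarith
  then show ?thesis unfolding R using E h_def by linarith
qed

lemma eigval_bounds:
  assumes "coef_p al mu 1 th < 0" "0 < d"
  shows "- coef_p al mu 1 th * d \<le> eigval al mu d 1 th"
    "eigval al mu d 1 th \<le> - coef_p al mu 1 th * d + sqrt (- coef_p al mu 1 th)"
proof -
  define P where "P = - coef_p al mu 1 th"
  have P: "0 < P" using assms by (simp add: P_def)
  define s where "s = sqrt (d^2 * P^2 + 4 * P)"
  have e: "eigval al mu d 1 th = (d * P + s) / 2" unfolding eigval_def s_def P_def by (simp add: field_simps)
  have "sqrt ((d * P)^2) \<le> s" unfolding s_def using P by (simp add: power_mult_distrib)
  then have "d * P \<le> s" using P assms by simp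
  moreover have "s \<le> sqrt ((d * P)^2) + sqrt (4 * P)" unfolding s_def
    using sqrt_add_le_add_sqrt[of "(d * P)^2" "4 * P"] P by (simp add: power_mult_distrib)
  then have "s \<le> d * P + 2 * sqrt P" using P assms by (simp add: real_sqrt_mult)
  ultimately show "- coef_p al mu 1 th * d \<le> eigval al mu d 1 th"
    "eigval al mu d 1 th \<le> - coef_p al mu 1 th * d + sqrt (- coef_p al mu 1 th)"
    unfolding e P_def[symmetric] by (auto simp: mult.commute)
qed

lemma large_error_bigo:
  assumes "0 < S" "0 < P"
  shows "(\<lambda>d. S / (P * d^2 * (S + P)) + (ln (1 + d * (P * d + sqrt P)) / (d^2 * S) + 2 * ln (1 + S * d^2) / (d^2 * S)))
    \<in> O[at_top](\<lambda>d. 1 / d^2 * ln (1 / d^2) :: real)"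
proof -
  have sq: "0 < sqrt P" using assms by simp
  have "(\<lambda>d. S / (P * d^2 * (S + P))) \<in> O[at_top](\<lambda>d. 1 / d^2 * ln (1 / d^2) :: real)"
    using assms by real_asymp
  moreover have "(\<lambda>d. ln (1 + d * (P * d + s)) / (d^2 * S)) \<in> O[at_top](\<lambda>d. 1 / d^2 * ln (1 / d^2) :: real)" if "0 < s" for s
    using assms that by real_asymp
  moreover have "(\<lambda>d. 2 * ln (1 + S * d^2) / (d^2 * S)) \<in> O[at_top](\<lambda>d. 1 / d^2 * ln (1 / d^2) :: real)"
    using assms by real_asymp
  ultimately show ?thesis using sq by (intro sum_in_bigo)
qed

lemma e_fun_large:
  assumes par: "0 < al" "0 < mu" "coef_p al mu 1 th < 0" "coef_q al mu 1 th < 0"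
  defines "C \<equiv> (S_w al mu th - coef_p al mu 1 th) / (S_w al mu th * (- coef_q al mu 1 th))"
  shows "\<exists>r. r \<in> O[at_top](\<lambda>d. 1 / d^2 * ln (1 / d^2)) \<and> (\<forall>d>0. e_fun al mu d th = C * (1 / d^2) * (1 + r d))"
proof -
  define S p q where "S = S_w al mu th" and "p = coef_p al mu 1 th" and "q = coef_q al mu 1 th"
  have S: "0 < S" "p < 0" "q < 0" using S_w_pos par by (auto simp: S_def p_def q_def)
  have C: "C = (S - p) / (S * (- q))" by (simp add: C_def S_def p_def q_def)
  have C0: "0 < C" unfolding C using S by (intro divide_pos_pos mult_pos_pos) auto
  define r where "r d = e_fun al mu d th * d^2 / C - 1" for d
  let ?g = "\<lambda>d. S / (- p * d^2 * (S + - p)) + (ln (1 + d * (- p * d + sqrt (- p))) / (d^2 * S) + 2 * ln (1 + S * d^2) / (d^2 * S))"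
  have "\<forall>\<^sub>F d in at_top. norm (r d) \<le> 1 * norm (?g d)"
  proof -
    have "\<forall>\<^sub>F d in at_top. 0 < d \<and> 4 \<le> d^2 * S"
      using S(1) by (intro eventually_conj eventually_gt_at_top) real_asymp
    then show ?thesis
    proof eventually_elim
      case (elim d)
      define l where "l = eigval al mu d 1 th"
      have l: "0 < l" "l^2 = - p * (1 + d * l)"
        using eigval_pos[of d al mu th] eigval_square[OF par(3), of d] elim par by (auto simp: p_def l_def)
      have lb: "- p * d \<le> l" "l \<le> - p * d + sqrt (- p)"
        using eigval_bounds[of al mu th d] elim par by (auto simp: p_def l_def)
      have "\<bar>r d\<bar> \<le> - S * p / (l^2 * (S - p)) + (ln (1 + d * l) / (d^2 * S) + 2 * ln (1 + S * d^2) / (d^2 * S))"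
        using e_real_large[OF S(1) _ _ l S(2,3)] elim e_fun_eq[of al mu d th] par
        unfolding r_def C by (simp add: S_def p_def q_def l_def)
      also have "\<dots> \<le> ?g d"
      proof (intro add_mono order_refl divide_right_mono)
        have "- S * p / (l^2 * (S - p)) \<le> - S * p / ((- p * d)^2 * (S - p))"
          using lb S elim l(1) by (intro divide_left_mono mult_right_mono power_mono mult_pos_pos) (auto simp: mult_nonneg_nonpos mult_nonpos_nonneg mult_neg_pos)
        also have "\<dots> = S / (- p * d^2 * (S + - p))"
          using S elim by (simp add: power2_eq_square field_simps)
        finally show "- S * p / (l^2 * (S - p)) \<le> S / (- p * d^2 * (S + - p))" .
        have "d * l \<le> d * (- p * d + sqrt (- p))" using lb elim by (intro mult_left_mono) auto
        moreover have "0 < d * l" using elim l by simp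
        ultimately show "ln (1 + d * l) \<le> ln (1 + d * (- p * d + sqrt (- p)))" by (subst ln_le_cancel_iff) linarith+
        show "0 \<le> d^2 * S" using S by simp
      qed
      finally show ?case by simp
    qed
  qed
  then have "r \<in> O[at_top](?g)" by (rule bigoI)
  also have "?g \<in> O[at_top](\<lambda>d. 1 / d^2 * ln (1 / d^2))"
    using large_error_bigo[of S "- p"] S by simp
  finally show ?thesis using C0 by (intro exI[of _ r]) (auto simp: r_def)
qed

section \<open>Expansion for small damping\<close>

lemma e_fun_small:
  assumes par: "0 < al" "0 < mu" "coef_p al mu 1 th < 0" "coef_q al mu 1 th < 0"
  defines "S \<equiv> S_w al mu th" and "p \<equiv> coef_p al mu 1 th" and "q \<equiv> coef_q al mu 1 th"
  shows "\<exists>r. r \<in> O[at_right 0](\<lambda>d. d^2) \<and> (\<forall>d>0. e_fun al mu d th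
     = p / q * sqrt ((S - p) / (- p)) * (1 - sqrt S / 2 * (pi - arctan (sqrt (- (S / p)))) * d + r d))"
proof -
  have S: "0 < S" "p < 0" "q < 0" using S_w_pos par by (auto simp: S_def p_def q_def)
  define l where "l d = (sqrt (d^2 * p^2 - 4 * p) - d * p) / 2" for d
  have l_eig: "eigval al mu d 1 th = l d" for d by (simp add: eigval_def l_def p_def field_simps)
  define w where "w d = sqrt (S - d^2 * S^2 / 4)" for d
  \<comment> \<open>For small d the quadratic is w^2 + (z - d S / 2)^2 and the clock is a difference
    of arctangents. The one at z = 1 / d has a large argument and is written as pi / 2 minus the
    arctangent of the reciprocal; in this form \<open>G\<close> is differentiable at 0.\<close>
  define G where "G d = (pi / 2 - arctan (w d * d / (1 - d^2 * S / 2)) + arctan ((l d + d * S / 2) / w d)) / w d" for d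
  have "\<exists>D. (G has_real_derivative D) (at 0)"
    unfolding G_def l_def w_def using S
    by (intro exI) (rule derivative_eq_intros refl | simp)+
  then obtain D where "(G has_real_derivative D) (at 0)" by blast
  then have "((\<lambda>d. (G d - G 0) / (d - 0)) \<longlongrightarrow> D) (at_right 0)"
    unfolding has_field_derivative_iff by (rule tendsto_within_subset) simp
  then have "\<forall>\<^sub>F d in at_right 0. dist ((G d - G 0) / (d - 0)) D < 1"
    by (rule tendstoD) simp
  then have G1: "\<forall>\<^sub>F d in at_right 0. \<bar>G d - G 0\<bar> \<le> (\<bar>D\<bar> + 1) * d"
    using eventually_at_right_less[of 0]
  proof eventually_elim
    case (elim d)
    then have "\<bar>(G d - G 0) / d\<bar> \<le> \<bar>D\<bar> + 1" by (auto simp: dist_real_def)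
    then show ?case using elim by (simp add: abs_divide field_simps)
  qed
  \<comment> \<open>The bound d^2 S < 2 makes w real and nonzero and keeps 1 - d^2 S / 2 positive,
    as the reciprocal rule for arctan requires.\<close>
  have T: "stick_clock S d (l d) (1 / d) = G d" if d: "0 < d" "d^2 * S < 2" for d
  proof -
    have ld: "0 < l d" using eigval_pos[OF d(1) par(3)] by (simp add: l_eig)
    then have i: "- l d \<le> 1 / d" using d by (smt (verit) divide_pos_pos)
    have "0 < S * (4 - d^2 * S)" using S d by simp
    then have w2: "0 < S - d^2 * S^2 / 4" by (simp add: power2_eq_square algebra_simps)
    then have w0: "0 < w d" "(w d)^2 = S - d^2 * S^2 / 4" by (simp_all add: w_def)
    have Q: "quad S d z = (w d)^2 + (z - d * S / 2)^2" for z
      unfolding w0 quad_def by (simp add: power2_eq_square field_simps)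
    have "((\<lambda>z. 1 / quad S d z) has_integral
        (arctan ((1 / d - d * S / 2) / w d) / w d - arctan ((- l d - d * S / 2) / w d) / w d)) {- l d..1 / d}"
    proof (rule fundamental_theorem_of_calculus[OF i])
      fix z
      have "((\<lambda>z. arctan ((z - d * S / 2) / w d) / w d) has_real_derivative
          inverse (1 + ((z - d * S / 2) / w d)^2) * (1 / w d) / w d) (at z within {- l d..1 / d})"
        using w0(1) by (auto intro!: derivative_eq_intros)
      moreover have "inverse (1 + ((z - d * S / 2) / w d)^2) * (1 / w d) / w d = 1 / quad S d z"
      proof -
        have "1 + ((z - d * S / 2) / w d)^2 = quad S d z / (w d)^2"
          using w0(1) unfolding Q by (simp add: power_divide add_divide_distrib)
        then show ?thesis using w0(1) by (simp add: power2_eq_square)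
      qed
      ultimately show "((\<lambda>z. arctan ((z - d * S / 2) / w d) / w d) has_vector_derivative 1 / quad S d z) (at z within {- l d..1 / d})"
        by (simp add: has_real_derivative_iff_has_vector_derivative)
    qed
    then have "stick_clock S d (l d) (1 / d) = arctan ((1 / d - d * S / 2) / w d) / w d - arctan ((- l d - d * S / 2) / w d) / w d"
      unfolding stick_clock_def by (rule integral_unique)
    moreover have "arctan ((- l d - d * S / 2) / w d) = - arctan ((l d + d * S / 2) / w d)"
    proof -
      have "(- l d - d * S / 2) / w d = - ((l d + d * S / 2) / w d)" by (simp add: diff_divide_distrib add_divide_distrib)
      then show ?thesis by (simp only: arctan_minus)
    qed
    moreover have "arctan ((1 / d - d * S / 2) / w d) = pi / 2 - arctan (w d * d / (1 - d^2 * S / 2))"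
    proof -
      let ?x = "w d * d / (1 - d^2 * S / 2)"
      have "0 < ?x" using d w0(1) by simp
      moreover have "1 / ?x = (1 / d - d * S / 2) / w d"
        using d w0(1) by (simp add: power2_eq_square field_simps)
      ultimately show ?thesis using arctan_inverse[of ?x] by simp
    qed
    ultimately show ?thesis by (simp add: G_def add_divide_distrib)
  qed
  define A where "A = p / q * sqrt ((S - p) / (- p))"
  have A0: "0 < A" unfolding A_def using S by (intro mult_pos_pos real_sqrt_gt_zero divide_pos_pos divide_neg_neg) auto
  define c where "c = sqrt S / 2 * (pi - arctan (sqrt (- (S / p))))"
  have c: "c = S / 2 * G 0"
  proof -
    have y0: "0 < sqrt (S / (- p))" using S by (intro real_sqrt_gt_zero divide_pos_pos) auto
    have y1: "inverse (sqrt (S / (- p))) = sqrt (- p) / sqrt S" by (simp only: real_sqrt_divide inverse_divide)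
    have "arctan (sqrt (- p) / sqrt S) = pi / 2 - arctan (sqrt (S / (- p)))"
      using arctan_inverse[OF y0] unfolding y1 .
    moreover have "l 0 = sqrt (- p)"
    proof -
      have "sqrt (- (4 * p)) = 2 * sqrt (- p)" using real_sqrt_mult[of 4 "- p"] by simp
      then show ?thesis by (simp add: l_def)
    qed
    moreover have "S / 2 * (x / sqrt S) = sqrt S / 2 * x" for x
      using S(1) by (simp add: real_div_sqrt field_simps)
    ultimately show ?thesis unfolding c_def G_def w_def by simp
  qed
  define r where "r d = e_fun al mu d th / A - 1 + c * d" for d
  \<comment> \<open>The first summand bounds the quadratic remainder of the exponential, the second
    the remainder of the first-order expansion of G at 0.\<close>
  define K where "K = (S / 2 * (\<bar>G 0\<bar> + \<bar>D\<bar> + 1))^2 + S / 2 * (\<bar>D\<bar> + 1)"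
  have "\<forall>\<^sub>F d in at_right 0. norm (r d) \<le> K * norm (d^2)"
  proof -
    have "((\<lambda>d. d^2 * S) \<longlongrightarrow> 0^2 * S) (at_right 0)" by (intro tendsto_intros)
    then have "\<forall>\<^sub>F d in at_right 0. d^2 * S < 2"
      by (rule order_tendstoD) simp
    moreover have "\<forall>\<^sub>F d in at_right (0::real). d < 1"
      by (rule order_tendstoD[OF tendsto_ident_at]) simp
    ultimately show ?thesis using G1 eventually_at_right_less[of 0]
    proof eventually_elim
      case (elim d)
      define x where "x = S / 2 * (d * G d)"
      have ld: "0 < l d" using eigval_pos[OF elim(4) par(3)] by (simp add: l_eig)
      have "0 \<le> G d"
        using T[OF elim(4,1)] stick_clock_strict_mono[OF S(1) elim(4), of "l d" "- l d" "1 / d"] ld elim(4) stick_clock_start[of S d "l d"]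
        by (smt (verit) divide_pos_pos)
      then have x0: "0 \<le> x" using S elim by (simp add: x_def)
      have e: "e_fun al mu d th / A = exp (- x)"
        using e_fun_eq[OF par(1,2) elim(4) par(3)] A0 T[OF elim(4,1)]
        unfolding e_real_def S_def[symmetric] p_def[symmetric] q_def[symmetric] l_eig A_def[symmetric]
        by (simp add: x_def)
      have "1 - x \<le> exp (- x)" using exp_ge_add_one_self[of "- x"] by simp
      moreover have "exp (- x) \<le> 1 - x + x^2"
      proof -
        have "1 \<le> (1 - x + x^2) * (1 + x)" using x0 by (simp add: power2_eq_square algebra_simps)
        also have "\<dots> \<le> (1 - x + x^2) * exp x"
        proof (rule mult_left_mono[OF exp_ge_add_one_self])
          have "0 \<le> (x - 1 / 2)^2" by simp
          then show "0 \<le> 1 - x + x^2" by (simp add: power2_eq_square algebra_simps)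
        qed
        finally show ?thesis by (simp add: exp_minus field_simps)
      qed
      ultimately have "\<bar>exp (- x) - 1 + x\<bar> \<le> x^2" by linarith
      moreover have "\<bar>c * d - x\<bar> \<le> S / 2 * (\<bar>D\<bar> + 1) * d^2"
      proof -
        have "c * d - x = - (S / 2 * d * (G d - G 0))" by (simp add: c x_def field_simps)
        then have "\<bar>c * d - x\<bar> = S / 2 * d * \<bar>G d - G 0\<bar>" using S elim by (simp add: abs_mult)
        also have "\<dots> \<le> S / 2 * d * ((\<bar>D\<bar> + 1) * d)" using S elim by (intro mult_left_mono) auto
        finally show ?thesis by (simp add: power2_eq_square algebra_simps)
      qed
      moreover have "x^2 \<le> (S / 2 * (\<bar>G 0\<bar> + \<bar>D\<bar> + 1))^2 * d^2"
      proof -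
        have "(\<bar>D\<bar> + 1) * d \<le> \<bar>D\<bar> + 1" using elim by (intro mult_left_le) auto
        then have "G d \<le> \<bar>G 0\<bar> + \<bar>D\<bar> + 1" using elim(3) by linarith
        then have "x \<le> S / 2 * (d * (\<bar>G 0\<bar> + \<bar>D\<bar> + 1))" using S elim unfolding x_def by (intro mult_left_mono) auto
        then have "x^2 \<le> (S / 2 * (d * (\<bar>G 0\<bar> + \<bar>D\<bar> + 1)))^2" using x0 by (intro power_mono) auto
        also have "\<dots> = (S / 2 * (\<bar>G 0\<bar> + \<bar>D\<bar> + 1))^2 * d^2" by (simp only: power_mult_distrib mult_ac)
        finally show ?thesis .
      qed
      moreover have "r d = (exp (- x) - 1 + x) + (c * d - x)" unfolding r_def e by simp
      ultimately have "\<bar>r d\<bar> \<le> K * d^2" unfolding K_def distrib_right by linarith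
      then show ?case by simp
    qed
  qed
  then have "r \<in> O[at_right 0](\<lambda>d. d^2)" by (rule bigoI)
  moreover have "e_fun al mu d th = A * (1 - c * d + r d)" for d using A0 by (simp add: r_def)
  ultimately show ?thesis unfolding A_def c_def by (intro exI[of _ r] conjI allI impI)
qed

text \<open>Everything rests on S_w - p_+ = - q_+ (p_- - p_+) / (q_- - q_+). This converts the
  constants found above into those of the statement, here and in the small damping case.\<close>

lemma coef_ratio_large:
  assumes "0 < al" "0 < mu" "coef_q al mu 1 th < 0" "coef_q al mu (-1) th > 0"
  shows "(S_w al mu th - coef_p al mu 1 th) / (S_w al mu th * (- coef_q al mu 1 th))
    = (coef_p al mu (-1) th - coef_p al mu 1 th)
      / (coef_q al mu (-1) th * coef_p al mu 1 th - coef_q al mu 1 th * coef_p al mu (-1) th)"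
proof -
  define p q pm qm where "p = coef_p al mu 1 th" and "q = coef_q al mu 1 th" and "pm = coef_p al mu (-1) th" and "qm = coef_q al mu (-1) th"
  define N where "N = qm * p - q * pm"
  have S: "S_w al mu th = N / (qm - q)" by (simp add: S_w_def p_def q_def pm_def qm_def N_def)
  have q: "q < 0" "0 < qm - q" using assms by (auto simp: q_def qm_def)
  have "N \<noteq> 0" using S_w_pos[OF assms(1,2), of th] unfolding S by auto
  have "(N / (qm - q) - p) / (N / (qm - q) * (- q)) = (N - p * (qm - q)) / (N * (- q))"
    using q \<open>N \<noteq> 0\<close> by (simp add: field_simps)
  also have "N - p * (qm - q) = (pm - p) * (- q)" by (simp add: N_def algebra_simps)
  also have "(pm - p) * (- q) / (N * (- q)) = (pm - p) / N" using q by simp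
  finally show ?thesis unfolding S p_def[symmetric] q_def[symmetric] pm_def[symmetric] qm_def[symmetric] by (simp add: N_def)
qed

lemma coef_ratio_small:
  assumes "0 < al" "0 < mu" "coef_p al mu 1 th < 0" "coef_q al mu 1 th < 0" "coef_q al mu (-1) th > 0"
  shows "coef_p al mu 1 th / coef_q al mu 1 th * sqrt ((S_w al mu th - coef_p al mu 1 th) / (- coef_p al mu 1 th))
    = sqrt (coef_p al mu 1 th * (coef_p al mu (-1) th - coef_p al mu 1 th)
                      / (coef_q al mu 1 th * (coef_q al mu (-1) th - coef_q al mu 1 th)))"
proof -
  define p q pm qm where "p = coef_p al mu 1 th" and "q = coef_q al mu 1 th" and "pm = coef_p al mu (-1) th" and "qm = coef_q al mu (-1) th"
  have S: "S_w al mu th = (qm * p - q * pm) / (qm - q)" by (simp add: S_w_def p_def q_def pm_def qm_def)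
  have q: "p < 0" "q < 0" "0 < qm - q" using assms by (auto simp: p_def q_def qm_def)
  have "(qm * p - q * pm) / (qm - q) - p = - q * (pm - p) / (qm - q)"
    using q by (simp add: field_simps)
  then have "(S_w al mu th - p) / (- p) = q * (pm - p) / (p * (qm - q))"
    unfolding S using q by simp
  moreover have "p / q * sqrt x = sqrt ((p / q)^2 * x)" for x
    using q by (simp add: real_sqrt_mult divide_neg_neg less_imp_le)
  moreover have "(p / q)^2 * (q * (pm - p) / (p * (qm - q))) = p * (pm - p) / (q * (qm - q))"
    using q by (simp add: power2_eq_square)
  ultimately show ?thesis unfolding p_def[symmetric] q_def[symmetric] pm_def[symmetric] qm_def[symmetric] by simp
qed

section \<open>Existence of Filippov solutions\<close>

text \<open>Each point is given a rational number in the gap to its right; disjoint gaps give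
  different rationals. It is applied to the instants at which both fields cross v = 0 in the same
  direction.\<close>

lemma countable_right_isolated:
  fixes E :: "real set"
  assumes "\<And>t. t \<in> E \<Longrightarrow> \<exists>e>0. {t<..<t + e} \<inter> E = {}"
  shows "countable E"
proof -
  from assms obtain e where e: "\<And>t. t \<in> E \<Longrightarrow> 0 < e t \<and> {t<..<t + e t} \<inter> E = {}" by metis
  have "\<exists>r. t < real_of_rat r \<and> real_of_rat r < t + e t" if "t \<in> E" for t
    using of_rat_dense[of t "t + e t"] e[OF that] by simp
  then obtain r where r: "\<And>t. t \<in> E \<Longrightarrow> t < real_of_rat (r t) \<and> real_of_rat (r t) < t + e t" by metis
  have "inj_on r E"
  proof (rule linorder_inj_onI)
    fix s t assume st: "s < t" "s \<in> E" "t \<in> E"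
    then have "t \<notin> {s<..<s + e s}" using e by blast
    then have "s + e s \<le> t" using st by simp
    then have "real_of_rat (r s) < real_of_rat (r t)" using r[OF st(2)] r[OF st(3)] by linarith
    then show "r s \<noteq> r t" by auto
  qed auto
  then show ?thesis using countableI'[of "to_nat \<circ> r" E] by (simp add: comp_inj_on)
qed

text \<open>With a delay r the right-hand side at time s is known from times up to s - r. Successive
  approximation therefore becomes exact on one more interval of length r at each step, and finitely
  many steps suffice without any Lipschitz condition.\<close>

lemma tonelli_delay:
  fixes F :: "'a::euclidean_space \<Rightarrow> 'a" and r L :: real
  assumes F: "continuous_on UNIV F" and r: "0 < r"
  obtains x where "continuous_on {0..L} x"
    "\<And>t. t \<in> {0..L} \<Longrightarrow> x t = x0 + integral {0..t} (\<lambda>s. F (x (max 0 (s - r))))"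
proof -
  define u where "u = rec_nat (\<lambda>_. x0) (\<lambda>_ v t. x0 + integral {0..t} (\<lambda>s. F (v (max 0 (s - r)))))"
  have u0: "u 0 t = x0" and uS: "u (Suc k) t = x0 + integral {0..t} (\<lambda>s. F (u k (max 0 (s - r))))" for k t
    by (simp_all add: u_def)
  have cd: "continuous_on {0..L} (\<lambda>s. F (v (max 0 (s - r))))" if "continuous_on {0..L} v" for v
  proof -
    have "continuous_on {0..L} (\<lambda>s. v (max 0 (s - r)))"
      by (rule continuous_on_compose2[OF that]) (use r in \<open>auto intro!: continuous_intros\<close>)
    then show ?thesis by (rule continuous_on_compose2[OF F]) auto
  qed
  have uc: "continuous_on {0..L} (u k)" for k
  proof (induction k)
    case 0
    then show ?case by (simp add: u0)
  next
    case (Suc k)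
    then have "continuous_on {0..L} (\<lambda>t. x0 + integral {0..t} (\<lambda>s. F (u k (max 0 (s - r)))))"
      by (intro continuous_intros indefinite_integral_continuous_1 integrable_continuous_real cd)
    then show ?case by (simp add: uS[abs_def])
  qed
  have stable: "u (Suc k) t = u k t" if "0 \<le> t" "t \<le> real k * r" for k t
    using that
  proof (induction k arbitrary: t)
    case 0
    then have "t = 0" by simp
    then show ?case by (simp add: u0 uS)
  next
    case (Suc k)
    have "integral {0..t} (\<lambda>s. F (u (Suc k) (max 0 (s - r)))) = integral {0..t} (\<lambda>s. F (u k (max 0 (s - r))))"
    proof (rule Henstock_Kurzweil_Integration.integral_cong)
      fix s assume "s \<in> {0..t}"
      then show "F (u (Suc k) (max 0 (s - r))) = F (u k (max 0 (s - r)))"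
        using Suc.prems r by (subst Suc.IH) (auto simp: distrib_right max_def)
    qed
    then show ?case unfolding uS[of "Suc k"] uS[of k] by simp
  qed
  obtain N where "L \<le> real N * r" using reals_Archimedean3[OF r, rule_format, of L] less_imp_le by blast
  then have "u N t = x0 + integral {0..t} (\<lambda>s. F (u N (max 0 (s - r))))" if "t \<in> {0..L}" for t
    using stable[of t N] that uS[of N t] by simp
  then show ?thesis using uc that by blast
qed

section \<open>Continuous approximation of the sign and smoothing at the zeros of v\<close>

definition sat :: "real \<Rightarrow> real" where "sat c = max (- 1) (min 1 c)"

lemma abs_sat_le: "\<bar>sat c\<bar> \<le> 1" by (auto simp: sat_def)

lemma continuous_on_sat: "continuous_on A f \<Longrightarrow> continuous_on A (\<lambda>x. sat (f x))"
  unfolding sat_def by (intro continuous_intros)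

lemma sat_tendsto_sgn:
  assumes c: "c \<longlonglongrightarrow> l" and m: "filterlim m at_top sequentially" and l: "l \<noteq> (0::real)"
  shows "(\<lambda>n. sat (m n * c n)) \<longlonglongrightarrow> sgn l"
proof (cases "0 < l")
  case True
  have "filterlim (\<lambda>n. c n * m n) at_top sequentially"
    by (rule filterlim_tendsto_pos_mult_at_top[OF c True m])
  then have "\<forall>\<^sub>F n in sequentially. 1 \<le> c n * m n" by (simp add: filterlim_at_top)
  then have "\<forall>\<^sub>F n in sequentially. sat (m n * c n) = sgn l"
    by eventually_elim (use True in \<open>auto simp: sat_def mult.commute\<close>)
  then show ?thesis by (rule tendsto_eventually)
next
  case False
  then have "l < 0" using l by simp
  then have "filterlim (\<lambda>n. c n * m n) at_bot sequentially"
    by (rule filterlim_tendsto_neg_mult_at_bot[OF c _ m])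
  then have "\<forall>\<^sub>F n in sequentially. c n * m n \<le> - 1" by (simp add: filterlim_at_bot)
  then have "\<forall>\<^sub>F n in sequentially. sat (m n * c n) = sgn l"
    by eventually_elim (use \<open>l < 0\<close> in \<open>auto simp: sat_def mult.commute\<close>)
  then show ?thesis by (rule tendsto_eventually)
qed

text \<open>Along \<open>\<psi>\<^sub>\<eta>(v) = v\<^sup>3 / (v^2 + \<eta>)\<close> a Lipschitz \<open>v\<close> becomes differentiable at its zeros,
  so the fundamental theorem of calculus applies without any theorem on differentiation almost everywhere;
  then \<open>\<eta>\<close> tends to \<open>0\<close>.\<close>

definition cubic :: "real \<Rightarrow> real \<Rightarrow> real" where "cubic et v = v ^ 3 / (v^2 + et)"

definition cubic' :: "real \<Rightarrow> real \<Rightarrow> real" where "cubic' et v = (v ^ 4 + 3 * et * v^2) / (v^2 + et)^2"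

lemma cubic_deriv: "0 < et \<Longrightarrow> (cubic et has_real_derivative cubic' et v) (at v)"
proof -
  assume e: "0 < et"
  then have "v^2 + et \<noteq> 0" by (smt (verit) zero_le_power2)
  moreover have "(3 * v^2 * (v^2 + et) - v ^ 3 * (2 * v)) / ((v^2 + et) * (v^2 + et)) = cubic' et v"
    unfolding cubic'_def by (simp add: power2_eq_square power3_eq_cube power4_eq_xxxx algebra_simps)
  ultimately show ?thesis unfolding cubic_def[abs_def]
    by (auto intro!: derivative_eq_intros simp: numeral_eq_Suc)
qed

lemma abs_cubic_le: "0 < et \<Longrightarrow> \<bar>cubic et v\<bar> \<le> \<bar>v\<bar>"
proof -
  assume e: "0 < et"
  have "\<bar>v\<bar> ^ 3 = \<bar>v\<bar> * v^2" by (simp add: power3_eq_cube power2_eq_square)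
  also have "\<dots> \<le> \<bar>v\<bar> * (v^2 + et)" using e by (intro mult_left_mono) auto
  finally show ?thesis using e by (simp add: cubic_def abs_divide power_abs divide_le_eq add_nonneg_pos abs_of_nonneg)
qed

lemma cubic'_bounds: "0 < et \<Longrightarrow> 0 \<le> cubic' et v \<and> cubic' et v \<le> 3"
proof -
  assume e: "0 < et"
  have "3 * (v^2 + et)^2 - (v ^ 4 + 3 * et * v^2) = 3 * et^2 + 3 * (et * v^2) + 2 * (v^2)^2"
    by (simp add: power2_eq_square power4_eq_xxxx algebra_simps)
  moreover have "0 \<le> 3 * et^2 + 3 * (et * v^2) + 2 * (v^2)^2" using e by simp
  ultimately have "v ^ 4 + 3 * et * v^2 \<le> 3 * (v^2 + et)^2" by linarith
  moreover have "0 < (v^2 + et)^2" using e by (intro zero_less_power add_nonneg_pos) auto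
  moreover have "0 \<le> v ^ 4 + 3 * et * v^2" using e by simp
  ultimately show ?thesis by (simp add: cubic'_def divide_le_eq)
qed

lemma cubic_tendsto: "(\<lambda>n. cubic (1 / real (Suc n)) v) \<longlonglongrightarrow> v"
proof (cases "v = 0")
  case False
  have "(\<lambda>n. v ^ 3 / (v^2 + 1 / real (Suc n))) \<longlonglongrightarrow> v ^ 3 / (v^2 + 0)"
    by (intro tendsto_intros LIMSEQ_Suc[OF lim_1_over_n]) (use False in auto)
  then show ?thesis using False by (simp add: cubic_def power3_eq_cube power2_eq_square)
qed (simp add: cubic_def)

lemma cubic'_tendsto: "v \<noteq> 0 \<Longrightarrow> (\<lambda>n. cubic' (1 / real (Suc n)) v) \<longlonglongrightarrow> 1"
proof -
  assume v: "v \<noteq> 0"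
  have "(\<lambda>n. (v ^ 4 + 3 * (1 / real (Suc n)) * v^2) / (v^2 + 1 / real (Suc n))^2) \<longlonglongrightarrow> (v ^ 4 + 3 * 0 * v^2) / (v^2 + 0)^2"
    by (intro tendsto_intros LIMSEQ_Suc[OF lim_1_over_n]) (use v in auto)
  then show ?thesis using v by (simp add: cubic'_def power4_eq_xxxx power2_eq_square)
qed

text \<open>An integrated product rule for v n in which v is Lipschitz and differentiable only off
  its zeros, with derivative declared 0 at the zeros. Exactly this convention makes the density
  constructed below tangent to v = 0.\<close>

lemma integral_mult_parts_with_zeros:
  fixes n :: "real \<Rightarrow> 'a::euclidean_space"
  assumes L: "0 \<le> L"
    and cont: "continuous_on {0..L} v" "continuous_on {0..L} n" "continuous_on {0..L} n'"
    and lip: "\<And>s t. s \<in> {0..L} \<Longrightarrow> t \<in> {0..L} \<Longrightarrow> \<bar>v s - v t\<bar> \<le> K * \<bar>s - t\<bar>"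
    and dn: "\<And>t. t \<in> {0<..<L} \<Longrightarrow> (n has_vector_derivative n' t) (at t)"
    and dv: "\<And>t. t \<in> {0<..<L} \<Longrightarrow> v t \<noteq> 0 \<Longrightarrow> (v has_real_derivative g t) (at t)"
    and g0: "\<And>t. v t = 0 \<Longrightarrow> g t = 0" and gb: "\<And>t. t \<in> {0..L} \<Longrightarrow> \<bar>g t\<bar> \<le> K"
  shows "((\<lambda>t. v t *\<^sub>R n' t + g t *\<^sub>R n t) has_integral (v L *\<^sub>R n L - v 0 *\<^sub>R n 0)) {0..L}"
proof -
  define f where "f k t = cubic (1 / real (Suc k)) (v t) *\<^sub>R n' t + (cubic' (1 / real (Suc k)) (v t) * g t) *\<^sub>R n t" for k t
  define G where "G k t = cubic (1 / real (Suc k)) (v t) *\<^sub>R n t" for k t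
  have I: "(f k has_integral (G k L - G k 0)) {0..L}" for k
  proof (rule fundamental_theorem_of_calculus_interior[OF L])
    define et where "et = 1 / real (Suc k)"
    have e: "0 < et" by (simp add: et_def)
    have cc: "continuous_on UNIV (cubic et)"
      by (rule DERIV_continuous_on[where D = "cubic' et"]) (use cubic_deriv[OF e] in auto)
    show "continuous_on {0..L} (G k)"
      unfolding G_def et_def[symmetric]
      by (intro continuous_intros continuous_on_compose2[OF cc cont(1)] cont) auto
    fix t assume t: "t \<in> {0<..<L}"
    have "((\<lambda>t. cubic et (v t)) has_real_derivative cubic' et (v t) * g t) (at t)"
    proof (cases "v t = 0")
      case False
      then show ?thesis using DERIV_chain2[OF cubic_deriv[OF e] dv[OF t False]] by simp
    next
      case True
      have "((\<lambda>s. cubic et (v s) / (s - t)) \<longlongrightarrow> 0) (at t)"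
      proof (rule Lim_null_comparison)
        show "((\<lambda>s. K ^ 3 * \<bar>s - t\<bar>^2 / et) \<longlongrightarrow> 0) (at t)"
          using e by (auto intro!: tendsto_eq_intros)
        have "\<forall>\<^sub>F s in at t. s \<in> {0<..<L} \<and> s \<noteq> t"
          using t eventually_at_in_open[of "{0<..<L}" t] by (auto elim: eventually_mono)
        then show "\<forall>\<^sub>F s in at t. norm (cubic et (v s) / (s - t)) \<le> K ^ 3 * \<bar>s - t\<bar>^2 / et"
        proof eventually_elim
          case (elim s)
          have "\<bar>v s\<bar> \<le> K * \<bar>s - t\<bar>" using lip[of s t] elim t True by auto
          then have "\<bar>v s\<bar> ^ 3 \<le> (K * \<bar>s - t\<bar>) ^ 3" by (intro power_mono) auto
          moreover have "\<bar>cubic et (v s)\<bar> \<le> \<bar>v s\<bar> ^ 3 / et"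
            unfolding cubic_def abs_divide power_abs using e by (intro divide_left_mono) (auto simp: add_nonneg_pos)
          ultimately have "\<bar>cubic et (v s)\<bar> \<le> (K * \<bar>s - t\<bar>) ^ 3 / et"
            using e by (meson divide_right_mono less_imp_le order_trans)
          then have "\<bar>cubic et (v s)\<bar> / \<bar>s - t\<bar> \<le> (K * \<bar>s - t\<bar>) ^ 3 / et / \<bar>s - t\<bar>"
            by (rule divide_right_mono) simp
          also have "\<dots> = K ^ 3 * \<bar>s - t\<bar>^2 / et"
            using elim by (simp add: power_mult_distrib power3_eq_cube power2_eq_square)
          finally show ?case by (simp add: abs_divide)
        qed
      qed
      then show ?thesis using True g0[OF True] by (simp add: has_field_derivative_iff cubic_def[of _ 0])
    qed
    then have "((\<lambda>t. cubic et (v t)) has_vector_derivative cubic' et (v t) * g t) (at t)"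
      by (simp add: has_real_derivative_iff_has_vector_derivative)
    from has_vector_derivative_scaleR[OF this[folded has_real_derivative_iff_has_vector_derivative] dn[OF t]]
    show "(G k has_vector_derivative f k t) (at t)"
      unfolding G_def f_def et_def by simp
  qed
  obtain B where B: "\<And>t. t \<in> {0..L} \<Longrightarrow> norm (v t) \<le> B" "\<And>t. t \<in> {0..L} \<Longrightarrow> norm (n t) \<le> B" "\<And>t. t \<in> {0..L} \<Longrightarrow> norm (n' t) \<le> B"
  proof -
    have "bounded (v ` {0..L})" "bounded (n ` {0..L})" "bounded (n' ` {0..L})"
      using cont by (auto intro: compact_imp_bounded compact_continuous_image)
    then obtain a b c where "\<forall>t\<in>{0..L}. norm (v t) \<le> a" "\<forall>t\<in>{0..L}. norm (n t) \<le> b" "\<forall>t\<in>{0..L}. norm (n' t) \<le> c"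
      by (auto simp: bounded_iff)
    then show ?thesis using that[of "max a (max b c)"] by (auto simp: le_max_iff_disj)
  qed
  have fb: "norm (f k t) \<le> B * B + 3 * K * B" if t: "t \<in> {0..L}" for k t
  proof -
    have e: "0 < 1 / real (Suc k)" by simp
    have "norm (f k t) \<le> \<bar>cubic (1 / real (Suc k)) (v t)\<bar> * norm (n' t) + (\<bar>cubic' (1 / real (Suc k)) (v t)\<bar> * \<bar>g t\<bar>) * norm (n t)"
      unfolding f_def by (rule order_trans[OF norm_triangle_ineq]) (simp add: abs_mult)
    also have "\<dots> \<le> B * B + (3 * K) * B"
      using abs_cubic_le[OF e, of "v t"] cubic'_bounds[OF e, of "v t"] B[OF t] gb[OF t]
      by (intro add_mono mult_mono) (auto intro: order_trans[OF abs_ge_zero] mult_nonneg_nonneg)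
    finally show ?thesis by simp
  qed
  have lim: "(\<lambda>k. f k t) \<longlonglongrightarrow> v t *\<^sub>R n' t + g t *\<^sub>R n t" for t
  proof -
    have "(\<lambda>k. cubic' (1 / real (Suc k)) (v t) * g t) \<longlonglongrightarrow> g t"
      using tendsto_mult[OF cubic'_tendsto[of "v t"] tendsto_const[of "g t"]] g0[of t] by (cases "v t = 0") auto
    then show ?thesis unfolding f_def by (intro tendsto_intros cubic_tendsto)
  qed
  note dc = dominated_convergence[of f "{0..L}" "\<lambda>_. B * B + 3 * K * B", OF has_integral_integrable[OF I] integrable_const_ivl fb lim]
  have "(\<lambda>k. G k L - G k 0) \<longlonglongrightarrow> v L *\<^sub>R n L - v 0 *\<^sub>R n 0"
    unfolding G_def by (intro tendsto_intros cubic_tendsto)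
  moreover have "(\<lambda>k. G k L - G k 0) \<longlonglongrightarrow> integral {0..L} (\<lambda>t. v t *\<^sub>R n' t + g t *\<^sub>R n t)"
    using dc(2) integral_unique[OF I] by simp
  ultimately have "integral {0..L} (\<lambda>t. v t *\<^sub>R n' t + g t *\<^sub>R n t) = v L *\<^sub>R n L - v 0 *\<^sub>R n 0"
    by (rule LIMSEQ_unique[symmetric])
  then show ?thesis using integrable_integral[OF dc(1)] by simp
qed

lemma has_integral_increment:
  fixes f :: "real \<Rightarrow> 'a::euclidean_space"
  assumes f: "f integrable_on {0..L}" and x: "\<And>t. t \<in> {0..L} \<Longrightarrow> x t = c + integral {0..t} f"
    and st: "0 \<le> s" "s \<le> t" "t \<le> L"
  shows "(f has_integral (x t - x s)) {s..t}"
proof -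
  have "f integrable_on {0..t}" "f integrable_on {s..t}"
    using integrable_on_subinterval[OF f] st by auto
  moreover from this have "integral {0..s} f + integral {s..t} f = integral {0..t} f"
    using st by (intro Henstock_Kurzweil_Integration.integral_combine) auto
  ultimately show ?thesis
  proof -
    assume c: "f integrable_on {s..t}" "integral {0..s} f + integral {s..t} f = integral {0..t} f"
    then have "x t - x s = integral {s..t} f"
      using x[of s] x[of t] st by (auto simp: algebra_simps)
    then show ?thesis using c(1) by (simp add: integrable_integral)
  qed
qed

lemma has_integral_bounded_limit:
  fixes Fi :: "nat \<Rightarrow> real \<Rightarrow> 'b::euclidean_space"
  assumes F: "\<And>i. (Fi i has_integral li i) {s..t}"
    and b: "\<And>i r. r \<in> {s..t} \<Longrightarrow> norm (Fi i r) \<le> b" and c: "\<And>r. r \<in> {s..t} \<Longrightarrow> (\<lambda>i. Fi i r) \<longlonglongrightarrow> F r"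
    and l: "li \<longlonglongrightarrow> l"
  shows "(F has_integral l) {s..t}"
proof -
  note d = dominated_convergence[of Fi "{s..t}" "\<lambda>_. b" F, OF has_integral_integrable[OF F] integrable_const_ivl b c]
  have "li \<longlonglongrightarrow> integral {s..t} F" using d(2) integral_unique[OF F] by simp
  then have "l = integral {s..t} F" using l LIMSEQ_unique by blast
  then show ?thesis using integrable_integral[OF d(1)] by simp
qed

text \<open>The two fields differ along n (th z) by a multiple 2 h. Since th annihilates n, the
  angle th x has a continuous derivative in spite of the jump, so n (th x) can be differentiated
  along solutions; vv n = 1 lets v measure the jump direction.\<close>

locale friction_field =
  fixes f0 :: "'a::euclidean_space \<Rightarrow> 'a" and h :: "'a \<Rightarrow> real" and n n' :: "real \<Rightarrow> 'a"
    and vv th :: "'a \<Rightarrow> real" and C :: real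
  assumes f0: "continuous_on UNIV f0" "\<And>z. norm (f0 z) \<le> C"
    and h: "continuous_on UNIV h" "\<And>z. 0 \<le> h z" "\<And>z. h z \<le> C"
    and n: "\<And>a. (n has_vector_derivative n' a) (at a)" "continuous_on UNIV n'" "\<And>a. norm (n a) \<le> C"
    and vv: "bounded_linear vv" "\<And>a. vv (n a) = 1"
    and th: "bounded_linear th" "\<And>a. th (n a) = 0"
begin

definition approx_field :: "real \<Rightarrow> 'a \<Rightarrow> 'a" where
  "approx_field m z = f0 z - (sat (m * vv z) * h z) *\<^sub>R n (th z)"

lemma C_nonneg: "0 \<le> C"
  using f0(2)[of 0] norm_ge_zero order_trans by blast

lemma continuous_n: "continuous_on A n"
  by (intro continuous_at_imp_continuous_on ballI has_vector_derivative_continuous[OF n(1)])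

lemma continuous_comps [continuous_intros]:
  shows "continuous_on S f \<Longrightarrow> continuous_on S (\<lambda>s. f0 (f s))"
    and "continuous_on S f \<Longrightarrow> continuous_on S (\<lambda>s. h (f s))"
    and "continuous_on S f \<Longrightarrow> continuous_on S (\<lambda>s. vv (f s))"
    and "continuous_on S f \<Longrightarrow> continuous_on S (\<lambda>s. th (f s))"
    and "continuous_on S k \<Longrightarrow> continuous_on S (\<lambda>s. n (k s))"
    and "continuous_on S k \<Longrightarrow> continuous_on S (\<lambda>s. n' (k s))"
  by (auto intro: continuous_on_compose2[OF f0(1)] continuous_on_compose2[OF h(1)] continuous_on_compose2[OF n(2)]
      continuous_on_compose2[OF continuous_n[of UNIV]] bounded_linear.continuous_on[OF vv(1)] bounded_linear.continuous_on[OF th(1)])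

lemma sat_h_bound: "\<bar>sat c * h z\<bar> \<le> C"
  using mult_mono[OF abs_sat_le[of c] h(3)[of z]] h(2)[of z] by (simp add: abs_mult)

lemma approx_field_bound: "norm (approx_field m z) \<le> C + C * C"
proof -
  have "norm ((sat (m * vv z) * h z) *\<^sub>R n (th z)) \<le> C * C"
    unfolding norm_scaleR using sat_h_bound n(3) C_nonneg by (intro mult_mono) auto
  then show ?thesis unfolding approx_field_def using f0(2)[of z] norm_triangle_ineq4 by (smt (verit))
qed

lemma continuous_approx_field: "continuous_on UNIV (approx_field m)"
  unfolding approx_field_def[abs_def] by (intro continuous_intros continuous_on_sat)

text \<open>The delayed saturated approximations have a uniformly convergent subsequence, but their
  saturated signs converge only where v is nonzero. Weak limits are avoided: x - v n (th x) has a
  derivative without the sign and passes to the limit directly, and the product v n is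
  differentiated afterwards, in the limit.\<close>

theorem filippov_existence:
  assumes L: "0 \<le> L"
  shows "\<exists>x. x 0 = x0 \<and>
    filippov_solution vv (\<lambda>z. f0 z - h z *\<^sub>R n (th z)) (\<lambda>z. f0 z + h z *\<^sub>R n (th z)) L x"
proof -
  define C2 where "C2 = C + C * C"
  have C2: "0 \<le> C2" using C_nonneg by (simp add: C2_def)
  have "\<exists>xs. continuous_on {0..L} xs \<and> (\<forall>t\<in>{0..L}. xs t = x0 + integral {0..t} (\<lambda>s. approx_field (real (Suc m)) (xs (max 0 (s - 1 / real (Suc m))))))" for m
    using tonelli_delay[OF continuous_approx_field, of "1 / real (Suc m)" L x0 "real (Suc m)"] by (metis of_nat_0_less_iff zero_less_Suc zero_less_divide_1_iff)
  then obtain xs where xsc: "\<And>m. continuous_on {0..L} (xs m)"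
    and xs: "\<And>m t. t \<in> {0..L} \<Longrightarrow> xs m t = x0 + integral {0..t} (\<lambda>s. approx_field (real (Suc m)) (xs m (max 0 (s - 1 / real (Suc m)))))"
    by metis
  have dcont: "continuous_on {0..L} (\<lambda>s. xs m (max 0 (s - 1 / real (Suc m))))" for m
  proof (rule continuous_on_compose2[OF xsc])
    have "(\<lambda>s. max 0 (s - r)) ` {0..L} \<subseteq> {0..L}" if "0 \<le> r" for r :: real using that by auto
    then show "(\<lambda>s. max 0 (s - 1 / real (Suc m))) ` {0..L} \<subseteq> {0..L}" by simp
  qed (intro continuous_intros)
  have gcont: "continuous_on {0..L} (\<lambda>s. approx_field (real (Suc m)) (xs m (max 0 (s - 1 / real (Suc m)))))" for m
    by (rule continuous_on_compose2[OF continuous_approx_field dcont]) auto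
  note gint = integrable_continuous_real[OF gcont]
  have xs_lip1: "norm (xs m t - xs m s) \<le> C2 * \<bar>t - s\<bar>" if "s \<in> {0..L}" "t \<in> {0..L}" "s \<le> t" for m s t
    using has_integral_bound_real[OF C2 finite.emptyI has_integral_increment[OF gint xs, of s t m]] that approx_field_bound
    by (auto simp: C2_def)
  have xs_lip: "norm (xs m t - xs m s) \<le> C2 * \<bar>t - s\<bar>" if "s \<in> {0..L}" "t \<in> {0..L}" for m s t
    using xs_lip1[of s t m] xs_lip1[of t s m] that by (cases "s \<le> t") (auto simp: norm_minus_commute abs_minus_commute)
  define M where "M = norm x0 + C2 * L"
  have xs_bd: "norm (xs m t) \<le> M" if t: "t \<in> {0..L}" for m t
  proof -
    have "xs m 0 = x0" using xs[of 0 m] L by simp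
    then have "norm (xs m t) \<le> norm x0 + C2 * t"
      using xs_lip[of 0 t m] t L norm_triangle_sub[of "xs m t" x0] by (simp add: abs_of_nonneg)
    also have "\<dots> \<le> M" unfolding M_def using t C2 by (simp add: mult_left_mono)
    finally show ?thesis .
  qed
  obtain x k where xc: "continuous_on {0..L} x" and k: "strict_mono (k :: nat \<Rightarrow> nat)"
    and xk: "\<And>e. 0 < e \<Longrightarrow> \<exists>N. \<forall>i t. N \<le> i \<and> t \<in> {0..L} \<longrightarrow> norm (xs (k i) t - x t) < e"
  proof (rule Arzela_Ascoli[of "{0..L}" xs M])
    show "\<exists>d>0. \<forall>m y. y \<in> {0..L} \<and> norm (t - y) < d \<longrightarrow> norm (xs m t - xs m y) < e"
      if t: "t \<in> {0..L}" and e: "0 < e" for t e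
    proof (intro exI[of _ "e / (C2 + 1)"] conjI allI impI)
      show "0 < e / (C2 + 1)" using e C2 by simp
      fix m y assume y: "y \<in> {0..L} \<and> norm (t - y) < e / (C2 + 1)"
      then have "norm (xs m t - xs m y) \<le> C2 * \<bar>t - y\<bar>" using xs_lip[of y t m] t by simp
      also have "\<dots> \<le> (C2 + 1) * \<bar>t - y\<bar>" by (simp add: mult_right_mono)
      also have "\<dots> < e" using y C2 by (simp add: pos_less_divide_eq mult.commute)
      finally show "norm (xs m t - xs m y) < e" .
    qed
  qed (use xs_bd in auto)
  define m where "m i = real (Suc (k i))" for i
  define X where "X i = xs (k i)" for i
  define z where "z i s = X i (max 0 (s - 1 / m i))" for i s
  define sg where "sg i s = sat (m i * vv (z i s))" for i s
  have m_lim: "filterlim m at_top sequentially"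
    unfolding m_def
    by (rule filterlim_compose[OF filterlim_real_sequentially])
      (rule filterlim_compose[OF filterlim_Suc filterlim_subseq[OF k]])
  have X_lim: "(\<lambda>i. X i t) \<longlonglongrightarrow> x t" if "t \<in> {0..L}" for t
    using xk that unfolding LIMSEQ_iff X_def by blast
  have z_lim: "(\<lambda>i. z i t) \<longlonglongrightarrow> x t" if t: "t \<in> {0..L}" for t
  proof -
    have "(\<lambda>i. z i t - X i t) \<longlonglongrightarrow> 0"
    proof (rule Lim_null_comparison)
      show "\<forall>\<^sub>F i in sequentially. norm (z i t - X i t) \<le> C2 * (1 / m i)"
      proof (rule always_eventually, rule allI)
        fix i
        have "0 < m i" "0 < 1 / m i" by (simp_all add: m_def)
        have "norm (z i t - X i t) \<le> C2 * \<bar>max 0 (t - 1 / m i) - t\<bar>"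
        proof -
          have "max 0 (t - r) \<in> {0..L}" if "0 \<le> r" for r :: real using t that by auto
          from this[OF less_imp_le[OF \<open>0 < 1 / m i\<close>]]
          show ?thesis unfolding z_def X_def by (rule xs_lip[OF t])
        qed
        also have "\<dots> \<le> C2 * (1 / m i)"
          using C2 t \<open>0 < 1 / m i\<close> by (intro mult_left_mono) (auto simp: max_def)
        finally show "norm (z i t - X i t) \<le> C2 * (1 / m i)" .
      qed
      have "(\<lambda>i. C2 * inverse (m i)) \<longlonglongrightarrow> C2 * 0"
        by (intro tendsto_intros tendsto_inverse_0_at_top m_lim)
      then show "(\<lambda>i. C2 * (1 / m i)) \<longlonglongrightarrow> 0" by (simp add: divide_inverse)
    qed
    from tendsto_add[OF this X_lim[OF t]] show ?thesis by simp
  qed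
  have z_cont: "continuous_on {0..L} (z i)" for i
    using dcont[of "k i"] by (simp add: z_def[abs_def] X_def m_def)
  have X_cont: "continuous_on {0..L} (X i)" for i using xsc by (simp add: X_def)
  have X_int: "((\<lambda>s. approx_field (m i) (z i s)) has_integral (X i t - X i s)) {s..t}"
    if "0 \<le> s" "s \<le> t" "t \<le> L" for i s t
    using has_integral_increment[OF gint xs that, of "k i"] by (simp add: X_def m_def z_def)
  define v where "v t = vv (x t)" for t
  define ang where "ang t = th (x t)" for t
  define A where "A t = vv (f0 (x t))" for t
  define B where "B t = h (x t)" for t
  \<comment> \<open>The candidate for v'. The value 0 at zeros of v is the normal velocity of a
    sliding motion; crossing instants, where it would be wrong, turn out to be countable.\<close>
  define g where "g t = (if v t = 0 then 0 else A t - sgn (v t) * B t)" for t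
  have cont: "continuous_on {0..L} v" "continuous_on {0..L} ang" "continuous_on {0..L} A" "continuous_on {0..L} B"
    unfolding v_def[abs_def] ang_def[abs_def] A_def[abs_def] B_def[abs_def] by (intro continuous_intros xc)+
  have lim_comp: "(\<lambda>i. F (u i)) \<longlonglongrightarrow> F l" if "continuous_on UNIV F" "u \<longlonglongrightarrow> l" for F :: "'a \<Rightarrow> 'c::topological_space" and u l
    using continuous_on_tendsto_compose[OF that] by simp
  have lim_n: "(\<lambda>i. n (u i)) \<longlonglongrightarrow> n l" "(\<lambda>i. n' (u i)) \<longlonglongrightarrow> n' l" if "u \<longlonglongrightarrow> l" for u l
    using continuous_on_tendsto_compose[OF continuous_n[of UNIV] that] continuous_on_tendsto_compose[OF n(2) that] by auto
  note lims = lim_comp[OF f0(1)] lim_comp[OF h(1)] lim_n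
    bounded_linear.tendsto[OF vv(1)] bounded_linear.tendsto[OF th(1)]
  have sg_lim: "(\<lambda>i. sg i t) \<longlonglongrightarrow> sgn (v t)" if "t \<in> {0..L}" "v t \<noteq> 0" for t
    unfolding sg_def using that by (intro sat_tendsto_sgn m_lim) (auto simp: v_def intro!: lims z_lim)
  obtain Kv Kt where Kv: "0 \<le> Kv" "\<And>a. \<bar>vv a\<bar> \<le> Kv * norm a" and Kt: "0 \<le> Kt" "\<And>a. \<bar>th a\<bar> \<le> Kt * norm a"
  proof -
    from bounded_linear.nonneg_bounded[OF vv(1)] bounded_linear.nonneg_bounded[OF th(1)]
    show ?thesis using that by (auto simp: mult.commute)
  qed
  have vvf: "\<bar>vv (f0 a)\<bar> \<le> Kv * C" and thf: "\<bar>th (f0 a)\<bar> \<le> Kt * C" for a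
    using Kv(2)[of "f0 a"] Kt(2)[of "f0 a"] mult_left_mono[OF f0(2)[of a] Kv(1)] mult_left_mono[OF f0(2)[of a] Kt(1)] by linarith+
  have vX: "((\<lambda>r. vv (f0 (z i r)) - sg i r * h (z i r)) has_integral (vv (X i t) - vv (X i s))) {s..t}"
    if "0 \<le> s" "s \<le> t" "t \<le> L" for i s t
  proof -
    have "vv (approx_field (m i) (z i r)) = vv (f0 (z i r)) - sg i r * h (z i r)" for r
      unfolding approx_field_def sg_def
      by (simp add: linear_diff[OF bounded_linear.linear[OF vv(1)]] linear_scale[OF bounded_linear.linear[OF vv(1)]] vv(2))
    then show ?thesis
      using has_integral_linear[OF X_int[OF that] vv(1), of i]
      by (simp add: o_def linear_diff[OF bounded_linear.linear[OF vv(1)]])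
  qed
  have tX: "((\<lambda>r. th (f0 (z i r))) has_integral (th (X i t) - th (X i s))) {s..t}"
    if "0 \<le> s" "s \<le> t" "t \<le> L" for i s t
  proof -
    have "th (approx_field (m i) (z i r)) = th (f0 (z i r))" for r
      unfolding approx_field_def
      by (simp add: linear_diff[OF bounded_linear.linear[OF th(1)]] linear_scale[OF bounded_linear.linear[OF th(1)]] th(2))
    then show ?thesis
      using has_integral_linear[OF X_int[OF that] th(1), of i]
      by (simp add: o_def linear_diff[OF bounded_linear.linear[OF th(1)]])
  qed
  have v_lim: "(\<lambda>i. vv (X i t) - vv (X i s)) \<longlonglongrightarrow> v t - v s" if "s \<in> {0..L}" "t \<in> {0..L}" for s t
    unfolding v_def by (intro tendsto_intros lims X_lim that)
  have v_int: "((\<lambda>r. A r - sgn (v r) * B r) has_integral (v t - v s)) {s..t}"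
    if st: "0 \<le> s" "s \<le> t" "t \<le> L" and nz: "\<And>r. r \<in> {s..t} \<Longrightarrow> v r \<noteq> 0" for s t
  proof (rule has_integral_bounded_limit[OF vX[OF st]])
    fix i r assume r: "r \<in> {s..t}"
    show "norm (vv (f0 (z i r)) - sg i r * h (z i r)) \<le> Kv * C + C"
      using vvf[of "z i r"] sat_h_bound[of "m i * vv (z i r)" "z i r"] unfolding sg_def real_norm_def by linarith
  next
    fix r assume r: "r \<in> {s..t}"
    then have "r \<in> {0..L}" using st by auto
    then show "(\<lambda>i. vv (f0 (z i r)) - sg i r * h (z i r)) \<longlonglongrightarrow> A r - sgn (v r) * B r"
      unfolding A_def B_def using nz[OF r] by (intro tendsto_intros lims z_lim sg_lim)
  qed (use st in \<open>auto intro: v_lim\<close>)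
  have v_deriv: "(v has_real_derivative g t) (at t)" if t: "t \<in> {0<..<L}" "v t \<noteq> 0" for t
  proof -
    have "\<exists>e>0. \<forall>s\<in>{0..L}. dist s t < e \<longrightarrow> dist (v s) (v t) < \<bar>v t\<bar>"
      using cont(1) t unfolding continuous_on_iff by auto
    then obtain e0 where e0: "0 < e0" "\<And>s. s \<in> {0..L} \<Longrightarrow> dist s t < e0 \<Longrightarrow> dist (v s) (v t) < \<bar>v t\<bar>" by blast
    define e where "e = min e0 (min t (L - t))"
    have e: "0 < e" "\<And>s. dist s t < e \<Longrightarrow> sgn (v s) = sgn (v t) \<and> s \<in> {0<..<L}"
    proof -
      show "0 < e" using e0 t by (simp add: e_def)
      fix s assume s: "dist s t < e"
      then have "s \<in> {0<..<L}" by (auto simp: e_def dist_real_def abs_if split: if_splits)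
      moreover from this have "dist (v s) (v t) < \<bar>v t\<bar>" using s by (intro e0(2)) (auto simp: e_def)
      ultimately show "sgn (v s) = sgn (v t) \<and> s \<in> {0<..<L}" by (auto simp: dist_real_def sgn_if abs_if split: if_splits)
    qed
    define a b where "a = t - e / 2" and "b = t + e / 2"
    have ab: "a < t" "t < b" using e by (auto simp: a_def b_def)
    have in_ab: "sgn (v s) = sgn (v t) \<and> s \<in> {0<..<L}" if "s \<in> {a..b}" for s
      using that e(1) by (intro e(2)) (auto simp: a_def b_def dist_real_def abs_if)
    have sub: "0 \<le> a" "b \<le> L" using in_ab[of a] in_ab[of b] ab by auto
    let ?f = "\<lambda>s. A s - sgn (v t) * B s"
    have vs: "v s = v a + integral {a..s} ?f" if s: "s \<in> {a..b}" for s
    proof -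
      have "((\<lambda>r. A r - sgn (v r) * B r) has_integral (v s - v a)) {a..s}"
      proof (rule v_int)
        fix r assume "r \<in> {a..s}"
        then have "sgn (v r) = sgn (v t)" using in_ab[of r] s by auto
        then show "v r \<noteq> 0" using t(2) by (metis sgn_0_0)
      qed (use s sub in auto)
      then have "(?f has_integral (v s - v a)) {a..s}"
        by (rule has_integral_eq[rotated]) (use in_ab s in auto)
      then show ?thesis by (simp add: integral_unique)
    qed
    have "continuous_on {a..b} ?f"
      by (intro continuous_intros continuous_on_subset[OF cont(3)] continuous_on_subset[OF cont(4)]) (use sub in auto)
    then have "((\<lambda>s. v a + integral {a..s} ?f) has_real_derivative ?f t) (at t within {a..b})"
      using ab by (auto intro!: derivative_eq_intros integral_has_real_derivative)
    then have "(v has_real_derivative ?f t) (at t within {a..b})"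
      by (rule has_field_derivative_transform_within[OF _ zero_less_one]) (use ab vs[symmetric] in auto)
    then have "(v has_real_derivative ?f t) (at t)" using ab by (simp add: at_within_Icc_at)
    then show ?thesis using t(2) by (simp add: g_def)
  qed
  have AB_int: "A integrable_on {s..t}" "B integrable_on {s..t}" if "0 \<le> s" "t \<le> L" for s t
    using that by (auto intro!: integrable_continuous_real continuous_on_subset[OF cont(3)] continuous_on_subset[OF cont(4)])
  \<comment> \<open>Unlike \<open>v_int\<close>, this two-sided bound is valid across zeros of v,
    because it uses only that the saturated sign lies between -1 and 1.\<close>
  have v_incr: "integral {s..t} (\<lambda>r. A r - B r) \<le> v t - v s \<and> v t - v s \<le> integral {s..t} (\<lambda>r. A r + B r)"
    if st: "0 \<le> s" "s \<le> t" "t \<le> L" for s t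
  proof -
    have ci: "(\<lambda>r. vv (f0 (z i r)) - h (z i r)) integrable_on {s..t}" "(\<lambda>r. vv (f0 (z i r)) + h (z i r)) integrable_on {s..t}" for i
      using st by (intro integrable_continuous_real continuous_intros continuous_on_subset[OF z_cont] subset_UNIV; force)+
    have bd: "norm (vv (f0 (z i r)) - h (z i r)) \<le> Kv * C + C" "norm (vv (f0 (z i r)) + h (z i r)) \<le> Kv * C + C" for i r
      using vvf[of "z i r"] h(2,3)[of "z i r"] by auto
    have "(\<lambda>i. integral {s..t} (\<lambda>r. vv (f0 (z i r)) - h (z i r))) \<longlonglongrightarrow> integral {s..t} (\<lambda>r. A r - B r)"
      by (rule dominated_convergence(2)[OF ci(1) integrable_const_ivl bd(1)])
        (use st in \<open>auto simp: A_def B_def intro!: tendsto_intros lims z_lim\<close>)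
    moreover have "(\<lambda>i. integral {s..t} (\<lambda>r. vv (f0 (z i r)) + h (z i r))) \<longlonglongrightarrow> integral {s..t} (\<lambda>r. A r + B r)"
      by (rule dominated_convergence(2)[OF ci(2) integrable_const_ivl bd(2)])
        (use st in \<open>auto simp: A_def B_def intro!: tendsto_intros lims z_lim\<close>)
    moreover have "integral {s..t} (\<lambda>r. vv (f0 (z i r)) - h (z i r)) \<le> vv (X i t) - vv (X i s)
        \<and> vv (X i t) - vv (X i s) \<le> integral {s..t} (\<lambda>r. vv (f0 (z i r)) + h (z i r))" for i
    proof -
      have "\<bar>sg i r * h (z i r)\<bar> \<le> h (z i r)" for r
        using mult_right_mono[OF abs_sat_le[of "m i * vv (z i r)"] h(2)[of "z i r"]] h(2)[of "z i r"]
        by (simp add: sg_def abs_mult)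
      then have *: "- h (z i r) \<le> sg i r * h (z i r)" "sg i r * h (z i r) \<le> h (z i r)" for r
        by (smt (verit) abs_le_iff)+
      have "vv (f0 (z i r)) - h (z i r) \<le> vv (f0 (z i r)) - sg i r * h (z i r)" "vv (f0 (z i r)) - sg i r * h (z i r) \<le> vv (f0 (z i r)) + h (z i r)" for r
        using *[of r] by linarith+
      then show ?thesis
        by (intro conjI has_integral_le[OF integrable_integral[OF ci(1)] vX[OF st]] has_integral_le[OF vX[OF st] integrable_integral[OF ci(2)]])
    qed
    ultimately show ?thesis
      using v_lim[of s t] st by (auto intro: LIMSEQ_le)
  qed
  \<comment> \<open>Zeros of v at which both fields point strictly to the same side. After such a
    zero v moves strictly in the direction of A for a while, so the next zero is at a positive
    distance to the right.\<close>
  define E where "E = {t \<in> {0..<L}. v t = 0 \<and> B t < \<bar>A t\<bar>}"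
  have "countable E"
  proof (rule countable_right_isolated)
    fix t assume t: "t \<in> E"
    define sig where "sig = sgn (A t)"
    define D where "D s = sig * A s - B s" for s
    have sig: "sig = 1 \<or> sig = - 1" "0 < D t" using t h(2)[of "x t"] by (auto simp: sig_def D_def E_def sgn_if B_def)
    have cD: "continuous_on {0..L} D" unfolding D_def[abs_def] by (intro continuous_intros cont)
    then have "\<exists>e>0. \<forall>s\<in>{0..L}. dist s t < e \<longrightarrow> dist (D s) (D t) < D t"
      using t sig(2) unfolding continuous_on_iff E_def by auto
    then obtain e where e: "0 < e" and e': "\<And>s. s \<in> {0..L} \<Longrightarrow> dist s t < e \<Longrightarrow> dist (D s) (D t) < D t" by blast
    have e2: "0 < D s" if "s \<in> {0..L}" "dist s t < e" for s
      using e'[OF that] by (auto simp: dist_real_def abs_if split: if_splits)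
    show "\<exists>e>0. {t<..<t + e} \<inter> E = {}"
    proof (intro exI[of _ e] conjI e)
      have "v s \<noteq> 0" if s: "s \<in> {t<..<t + e}" "s \<in> E" for s
      proof -
        have st: "0 \<le> t" "t < s" "s \<le> L" using s t by (auto simp: E_def)
        have Dp: "0 < D r" if "r \<in> {t..s}" for r using that st s by (intro e2) (auto simp: dist_real_def)
        have "continuous_on {t..s} D" by (rule continuous_on_subset[OF cD]) (use st in auto)
        then have "0 < integral {t..s} D"
        proof -
          assume c: "continuous_on {t..s} D"
          have "\<exists>r\<in>{t..s}. \<forall>y\<in>{t..s}. D r \<le> D y" by (rule continuous_attains_inf) (use st c in auto)
          then obtain r where r: "r \<in> {t..s}" "\<And>y. y \<in> {t..s} \<Longrightarrow> D r \<le> D y" by blast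
          have "0 < D r * (s - t)" using Dp[OF r(1)] st by simp
          also have "\<dots> = integral {t..s} (\<lambda>_. D r)" using st by simp
          also have "\<dots> \<le> integral {t..s} D"
            using r c by (intro integral_le integrable_continuous_real) auto
          finally show ?thesis .
        qed
        moreover have "integral {t..s} D \<le> sig * (v s - v t)"
        proof (cases "sig = 1")
          case True
          then show ?thesis using v_incr[of t s] st by (simp add: D_def[abs_def])
        next
          case False
          then have "sig = - 1" using sig by auto
          moreover have "integral {t..s} (\<lambda>r. - (A r + B r)) = - integral {t..s} (\<lambda>r. A r + B r)" by (rule integral_neg)
          ultimately show ?thesis using v_incr[of t s] st by (simp add: D_def[abs_def])
        qed
        ultimately show ?thesis using t by (auto simp: E_def)
      qed
      moreover have "v s = 0" if "s \<in> E" for s using that by (simp add: E_def)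
      ultimately show "{t<..<t + e} \<inter> E = {}" by blast
    qed
  qed
  have th_int: "((\<lambda>r. th (f0 (x r))) has_integral (ang t - ang s)) {s..t}" if st: "0 \<le> s" "s \<le> t" "t \<le> L" for s t
    by (rule has_integral_bounded_limit[OF tX[OF st]], use thf in simp)
      (use st in \<open>auto simp: ang_def intro!: tendsto_intros lims z_lim X_lim\<close>)
  have cth: "continuous_on {0..L} (\<lambda>r. th (f0 (x r)))" by (intro continuous_intros xc)
  have ang_deriv: "(ang has_real_derivative th (f0 (x t))) (at t within {0..L})" if t: "t \<in> {0..L}" for t
  proof -
    have "((\<lambda>s. ang 0 + integral {0..s} (\<lambda>r. th (f0 (x r)))) has_real_derivative th (f0 (x t))) (at t within {0..L})"
      using t cth by (auto intro!: derivative_eq_intros integral_has_real_derivative)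
    then show ?thesis
    proof (rule has_field_derivative_transform_within[OF _ zero_less_one t])
      fix s assume "s \<in> {0..L}"
      then show "ang 0 + integral {0..s} (\<lambda>r. th (f0 (x r))) = ang s" using integral_unique[OF th_int[of 0 s]] by simp
    qed
  qed
  \<comment> \<open>The derivative of x - v n (ang). The terms with the sign of v cancel because n
    has v-component 1, and only continuous functions of x remain.\<close>
  define W where "W r = f0 (x r) - A r *\<^sub>R n (ang r) - (v r * th (f0 (x r))) *\<^sub>R n' (ang r)" for r
  have x0: "x 0 = x0"
  proof -
    have "X i 0 = x0" for i unfolding X_def using xs[of 0 "k i"] L by simp
    then show ?thesis using X_lim[of 0] L LIMSEQ_unique[OF tendsto_const] by auto
  qed
  have W_int: "(W has_integral (x t - v t *\<^sub>R n (ang t) - (x 0 - v 0 *\<^sub>R n (ang 0)))) {0..t}" if t: "t \<in> {0..L}" for t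
  proof -
    define T where "T = Kt * M"
    have thX: "\<bar>th (X i r)\<bar> \<le> T" if "r \<in> {0..L}" for i r
      using Kt(2)[of "X i r"] mult_left_mono[OF xs_bd[OF that, of "k i"] Kt(1)] unfolding T_def X_def by linarith
    have "bounded (n' ` {- T..T})"
      by (intro compact_imp_bounded compact_continuous_image continuous_on_subset[OF n(2)]) auto
    then obtain Bn where Bn: "\<And>a. a \<in> {- T..T} \<Longrightarrow> norm (n' a) \<le> Bn" unfolding bounded_iff by blast
    define Wi where "Wi i r = approx_field (m i) (z i r) - (vv (X i r) *\<^sub>R (th (f0 (z i r)) *\<^sub>R n' (th (X i r)))
        + (vv (f0 (z i r)) - sg i r * h (z i r)) *\<^sub>R n (th (X i r)))" for i r
    have Wi_int: "(Wi i has_integral (X i t - vv (X i t) *\<^sub>R n (th (X i t)) - (X i 0 - vv (X i 0) *\<^sub>R n (th (X i 0))))) {0..t}" for i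
    proof (rule fundamental_theorem_of_calculus)
      show "0 \<le> t" using t by simp
      fix r assume "r \<in> {0..t}"
      then have r: "r \<in> {0..L}" using t by auto
      have ca: "continuous_on {0..L} (\<lambda>s. approx_field (m i) (z i s))"
        by (rule continuous_on_compose2[OF continuous_approx_field z_cont]) auto
      have "((\<lambda>u. X i 0 + integral {0..u} (\<lambda>s. approx_field (m i) (z i s))) has_vector_derivative approx_field (m i) (z i r)) (at r within {0..L})"
        using has_vector_derivative_add[OF has_vector_derivative_const integral_has_vector_derivative[OF ca r]] by simp
      then have dX: "(X i has_vector_derivative approx_field (m i) (z i r)) (at r within {0..L})"
      proof (rule has_vector_derivative_transform[OF r, rotated])
        fix u assume "u \<in> {0..L}"
        then show "X i u = X i 0 + integral {0..u} (\<lambda>s. approx_field (m i) (z i s))" using integral_unique[OF X_int[of 0 u i]] by simp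
      qed
      have dv: "((\<lambda>r. vv (X i r)) has_real_derivative vv (f0 (z i r)) - sg i r * h (z i r)) (at r within {0..L})"
        using bounded_linear.has_vector_derivative[OF vv(1) dX] unfolding has_real_derivative_iff_has_vector_derivative approx_field_def sg_def
        by (simp add: linear_diff[OF bounded_linear.linear[OF vv(1)]] linear_scale[OF bounded_linear.linear[OF vv(1)]] vv(2))
      have dt: "((\<lambda>r. th (X i r)) has_vector_derivative th (f0 (z i r))) (at r within {0..L})"
        using bounded_linear.has_vector_derivative[OF th(1) dX] unfolding approx_field_def
        by (simp add: linear_diff[OF bounded_linear.linear[OF th(1)]] linear_scale[OF bounded_linear.linear[OF th(1)]] th(2))
      have dn: "((\<lambda>r. n (th (X i r))) has_vector_derivative th (f0 (z i r)) *\<^sub>R n' (th (X i r))) (at r within {0..L})"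
        using vector_diff_chain_within[OF dt has_vector_derivative_at_within[OF n(1)]] by (simp add: o_def)
      have "((\<lambda>r. X i r - vv (X i r) *\<^sub>R n (th (X i r))) has_vector_derivative Wi i r) (at r within {0..L})"
        unfolding Wi_def by (rule has_vector_derivative_diff[OF dX has_vector_derivative_scaleR[OF dv dn]])
      then show "((\<lambda>r. X i r - vv (X i r) *\<^sub>R n (th (X i r))) has_vector_derivative Wi i r) (at r within {0..t})"
        by (rule has_vector_derivative_within_subset) (use t in auto)
    qed
    show ?thesis
    proof (rule has_integral_bounded_limit[OF Wi_int])
      fix i r assume r: "r \<in> {0..t}"
      then have rL: "r \<in> {0..L}" using t by auto
      have "\<bar>vv (X i r)\<bar> \<le> Kv * M"
        using Kv(2)[of "X i r"] mult_left_mono[OF xs_bd[OF rL, of "k i"] Kv(1)] unfolding X_def by linarith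
      moreover have "norm (n' (th (X i r))) \<le> Bn" using thX[OF rL, of i] by (intro Bn) auto
      moreover have "\<bar>vv (f0 (z i r)) - sg i r * h (z i r)\<bar> \<le> Kv * C + C"
        using vvf[of "z i r"] sat_h_bound[of "m i * vv (z i r)" "z i r"] unfolding sg_def by linarith
      ultimately have "norm (vv (X i r) *\<^sub>R (th (f0 (z i r)) *\<^sub>R n' (th (X i r)))) \<le> Kv * M * (Kt * C * Bn)"
        "norm ((vv (f0 (z i r)) - sg i r * h (z i r)) *\<^sub>R n (th (X i r))) \<le> (Kv * C + C) * C"
        unfolding norm_scaleR real_norm_def using thf[of "z i r"] n(3)[of "th (X i r)"]
        by - (rule mult_mono' mult_nonneg_nonneg abs_ge_zero norm_ge_zero | assumption)+
      then show "norm (Wi i r) \<le> (C + C * C) + (Kv * M * (Kt * C * Bn) + (Kv * C + C) * C)"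
        unfolding Wi_def using approx_field_bound[of "m i" "z i r"]
        by (intro order_trans[OF norm_triangle_ineq4] add_mono order_trans[OF norm_triangle_ineq])
    next
      fix r assume r: "r \<in> {0..t}"
      then have rL: "r \<in> {0..L}" using t by auto
      \<comment> \<open>The saturated sign survives only as a factor of n at the current angle minus
        n at the delayed angle. This difference tends to 0, so no limit of \<open>sg\<close> at the
        zeros of v is needed.\<close>
      have Wi_eq: "Wi i r = f0 (z i r) - vv (f0 (z i r)) *\<^sub>R n (th (X i r)) - (vv (X i r) * th (f0 (z i r))) *\<^sub>R n' (th (X i r))
          + (sg i r * h (z i r)) *\<^sub>R (n (th (X i r)) - n (th (z i r)))" for i
        unfolding Wi_def approx_field_def sg_def by (simp add: algebra_simps)
      have "(\<lambda>i. (sg i r * h (z i r)) *\<^sub>R (n (th (X i r)) - n (th (z i r)))) \<longlonglongrightarrow> 0"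
      proof (rule Lim_null_comparison)
        show "\<forall>\<^sub>F i in sequentially. norm ((sg i r * h (z i r)) *\<^sub>R (n (th (X i r)) - n (th (z i r)))) \<le> C * norm (n (th (X i r)) - n (th (z i r)))"
          by (rule always_eventually) (auto simp: sg_def intro!: mult_right_mono sat_h_bound)
        have "(\<lambda>i. C * norm (n (th (X i r)) - n (th (z i r)))) \<longlonglongrightarrow> C * norm (n (th (x r)) - n (th (x r)))"
          by (intro tendsto_intros lims X_lim z_lim rL)
        then show "(\<lambda>i. C * norm (n (th (X i r)) - n (th (z i r)))) \<longlonglongrightarrow> 0" by simp
      qed
      moreover have "(\<lambda>i. f0 (z i r) - vv (f0 (z i r)) *\<^sub>R n (th (X i r)) - (vv (X i r) * th (f0 (z i r))) *\<^sub>R n' (th (X i r))) \<longlonglongrightarrow> W r"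
        unfolding W_def A_def v_def ang_def by (intro tendsto_intros lims X_lim z_lim rL)
      ultimately show "(\<lambda>i. Wi i r) \<longlonglongrightarrow> W r" unfolding Wi_eq using tendsto_add by fastforce
    next
      show "(\<lambda>i. X i t - vv (X i t) *\<^sub>R n (th (X i t)) - (X i 0 - vv (X i 0) *\<^sub>R n (th (X i 0))))
          \<longlonglongrightarrow> x t - v t *\<^sub>R n (ang t) - (x 0 - v 0 *\<^sub>R n (ang 0))"
        unfolding v_def ang_def by (intro tendsto_intros lims X_lim) (use t in auto)
    qed
  qed
  have x_lip: "norm (x s - x t) \<le> C2 * \<bar>s - t\<bar>" if "s \<in> {0..L}" "t \<in> {0..L}" for s t
  proof (rule LIMSEQ_le_const2)
    show "(\<lambda>i. norm (X i s - X i t)) \<longlonglongrightarrow> norm (x s - x t)" by (intro tendsto_intros X_lim that)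
    show "\<exists>N. \<forall>i\<ge>N. norm (X i s - X i t) \<le> C2 * \<bar>s - t\<bar>" using xs_lip that by (auto simp: X_def)
  qed
  have gb: "\<bar>g t\<bar> \<le> Kv * C + C" for t
    using vvf[of "x t"] h(2,3)[of "x t"] C_nonneg Kv(1) by (auto simp: g_def A_def B_def sgn_if)
  have P_int: "((\<lambda>r. v r *\<^sub>R (th (f0 (x r)) *\<^sub>R n' (ang r)) + g r *\<^sub>R n (ang r)) has_integral (v t *\<^sub>R n (ang t) - v 0 *\<^sub>R n (ang 0))) {0..t}"
    if t: "t \<in> {0..L}" for t
  proof (rule integral_mult_parts_with_zeros[where K = "max (Kv * C2) (Kv * C + C)"])
    have sub: "{0..t} \<subseteq> {0..L}" using t by auto
    show "continuous_on {0..t} v" "continuous_on {0..t} (\<lambda>r. n (ang r))" "continuous_on {0..t} (\<lambda>r. th (f0 (x r)) *\<^sub>R n' (ang r))"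
      by (intro continuous_intros continuous_on_subset[OF cont(1) sub] continuous_on_subset[OF cont(2) sub] continuous_on_subset[OF xc sub])+
    show "0 \<le> t" using t by simp
    fix s assume s: "s \<in> {0<..<t}"
    then have s': "s \<in> {0<..<L}" "s \<in> {0..L}" using t by auto
    then have "(ang has_real_derivative th (f0 (x s))) (at s)"
      using ang_deriv[of s] by (simp add: at_within_Icc_at)
    then show "((\<lambda>r. n (ang r)) has_vector_derivative th (f0 (x s)) *\<^sub>R n' (ang s)) (at s)"
      using vector_diff_chain_at[of ang "th (f0 (x s))" s n "n' (ang s)"] n(1) by (simp add: o_def has_real_derivative_iff_has_vector_derivative)
    show "(v has_real_derivative g s) (at s)" if "v s \<noteq> 0" using v_deriv s' that by simp
  next
    fix r s assume "r \<in> {0..t}" "s \<in> {0..t}"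
    then have "norm (x r - x s) \<le> C2 * \<bar>r - s\<bar>" using t by (intro x_lip) auto
    then have "\<bar>v r - v s\<bar> \<le> Kv * C2 * \<bar>r - s\<bar>"
      using Kv(2)[of "x r - x s"] mult_left_mono[OF _ Kv(1)] unfolding v_def
      by (simp add: linear_diff[OF bounded_linear.linear[OF vv(1)]]) (smt (verit) mult.assoc)
    also have "\<dots> \<le> max (Kv * C2) (Kv * C + C) * \<bar>r - s\<bar>" by (intro mult_right_mono) auto
    finally show "\<bar>v r - v s\<bar> \<le> max (Kv * C2) (Kv * C + C) * \<bar>r - s\<bar>" .
  next
    fix r show "\<bar>g r\<bar> \<le> max (Kv * C2) (Kv * C + C)" using gb[of r] by simp
  qed (simp add: g_def)
  \<comment> \<open>The sum of the derivatives of both parts of x. The component along n is shifted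
    from A to g, so the v-component of \<open>G\<close> is g.\<close>
  define G where "G r = f0 (x r) + (g r - A r) *\<^sub>R n (ang r)" for r
  have G_int: "(G has_integral (x t - x 0)) {0..t}" if t: "t \<in> {0..L}" for t
  proof -
    have "W r + (v r *\<^sub>R (th (f0 (x r)) *\<^sub>R n' (ang r)) + g r *\<^sub>R n (ang r)) = G r" for r
      by (simp add: W_def G_def algebra_simps)
    then show ?thesis using has_integral_add[OF W_int[OF t] P_int[OF t]] by simp
  qed
  have "filippov_solution vv (\<lambda>z. f0 z - h z *\<^sub>R n (th z)) (\<lambda>z. f0 z + h z *\<^sub>R n (th z)) L x"
    unfolding filippov_solution_def
  proof (intro exI[of _ G] conjI ballI)
    have "norm (G r) \<le> C + (Kv * C + C + Kv * C) * C" for r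
    proof -
      have "\<bar>g r - A r\<bar> \<le> Kv * C + C + Kv * C" using gb[of r] vvf[of "x r"] unfolding A_def by linarith
      then have "norm ((g r - A r) *\<^sub>R n (ang r)) \<le> (Kv * C + C + Kv * C) * C"
        unfolding norm_scaleR using n(3) by (intro mult_mono) auto
      then show ?thesis unfolding G_def using f0(2)[of "x r"] norm_triangle_ineq order_trans add_mono by meson
    qed
    then show "G absolutely_integrable_on {0..L}"
      by (intro absolutely_integrable_integrable_bound[where g = "\<lambda>_. C + (Kv * C + C + Kv * C) * C"]
          has_integral_integrable[OF G_int] integrable_const_ivl) (use L in auto)
    show "x t = x 0 + integral {0..t} G" if "t \<in> {0..L}" for t
      using integral_unique[OF G_int[OF that]] by simp
    have "{t \<in> {0..L}. G t \<notin> filippov_set vv (\<lambda>z. f0 z - h z *\<^sub>R n (th z)) (\<lambda>z. f0 z + h z *\<^sub>R n (th z)) (x t)} \<subseteq> E \<union> {L}"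
    proof (rule subsetI, rule ccontr)
      fix t assume "t \<in> {t \<in> {0..L}. G t \<notin> filippov_set vv (\<lambda>z. f0 z - h z *\<^sub>R n (th z)) (\<lambda>z. f0 z + h z *\<^sub>R n (th z)) (x t)}"
        and tE: "t \<notin> E \<union> {L}"
      then have t: "t \<in> {0..<L}" and no: "G t \<notin> filippov_set vv (\<lambda>z. f0 z - h z *\<^sub>R n (th z)) (\<lambda>z. f0 z + h z *\<^sub>R n (th z)) (x t)"
        by auto
      consider "0 < v t" | "v t < 0" | "v t = 0" by linarith
      then show False
      proof cases
        case 3
        then have AB: "\<bar>A t\<bar> \<le> B t" using t tE by (auto simp: E_def)
        have "G t \<in> closed_segment (f0 (x t) - B t *\<^sub>R n (ang t)) (f0 (x t) + B t *\<^sub>R n (ang t))"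
        proof (cases "B t = 0")
          case True
          then show ?thesis using AB 3 by (simp add: G_def g_def)
        next
          case False
          then have B0: "0 < B t" using h(2)[of "x t"] by (simp add: B_def)
          \<comment> \<open>The weight that annihilates the v-component A - B + 2 u B of the convex
            combination; |A| \<le> B places it in [0, 1].\<close>
          define u where "u = (B t - A t) / (2 * B t)"
          have "0 \<le> u" "u \<le> 1" using AB B0 by (auto simp: u_def)
          moreover have "2 * B t * u = B t - A t" using B0 by (simp add: u_def)
          then have "G t = (1 - u) *\<^sub>R (f0 (x t) - B t *\<^sub>R n (ang t)) + u *\<^sub>R (f0 (x t) + B t *\<^sub>R n (ang t))"
          proof -
            assume uu: "2 * B t * u = B t - A t"
            have "(1 - u) *\<^sub>R (f - c) + u *\<^sub>R (f + c) = f + (u *\<^sub>R c + u *\<^sub>R c - c)" for f c :: 'a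
              by (simp add: algebra_simps)
            moreover have "u *\<^sub>R (B t *\<^sub>R N) + u *\<^sub>R (B t *\<^sub>R N) - B t *\<^sub>R N = (u * B t + u * B t - B t) *\<^sub>R N" for N :: 'a
              by (simp only: scaleR_scaleR scaleR_left_diff_distrib scaleR_left_distrib)
            moreover have "u * B t + u * B t - B t = - A t" using uu by (simp add: algebra_simps)
            ultimately show ?thesis using 3 by (simp add: G_def g_def)
          qed
          ultimately show ?thesis unfolding closed_segment_def by blast
        qed
        then show False using no 3 by (simp add: filippov_set_def v_def B_def ang_def)
      qed (use no in \<open>auto simp: filippov_set_def v_def G_def g_def A_def B_def ang_def\<close>)
    qed
    moreover have "negligible (E \<union> {L})" using \<open>countable E\<close> by (simp add: negligible_iff_null_sets countable_imp_null_set_lborel null_sets_completionI)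
    ultimately show "negligible {t \<in> {0..L}. G t \<notin> filippov_set vv (\<lambda>z. f0 z - h z *\<^sub>R n (th z)) (\<lambda>z. f0 z + h z *\<^sub>R n (th z)) (x t)}"
      using negligible_subset by blast
  qed
  with x0 show ?thesis by blast
qed

end

section \<open>The slip phase\<close>

text \<open>Real induction: the supremum of the initial segments on which P holds belongs to them by
  \<open>close\<close> and cannot lie below T by \<open>ext\<close>. All bootstrap arguments below
  take this form.\<close>

lemma interval_continuation:
  fixes P :: "real \<Rightarrow> bool"
  assumes P0: "P 0"
    and close: "\<And>t. 0 < t \<Longrightarrow> t \<le> T \<Longrightarrow> (\<And>s. 0 \<le> s \<Longrightarrow> s < t \<Longrightarrow> P s) \<Longrightarrow> P t"
    and ext: "\<And>t. 0 \<le> t \<Longrightarrow> t < T \<Longrightarrow> (\<And>s. 0 \<le> s \<Longrightarrow> s \<le> t \<Longrightarrow> P s) \<Longrightarrow> \<exists>e>0. \<forall>s. t < s \<and> s < t + e \<and> s \<le> T \<longrightarrow> P s"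
    and t: "0 \<le> t" "t \<le> T"
  shows "P t"
proof -
  define S where "S = {t. 0 \<le> t \<and> t \<le> T \<and> (\<forall>s. 0 \<le> s \<and> s \<le> t \<longrightarrow> P s)}"
  define u where "u = Sup S"
  have T: "0 \<le> T" using t by simp
  have S0: "0 \<in> S" using T P0 by (auto simp: S_def)
  have bd: "bdd_above S" by (rule bdd_aboveI[of _ T]) (auto simp: S_def)
  have u: "0 \<le> u" "u \<le> T"
    using S0 bd unfolding u_def by (auto intro!: cSup_upper cSup_least simp: S_def)
  have below: "P s" if s: "0 \<le> s" "s < u" for s
  proof -
    obtain r where "r \<in> S" "s < r" using s less_cSup_iff[of S s] S0 bd by (auto simp: u_def)
    then show ?thesis using s by (auto simp: S_def)
  qed
  have Pu: "P u" using close[of u] below u P0 by (cases "u = 0") auto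
  have Pall: "P s" if "0 \<le> s" "s \<le> u" for s using below Pu that by (cases "s = u") auto
  have "u = T"
  proof (rule ccontr)
    assume "u \<noteq> T"
    then have uT: "u < T" using u by simp
    obtain e where e: "0 < e" "\<And>s. u < s \<Longrightarrow> s < u + e \<Longrightarrow> s \<le> T \<Longrightarrow> P s"
      using ext[OF u(1) uT Pall] by blast
    define r where "r = min T (u + e / 2)"
    have r: "u < r" "r \<le> T" "r < u + e" using uT e by (auto simp: r_def)
    then have "r \<in> S" using u Pall e(2) by (auto simp: S_def) (metis le_less_trans linorder_not_le)
    then have "r \<le> u" unfolding u_def by (rule cSup_upper[OF _ bd])
    then show False using r by simp
  qed
  then show ?thesis using Pall t by simp
qed

lemma deriv_le_increment:
  fixes f g :: "real \<Rightarrow> real"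
  assumes "a \<le> b" "continuous_on {a..b} f" "continuous_on {a..b} g"
    and "\<And>x. a < x \<Longrightarrow> x < b \<Longrightarrow> (f has_real_derivative f' x) (at x)"
    and "\<And>x. a < x \<Longrightarrow> x < b \<Longrightarrow> (g has_real_derivative g' x) (at x)"
    and "\<And>x. a < x \<Longrightarrow> x < b \<Longrightarrow> f' x \<le> g' x"
  shows "f b - f a \<le> g b - g a"
proof -
  have "g a - f a \<le> g b - f b"
  proof (rule DERIV_nonneg_imp_increasing_open[OF assms(1)])
    fix x assume x: "a < x" "x < b"
    have "((\<lambda>x. g x - f x) has_real_derivative g' x - f' x) (at x)"
      by (intro derivative_intros assms x)
    then show "\<exists>y. ((\<lambda>x. g x - f x) has_real_derivative y) (at x) \<and> 0 \<le> y"
      using assms(6)[OF x] by auto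
  qed (intro continuous_intros assms)
  then show ?thesis by simp
qed

lemma deriv_abs_le_increment:
  fixes f g :: "real \<Rightarrow> real"
  assumes "a \<le> b" "continuous_on {a..b} f" "continuous_on {a..b} g"
    and f: "\<And>x. a < x \<Longrightarrow> x < b \<Longrightarrow> (f has_real_derivative f' x) (at x)"
    and g: "\<And>x. a < x \<Longrightarrow> x < b \<Longrightarrow> (g has_real_derivative g' x) (at x)"
    and le: "\<And>x. a < x \<Longrightarrow> x < b \<Longrightarrow> \<bar>f' x\<bar> \<le> g' x"
  shows "\<bar>f b - f a\<bar> \<le> g b - g a"
proof -
  have "f b - f a \<le> g b - g a"
    by (rule deriv_le_increment[OF assms(1-3) f g]) (use le in \<open>auto simp: abs_le_iff\<close>)
  moreover have "- f b - - f a \<le> g b - g a"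
    by (rule deriv_le_increment[OF assms(1) _ assms(3) DERIV_minus[OF f] g])
      (use le assms(2) in \<open>auto simp: abs_le_iff intro: continuous_intros\<close>)
  ultimately show ?thesis by linarith
qed

text \<open>\<open>lm\<close> is \<open>- \<lambda>\<^sub>-\<close> and \<open>N = - W - lm Y\<close> is minus the unstable coordinate of the saddle. It
  grows exponentially, and as \<open>(e\<^bsup>lm t\<^esup> W)' = - e\<^bsup>lm t\<^esup> N'\<close> this alone forces \<open>W < 0\<close>.\<close>

lemma slip_growth:
  fixes Y W ph be p1 c1 :: "real \<Rightarrow> real"
  assumes par: "p < 0" "0 < de" "0 < l" "0 < lm" "l * lm = - p" "l - lm = - de * p"
    and sg0: "0 < b0" "0 < sg0" "0 < n0" "l * n0 = b0 + 4 * sg0" "0 < rh"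
    and small: "0 < ep" "0 \<le> et" "et \<le> 1" "et \<le> - p / 2" "et * (1 / lm + de) \<le> sg0 / n0" "et \<le> rh / (2 * (2 * (\<bar>c\<bar> + 1) / (- p)))"
      "et \<le> l / 4 * (rh / (2 * (2 * (\<bar>c\<bar> + 1) / (- p))))"
    and cont: "continuous_on {0..T} Y" "continuous_on {0..T} W" "continuous_on {0..T} ph"
    and F: "\<And>t. F t = max (- Y t - de * W t) 0"
    and dY: "\<And>t. 0 < t \<Longrightarrow> t < T \<Longrightarrow> (Y has_real_derivative W t) (at t)"
    and dW: "\<And>t. 0 < t \<Longrightarrow> t < T \<Longrightarrow> (W has_real_derivative be t + p1 t * F t) (at t)"
    and dph: "\<And>t. 0 < t \<Longrightarrow> t < T \<Longrightarrow> (ph has_real_derivative c1 t * F t) (at t)"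
    and p1: "\<And>t. 0 < t \<Longrightarrow> t < T \<Longrightarrow> \<bar>p1 t - p\<bar> \<le> et" and c1: "\<And>t. 0 < t \<Longrightarrow> t < T \<Longrightarrow> \<bar>c1 t - c\<bar> \<le> et"
    and be: "\<And>t. 0 < t \<Longrightarrow> t < T \<Longrightarrow> \<bar>be t\<bar> \<le> Eb" "Eb \<le> et" "Eb * T \<le> et" "0 \<le> Eb"
      "\<And>t. 0 < t \<Longrightarrow> t < T \<Longrightarrow> \<bar>ph t - ph 0\<bar> \<le> rh \<Longrightarrow> be t \<le> ep * (b0 + sg0)"
    and init: "Y 0 = 0" "W 0 = - (ep * n0)"
    and T: "0 \<le> T"
  defines "N \<equiv> \<lambda>t. - W t - lm * Y t"
  shows "\<And>t. 0 \<le> t \<Longrightarrow> t \<le> T \<Longrightarrow> W t < 0"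
    and "\<And>t. 0 \<le> t \<Longrightarrow> t \<le> T \<Longrightarrow> Y t \<le> 0"
    and "\<And>t. 0 < t \<Longrightarrow> t \<le> T \<Longrightarrow> Y t < 0"
    and "\<And>t. 0 < t \<Longrightarrow> t < T \<Longrightarrow> F t = - Y t - de * W t \<and> 0 \<le> F t \<and> F t \<le> (1 / lm + de) * N t"
    and "\<And>t. 0 < t \<Longrightarrow> t < T \<Longrightarrow> sg0 / n0 * N t \<le> l * N t - be t - (p1 t - p) * F t"
    and "\<And>t. 0 \<le> t \<Longrightarrow> t \<le> T \<Longrightarrow> ep * n0 * exp (sg0 / n0 * t) \<le> N t"
proof -
  define C1 where "C1 = 1 / lm + de"
  define C3 where "C3 = 2 * (\<bar>c\<bar> + 1) / (- p)"
  \<comment> \<open>The threshold k ep n0 lies strictly below the initial value ep n0 of N, yet a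
    forcing up to ep (b0 + sg0) is still at most N (b0 + 2 sg0) / n0. Of the growth rate l = (b0 + 4
    sg0) / n0 a surplus 2 sg0 / n0 remains.\<close>
  define k where "k = (b0 + sg0) / (b0 + 2 * sg0)"
  define cg where "cg = sg0 / n0"
  have C3: "0 < C3" unfolding C3_def using par by (intro divide_pos_pos) auto
  have C1: "0 < C1" using par by (simp add: C1_def add_pos_pos)
  have k: "0 < k" "k < 1" "k * (b0 + 2 * sg0) = b0 + sg0" using sg0 by (auto simp: k_def)
  have cg: "0 < cg" "cg \<le> l / 4"
  proof -
    have "4 * sg0 \<le> l * n0" using sg0 by simp
    then show "0 < cg" "cg \<le> l / 4" using sg0 by (auto simp: cg_def field_simps)
  qed
  have contN: "continuous_on {0..T} N" unfolding N_def by (intro continuous_intros cont)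
  have dN: "(N has_real_derivative l * N t - be t - (p1 t - p) * F t) (at t)"
    if t: "0 < t" "t < T" and Ft: "F t = - Y t - de * W t" for t
  proof -
    have "(N has_real_derivative - (be t + p1 t * F t) - lm * W t) (at t)"
      unfolding N_def by (auto intro!: derivative_eq_intros dY dW t)
    moreover have "- (be t + p1 t * F t) - lm * W t = l * N t - be t - (p1 t - p) * F t"
    proof -
      have "l * N t = - l * W t - l * lm * Y t" by (simp add: N_def algebra_simps)
      also have "\<dots> = - (lm - de * p) * W t + p * Y t"
      proof -
        have "l = lm - de * p" using par(6) by simp
        then have "- l * W t = - (lm - de * p) * W t" by simp
        moreover have "l * lm * Y t = - p * Y t" using par(5) by simp
        ultimately show ?thesis by linarith
      qed
      also have "\<dots> = - lm * W t - p * (- Y t - de * W t)" by (simp add: algebra_simps)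
      finally show ?thesis unfolding Ft by (simp add: algebra_simps)
    qed
    ultimately show ?thesis by (simp only:)
  qed
  define P where "P t \<longleftrightarrow> W t < 0 \<and> k * (ep * n0) < N t" for t
  have Yneg: "Y t \<le> 0 \<and> (0 < t \<longrightarrow> Y t < 0)" if t: "0 \<le> t" "t \<le> T" and W: "\<And>s. 0 \<le> s \<Longrightarrow> s < t \<Longrightarrow> W s < 0" for t
  proof (cases "t = 0")
    case False
    have "Y t < Y 0"
    proof (rule DERIV_neg_imp_decreasing_open[where f = Y and a = 0 and b = t])
      show "0 < t" using t False by simp
      show "continuous_on {0..t} Y" by (rule continuous_on_subset[OF cont(1)]) (use t in auto)
      fix x assume x: "0 < x" "x < t"
      then show "\<exists>y. (Y has_real_derivative y) (at x) \<and> y < 0"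
        using dY[of x] W[of x] t by (intro exI[of _ "W x"]) auto
    qed
    then show ?thesis using init by simp
  qed (use init in simp)
  have Fb: "F t = - Y t - de * W t \<and> 0 \<le> F t \<and> F t \<le> C1 * N t" if "Y t \<le> 0" "W t < 0" for t
  proof -
    have "0 \<le> - Y t - de * W t" using that par mult_pos_neg[of de "W t"] by simp
    moreover have "- Y t \<le> 1 / lm * N t" using that par by (simp add: N_def field_simps)
    moreover have "lm * Y t \<le> 0" using that par by (simp add: mult_le_0_iff)
    then have "de * (- W t) \<le> de * N t" using that par by (intro mult_left_mono) (auto simp: N_def)
    ultimately show ?thesis unfolding F C1_def by (auto simp: algebra_simps)
  qed
  have growth: "cg * N t \<le> l * N t - be t - (p1 t - p) * F t"
    if t: "0 < t" "t < T" and Ps: "\<And>s. 0 \<le> s \<Longrightarrow> s \<le> t \<Longrightarrow> P s" for t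
  proof -
    have W: "W s < 0" if "0 \<le> s" "s \<le> t" for s using Ps[OF that] by (simp add: P_def)
    have Y: "Y s \<le> 0" if "0 \<le> s" "s \<le> t" for s using Yneg[of s] W that t by auto
    \<comment> \<open>The contact impulse is paid for by the growth of -W, up to the small forcing.
      Hence ph can move only in proportion to -W.\<close>
    have phb: "\<bar>ph t - ph 0\<bar> \<le> (C3 * (- W t + Eb * t)) - (C3 * (- W 0 + Eb * 0))"
    proof (rule deriv_abs_le_increment)
      show "continuous_on {0..t} ph" by (rule continuous_on_subset[OF cont(3)]) (use t in auto)
      show "continuous_on {0..t} (\<lambda>s. C3 * (- W s + Eb * s))"
        by (intro continuous_intros continuous_on_subset[OF cont(2)]) (use t in auto)
      fix s assume s: "0 < s" "s < t"
      then have sT: "0 < s" "s < T" using t by auto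
      show "(ph has_real_derivative c1 s * F s) (at s)" by (rule dph[OF sT])
      show "((\<lambda>s. C3 * (- W s + Eb * s)) has_real_derivative C3 * (- (be s + p1 s * F s) + Eb)) (at s)"
        by (auto intro!: derivative_eq_intros dW sT)
      have F0: "0 \<le> F s" by (simp add: F)
      have "\<bar>c1 s * F s\<bar> \<le> (\<bar>c\<bar> + 1) * F s"
        unfolding abs_mult using c1[OF sT] small(3) F0 by (intro mult_mono) auto
      also have "\<dots> = C3 * (- p / 2 * F s)" using par by (simp add: C3_def field_simps)
      also have "\<dots> \<le> C3 * (- (be s + p1 s * F s) + Eb)"
      proof (rule mult_left_mono)
        have "p1 s * F s \<le> p / 2 * F s" using p1[OF sT] small(4) F0 by (intro mult_right_mono) auto
        then show "- p / 2 * F s \<le> - (be s + p1 s * F s) + Eb" using be(1)[OF sT] by auto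
      qed (use C3 in simp)
      finally show "\<bar>c1 s * F s\<bar> \<le> C3 * (- (be s + p1 s * F s) + Eb)" .
    qed (use t in auto)
    have "0 < k * (ep * n0)" using k(1) small(1) sg0(3) by simp
    moreover have "lm * Y t \<le> 0" using Y[of t] t par by (simp add: mult_le_0_iff)
    ultimately have Nt: "0 < N t" "- W t \<le> N t" using Ps[of t] t
      by (auto simp: P_def N_def)
    have "Eb * t \<le> et" using mult_left_mono[of t T Eb] be(3,4) t by linarith
    then have "C3 * (- W t + Eb * t) \<le> C3 * (N t + et)" using Nt C3 by (intro mult_left_mono) auto
    moreover have "0 \<le> C3 * (- W 0 + Eb * 0)" using init C3 small sg0 by simp
    ultimately have phN: "\<bar>ph t - ph 0\<bar> \<le> C3 * (N t + et)" using phb by linarith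
    have Ft: "F t \<le> C1 * N t" "0 \<le> F t" using Fb[of t] Y[of t] W[of t] t by auto
    have "(p1 t - p) * F t \<le> et * (C1 * N t)"
      using p1[OF t] Ft small by (intro mult_mono) auto
    then have r: "(p1 t - p) * F t \<le> et * C1 * N t" by simp
    show ?thesis
    \<comment> \<open>Near the initial ph the forcing is at most ep (b0 + sg0). Once ph has moved by
      more than rh, N has reached a fixed positive size, against which any forcing below
      \<open>et\<close> is negligible.\<close>
    proof (cases "\<bar>ph t - ph 0\<bar> \<le> rh")
      case True
      have "be t \<le> ep * (b0 + sg0)" using be(5)[OF t True] .
      also have "\<dots> = k * (ep * n0) * ((b0 + 2 * sg0) / n0)" using sg0 unfolding k(3)[symmetric] by simp
      also have "\<dots> \<le> N t * ((b0 + 2 * sg0) / n0)" using Ps[of t] t sg0 by (intro mult_right_mono) (auto simp: P_def)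
      finally have "be t \<le> N t * ((b0 + 2 * sg0) / n0)" .
      moreover have "et * C1 * N t \<le> cg * N t" using small(5) Nt by (intro mult_right_mono) (auto simp: C1_def cg_def)
      moreover have "l * N t = N t * ((b0 + 2 * sg0) / n0) + 2 * (cg * N t)"
      proof -
        have "l = (b0 + 4 * sg0) / n0" using sg0(3,4) by (simp add: field_simps)
        then have "l * N t = (b0 + 4 * sg0) / n0 * N t" by simp
        also have "\<dots> = N t * ((b0 + 2 * sg0) / n0) + 2 * (cg * N t)"
          using sg0(3) by (simp add: cg_def field_simps)
        finally show ?thesis .
      qed
      ultimately show ?thesis using r by linarith
    next
      case False
      then have "rh < C3 * (N t + et)" using phN by simp
      then have "rh / C3 < N t + et" using C3 by (simp add: field_simps)
      moreover have "et \<le> rh / C3 / 2" using small(6) unfolding C3_def[symmetric] by (simp add: field_simps)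
      ultimately have "rh / C3 / 2 \<le> N t" by linarith
      then have "l / 4 * (rh / C3 / 2) \<le> l / 4 * N t" using par by (intro mult_left_mono) auto
      moreover have "et \<le> l / 4 * (rh / C3 / 2)" using small(7) unfolding C3_def[symmetric] by (simp add: field_simps)
      ultimately have "be t \<le> l / 4 * N t" using be(1)[OF t] be(2) by linarith
      moreover have "et * C1 * N t \<le> l / 4 * N t"
      proof (rule mult_right_mono)
        have "et * C1 \<le> cg" using small(5) by (simp add: C1_def cg_def)
        then show "et * C1 \<le> l / 4" using cg by linarith
      qed (use Nt in simp)
      moreover have "cg * N t \<le> l / 4 * N t" using cg Nt by (intro mult_right_mono) auto
      moreover have "0 < l * N t" using par Nt by simp
      ultimately show ?thesis using r by linarith
    qed
  qed
  have N0: "N 0 = ep * n0" using init by (simp add: N_def)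
  have Pall: "P t" if "0 \<le> t" "t \<le> T" for t
  proof (rule interval_continuation[of P T])
    show "P 0" unfolding P_def N0 using init small sg0 k by simp
  next
    fix t assume t: "0 < t" "t \<le> T" and Ps: "\<And>s. 0 \<le> s \<Longrightarrow> s < t \<Longrightarrow> P s"
    have W: "W s < 0" if "0 \<le> s" "s < t" for s using Ps[OF that] by (simp add: P_def)
    have Y: "Y s \<le> 0" if "0 \<le> s" "s < t" for s using Yneg[of s] W that t by auto
    have Nd: "(N has_real_derivative l * N s - be s - (p1 s - p) * F s) (at s) \<and> 0 \<le> l * N s - be s - (p1 s - p) * F s"
      if s: "0 < s" "s < t" for s
    proof -
      have "0 < k * (ep * n0)" using k(1) small(1) sg0(3) by simp
      moreover have "k * (ep * n0) < N s" using Ps[of s] s by (simp add: P_def)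
      ultimately have "0 \<le> cg * N s" using cg by simp
      then show ?thesis using growth[of s] Ps s t dN[of s] Fb[of s] Y[of s] W[of s] by auto
    qed
    have "N 0 \<le> N t"
    proof (rule DERIV_nonneg_imp_increasing_open[where f = N and a = 0 and b = t])
      show "continuous_on {0..t} N" by (rule continuous_on_subset[OF contN]) (use t in auto)
      show "\<exists>y. (N has_real_derivative y) (at s) \<and> 0 \<le> y" if "0 < s" "s < t" for s
        by (rule exI, rule Nd[OF that])
    qed (use t in simp)
    moreover have "k * (ep * n0) < 1 * (ep * n0)"
      using k(2) small(1) sg0(3) by (intro mult_strict_right_mono) auto
    ultimately have 1: "k * (ep * n0) < N t" using N0 by linarith
    have "exp (lm * t) * W t \<le> exp (lm * 0) * W 0"
    proof (rule DERIV_nonpos_imp_decreasing_open[where f = "\<lambda>s. exp (lm * s) * W s" and a = 0 and b = t])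
      show "continuous_on {0..t} (\<lambda>s. exp (lm * s) * W s)"
        by (intro continuous_intros continuous_on_subset[OF cont(2)]) (use t in auto)
      fix s assume s: "0 < s" "s < t"
      have "(W has_real_derivative - (l * N s - be s - (p1 s - p) * F s) - lm * W s) (at s)"
      proof -
        have "((\<lambda>s. - N s - lm * Y s) has_real_derivative - (l * N s - be s - (p1 s - p) * F s) - lm * W s) (at s)"
          using Nd[OF s] dY[of s] s t by (auto intro!: derivative_eq_intros)
        moreover have "(\<lambda>s. - N s - lm * Y s) = W" by (auto simp: N_def)
        ultimately show ?thesis by simp
      qed
      then have "((\<lambda>s. exp (lm * s) * W s) has_real_derivative
          exp (lm * s) * (- (l * N s - be s - (p1 s - p) * F s) - lm * W s) + lm * exp (lm * s) * W s) (at s)"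
        by (auto intro!: derivative_eq_intros)
      moreover have "exp (lm * s) * (- (l * N s - be s - (p1 s - p) * F s) - lm * W s) + lm * exp (lm * s) * W s
          = - (exp (lm * s) * (l * N s - be s - (p1 s - p) * F s))" by (simp add: algebra_simps)
      ultimately have "((\<lambda>s. exp (lm * s) * W s) has_real_derivative - (exp (lm * s) * (l * N s - be s - (p1 s - p) * F s))) (at s)"
        by (simp only:)
      moreover have "- (exp (lm * s) * (l * N s - be s - (p1 s - p) * F s)) \<le> 0" using Nd[OF s] by simp
      ultimately show "\<exists>y. ((\<lambda>s. exp (lm * s) * W s) has_real_derivative y) (at s) \<and> y \<le> 0" by (intro exI conjI)
    qed (use t in simp)
    also have "\<dots> < 0" using init small sg0 by simp
    finally have "W t < 0" by (simp add: mult_less_0_iff)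
    then show "P t" using 1 by (simp add: P_def)
  next
    fix t assume t: "0 \<le> t" "t < T" and Ps: "\<And>s. 0 \<le> s \<Longrightarrow> s \<le> t \<Longrightarrow> P s"
    \<comment> \<open>P consists of strict inequalities between continuous functions, here merged
      into the positivity of one of them, so it persists to the right.\<close>
    define m where "m s = min (- W s) (N s - k * (ep * n0))" for s
    have "continuous_on {0..T} m"
      unfolding m_def by (intro continuous_intros cont contN)
    moreover have mt: "0 < m t" using Ps[of t] t by (simp add: P_def m_def)
    ultimately have "\<exists>e>0. \<forall>s\<in>{0..T}. dist s t < e \<longrightarrow> dist (m s) (m t) < m t"
      using t unfolding continuous_on_iff by auto
    then obtain e where e: "0 < e" "\<And>s. s \<in> {0..T} \<Longrightarrow> dist s t < e \<Longrightarrow> dist (m s) (m t) < m t" by blast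
    have "P s" if "t < s" "s < t + e" "s \<le> T" for s
    proof -
      have "0 < m s" using e(2)[of s] that t unfolding dist_real_def by auto
      then show ?thesis by (simp add: P_def m_def)
    qed
    then show "\<exists>e>0. \<forall>s. t < s \<and> s < t + e \<and> s \<le> T \<longrightarrow> P s" using e(1) by blast
  qed (use that in auto)
  show Wn: "W t < 0" if "0 \<le> t" "t \<le> T" for t using Pall[OF that] by (simp add: P_def)
  show Yn: "Y t \<le> 0" if "0 \<le> t" "t \<le> T" for t using Yneg[of t] that Wn by auto
  show "Y t < 0" if "0 < t" "t \<le> T" for t using Yneg[of t] that Wn by auto
  show Fa: "F t = - Y t - de * W t \<and> 0 \<le> F t \<and> F t \<le> (1 / lm + de) * N t" if "0 < t" "t < T" for t
    using Fb[of t] Yn[of t] Wn[of t] that by (simp add: C1_def)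
  show gr: "sg0 / n0 * N t \<le> l * N t - be t - (p1 t - p) * F t" if "0 < t" "t < T" for t
    using growth[OF that] Pall that by (simp add: cg_def)
  show "ep * n0 * exp (sg0 / n0 * t) \<le> N t" if t: "0 \<le> t" "t \<le> T" for t
  proof -
    have "exp (- (cg * 0)) * N 0 \<le> exp (- (cg * t)) * N t"
    proof (rule DERIV_nonneg_imp_increasing_open[where f = "\<lambda>s. exp (- (cg * s)) * N s" and a = 0 and b = t])
      show "continuous_on {0..t} (\<lambda>s. exp (- (cg * s)) * N s)"
        by (intro continuous_intros continuous_on_subset[OF contN]) (use t in auto)
      fix s assume s: "0 < s" "s < t"
      then have sT: "0 < s" "s < T" using t by auto
      have "((\<lambda>s. exp (- (cg * s)) * N s) has_real_derivative
          exp (- (cg * s)) * (l * N s - be s - (p1 s - p) * F s) + - cg * exp (- (cg * s)) * N s) (at s)"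
        using dN[OF sT] Fa[OF sT] by (auto intro!: derivative_eq_intros)
      moreover have "0 \<le> exp (- (cg * s)) * (l * N s - be s - (p1 s - p) * F s) + - cg * exp (- (cg * s)) * N s"
      proof -
        have "0 \<le> exp (- (cg * s)) * ((l * N s - be s - (p1 s - p) * F s) - cg * N s)"
          using gr[OF sT] by (intro mult_nonneg_nonneg) (auto simp: cg_def)
        then show ?thesis by (simp add: algebra_simps)
      qed
      ultimately show "\<exists>y. ((\<lambda>s. exp (- (cg * s)) * N s) has_real_derivative y) (at s) \<and> 0 \<le> y" by (intro exI conjI)
    qed (use t in simp)
    then have "ep * n0 * exp (cg * t) \<le> exp (- (cg * t)) * N t * exp (cg * t)"
      using N0 by (intro mult_right_mono) auto
    also have "\<dots> = N t * exp (cg * t + - (cg * t))" by (simp only: exp_add mult_ac)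
    also have "\<dots> = N t" by (simp only: add.right_inverse exp_zero mult_1_right)
    finally show ?thesis unfolding cg_def .
  qed
qed

text \<open>Constant coefficients p, q, c up to the error et, and forces of size E that carry the
  factor epsilon. The condition E * T \<le> et, instead of a bound on T, admits durations of order
  ln (1 / epsilon).\<close>

definition slip_traj ::
    "real \<Rightarrow> real \<Rightarrow> real \<Rightarrow> real \<Rightarrow> real \<Rightarrow> real \<Rightarrow> real \<Rightarrow> real \<Rightarrow> real \<Rightarrow> real \<Rightarrow> real \<Rightarrow> real \<Rightarrow>
     (real \<Rightarrow> real) \<Rightarrow> (real \<Rightarrow> real) \<Rightarrow> (real \<Rightarrow> real) \<Rightarrow> (real \<Rightarrow> real) \<Rightarrow> bool" where
  "slip_traj p q c de b0 sg0 n0 rh v0 et ep T Y W ph v \<longleftrightarrow>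
    (\<exists>E be A p1 q1 c1. 0 \<le> T \<and> 0 < ep \<and> ep \<le> et \<and> 0 \<le> E \<and> E \<le> et \<and> E * T \<le> et
     \<and> continuous_on {0..T} Y \<and> continuous_on {0..T} W \<and> continuous_on {0..T} ph \<and> continuous_on {0..T} v
     \<and> Y 0 = 0 \<and> W 0 = - (ep * n0) \<and> v 0 = v0 \<and> (\<forall>t. 0 \<le> t \<and> t \<le> T \<longrightarrow> 0 \<le> v t)
     \<and> (\<forall>t. 0 < t \<and> t < T \<longrightarrow>
          (Y has_real_derivative W t) (at t)
          \<and> (W has_real_derivative be t + p1 t * max (- Y t - de * W t) 0) (at t)
          \<and> (ph has_real_derivative c1 t * max (- Y t - de * W t) 0) (at t)
          \<and> (v has_real_derivative A t + q1 t * max (- Y t - de * W t) 0) (at t)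
          \<and> \<bar>p1 t - p\<bar> \<le> et \<and> \<bar>q1 t - q\<bar> \<le> et \<and> \<bar>c1 t - c\<bar> \<le> et \<and> \<bar>be t\<bar> \<le> E \<and> \<bar>A t\<bar> \<le> E
          \<and> (\<bar>ph t - ph 0\<bar> \<le> rh \<longrightarrow> be t \<le> ep * (b0 + sg0))))"

text \<open>The impulse, the integral of F, is bounded independently of the duration, since q1 \<le>
  q / 2 makes v pay for it and v only falls from v0 to nonnegative values. Coefficient errors of
  size et therefore change the two nearly conserved combinations by O(et). W - l Y is damped at the
  rate lm, and N, which grows exponentially but stays bounded, limits the duration.\<close>

lemma slip_phase:
  fixes p q c de l lm b0 sg0 n0 rh v0 :: real
  assumes par: "p < 0" "q < 0" "0 < de" "0 < l" "0 < lm" "l * lm = - p" "l - lm = - de * p"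
    and sg0: "0 < b0" "0 < sg0" "0 < n0" "l * n0 = b0 + 4 * sg0" "0 < rh" "0 < v0"
  shows "\<exists>g>0. \<exists>et0>0. \<exists>C>0. \<forall>et ep T Y W ph v. et \<le> et0 \<longrightarrow> slip_traj p q c de b0 sg0 n0 rh v0 et ep T Y W ph v \<longrightarrow>
    (\<forall>t\<in>{0..T}. W t < 0 \<and> Y t \<le> 0 \<and> (0 < t \<longrightarrow> Y t < 0) \<and> \<bar>Y t\<bar> \<le> C \<and> \<bar>W t\<bar> \<le> C
      \<and> \<bar>W t - p / q * (v t - v0)\<bar> \<le> C * et \<and> \<bar>ph t - ph 0 - c / q * (v t - v0)\<bar> \<le> C * et
      \<and> \<bar>W t - l * Y t\<bar> \<le> C * et \<and> ep * exp (g * t) \<le> C)"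
proof -
  define m1 m2 m3 where "m1 = p / q" and "m2 = c / q" and "m3 = 2 / (- q)"
  have m: "0 < m1" "m1 * q = p" "m2 * q = c" "0 < m3" "m3 * (- q / 2 * x) = x" for x
    using par by (auto simp: m1_def m2_def m3_def divide_neg_neg divide_pos_neg)
  define C1 where "C1 = 1 / lm + de"
  define C3 where "C3 = 2 * (\<bar>c\<bar> + 1) / (- p)"
  define cg where "cg = sg0 / n0"
  define Q where "Q = 1 + m3 * (v0 + 1)"
  define R where "R = 1 + m1"
  define R' where "R' = 1 + \<bar>m2\<bar>"
  define Wm where "Wm = m1 * v0 + (R * Q + n0)"
  define Nm where "Nm = 2 * ((1 + lm / l) * Wm + lm / l * (n0 + 1))"
  define CZ where "CZ = n0 + 1 + C1 / cg * Nm"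
  \<comment> \<open>The entries up to the last are the smallness conditions of
    \<open>slip_growth\<close> together with q1 \<le> q / 2. The last one makes lm / l * K \<le> 1 /
    2, so that N can be absorbed in its own bound.\<close>
  define et0 where "et0 = Min {1, - p / 2, - q / 2, cg / C1, rh / (2 * C3), l / 4 * (rh / (2 * C3)), cg / C1 * (l / lm) / 2}"
  define C where "C = Nm / lm + Wm + (R * Q + n0) + R' * Q + CZ + Nm / n0 + 1"
  note pq = m(1)
  have pos: "0 < C1" "0 < C3" "0 < cg" "0 < Q" "0 < R" "0 < R'"
  proof -
    show "0 < C1" unfolding C1_def using par by (intro add_pos_pos divide_pos_pos) auto
    show "0 < C3" unfolding C3_def using par(1) by (intro divide_pos_pos) auto
    show "0 < cg" unfolding cg_def using sg0 by simp
    show "0 < Q" unfolding Q_def using m(4) sg0(6) by (intro add_pos_pos mult_pos_pos) auto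
    show "0 < R" unfolding R_def using m(1) by simp
    show "0 < R'" unfolding R'_def by (simp add: add_pos_nonneg)
  qed
  have Wm: "0 < Wm" unfolding Wm_def using pq pos sg0 by (intro add_pos_pos mult_pos_pos) auto
  have Nm: "0 < Nm" unfolding Nm_def using Wm par sg0 by (intro mult_pos_pos add_pos_pos divide_pos_pos) auto
  have CZ: "0 < CZ" unfolding CZ_def using sg0 pos Nm by (intro add_pos_pos mult_pos_pos divide_pos_pos) auto
  have parts: "0 < Nm / lm" "0 < R * Q + n0" "0 < R' * Q" "0 < Nm / n0"
    using Nm par pos sg0 by (auto intro!: add_pos_pos mult_pos_pos divide_pos_pos)
  have C: "0 < C" "Nm / lm \<le> C" "Wm \<le> C" "R * Q + n0 \<le> C" "R' * Q \<le> C" "CZ \<le> C" "Nm / n0 \<le> C"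
    unfolding C_def using parts Wm CZ by linarith+
  have et0_le: "et0 \<le> x" if "x \<in> {1, - p / 2, - q / 2, cg / C1, rh / (2 * C3), l / 4 * (rh / (2 * C3)), cg / C1 * (l / lm) / 2}" for x
    unfolding et0_def by (rule Min_le[OF _ that]) simp
  have et0: "0 < et0"
  proof -
    have f: "0 < - p / 2" "0 < - q / 2" "0 < cg / C1" "0 < rh / (2 * C3)" using par(1,2) pos(1-3) sg0(5) by simp_all
    then have "0 < l / 4 * (rh / (2 * C3))" "0 < cg / C1 * (l / lm) / 2"
      using mult_pos_pos[of "l / 4" "rh / (2 * C3)"] mult_pos_pos[of "cg / C1" "l / lm"] par(4,5) by auto
    moreover have "et0 \<in> {1, - p / 2, - q / 2, cg / C1, rh / (2 * C3), l / 4 * (rh / (2 * C3)), cg / C1 * (l / lm) / 2}" unfolding et0_def by (rule Min_in) simp_all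
    ultimately show ?thesis using f by (elim insertE emptyE) (simp_all only: zero_less_one)
  qed
  have main: "W t < 0 \<and> Y t \<le> 0 \<and> (0 < t \<longrightarrow> Y t < 0) \<and> \<bar>Y t\<bar> \<le> C \<and> \<bar>W t\<bar> \<le> C
      \<and> \<bar>W t - m1 * (v t - v0)\<bar> \<le> C * et \<and> \<bar>ph t - ph 0 - m2 * (v t - v0)\<bar> \<le> C * et
      \<and> \<bar>W t - l * Y t\<bar> \<le> C * et \<and> ep * exp (cg * t) \<le> C"
    if et: "et \<le> et0" and traj: "slip_traj p q c de b0 sg0 n0 rh v0 et ep T Y W ph v" and t: "t \<in> {0..T}"
    for et ep T t :: real and Y W ph v :: "real \<Rightarrow> real"
  proof -
    obtain E be A p1 q1 c1 where T: "0 \<le> T" and eps: "0 < ep" "ep \<le> et" and E: "0 \<le> E" "E \<le> et" "E * T \<le> et"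
      and cont: "continuous_on {0..T} Y" "continuous_on {0..T} W" "continuous_on {0..T} ph" "continuous_on {0..T} v"
      and init: "Y 0 = 0" "W 0 = - (ep * n0)" "v 0 = v0" and vpos: "\<And>t. 0 \<le> t \<Longrightarrow> t \<le> T \<Longrightarrow> 0 \<le> v t"
      and D: "\<And>t. 0 < t \<Longrightarrow> t < T \<Longrightarrow>
          (Y has_real_derivative W t) (at t)
          \<and> (W has_real_derivative be t + p1 t * max (- Y t - de * W t) 0) (at t)
          \<and> (ph has_real_derivative c1 t * max (- Y t - de * W t) 0) (at t)
          \<and> (v has_real_derivative A t + q1 t * max (- Y t - de * W t) 0) (at t)
          \<and> \<bar>p1 t - p\<bar> \<le> et \<and> \<bar>q1 t - q\<bar> \<le> et \<and> \<bar>c1 t - c\<bar> \<le> et \<and> \<bar>be t\<bar> \<le> E \<and> \<bar>A t\<bar> \<le> E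
          \<and> (\<bar>ph t - ph 0\<bar> \<le> rh \<longrightarrow> be t \<le> ep * (b0 + sg0))"
      using traj unfolding slip_traj_def by blast
    define F where "F t = max (- Y t - de * W t) 0" for t
    define N where "N t = - W t - lm * Y t" for t
    have F0: "0 \<le> F s" for s by (simp add: F_def)
    have etpos: "0 \<le> et" using eps by simp
    have etb: "et \<le> 1" "et \<le> - p / 2" "et \<le> - q / 2" "et \<le> cg / C1" "et \<le> rh / (2 * C3)" "et \<le> l / 4 * (rh / (2 * C3))" "et \<le> cg / C1 * (l / lm) / 2"
      by (rule order_trans[OF et et0_le], blast)+
    have etC1: "et * C1 \<le> cg" using etb(4) pos by (simp add: field_simps)
    note G = slip_growth[OF par(1,3-7) sg0(1-5) eps(1) etpos etb(1,2) etC1[unfolded C1_def cg_def] etb(5,6)[unfolded C3_def] cont(1-3) F_def,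
        of be p1 c1 E, folded F_def C1_def cg_def N_def]
    note D' = D[folded F_def]
    have Wn: "W s < 0" and Yn: "Y s \<le> 0" and Yn': "0 < s \<Longrightarrow> Y s < 0" and Nexp: "ep * n0 * exp (cg * s) \<le> N s" if "0 \<le> s" "s \<le> T" for s
      by (rule G; use D' E init T that in auto)+
    have Fa: "F s = - Y s - de * W s \<and> 0 \<le> F s \<and> F s \<le> C1 * N s" and gr: "cg * N s \<le> l * N s - be s - (p1 s - p) * F s" if "0 < s" "s < T" for s
      by (rule G; use D' E init T that in auto)+
    have tT: "0 \<le> t" "t \<le> T" using t by auto
    have sub: "continuous_on {0..t} Y" "continuous_on {0..t} W" "continuous_on {0..t} ph" "continuous_on {0..t} v"
      by (rule continuous_on_subset[OF cont(1)] continuous_on_subset[OF cont(2)] continuous_on_subset[OF cont(3)] continuous_on_subset[OF cont(4)]; use tT in auto)+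
    have Et: "E * t \<le> et" using mult_left_mono[of t T E] E tT by linarith
    \<comment> \<open>Solved for F, the equation of v bounds the contact force by its rate of
      decrease plus E; m3 is the reciprocal of - q / 2.\<close>
    have FD: "F s \<le> m3 * (- (A s + q1 s * F s) + E)" if s: "0 < s" "s < T" for s
    proof -
      have "q1 s * F s \<le> q / 2 * F s" using D'[OF s] etb(3) F0[of s] by (intro mult_right_mono) auto
      then have "- q / 2 * F s \<le> - (A s + q1 s * F s) + E" using D'[OF s] by auto
      then have "m3 * (- q / 2 * F s) \<le> m3 * (- (A s + q1 s * F s) + E)"
        using m(4) by (intro mult_left_mono) auto
      then show ?thesis unfolding m(5) .
    qed
    \<comment> \<open>Meant for quantities whose rate is O(E + et F): by \<open>FD\<close> the
      integral of F is at most a multiple of v0 + 1, hence the factor \<open>Q\<close>.\<close>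
    have drift: "\<bar>X t - X 0\<bar> \<le> r * Q * et"
      if X: "continuous_on {0..t} X" "\<And>s. 0 < s \<Longrightarrow> s < t \<Longrightarrow> (X has_real_derivative X' s) (at s)"
        and X': "\<And>s. 0 < s \<Longrightarrow> s < t \<Longrightarrow> \<bar>X' s\<bar> \<le> r * (E + et * F s)" and r: "0 < r" for X X' r
    proof -
      define B where "B s = r * (E * s + et * (m3 * (- v s + E * s)))" for s
      have "\<bar>X t - X 0\<bar> \<le> B t - B 0"
      proof (rule deriv_abs_le_increment[OF tT(1) X(1) _ X(2)])
        show "continuous_on {0..t} B" unfolding B_def by (intro continuous_intros sub)
        fix s assume s: "0 < s" "s < t"
        then have sT: "0 < s" "s < T" using tT by auto
        show "(B has_real_derivative r * (E + et * (m3 * (- (A s + q1 s * F s) + E)))) (at s)"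
          unfolding B_def[abs_def] using D'[OF sT] by (auto intro!: derivative_eq_intros)
        have "r * (E + et * F s) \<le> r * (E + et * (m3 * (- (A s + q1 s * F s) + E)))"
          using FD[OF sT] r etpos by (intro mult_left_mono add_left_mono) auto
        then show "\<bar>X' s\<bar> \<le> r * (E + et * (m3 * (- (A s + q1 s * F s) + E)))" using X'[OF s] by linarith
      qed
      also have "B t - B 0 = r * (E * t + et * (m3 * (v0 - v t + E * t)))"
        by (simp add: B_def init algebra_simps)
      also have "\<dots> \<le> r * (et + et * (m3 * (v0 + 1)))"
        using Et etb(1) vpos[OF tT] r etpos m(4)
        by (intro mult_left_mono add_mono) auto
      also have "\<dots> = r * Q * et" by (simp add: Q_def algebra_simps)
      finally show ?thesis .
    qed
    have "\<bar>(W t - m1 * v t) - (W 0 - m1 * v 0)\<bar> \<le> R * Q * et"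
    proof (rule drift[OF _ _ _ pos(5)])
      show "continuous_on {0..t} (\<lambda>s. W s - m1 * v s)" by (intro continuous_intros sub)
      fix s assume s: "0 < s" "s < t"
      then have sT: "0 < s" "s < T" using tT by auto
      show "((\<lambda>s. W s - m1 * v s) has_real_derivative (be s + p1 s * F s) - m1 * (A s + q1 s * F s)) (at s)"
        by (intro derivative_intros DERIV_cmult) (use D'[OF sT] in auto)
      have "(be s + p1 s * F s) - m1 * (A s + q1 s * F s) = be s - m1 * A s + ((p1 s - p) * F s - m1 * ((q1 s - q) * F s))"
        unfolding m(2)[symmetric] by (simp add: algebra_simps)
      also have "\<bar>\<dots>\<bar> \<le> (\<bar>be s\<bar> + \<bar>m1 * A s\<bar>) + (\<bar>(p1 s - p) * F s\<bar> + \<bar>m1 * ((q1 s - q) * F s)\<bar>)"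
        by (intro order_trans[OF abs_triangle_ineq] add_mono abs_triangle_ineq4)
      also have "\<dots> = (\<bar>be s\<bar> + m1 * \<bar>A s\<bar>) + (\<bar>p1 s - p\<bar> * F s + m1 * (\<bar>q1 s - q\<bar> * F s))"
        using pq F0[of s] by (simp only: abs_mult abs_of_pos abs_of_nonneg)
      also have "\<dots> \<le> (E + m1 * E) + (et * F s + m1 * (et * F s))"
        using D'[OF sT] pq F0[of s] by (intro add_mono mult_left_mono mult_right_mono) auto
      also have "\<dots> = R * (E + et * F s)" by (simp add: R_def algebra_simps)
      finally show "\<bar>(be s + p1 s * F s) - m1 * (A s + q1 s * F s)\<bar> \<le> R * (E + et * F s)" .
    qed
    moreover have "ep * n0 \<le> et * n0" using eps sg0 by (intro mult_right_mono) auto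
    moreover have "W t - m1 * (v t - v0) = ((W t - m1 * v t) - (W 0 - m1 * v 0)) - ep * n0"
      using init by (simp add: algebra_simps)
    moreover have "0 \<le> ep * n0" using eps sg0 by simp
    ultimately have Wv: "\<bar>W t - m1 * (v t - v0)\<bar> \<le> (R * Q + n0) * et" unfolding distrib_right by (simp add: mult.commute)
    have "\<bar>(ph t - m2 * v t) - (ph 0 - m2 * v 0)\<bar> \<le> R' * Q * et"
    proof (rule drift[OF _ _ _ pos(6)])
      show "continuous_on {0..t} (\<lambda>s. ph s - m2 * v s)" by (intro continuous_intros sub)
      fix s assume s: "0 < s" "s < t"
      then have sT: "0 < s" "s < T" using tT by auto
      show "((\<lambda>s. ph s - m2 * v s) has_real_derivative c1 s * F s - m2 * (A s + q1 s * F s)) (at s)"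
        by (intro derivative_intros DERIV_cmult) (use D'[OF sT] in auto)
      have "c1 s * F s - m2 * (A s + q1 s * F s) = - (m2 * A s) + ((c1 s - c) * F s - m2 * ((q1 s - q) * F s))"
        unfolding m(3)[symmetric] by (simp add: algebra_simps)
      also have "\<bar>\<dots>\<bar> \<le> \<bar>m2 * A s\<bar> + (\<bar>(c1 s - c) * F s\<bar> + \<bar>m2 * ((q1 s - q) * F s)\<bar>)"
        using abs_triangle_ineq[of "- (m2 * A s)"] abs_triangle_ineq4[of "(c1 s - c) * F s" "m2 * ((q1 s - q) * F s)"]
        by (smt (verit) abs_minus_cancel)
      also have "\<dots> = \<bar>m2\<bar> * \<bar>A s\<bar> + (\<bar>c1 s - c\<bar> * F s + \<bar>m2\<bar> * (\<bar>q1 s - q\<bar> * F s))"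
        using F0[of s] by (simp only: abs_mult abs_of_nonneg)
      also have "\<dots> \<le> \<bar>m2\<bar> * E + (et * F s + \<bar>m2\<bar> * (et * F s))"
        using D'[OF sT] F0[of s] by (intro add_mono mult_left_mono mult_right_mono) auto
      also have "\<dots> \<le> R' * (E + et * F s)" using E by (simp add: R'_def algebra_simps)
      finally show "\<bar>c1 s * F s - m2 * (A s + q1 s * F s)\<bar> \<le> R' * (E + et * F s)" .
    qed
    then have phv: "\<bar>ph t - ph 0 - m2 * (v t - v0)\<bar> \<le> R' * Q * et" using init by (simp add: algebra_simps)
    have "- (m1 * (v t - v0)) \<le> m1 * v0"
    proof -
      have "0 \<le> m1 * v t" using pq vpos[OF tT] by simp
      then show ?thesis by (simp add: right_diff_distrib)
    qed
    moreover have "(R * Q + n0) * et \<le> R * Q + n0" using etb(1) parts(2) etpos by (intro mult_left_le) auto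
    ultimately have Wb: "- W t \<le> Wm" using Wv unfolding Wm_def by (simp add: abs_le_iff)
    define Z where "Z s = W s - l * Y s" for s
    \<comment> \<open>The contracting coordinate obeys Z' = - lm Z + error, the error being at most
      E + et C1 N. Since N' \<ge> cg N, it is bounded by the derivative of E s + K N, so
      \<open>Ps\<close> is an upper solution for both Z and - Z.\<close>
    define K where "K = et * C1 / cg"
    have K: "0 \<le> K" "K * cg = et * C1" using etpos pos by (auto simp: K_def)
    define Ps where "Ps s = n0 * ep + E * s + K * N s" for s
    have dN: "(N has_real_derivative l * N s - be s - (p1 s - p) * F s) (at s)"
      and dZ: "(Z has_real_derivative be s + (p1 s - p) * F s - lm * Z s) (at s)" if s: "0 < s" "s < T" for s
    proof -
      have l: "l = lm - de * p" using par by simp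
      have lW: "l * W s = lm * W s - p * de * W s" by (subst l) (simp add: algebra_simps)
      have "p * F s = p * (- Y s) - p * de * W s" using Fa[OF s] by (simp add: right_diff_distrib)
      moreover have "p * (- Y s) = (lm * l) * Y s" using par(6) by (simp add: mult.commute)
      ultimately have pW: "p * F s = (lm * l) * Y s - p * de * W s" by simp
      have r: "(p1 s - p) * F s = p1 s * F s - p * F s" by (simp add: left_diff_distrib)
      have "(N has_real_derivative - (be s + p1 s * F s) - lm * W s) (at s)"
        unfolding N_def[abs_def] using D'[OF s] by (auto intro!: derivative_eq_intros)
      moreover have "- (be s + p1 s * F s) - lm * W s = l * N s - be s - (p1 s - p) * F s"
      proof -
        have "l * N s = - (l * W s) - (lm * l) * Y s" by (simp add: N_def algebra_simps)
        then show ?thesis using pW lW r by linarith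
      qed
      ultimately show "(N has_real_derivative l * N s - be s - (p1 s - p) * F s) (at s)" by (simp only:)
      have "(Z has_real_derivative (be s + p1 s * F s) - l * W s) (at s)"
        unfolding Z_def[abs_def] using D'[OF s] by (auto intro!: derivative_eq_intros)
      moreover have "(be s + p1 s * F s) - l * W s = be s + (p1 s - p) * F s - lm * Z s"
      proof -
        have "lm * Z s = lm * W s - (lm * l) * Y s" by (simp add: Z_def algebra_simps)
        then show ?thesis using pW lW r by linarith
      qed
      ultimately show "(Z has_real_derivative be s + (p1 s - p) * F s - lm * Z s) (at s)" by (simp only:)
    qed
    have N0: "0 \<le> N s" if "0 \<le> s" "s \<le> T" for s using Nexp[OF that] eps sg0 by (meson exp_ge_zero less_imp_le mult_nonneg_nonneg order_trans)
    have cN: "continuous_on {0..t} N" "continuous_on {0..t} Z" unfolding N_def Z_def by (intro continuous_intros sub)+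
    have Zside: "ta * Z t \<le> Ps t" if ta: "ta = 1 \<or> ta = - 1" for ta
    proof -
      have "exp (lm * t) * (ta * Z t - Ps t) \<le> exp (lm * 0) * (ta * Z 0 - Ps 0)"
      proof (rule DERIV_nonpos_imp_decreasing_open[where f = "\<lambda>s. exp (lm * s) * (ta * Z s - Ps s)" and a = 0 and b = t])
        show "continuous_on {0..t} (\<lambda>s. exp (lm * s) * (ta * Z s - Ps s))"
          unfolding Ps_def by (intro continuous_intros cN)
        fix s assume s: "0 < s" "s < t"
        then have sT: "0 < s" "s < T" using tT by auto
        let ?N' = "l * N s - be s - (p1 s - p) * F s"
        have "((\<lambda>s. exp (lm * s) * (ta * Z s - Ps s)) has_real_derivative
            exp (lm * s) * (ta * (be s + (p1 s - p) * F s - lm * Z s) - (E + K * ?N')) + lm * exp (lm * s) * (ta * Z s - Ps s)) (at s)"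
          unfolding Ps_def by (auto intro!: derivative_eq_intros dN[OF sT] dZ[OF sT])
        moreover have "exp (lm * s) * (ta * (be s + (p1 s - p) * F s - lm * Z s) - (E + K * ?N')) + lm * exp (lm * s) * (ta * Z s - Ps s)
            = exp (lm * s) * (ta * (be s + (p1 s - p) * F s) - (E + K * ?N') - lm * Ps s)"
          by (simp add: algebra_simps)
        moreover have "\<dots> \<le> 0"
        proof -
          have "ta * (be s + (p1 s - p) * F s) \<le> \<bar>be s\<bar> + \<bar>p1 s - p\<bar> * F s"
          proof -
            have "ta * (be s + (p1 s - p) * F s) \<le> \<bar>be s + (p1 s - p) * F s\<bar>"
              using ta abs_ge_self[of "be s + (p1 s - p) * F s"] abs_ge_minus_self[of "be s + (p1 s - p) * F s"]
              by (elim disjE) (simp_all only: mult_1 mult_minus1)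
            also have "\<dots> \<le> \<bar>be s\<bar> + \<bar>(p1 s - p) * F s\<bar>" by (rule abs_triangle_ineq)
            finally show ?thesis using F0[of s] by (simp only: abs_mult abs_of_nonneg)
          qed
          also have "\<dots> \<le> E + et * (C1 * N s)"
            using D'[OF sT] Fa[OF sT] etpos by (intro add_mono mult_mono) auto
          also have "et * (C1 * N s) = K * (cg * N s)" using K(2) by (simp add: mult.assoc[symmetric])
          also have "\<dots> \<le> K * ?N'" using gr[OF sT] K by (intro mult_left_mono) auto
          finally have "ta * (be s + (p1 s - p) * F s) - (E + K * ?N') \<le> 0" by simp
          moreover have "0 \<le> Ps s" unfolding Ps_def using eps sg0 E s K N0[of s] sT by (intro add_nonneg_nonneg mult_nonneg_nonneg) auto
          then have "0 \<le> lm * Ps s" using par by simp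
          ultimately show ?thesis by (intro mult_nonneg_nonpos) auto
        qed
        ultimately show "\<exists>y. ((\<lambda>s. exp (lm * s) * (ta * Z s - Ps s)) has_real_derivative y) (at s) \<and> y \<le> 0" by (intro exI conjI) simp_all
      qed (use tT in simp)
      moreover have "ta * Z 0 - Ps 0 \<le> 0"
      proof -
        have "ta * Z 0 \<le> n0 * ep" using ta init eps sg0 by (auto simp: Z_def)
        moreover have "0 \<le> K * N 0" using K N0[of 0] T by simp
        ultimately show ?thesis by (simp add: Ps_def)
      qed
      ultimately have "exp (lm * t) * (ta * Z t - Ps t) \<le> 0" by simp
      then show ?thesis by (simp add: mult_le_0_iff)
    qed
    have Zb: "\<bar>Z t\<bar> \<le> Ps t" using Zside[of 1] Zside[of "- 1"] by (simp add: abs_le_iff)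
    have nep: "n0 * ep \<le> n0 * et" using eps sg0 by (intro mult_left_mono) auto
    \<comment> \<open>N is a combination of - W, bounded through the conservation law, and of Z,
      whose bound contains K N again. The factor 1 / 2 allows this term to be moved to the
      left.\<close>
    have Nb: "N t \<le> Nm"
    proof -
      have "lm * Y t = lm / l * (W t - Z t)" using par by (simp add: Z_def)
      then have "N t = (1 + lm / l) * (- W t) + lm / l * Z t" by (simp add: N_def algebra_simps)
      also have "\<dots> \<le> (1 + lm / l) * Wm + lm / l * Ps t"
        using Wb Zb par by (intro add_mono mult_left_mono) auto
      also have "lm / l * Ps t \<le> lm / l * (n0 + 1) + N t / 2"
      proof -
        have "Ps t \<le> n0 * 1 + 1 + K * N t"
          unfolding Ps_def using nep Et etb(1) sg0 mult_left_mono[of et 1 n0] by linarith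
        then have "lm / l * Ps t \<le> lm / l * (n0 + 1 + K * N t)" using par by (intro mult_left_mono) auto
        also have "\<dots> = lm / l * (n0 + 1) + lm / l * K * N t" by (simp add: distrib_left)
        also have "lm / l * K * N t \<le> 1 / 2 * N t"
        proof (rule mult_right_mono)
          have "lm / l * K \<le> lm / l * ((cg / C1 * (l / lm) / 2) * C1 / cg)"
            unfolding K_def using etb(7) par pos by (intro mult_left_mono divide_right_mono mult_right_mono) auto
          also have "\<dots> = 1 / 2" using par pos by simp
          finally show "lm / l * K \<le> 1 / 2" .
        qed (use N0[OF tT] in simp)
        finally show ?thesis by simp
      qed
      finally show ?thesis unfolding Nm_def by simp
    qed
    have Zf: "\<bar>W t - l * Y t\<bar> \<le> CZ * et"
    proof -
      have "K * N t \<le> K * Nm" using Nb K by (intro mult_left_mono) auto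
      then have "Ps t \<le> n0 * et + et + K * Nm" unfolding Ps_def using nep Et by linarith
      also have "\<dots> = CZ * et" by (simp add: CZ_def K_def algebra_simps)
      finally show ?thesis using Zb by (simp add: Z_def)
    qed
    have "lm * Y t \<le> 0" using Yn[OF tT] par by (simp add: mult_le_0_iff)
    have "- Y t \<le> N t / lm" using Wn[OF tT] par by (simp add: N_def field_simps)
    also have "\<dots> \<le> Nm / lm" using Nb par by (intro divide_right_mono) auto
    finally have Yb: "\<bar>Y t\<bar> \<le> C" using Yn[OF tT] C(2) by linarith
    have "ep * exp (cg * t) \<le> Nm / n0" using Nexp[OF tT] Nb sg0 by (simp add: field_simps)
    moreover have "(R * Q + n0) * et \<le> C * et" "R' * Q * et \<le> C * et" "CZ * et \<le> C * et"
      using C etpos by (auto intro!: mult_right_mono)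
    ultimately show ?thesis
      using Wn[OF tT] Yn[OF tT] Yn'[OF tT] Yb Wb Wv phv Zf C by auto
  qed
  show ?thesis unfolding m1_def[symmetric] m2_def[symmetric] by (intro exI[of _ cg] exI[of _ et0] exI[of _ C] conjI pos(3) et0 C(1) allI impI ballI main)
qed

section \<open>The stick phase\<close>

text \<open>Contact ends at time \<open>ta\<close>, when Yb = - d We is still negative. The motion
  is free from then on and reaches Yb = 0 only at ta + d, already with its final velocity.\<close>

definition stick_limit ::
    "real \<Rightarrow> real \<Rightarrow> real \<Rightarrow> real \<Rightarrow> real \<Rightarrow> real \<Rightarrow> (real \<Rightarrow> real) \<Rightarrow> (real \<Rightarrow> real) \<Rightarrow> bool" where
  "stick_limit S d Y1 W1 We ta Yb Wb \<longleftrightarrow>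
     0 < ta \<and> 0 < We \<and> Yb 0 = Y1 \<and> Wb 0 = W1
     \<and> (\<forall>R. continuous_on {0..R} Yb \<and> continuous_on {0..R} Wb)
     \<and> (\<forall>t\<ge>0. (Wb has_integral (Yb t - Yb 0)) {0..t}
          \<and> ((\<lambda>s. S * max (- Yb s - d * Wb s) 0) has_integral (Wb t - Wb 0)) {0..t})
     \<and> (\<forall>t. 0 \<le> t \<and> t \<le> ta \<longrightarrow> Yb t < 0)
     \<and> (\<forall>t\<ge>ta. Wb t = We \<and> Yb t = We * (t - ta - d))"

text \<open>With \<open>z = - W / Y\<close> the sticking motion obeys \<open>z' = quad S d z\<close>; it is constructed from the
  inverse of \<open>stick_clock\<close>, which treats all damping regimes alike.\<close>

lemma stick_limit_exists:
  assumes S: "0 < S" "0 < d" and l: "0 < l" and W1: "W1 < 0"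
  defines "ta \<equiv> stick_clock S d l (1 / d)"
  shows "\<exists>Yb Wb. stick_limit S d (W1 / l) W1 (- W1 / l * sqrt (quad S d (- l)) * exp (- (d * S / 2) * ta)) ta Yb Wb"
proof -
  let ?T = "stick_clock S d l" and ?I = "{- l..1 / d}"
  have ld: "- l < 1 / d" using S l by (smt (verit) divide_pos_pos)
  have Tc: "continuous_on ?I ?T" by (rule continuous_on_stick_clock[OF S])
  have Tm: "?T a < ?T b" if "- l \<le> a" "a < b" "b \<le> 1 / d" for a b
    by (rule stick_clock_strict_mono[OF S that])
  have T0: "?T (- l) = 0" by (rule stick_clock_start)
  have ta: "0 < ta" using Tm[of "- l" "1 / d"] ld T0 by (simp add: ta_def)
  \<comment> \<open>The solution of the Riccati equation, as the inverse function of its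
    clock.\<close>
  define ze where "ze = the_inv_into ?I ?T"
  have inj: "inj_on ?T ?I" by (rule linorder_inj_onI) (use Tm in \<open>auto simp: less_le\<close>)
  have img: "?T ` ?I = {0..ta}"
  proof
    show "?T ` ?I \<subseteq> {0..ta}"
    proof
      fix y assume "y \<in> ?T ` ?I"
      then obtain z where z: "z \<in> ?I" "y = ?T z" by blast
      have "?T (- l) \<le> ?T z" using Tm[of "- l" z] z by (cases "z = - l") auto
      moreover have "?T z \<le> ?T (1 / d)" using Tm[of z "1 / d"] z by (cases "z = 1 / d") auto
      ultimately show "y \<in> {0..ta}" using z T0 by (simp add: ta_def)
    qed
    show "{0..ta} \<subseteq> ?T ` ?I"
    proof
      fix y assume "y \<in> {0..ta}"
      then obtain z where "- l \<le> z" "z \<le> 1 / d" "?T z = y"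
        using IVT'[of ?T "- l" y "1 / d"] Tc ld T0 by (auto simp: ta_def)
      then show "y \<in> ?T ` ?I" by force
    qed
  qed
  have zeT: "ze (?T z) = z" if "z \<in> ?I" for z unfolding ze_def by (rule the_inv_into_f_f[OF inj that])
  have Tze: "?T (ze t) = t" and zeI: "ze t \<in> ?I" if "t \<in> {0..ta}" for t
    using that img f_the_inv_into_f[OF inj, of t] the_inv_into_into[OF inj, of t ?I] unfolding ze_def by auto
  have zec: "continuous_on {0..ta} ze"
    using continuous_on_inv[OF Tc compact_Icc, of ze] zeT img by auto
  have ze0: "ze 0 = - l" using zeT[of "- l"] T0 ld by simp
  have zeta: "ze ta = 1 / d" using zeT[of "1 / d"] ld by (simp add: ta_def)
  have zelt: "- l < ze t \<and> ze t < 1 / d" if t: "0 < t" "t < ta" for t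
  proof -
    have "ze t \<noteq> - l" "ze t \<noteq> 1 / d" using Tze[of t] T0 t by (auto simp: ta_def)
    then show ?thesis using zeI[of t] t by auto
  qed
  have Qp: "0 < quad S d z" if "z \<le> 1 / d" for z by (rule quad_pos[OF S that])
  have zed: "(ze has_real_derivative quad S d (ze t)) (at t)" if t: "0 < t" "t < ta" for t
  proof -
    have z: "ze t \<in> {- l<..<1 / d}" using zelt[OF t] by auto
    have "(?T has_real_derivative 1 / quad S d (ze t)) (at (ze t))"
      using stick_clock_deriv[OF S, of "ze t" l] z at_within_interior[of "ze t" ?I] by auto
    moreover have "isCont ze t" using zec t by (intro continuous_on_interior[of "{0..ta}"]) auto
    ultimately have "(ze has_real_derivative inverse (1 / quad S d (ze t))) (at t)"
      using Qp[of "ze t"] z Tze t by (intro DERIV_inverse_function[where a = 0 and b = ta]) auto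
    then show ?thesis by simp
  qed
  define k where "k = W1 / l * sqrt (quad S d (- l))"
  have k: "k < 0" using W1 l Qp[of "- l"] ld by (simp add: k_def mult_neg_pos divide_neg_pos)
  define We where "We = - k * exp (- (d * S / 2) * ta)"
  have We: "0 < We" using k by (simp add: We_def mult_neg_pos)
  \<comment> \<open>Along the Riccati flow (ln quad)' = 2 z - d S, so y' = - z y integrates to ln
    |y| = - (ln quad) / 2 - d S t / 2 plus a constant; \<open>k\<close> fixes the initial value W1 /
    l.\<close>
  define y where "y t = k * exp (- (d * S / 2) * t) / sqrt (quad S d (ze t))" for t
  define Yb where "Yb t = (if t \<le> ta then y t else We * (t - ta - d))" for t
  define Wb where "Wb t = (if t \<le> ta then - ze t * y t else We)" for t
  have y_alt: "y t = k * exp (- (d * S / 2) * t) * inverse (sqrt (quad S d (ze t)))" for t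
    by (simp only: y_def divide_inverse)
  have Qc: "continuous_on {0..ta} (\<lambda>t. quad S d (ze t))" unfolding quad_def by (intro continuous_intros zec)
  have yc: "continuous_on {0..ta} y" unfolding y_def
    by (intro continuous_intros Qc) (use Qp zeI in force)
  have yneg: "y t < 0" if "0 \<le> t" "t \<le> ta" for t
    unfolding y_def using k Qp[of "ze t"] zeI[of t] that by (auto intro!: divide_neg_pos mult_neg_pos)
  have yd: "(y has_real_derivative - ze t * y t) (at t)" if t: "0 < t" "t < ta" for t
  proof -
    have Q: "0 < quad S d (ze t)" using Qp zelt[OF t] by auto
    have "((\<lambda>t. quad S d (ze t)) has_real_derivative (2 * ze t - d * S) * quad S d (ze t)) (at t)"
      using DERIV_chain2[OF quad_deriv zed[OF t]] by simp
    from DERIV_inverse_fun[OF DERIV_chain2[OF DERIV_real_sqrt[OF Q] this]]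
    have "((\<lambda>t. inverse (sqrt (quad S d (ze t)))) has_real_derivative
        - (inverse (sqrt (quad S d (ze t))) / 2 * ((2 * ze t - d * S) * quad S d (ze t)) * inverse ((sqrt (quad S d (ze t)))^2))) (at t)"
      using Q by (simp add: power2_eq_square numeral_2_eq_2)
    moreover have "- (inverse (sqrt (quad S d (ze t))) / 2 * ((2 * ze t - d * S) * quad S d (ze t)) * inverse ((sqrt (quad S d (ze t)))^2))
        = - ((2 * ze t - d * S) / 2) * inverse (sqrt (quad S d (ze t)))"
    proof -
      have "- (r / 2 * (x * Q) * inverse Q) = - (x / 2) * r" if "Q \<noteq> 0" for r x Q :: real using that by (simp add: field_simps)
      then show ?thesis using Q by simp
    qed
    ultimately have i: "((\<lambda>t. inverse (sqrt (quad S d (ze t)))) has_real_derivative - ((2 * ze t - d * S) / 2) * inverse (sqrt (quad S d (ze t)))) (at t)"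
      by (simp only:)
    have "((\<lambda>t. k * exp (- (d * S / 2) * t)) has_real_derivative k * (- (d * S / 2) * exp (- (d * S / 2) * t))) (at t)"
      by (auto intro!: derivative_eq_intros)
    from DERIV_mult'[OF this i]
    have "((\<lambda>t. k * exp (- (d * S / 2) * t) * inverse (sqrt (quad S d (ze t)))) has_real_derivative
        k * (- (d * S / 2) * exp (- (d * S / 2) * t)) * inverse (sqrt (quad S d (ze t)))
        + k * exp (- (d * S / 2) * t) * (- ((2 * ze t - d * S) / 2) * inverse (sqrt (quad S d (ze t))))) (at t)"
      by (simp only: add.commute)
    moreover have "k * (- (d * S / 2) * exp (- (d * S / 2) * t)) * inverse (sqrt (quad S d (ze t)))
        + k * exp (- (d * S / 2) * t) * (- ((2 * ze t - d * S) / 2) * inverse (sqrt (quad S d (ze t)))) = - ze t * y t"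
    proof -
      have "k * (- (d * S / 2) * e) * i + k * e * (- ((2 * z - d * S) / 2) * i) = - z * (k * e * i)" for e i z :: real
        by (simp add: field_simps)
      then show ?thesis by (simp only: y_alt)
    qed
    moreover have "y = (\<lambda>t. k * exp (- (d * S / 2) * t) * inverse (sqrt (quad S d (ze t))))"
      by (rule ext) (rule y_alt)
    ultimately show ?thesis by (simp only:)
  qed
  have wd: "((\<lambda>t. - ze t * y t) has_real_derivative S * (- y t - d * (- ze t * y t))) (at t)" if t: "0 < t" "t < ta" for t
  proof -
    have "((\<lambda>t. - ze t * y t) has_real_derivative - quad S d (ze t) * y t + - ze t * (- ze t * y t)) (at t)"
      using DERIV_mult'[OF DERIV_minus[OF zed[OF t]] yd[OF t]] by (simp add: algebra_simps)
    then show ?thesis by (simp add: quad_def power2_eq_square algebra_simps)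
  qed
  have yta: "y ta = - d * We"
  proof -
    have "quad S d (1 / d) = (1 / d)^2" using S by (simp add: quad_def power2_eq_square field_simps)
    then have "sqrt (quad S d (1 / d)) = 1 / d" using S by simp
    then show ?thesis unfolding y_def zeta We_def by simp
  qed
  have contA: "continuous_on {0..R} Yb" "continuous_on {0..R} Wb" for R
  proof -
    have e: "{0..R} \<subseteq> {0..ta} \<union> {ta..max ta R}" using ta by auto
    have "continuous_on ({0..ta} \<union> {ta..max ta R}) Yb" unfolding Yb_def
      by (rule continuous_on_cases) (use yta in \<open>auto intro!: yc continuous_intros\<close>)
    then show "continuous_on {0..R} Yb" by (rule continuous_on_subset[OF _ e])
    have "continuous_on ({0..ta} \<union> {ta..max ta R}) Wb" unfolding Wb_def
      by (rule continuous_on_cases) (use yta zeta S in \<open>auto intro!: yc zec continuous_intros\<close>)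
    then show "continuous_on {0..R} Wb" by (rule continuous_on_subset[OF _ e])
  qed
  have dYW: "(Yb has_real_derivative Wb t) (at t) \<and> (Wb has_real_derivative S * max (- Yb t - d * Wb t) 0) (at t)"
    if t: "0 < t" "t \<noteq> ta" for t
  proof (cases "t < ta")
    case True
    have "0 \<le> - y t - d * (- ze t * y t)"
    proof -
      have "d * ze t \<le> 1" using zelt[OF t(1) True] S by (simp add: field_simps)
      then have "(1 - d * ze t) * y t \<le> 0" using yneg[of t] t True by (intro mult_nonneg_nonpos) auto
      then show ?thesis by (simp add: algebra_simps)
    qed
    then have m: "max (- y t - d * (- ze t * y t)) 0 = - y t - d * (- ze t * y t)" by simp
    have o: "open {0<..<ta}" "t \<in> {0<..<ta}" using t True by auto
    have "(Yb has_real_derivative - ze t * y t) (at t)"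
      by (rule has_field_derivative_transform_within_open[OF yd[OF t(1) True] o]) (auto simp: Yb_def)
    moreover have "(Wb has_real_derivative S * (- y t - d * (- ze t * y t))) (at t)"
      by (rule has_field_derivative_transform_within_open[OF wd[OF t(1) True] o]) (auto simp: Wb_def)
    moreover have "Yb t = y t" "Wb t = - ze t * y t" using True by (auto simp: Yb_def Wb_def)
    ultimately show ?thesis using m by (simp only:)
  next
    case False
    then have t': "ta < t" using t by simp
    have o: "open {ta<..}" "t \<in> {ta<..}" using t' by auto
    have "((\<lambda>t. We * (t - ta - d)) has_real_derivative We) (at t)" by (auto intro!: derivative_eq_intros)
    then have "(Yb has_real_derivative We) (at t)"
      by (rule has_field_derivative_transform_within_open[OF _ o]) (auto simp: Yb_def)
    moreover have "(Wb has_real_derivative 0) (at t)"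
      by (rule has_field_derivative_transform_within_open[OF DERIV_const o]) (auto simp: Wb_def)
    moreover have "max (- Yb t - d * Wb t) 0 = 0"
    proof -
      have "0 \<le> We * (t - ta)" using We t' by simp
      then show ?thesis using t' by (simp add: Yb_def Wb_def algebra_simps)
    qed
    moreover have "Wb t = We" using t' by (simp add: Wb_def)
    ultimately show ?thesis by simp
  qed
  have Yb0: "Yb 0 = W1 / l" "Wb 0 = W1"
    using ta ze0 l Qp[of "- l"] ld by (auto simp: Yb_def Wb_def y_def k_def)
  have "stick_limit S d (W1 / l) W1 We ta Yb Wb"
    unfolding stick_limit_def
  proof (intro conjI allI impI contA ta We Yb0)
    fix t :: real assume t: "0 \<le> t"
    show "(Wb has_integral Yb t - Yb 0) {0..t}"
      by (rule fundamental_theorem_of_calculus_interior_strong[where S = "{ta}"])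
        (use t dYW contA in \<open>auto simp: has_real_derivative_iff_has_vector_derivative\<close>)
    show "((\<lambda>s. S * max (- Yb s - d * Wb s) 0) has_integral Wb t - Wb 0) {0..t}"
      by (rule fundamental_theorem_of_calculus_interior_strong[where S = "{ta}"])
        (use t dYW contA in \<open>auto simp: has_real_derivative_iff_has_vector_derivative\<close>)
  next
    fix t assume "0 \<le> t \<and> t \<le> ta"
    then show "Yb t < 0" using yneg by (simp add: Yb_def)
  next
    fix t assume "ta \<le> t"
    then show "Wb t = We" "Yb t = We * (t - ta - d)"
      using yta zeta S by (auto simp: Wb_def Yb_def)
  qed
  then show ?thesis by (intro exI[of _ Yb] exI[of _ Wb]) (simp add: We_def k_def)
qed

lemma gronwall_integral:
  fixes u :: "real \<Rightarrow> real"
  assumes u: "continuous_on {0..T} u" and C: "0 \<le> C"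
    and le: "\<And>t. t \<in> {0..T} \<Longrightarrow> u t \<le> A + C * integral {0..t} u" and t: "t \<in> {0..T}"
  shows "u t \<le> A * exp (C * t)"
proof -
  define m where "m t = A + C * integral {0..t} u" for t
  have mc: "continuous_on {0..T} m"
    unfolding m_def by (intro continuous_intros indefinite_integral_continuous_1 integrable_continuous_real u)
  have md: "(m has_real_derivative C * u s) (at s)" if s: "0 < s" "s < T" for s
  proof -
    have "((\<lambda>t. integral {0..t} u) has_real_derivative u s) (at s within {0..T})"
      by (rule integral_has_real_derivative[OF u]) (use s in auto)
    then have "((\<lambda>t. integral {0..t} u) has_real_derivative u s) (at s)" using s by (simp add: at_within_Icc_at)
    then show ?thesis unfolding m_def[abs_def] by (auto intro!: derivative_eq_intros)
  qed
  have "exp (- (C * t)) * m t \<le> exp (- (C * 0)) * m 0"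
  proof (rule DERIV_nonpos_imp_decreasing_open[where f = "\<lambda>s. exp (- (C * s)) * m s" and a = 0 and b = t])
    show "continuous_on {0..t} (\<lambda>s. exp (- (C * s)) * m s)"
      by (intro continuous_intros continuous_on_subset[OF mc]) (use t in auto)
    fix s assume s: "0 < s" "s < t"
    then have sT: "0 < s" "s < T" using t by auto
    have "((\<lambda>s. exp (- (C * s)) * m s) has_real_derivative exp (- (C * s)) * (C * u s) + - C * exp (- (C * s)) * m s) (at s)"
      by (auto intro!: derivative_eq_intros md[OF sT])
    moreover have "exp (- (C * s)) * (C * u s) + - C * exp (- (C * s)) * m s = C * exp (- (C * s)) * (u s - m s)"
      by (simp add: algebra_simps)
    moreover have "C * exp (- (C * s)) * (u s - m s) \<le> 0"
      using le[of s] sT C by (intro mult_nonneg_nonpos) (auto simp: m_def)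
    ultimately show "\<exists>y. ((\<lambda>s. exp (- (C * s)) * m s) has_real_derivative y) (at s) \<and> y \<le> 0" by (intro exI conjI) simp_all
  qed (use t in simp)
  then have "exp (- (C * t)) * m t \<le> A" by (simp add: m_def)
  then have "exp (C * t) * (exp (- (C * t)) * m t) \<le> exp (C * t) * A" by (rule mult_left_mono) simp
  moreover have "exp (C * t) * (exp (- (C * t)) * m t) = m t" by (simp add: exp_minus)
  ultimately have "m t \<le> exp (C * t) * A" by (simp only:)
  then show ?thesis using le[OF t] by (simp add: m_def mult.commute)
qed

lemma has_integral_abs_le:
  fixes f g :: "real \<Rightarrow> real"
  assumes f: "(f has_integral i) {a..b}" and g: "continuous_on {a..b} g" and le: "\<And>x. x \<in> {a..b} \<Longrightarrow> \<bar>f x\<bar> \<le> g x"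
  shows "\<bar>i\<bar> \<le> integral {a..b} g"
  using integral_norm_bound_integral[OF has_integral_integrable[OF f] integrable_continuous_real[OF g]] le integral_unique[OF f] by auto

lemma last_zero_before:
  fixes u :: "real \<Rightarrow> real"
  assumes u: "continuous_on {0..t} u" "u 0 \<le> 0" "0 < u t" "0 \<le> t"
  shows "\<exists>r. 0 \<le> r \<and> r < t \<and> u r = 0 \<and> (\<forall>s. r < s \<and> s \<le> t \<longrightarrow> 0 < u s)"
proof -
  define Z where "Z = {s \<in> {0..t}. u s \<le> 0}"
  have "closed Z"
  proof -
    have "Z = {0..t} \<inter> u -` {..0}" by (auto simp: Z_def)
    then show ?thesis using continuous_closed_preimage[OF u(1)] by simp
  qed
  moreover have "{0..t} \<inter> Z = Z" by (auto simp: Z_def)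
  ultimately have cZ: "compact Z" using compact_Int_closed[OF compact_Icc, of Z 0 t] by simp
  have "0 \<in> Z" using u by (simp add: Z_def)
  then have "Z \<noteq> {}" by blast
  then obtain r where r: "r \<in> Z" "\<And>s. s \<in> Z \<Longrightarrow> s \<le> r"
    using continuous_attains_sup[OF cZ _ continuous_on_id] by blast
  have rt: "0 \<le> r" "r < t" using r(1) u(3) by (auto simp: Z_def less_le)
  have pos: "0 < u s" if "r < s" "s \<le> t" for s
  proof (rule ccontr)
    assume "\<not> 0 < u s"
    then have "s \<in> Z" using that rt by (simp add: Z_def)
    then show False using r(2)[of s] that by simp
  qed
  have "u r = 0"
  proof (rule ccontr)
    assume "u r \<noteq> 0"
    then have neg: "u r < 0" using r(1) by (simp add: Z_def)
    obtain s where s: "r \<le> s" "s \<le> t" "u s = 0"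
      using IVT'[of u r 0 t] neg u(3) rt continuous_on_subset[OF u(1), of "{r..t}"] by auto
    then have "r < s" using neg by (cases "r = s") auto
    then show False using pos[of s] s by simp
  qed
  then show ?thesis using rt pos by blast
qed

text \<open>P, Q and Cc contain the Filippov weight, hence integral equations instead of
  derivatives. The weight is not mentioned: only the combinations P - ka Q and Cc - kph Q, in which
  friction cancels, are close to constants, and Q has the sign that drives v back to 0.\<close>

definition stick_traj ::
    "real \<Rightarrow> real \<Rightarrow> real \<Rightarrow> real \<Rightarrow> real \<Rightarrow> real \<Rightarrow> real \<Rightarrow>
     (real \<Rightarrow> real) \<Rightarrow> (real \<Rightarrow> real) \<Rightarrow> (real \<Rightarrow> real) \<Rightarrow> (real \<Rightarrow> real) \<Rightarrow> bool" where
  "stick_traj S ka kph Sph de et T Y W ph v \<longleftrightarrow>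
    (\<exists>E be A P Q Cc. 0 \<le> T \<and> 0 \<le> E \<and> E \<le> et \<and> E * T \<le> et
     \<and> continuous_on {0..T} Y \<and> continuous_on {0..T} W \<and> continuous_on {0..T} ph \<and> continuous_on {0..T} v
     \<and> v 0 = 0
     \<and> (\<forall>r t. 0 \<le> r \<and> r \<le> t \<and> t \<le> T \<longrightarrow>
          (W has_integral (Y t - Y r)) {r..t}
          \<and> ((\<lambda>s. be s + P s * max (- Y s - de * W s) 0) has_integral (W t - W r)) {r..t}
          \<and> ((\<lambda>s. Cc s * max (- Y s - de * W s) 0) has_integral (ph t - ph r)) {r..t}
          \<and> ((\<lambda>s. A s + Q s * max (- Y s - de * W s) 0) has_integral (v t - v r)) {r..t})
     \<and> (\<forall>t. 0 \<le> t \<and> t \<le> T \<longrightarrow>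
          \<bar>P t - ka * Q t - S\<bar> \<le> et \<and> \<bar>Cc t - kph * Q t - Sph\<bar> \<le> et \<and> \<bar>be t\<bar> \<le> E \<and> \<bar>A t\<bar> \<le> E
          \<and> (0 < v t \<longrightarrow> Q t \<le> 0) \<and> (v t < 0 \<longrightarrow> 0 \<le> Q t)))"

text \<open>Two combinations are free of friction: W - ka v, which changes at the rate S F up to
  errors, and ph - kph v - (Sph / S) (W - ka v), which has no leading rate at all. As |v| \<le> et,
  replacing them by W and ph - (Sph / S) W costs O(et).\<close>

lemma stick_phase:
  fixes S ka kph Sph de K R :: real
  assumes par: "0 < S" "0 < de" "0 \<le> K" "0 \<le> R"
    and lim: "stick_limit S de Y1 W1 We ta Yb Wb"
  shows "\<exists>C>0. \<forall>et T Y W ph v. 0 \<le> et \<and> et \<le> 1 \<and> T \<le> R \<and> \<bar>Y 0 - Y1\<bar> \<le> K * et \<and> \<bar>W 0 - W1\<bar> \<le> K * et \<longrightarrow>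
    stick_traj S ka kph Sph de et T Y W ph v \<longrightarrow>
    (\<forall>t\<in>{0..T}. \<bar>v t\<bar> \<le> et \<and> \<bar>Y t - Yb t\<bar> \<le> C * et \<and> \<bar>W t - Wb t\<bar> \<le> C * et
      \<and> \<bar>ph t - ph 0 - Sph / S * (W t - W 0)\<bar> \<le> C * et)"
proof -
  define Fb where "Fb t = max (- Yb t - de * Wb t) 0" for t
  have Yb: "continuous_on {0..T} Yb" "continuous_on {0..T} Wb" for T
    using lim by (auto simp: stick_limit_def)
  have Yb0: "Yb 0 = Y1" "Wb 0 = W1" using lim by (auto simp: stick_limit_def)
  have Yi: "(Wb has_integral (Yb t - Yb 0)) {0..t}" "((\<lambda>s. S * Fb s) has_integral (Wb t - Wb 0)) {0..t}" if "0 \<le> t" for t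
    using lim that by (auto simp: stick_limit_def Fb_def)
  have Fbc: "continuous_on {0..T} Fb" for T unfolding Fb_def by (intro continuous_intros Yb)
  obtain Fm where Fm: "0 \<le> Fm" "\<And>t. t \<in> {0..R} \<Longrightarrow> Fb t \<le> Fm"
  proof -
    have "compact (Fb ` {0..R})" by (intro compact_continuous_image Fbc compact_Icc)
    then obtain M where "\<forall>x\<in>Fb ` {0..R}. norm x \<le> M" using compact_imp_bounded bounded_iff by metis
    then show ?thesis using that[of "max 0 M"] by force
  qed
  define ak where "ak = \<bar>ka\<bar>"
  define sp where "sp = \<bar>Sph / S\<bar>"
  define c1 where "c1 = ak + (1 + ak) + Fm + (1 + S) * de * ak"
  define c2 where "c2 = 1 + (1 + S) * (1 + de)"
  \<comment> \<open>The Gronwall constant over the horizon R: 2 K for the initial error, c1 for the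
    inhomogeneity, c2 for the growth rate.\<close>
  define Ce where "Ce = (2 * K + c1 * R) * exp (c2 * R)"
  define Cp where "Cp = R * ((\<bar>kph\<bar> + sp * (1 + ak)) + (1 + sp) * (Fm + (1 + de) * Ce + de * ak)) + \<bar>kph\<bar> + sp * ak"
  define C where "C = Ce + ak + Cp + 1"
  have nn: "0 \<le> ak" "0 \<le> sp" by (auto simp: ak_def sp_def)
  have c: "0 \<le> c1" "0 \<le> c2" "0 \<le> Ce"
    using nn par Fm unfolding c1_def c2_def Ce_def by (auto intro!: add_nonneg_nonneg mult_nonneg_nonneg)
  have Cp: "0 \<le> Cp" unfolding Cp_def using nn par Fm c by (intro add_nonneg_nonneg mult_nonneg_nonneg) auto
  have C: "0 < C" "Ce \<le> C" "Ce + ak \<le> C" "Cp \<le> C" using c Cp nn by (auto simp: C_def)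
  have main: "\<bar>v t\<bar> \<le> et \<and> \<bar>Y t - Yb t\<bar> \<le> C * et \<and> \<bar>W t - Wb t\<bar> \<le> C * et
      \<and> \<bar>ph t - ph 0 - Sph / S * (W t - W 0)\<bar> \<le> C * et"
    if h: "0 \<le> et \<and> et \<le> 1 \<and> T \<le> R \<and> \<bar>Y 0 - Y1\<bar> \<le> K * et \<and> \<bar>W 0 - W1\<bar> \<le> K * et"
      and traj: "stick_traj S ka kph Sph de et T Y W ph v" and t: "t \<in> {0..T}"
    for et T t :: real and Y W ph v :: "real \<Rightarrow> real"
  proof -
    define F where "F s = max (- Y s - de * W s) 0" for s
    obtain E be A P Q Cc where T: "0 \<le> T" and E: "0 \<le> E" "E \<le> et" "E * T \<le> et"
      and cont: "continuous_on {0..T} Y" "continuous_on {0..T} W" "continuous_on {0..T} ph" "continuous_on {0..T} v"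
      and v0: "v 0 = 0"
      and I: "\<And>r t. 0 \<le> r \<and> r \<le> t \<and> t \<le> T \<Longrightarrow> (W has_integral (Y t - Y r)) {r..t}
          \<and> ((\<lambda>s. be s + P s * F s) has_integral (W t - W r)) {r..t}
          \<and> ((\<lambda>s. Cc s * F s) has_integral (ph t - ph r)) {r..t}
          \<and> ((\<lambda>s. A s + Q s * F s) has_integral (v t - v r)) {r..t}"
      and B: "\<And>t. 0 \<le> t \<and> t \<le> T \<Longrightarrow> \<bar>P t - ka * Q t - S\<bar> \<le> et \<and> \<bar>Cc t - kph * Q t - Sph\<bar> \<le> et \<and> \<bar>be t\<bar> \<le> E \<and> \<bar>A t\<bar> \<le> E
          \<and> (0 < v t \<longrightarrow> Q t \<le> 0) \<and> (v t < 0 \<longrightarrow> 0 \<le> Q t)"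
      using traj unfolding stick_traj_def F_def by blast
    have F0: "0 \<le> F s" for s by (simp add: F_def)
    have Fc: "continuous_on {0..T} F" unfolding F_def by (intro continuous_intros cont)
    \<comment> \<open>Since the last zero of v the term sg Q F has been nonpositive. So sg v has
      grown by at most E T since then, and this is at most et.\<close>
    have vside: "sg * v t \<le> et" if t: "t \<in> {0..T}" and sg: "sg = 1 \<or> sg = - 1" for t sg
    proof (cases "0 < sg * v t")
      case True
      have "continuous_on {0..t} (\<lambda>s. sg * v s)"
        by (intro continuous_intros continuous_on_subset[OF cont(4)]) (use t in auto)
      then obtain r where r: "0 \<le> r" "r < t" "sg * v r = 0" "\<And>s. r < s \<and> s \<le> t \<Longrightarrow> 0 < sg * v s"
        using last_zero_before[of t "\<lambda>s. sg * v s"] True v0 t by auto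
      have vr: "v r = 0" using r(3) sg by auto
      have "((\<lambda>s. sg * (A s + Q s * F s)) has_integral sg * (v t - v r)) {r..t}"
        using I[of r t] r t by (intro has_integral_mult_right) auto
      moreover have "((\<lambda>_. E) has_integral E * (t - r)) {r..t}"
        using has_integral_const_real[of E r t] r by (simp add: mult.commute)
      moreover have "sg * (A s + Q s * F s) \<le> E" if s: "s \<in> {r..t} - {r}" for s
      proof -
        have st: "0 < sg * v s" "0 \<le> s \<and> s \<le> T" using r s t by auto
        then have "sg * Q s \<le> 0" using B[OF st(2)] sg by auto
        then have "sg * Q s * F s \<le> 0" by (rule mult_nonpos_nonneg[OF _ F0])
        moreover have "sg * A s \<le> E" using B[OF st(2)] sg by auto
        ultimately show ?thesis by (simp add: distrib_left mult.assoc)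
      qed
      \<comment> \<open>At the zero r itself the sign conditions say nothing about Q; the value at
        one point is changed without affecting the integral.\<close>
      moreover from calculation(1) have "((\<lambda>s. if s = r then E else sg * (A s + Q s * F s)) has_integral sg * (v t - v r)) {r..t}"
        by (rule has_integral_spike_finite[of "{r}", rotated 2]) auto
      moreover have "(if s = r then E else sg * (A s + Q s * F s)) \<le> E" if "s \<in> {r..t}" for s
        using calculation(3)[of s] that by simp
      ultimately have "sg * (v t - v r) \<le> E * (t - r)"
        using has_integral_le[of "\<lambda>s. if s = r then E else sg * (A s + Q s * F s)" "sg * (v t - v r)" "{r..t}" "\<lambda>_. E" "E * (t - r)"] by simp
      also have "\<dots> \<le> E * T" using E r t by (intro mult_left_mono) auto
      finally show ?thesis using E vr by simp
    qed (use h in simp)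
    have vb: "\<bar>v t\<bar> \<le> et" if "t \<in> {0..T}" for t
      using vside[OF that, of 1] vside[OF that, of "- 1"] by (simp add: abs_le_iff)
    define e where "e s = \<bar>Y s - Yb s\<bar> + \<bar>W s - ka * v s - Wb s\<bar>" for s
    have ec: "continuous_on {0..T} e" unfolding e_def by (intro continuous_intros cont Yb)
    have WW: "\<bar>W s - Wb s\<bar> \<le> \<bar>W s - ka * v s - Wb s\<bar> + ak * et" if s: "s \<in> {0..T}" for s
    proof -
      have "\<bar>W s - Wb s\<bar> \<le> \<bar>W s - ka * v s - Wb s\<bar> + \<bar>ka * v s\<bar>" by linarith
      also have "\<bar>ka * v s\<bar> \<le> ak * et" unfolding abs_mult ak_def using vb[OF s] by (intro mult_left_mono) auto
      finally show ?thesis by simp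
    qed
    have FF: "\<bar>F s - Fb s\<bar> \<le> (1 + de) * e s + de * ak * et" if s: "s \<in> {0..T}" for s
    proof -
      have "\<bar>F s - Fb s\<bar> \<le> \<bar>(- Y s - de * W s) - (- Yb s - de * Wb s)\<bar>" unfolding F_def Fb_def by linarith
      also have "(- Y s - de * W s) - (- Yb s - de * Wb s) = - (Y s - Yb s) - de * (W s - Wb s)" by (simp add: algebra_simps)
      also have "\<bar>\<dots>\<bar> \<le> \<bar>Y s - Yb s\<bar> + \<bar>de * (W s - Wb s)\<bar>" by linarith
      also have "\<bar>de * (W s - Wb s)\<bar> \<le> de * (\<bar>W s - ka * v s - Wb s\<bar> + ak * et)"
        unfolding abs_mult using WW[OF s] par by (simp add: mult_left_mono)
      finally have "\<bar>F s - Fb s\<bar> \<le> \<bar>Y s - Yb s\<bar> + de * \<bar>W s - ka * v s - Wb s\<bar> + de * ak * et" by (simp add: algebra_simps)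
      moreover have "0 \<le> de * \<bar>Y s - Yb s\<bar>" using par by simp
      ultimately show ?thesis unfolding e_def by (simp add: algebra_simps)
    qed
    have tR: "s \<in> {0..R}" if "s \<in> {0..T}" for s using that h by auto
    have Fbd: "F s \<le> Fm + ((1 + de) * e s + de * ak * et)" if s: "s \<in> {0..T}" for s
      using FF[OF s] Fm(2)[OF tR[OF s]] by linarith
    have e_le: "e t \<le> (2 * K * et + c1 * R * et) + c2 * integral {0..t} e" if t: "t \<in> {0..T}" for t
    proof -
      have sub: "continuous_on {0..t} e" by (rule continuous_on_subset[OF ec]) (use t in auto)
      have t0: "0 \<le> t" "0 \<le> t \<and> t \<le> T" using t by auto
      have iY: "((\<lambda>s. W s - Wb s) has_integral ((Y t - Y 0) - (Yb t - Yb 0))) {0..t}"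
        using I[of 0 t] Yi(1)[OF t0(1)] t by (intro has_integral_diff) auto
      have iV: "((\<lambda>s. ka * (A s + Q s * F s)) has_integral ka * (v t - v 0)) {0..t}"
        using I[of 0 t] t by (intro has_integral_mult_right) auto
      have iW: "((\<lambda>s. (be s + P s * F s) - ka * (A s + Q s * F s) - S * Fb s) has_integral
          ((W t - W 0) - ka * (v t - v 0) - (Wb t - Wb 0))) {0..t}"
        using I[of 0 t] Yi(2)[OF t0(1)] iV t by (intro has_integral_diff) auto
      have b1: "\<bar>(Y t - Y 0) - (Yb t - Yb 0)\<bar> \<le> integral {0..t} (\<lambda>s. \<bar>W s - ka * v s - Wb s\<bar> + ak * et)"
        by (rule has_integral_abs_le[OF iY])
          (use WW t in \<open>auto intro!: continuous_intros continuous_on_subset[OF cont(2)] continuous_on_subset[OF cont(4)] Yb\<close>)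
      have b2: "\<bar>(W t - W 0) - ka * (v t - v 0) - (Wb t - Wb 0)\<bar>
          \<le> integral {0..t} (\<lambda>s. (1 + ak) * et + Fm * et + (1 + S) * ((1 + de) * e s + de * ak * et))"
      proof (rule has_integral_abs_le[OF iW])
        show "continuous_on {0..t} (\<lambda>s. (1 + ak) * et + Fm * et + (1 + S) * ((1 + de) * e s + de * ak * et))"
          by (intro continuous_intros sub)
        fix s assume "s \<in> {0..t}"
        then have s: "s \<in> {0..T}" "0 \<le> s \<and> s \<le> T" using t by auto
        let ?X = "(1 + de) * e s + de * ak * et"
        have X0: "0 \<le> ?X" using FF[OF s(1)] by linarith
        have "(be s + P s * F s) - ka * (A s + Q s * F s) - S * Fb s
          = (be s - ka * A s) + ((P s - ka * Q s - S) * F s + S * (F s - Fb s))" by (simp add: algebra_simps)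
        also have "\<bar>\<dots>\<bar> \<le> (\<bar>be s\<bar> + \<bar>ka * A s\<bar>) + (\<bar>(P s - ka * Q s - S) * F s\<bar> + \<bar>S * (F s - Fb s)\<bar>)"
          by (intro order_trans[OF abs_triangle_ineq] add_mono abs_triangle_ineq4 abs_triangle_ineq)
        also have "\<dots> = (\<bar>be s\<bar> + ak * \<bar>A s\<bar>) + (\<bar>P s - ka * Q s - S\<bar> * F s + S * \<bar>F s - Fb s\<bar>)"
          using F0[of s] par by (simp add: abs_mult ak_def)
        also have "\<dots> \<le> (et + ak * et) + (et * (Fm + ?X) + S * ?X)"
          using B[OF s(2)] E h Fbd[OF s(1)] FF[OF s(1)] nn par F0[of s] by (intro add_mono mult_mono) auto
        also have "\<dots> \<le> (et + ak * et) + (et * Fm + 1 * ?X + S * ?X)"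
          using mult_right_mono[of et 1 ?X] h X0 by (simp add: distrib_left)
        also have "\<dots> = (1 + ak) * et + Fm * et + (1 + S) * ?X" by (simp add: algebra_simps)
        finally show "\<bar>(be s + P s * F s) - ka * (A s + Q s * F s) - S * Fb s\<bar> \<le> (1 + ak) * et + Fm * et + (1 + S) * ?X" .
      qed
      have i1: "(\<lambda>s. \<bar>W s - ka * v s - Wb s\<bar> + ak * et) integrable_on {0..t}"
        by (rule integrable_continuous_real)
          (use t in \<open>auto intro!: continuous_intros continuous_on_subset[OF cont(2)] continuous_on_subset[OF cont(4)] Yb\<close>)
      have i2: "(\<lambda>s. (1 + ak) * et + Fm * et + (1 + S) * ((1 + de) * e s + de * ak * et)) integrable_on {0..t}"
        by (intro integrable_continuous_real continuous_intros sub)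
      have ei: "(e has_integral integral {0..t} e) {0..t}" using sub integrable_continuous_real by blast
      have ci: "((\<lambda>_. c1 * et) has_integral c1 * et * t) {0..t}"
        using has_integral_const_real[of "c1 * et" 0 t] t0 by (simp add: mult.commute)
      have "integral {0..t} (\<lambda>s. \<bar>W s - ka * v s - Wb s\<bar> + ak * et) + integral {0..t} (\<lambda>s. (1 + ak) * et + Fm * et + (1 + S) * ((1 + de) * e s + de * ak * et))
        \<le> c1 * et * t + c2 * integral {0..t} e"
      proof (rule has_integral_le[OF has_integral_add[OF integrable_integral[OF i1] integrable_integral[OF i2]] has_integral_add[OF ci has_integral_mult_right[OF ei]]])
        fix s
        have "\<bar>W s - ka * v s - Wb s\<bar> \<le> e s" by (simp add: e_def)
        then show "\<bar>W s - ka * v s - Wb s\<bar> + ak * et + ((1 + ak) * et + Fm * et + (1 + S) * ((1 + de) * e s + de * ak * et)) \<le> c1 * et + c2 * e s"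
          unfolding c1_def c2_def by (simp add: algebra_simps)
      qed
      moreover have "c1 * et * t \<le> c1 * R * et" using c h t0 t mult_left_mono[of t R "c1 * et"] by (simp add: mult_ac)
      moreover have "\<bar>Y t - Yb t\<bar> \<le> \<bar>Y 0 - Y1\<bar> + \<bar>(Y t - Y 0) - (Yb t - Yb 0)\<bar>" unfolding Yb0 by linarith
      moreover have "\<bar>W t - ka * v t - Wb t\<bar> \<le> \<bar>W 0 - W1\<bar> + \<bar>(W t - W 0) - ka * (v t - v 0) - (Wb t - Wb 0)\<bar>" unfolding Yb0 v0 by simp
      ultimately show ?thesis using b1 b2 h unfolding e_def[of t] by linarith
    qed
    have eb: "e s \<le> Ce * et" if s: "s \<in> {0..T}" for s
    proof -
      have "e s \<le> (2 * K * et + c1 * R * et) * exp (c2 * s)" by (rule gronwall_integral[OF ec c(2) e_le s])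
      also have "\<dots> \<le> (2 * K * et + c1 * R * et) * exp (c2 * R)"
        using c par h s by (intro mult_left_mono) (auto intro!: add_nonneg_nonneg mult_nonneg_nonneg mult_left_mono)
      also have "\<dots> = Ce * et" by (simp add: Ce_def algebra_simps)
      finally show ?thesis .
    qed
    have tT: "0 \<le> t" "0 \<le> t \<and> t \<le> T" using t by auto
    have phb: "\<bar>ph t - ph 0 - Sph / S * (W t - W 0)\<bar> \<le> Cp * et"
    proof -
      define G where "G = (\<bar>kph\<bar> + sp * (1 + ak)) * et + (1 + sp) * (et * (Fm + (1 + de) * Ce + de * ak))"
      have i: "((\<lambda>s. (Cc s * F s - kph * (A s + Q s * F s)) - Sph / S * ((be s + P s * F s) - ka * (A s + Q s * F s))) has_integral
        ((ph t - ph 0 - kph * (v t - v 0)) - Sph / S * ((W t - W 0) - ka * (v t - v 0)))) {0..t}"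
        using I[of 0 t] t by (intro has_integral_diff has_integral_mult_right) auto
      have "\<bar>(ph t - ph 0 - kph * (v t - v 0)) - Sph / S * ((W t - W 0) - ka * (v t - v 0))\<bar> \<le> integral {0..t} (\<lambda>_. G)"
      proof (rule has_integral_abs_le[OF i])
        fix s assume "s \<in> {0..t}"
        then have s: "s \<in> {0..T}" "0 \<le> s \<and> s \<le> T" using t by auto
        have "F s \<le> Fm + ((1 + de) * (Ce * et) + de * ak * et)"
          using Fbd[OF s(1)] mult_left_mono[OF eb[OF s(1)], of "1 + de"] par by linarith
        also have "\<dots> \<le> Fm + ((1 + de) * (Ce * 1) + de * ak * 1)"
          using par c nn h by (intro add_left_mono add_mono mult_left_mono) auto
        finally have Fs: "F s \<le> Fm + (1 + de) * Ce + de * ak" by simp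
        \<comment> \<open>Writing Sph as (Sph / S) S cancels the leading terms and leaves
          coefficient errors times F and the small forces.\<close>
        have SS: "Sph = Sph / S * S" using par by simp
        have "(Cc s * F s - kph * (A s + Q s * F s)) - Sph / S * ((be s + P s * F s) - ka * (A s + Q s * F s))
          = (- (kph * A s) - Sph / S * (be s - ka * A s)) + ((Cc s - kph * Q s - Sph) - Sph / S * (P s - ka * Q s - S)) * F s"
          by (subst (3) SS) (simp add: algebra_simps)
        also have "\<bar>\<dots>\<bar> \<le> (\<bar>kph * A s\<bar> + \<bar>Sph / S * (be s - ka * A s)\<bar>) + (\<bar>Cc s - kph * Q s - Sph\<bar> + \<bar>Sph / S * (P s - ka * Q s - S)\<bar>) * F s"
        proof (intro order_trans[OF abs_triangle_ineq] add_mono)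
          show "\<bar>- (kph * A s) - Sph / S * (be s - ka * A s)\<bar> \<le> \<bar>kph * A s\<bar> + \<bar>Sph / S * (be s - ka * A s)\<bar>"
            using abs_triangle_ineq4[of "- (kph * A s)" "Sph / S * (be s - ka * A s)"] unfolding abs_minus_cancel .
          show "\<bar>(Cc s - kph * Q s - Sph - Sph / S * (P s - ka * Q s - S)) * F s\<bar>
              \<le> (\<bar>Cc s - kph * Q s - Sph\<bar> + \<bar>Sph / S * (P s - ka * Q s - S)\<bar>) * F s"
            unfolding abs_mult[of _ "F s"] abs_of_nonneg[OF F0] by (intro mult_right_mono abs_triangle_ineq4 F0)
        qed
        also have "\<dots> \<le> (\<bar>kph\<bar> * et + sp * (et + ak * et)) + (et + sp * et) * (Fm + (1 + de) * Ce + de * ak)"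
        proof (intro add_mono mult_mono)
          have bs: "\<bar>be s\<bar> \<le> et" "\<bar>A s\<bar> \<le> et" using B[OF s(2)] E by auto
          show "\<bar>kph * A s\<bar> \<le> \<bar>kph\<bar> * et" unfolding abs_mult using bs by (intro mult_left_mono) auto
          have "\<bar>be s - ka * A s\<bar> \<le> \<bar>be s\<bar> + ak * \<bar>A s\<bar>" using abs_triangle_ineq4[of "be s" "ka * A s"] by (simp add: abs_mult ak_def)
          also have "\<dots> \<le> et + ak * et" using bs nn by (intro add_mono mult_left_mono) auto
          finally show "\<bar>Sph / S * (be s - ka * A s)\<bar> \<le> sp * (et + ak * et)" unfolding abs_mult[of "Sph / S"] sp_def[symmetric] using nn by (intro mult_left_mono) auto
          show "\<bar>Sph / S * (P s - ka * Q s - S)\<bar> \<le> sp * et" unfolding abs_mult[of "Sph / S"] sp_def[symmetric] using nn B[OF s(2)] by (intro mult_left_mono) auto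
        qed (use B[OF s(2)] Fs F0 h nn in auto)
        also have "\<dots> = G" by (simp add: G_def algebra_simps)
        finally show "\<bar>(Cc s * F s - kph * (A s + Q s * F s)) - Sph / S * ((be s + P s * F s) - ka * (A s + Q s * F s))\<bar> \<le> G" .
      qed simp
      also have "integral {0..t} (\<lambda>_. G) = t * G" using tT by simp
      also have "\<dots> \<le> R * G" using tT h nn par Fm c unfolding G_def by (intro mult_right_mono add_nonneg_nonneg mult_nonneg_nonneg) auto
      finally have 1: "\<bar>(ph t - ph 0 - kph * v t) - Sph / S * ((W t - W 0) - ka * v t)\<bar> \<le> R * G" by (simp add: v0)
      have "ph t - ph 0 - Sph / S * (W t - W 0) = ((ph t - ph 0 - kph * v t) - Sph / S * ((W t - W 0) - ka * v t)) + (kph * v t - Sph / S * (ka * v t))"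
        by (simp add: right_diff_distrib)
      also have "\<bar>\<dots>\<bar> \<le> R * G + (\<bar>kph\<bar> * et + sp * (ak * et))"
      proof (intro order_trans[OF abs_triangle_ineq] add_mono 1 order_trans[OF abs_triangle_ineq4])
        show "\<bar>kph * v t\<bar> \<le> \<bar>kph\<bar> * et" unfolding abs_mult using vb[OF t] by (intro mult_left_mono) auto
        show "\<bar>Sph / S * (ka * v t)\<bar> \<le> sp * (ak * et)"
          unfolding abs_mult[of "Sph / S"] abs_mult[of ka] sp_def[symmetric] ak_def[symmetric] using vb[OF t] nn by (intro mult_left_mono) auto
      qed
      also have "\<dots> = Cp * et" by (simp add: G_def Cp_def algebra_simps)
      finally show ?thesis .
    qed
    have "\<bar>Y t - Yb t\<bar> \<le> Ce * et" "\<bar>W t - ka * v t - Wb t\<bar> \<le> Ce * et" using eb[OF t] unfolding e_def by linarith+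
    moreover from this have "\<bar>W t - Wb t\<bar> \<le> (Ce + ak) * et" using WW[OF t] by (simp add: distrib_right)
    moreover have "Ce * et \<le> C * et" "(Ce + ak) * et \<le> C * et" "Cp * et \<le> C * et" using C h by (auto intro!: mult_right_mono)
    ultimately show ?thesis using vb[OF t] phb by linarith
  qed
  show ?thesis by (intro exI[of _ C] conjI[OF C(1)] allI impI ballI main)
qed

section \<open>The truncated system\<close>

lemma of_eqs:
  "y_of = fst" "w_of = (\<lambda>x. fst (snd x))" "theta_of = (\<lambda>x. fst (snd (snd x)))"
  "phi_of = (\<lambda>x. fst (snd (snd (snd x))))" "v_of = (\<lambda>x. snd (snd (snd (snd x))))"
  by (auto simp: fun_eq_iff)

lemma bounded_linear_of:
  "bounded_linear y_of" "bounded_linear w_of" "bounded_linear theta_of" "bounded_linear phi_of" "bounded_linear v_of"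
  unfolding of_eqs by (intro bounded_linear_fst bounded_linear_snd bounded_linear_compose[OF bounded_linear_fst]
      bounded_linear_compose[OF bounded_linear_snd])+

lemmas continuous_on_of [continuous_intros] =
  bounded_linear_of[THEN bounded_linear.continuous_on]

definition contact :: "real \<Rightarrow> real \<Rightarrow> state \<Rightarrow> real" where
  "contact de ep x = max (- (1 / ep) * y_of x - de * w_of x) 0"

text \<open>Where w < 0 the bracket drops from - delta w to 0 as y becomes positive, while
  \<open>contact\<close> is continuous. On admissible states the two agree, since for y > 0 and w
  \<ge> 0 both vanish; the orbits considered are shown not to leave this set.\<close>

definition admissible :: "state \<Rightarrow> bool" where
  "admissible x \<longleftrightarrow> y_of x \<le> 0 \<or> 0 \<le> w_of x"

definition in_box :: "real \<Rightarrow> real \<Rightarrow> real \<Rightarrow> real \<Rightarrow> real \<Rightarrow> real \<Rightarrow> state \<Rightarrow> bool" where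
  "in_box de ep ph0 M0 M1 M2 x \<longleftrightarrow> \<bar>phi_of x - ph0\<bar> \<le> M0 \<and> \<bar>w_of x\<bar> \<le> M1 \<and> contact de ep x \<le> M2"

definition bound_p :: "real \<Rightarrow> real \<Rightarrow> real" where
  "bound_p al mu = 1 + al + mu * al"

text \<open>Solutions of the given system and of a truncated, bounded system: the differential inclusion is only
  required while the state stays in the box.\<close>

definition local_solution ::
    "real \<Rightarrow> real \<Rightarrow> real \<Rightarrow> real \<Rightarrow> real \<Rightarrow> real \<Rightarrow> real \<Rightarrow> real \<Rightarrow> state \<Rightarrow> real \<Rightarrow> (real \<Rightarrow> state) \<Rightarrow> bool" where
  "local_solution al mu de ep ph0 M0 M1 M2 x0 L x \<longleftrightarrow> x 0 = x0 \<and>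
    (\<exists>g. g absolutely_integrable_on {0..L} \<and> (\<forall>t\<in>{0..L}. x t = x 0 + integral {0..t} g)
      \<and> negligible {t\<in>{0..L}. in_box de ep ph0 M0 M1 M2 (x t) \<and>
          \<not> (y_of (g t) = w_of (x t)
             \<and> coef_b (theta_of (x t)) (phi_of (x t)) - bound_p al mu * ((1 / ep) * contact de ep (x t)) \<le> w_of (g t)
             \<and> (admissible (x t) \<longrightarrow>
                 g t \<in> filippov_set v_of (vfield al mu de ep 1) (vfield al mu de ep (-1)) (x t)))})"

lemma contact_nonneg: "0 \<le> contact de ep x"
  by (simp add: contact_def)

lemma F_N_eq_contact:
  assumes "0 < ep" "0 < de" "admissible x"
  shows "F_N ep de (y_of x) (w_of x) = (1 / ep) * contact de ep x"
proof (cases "0 < y_of x")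
  case True
  then have "0 \<le> w_of x" using assms by (auto simp: admissible_def)
  have "- (1 / ep) * y_of x - de * w_of x \<le> 0"
  proof -
    have "0 \<le> de * w_of x" "0 \<le> (1 / ep) * y_of x" using True assms \<open>0 \<le> w_of x\<close> by simp_all
    then show ?thesis by linarith
  qed
  then show ?thesis using True by (simp add: F_N_def bracket_def contact_def)
qed (simp add: F_N_def bracket_def contact_def)

lemma F_N_bounds:
  assumes "0 < ep"
  shows "0 \<le> F_N ep de (y_of x) (w_of x) \<and> F_N ep de (y_of x) (w_of x) \<le> (1 / ep) * contact de ep x"
  using assms by (auto simp: F_N_def bracket_def contact_def intro!: divide_right_mono)

lemma vfield_eq:
  "vfield al mu de ep s x = (w_of x,
     coef_b (theta_of x) (phi_of x) + coef_p al mu s (theta_of x) * F_N ep de (y_of x) (w_of x),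
     phi_of x, coef_c al mu s (theta_of x) * F_N ep de (y_of x) (w_of x),
     coef_a (theta_of x) (phi_of x) + coef_q al mu s (theta_of x) * F_N ep de (y_of x) (w_of x))"
  by (cases x) auto

text \<open>The coefficients are affine in the sign s, so the convex combination with weight u is
  the field with s = 1 - 2 u. The Filippov inclusion thus becomes an equation with an unknown weight
  in [-1, 1].\<close>

lemma vfield_segment:
  assumes "g \<in> filippov_set v_of (vfield al mu de ep 1) (vfield al mu de ep (-1)) x"
  shows "\<exists>s. \<bar>s\<bar> \<le> 1 \<and> (0 < v_of x \<longrightarrow> s = 1) \<and> (v_of x < 0 \<longrightarrow> s = - 1) \<and> g = vfield al mu de ep s x"
proof -
  have seg: "\<exists>s. \<bar>s\<bar> \<le> 1 \<and> g = vfield al mu de ep s x"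
    if "g \<in> closed_segment (vfield al mu de ep 1 x) (vfield al mu de ep (-1) x)"
  proof -
    obtain u where u: "0 \<le> u" "u \<le> 1" "g = (1 - u) *\<^sub>R vfield al mu de ep 1 x + u *\<^sub>R vfield al mu de ep (-1) x"
      using \<open>g \<in> closed_segment _ _\<close> unfolding closed_segment_def by blast
    have "g = vfield al mu de ep (1 - 2 * u) x"
      unfolding u(3) vfield_eq by (simp add: coef_p_def coef_q_def coef_c_def algebra_simps)
    moreover have "\<bar>1 - 2 * u\<bar> \<le> 1" using u by (simp add: abs_le_iff)
    ultimately show ?thesis by blast
  qed
  show ?thesis
  proof (cases "v_of x = 0")
    case True
    then show ?thesis using seg assms by (auto simp: filippov_set_def)
  next
    case False
    then show ?thesis using assms
      by (intro exI[of _ "if 0 < v_of x then 1 else - 1"]) (auto simp: filippov_set_def)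
  qed
qed

lemma abs_coef_p_le:
  assumes "0 < al" "0 < mu" "\<bar>s\<bar> \<le> 1"
  shows "\<bar>coef_p al mu s th\<bar> \<le> bound_p al mu"
proof -
  have "al * (cos th)^2 \<le> al" using assms by (simp add: abs_square_le_1)
  moreover have "0 \<le> al * (cos th)^2" using assms by simp
  moreover have "\<bar>s * mu * al * sin th * cos th\<bar> \<le> 1 * mu * al * 1 * 1"
    unfolding abs_mult using assms by (intro mult_mono) auto
  ultimately show ?thesis unfolding coef_p_def bound_p_def by linarith
qed

text \<open>The local notion is weaker, so estimates proved for it hold for arbitrary forward
  solutions. The lower bound on w' survives off the admissible set because F_N never exceeds contact
  / epsilon.\<close>

lemma forward_imp_local_solution:
  assumes par: "0 < al" "0 < mu" "0 < de" "0 < ep" and sol: "forward_solution al mu de ep x0 L x"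
  shows "local_solution al mu de ep ph0 M0 M1 M2 x0 L x"
proof -
  obtain g where g: "g absolutely_integrable_on {0..L}" "\<forall>t\<in>{0..L}. x t = x 0 + integral {0..t} g"
    and neg: "negligible {t \<in> {0..L}. g t \<notin> filippov_set v_of (vfield al mu de ep 1) (vfield al mu de ep (-1)) (x t)}"
    using sol unfolding forward_solution_def filippov_solution_def by blast
  have *: "y_of (g t) = w_of (x t)
       \<and> coef_b (theta_of (x t)) (phi_of (x t)) - bound_p al mu * ((1 / ep) * contact de ep (x t)) \<le> w_of (g t)"
    if gt: "g t \<in> filippov_set v_of (vfield al mu de ep 1) (vfield al mu de ep (-1)) (x t)" for t
  proof -
    obtain s where s: "\<bar>s\<bar> \<le> 1" "g t = vfield al mu de ep s (x t)" using vfield_segment[OF gt] by blast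
    let ?F = "F_N ep de (y_of (x t)) (w_of (x t))"
    have "- (coef_p al mu s (theta_of (x t)) * ?F) \<le> bound_p al mu * ((1 / ep) * contact de ep (x t))"
    proof -
      have "- coef_p al mu s (theta_of (x t)) * ?F \<le> bound_p al mu * ?F"
        using abs_coef_p_le[OF par(1,2) s(1), of "theta_of (x t)"] F_N_bounds[OF par(4), of de "x t"]
        by (intro mult_right_mono) auto
      also have "\<dots> \<le> bound_p al mu * ((1 / ep) * contact de ep (x t))"
        using F_N_bounds[OF par(4), of de "x t"] par by (intro mult_left_mono) (auto simp: bound_p_def)
      finally show ?thesis by simp
    qed
    then show ?thesis unfolding s(2) vfield_eq by simp
  qed
  have "negligible {t\<in>{0..L}. in_box de ep ph0 M0 M1 M2 (x t) \<and>
          \<not> (y_of (g t) = w_of (x t)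
             \<and> coef_b (theta_of (x t)) (phi_of (x t)) - bound_p al mu * ((1 / ep) * contact de ep (x t)) \<le> w_of (g t)
             \<and> (admissible (x t) \<longrightarrow>
                 g t \<in> filippov_set v_of (vfield al mu de ep 1) (vfield al mu de ep (-1)) (x t)))}"
    by (rule negligible_subset[OF neg]) (use * in blast)
  then show ?thesis using g sol unfolding local_solution_def forward_solution_def by blast
qed

lemma local_imp_forward_solution:
  assumes sol: "local_solution al mu de ep ph0 M0 M1 M2 x0 L x"
    and V: "\<And>t. t \<in> {0..L} \<Longrightarrow> in_box de ep ph0 M0 M1 M2 (x t) \<and> admissible (x t)"
  shows "forward_solution al mu de ep x0 L x"
proof -
  obtain g where x0: "x 0 = x0" and g: "g absolutely_integrable_on {0..L}" "\<forall>t\<in>{0..L}. x t = x 0 + integral {0..t} g"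
    and neg: "negligible {t\<in>{0..L}. in_box de ep ph0 M0 M1 M2 (x t) \<and>
          \<not> (y_of (g t) = w_of (x t)
             \<and> coef_b (theta_of (x t)) (phi_of (x t)) - bound_p al mu * ((1 / ep) * contact de ep (x t)) \<le> w_of (g t)
             \<and> (admissible (x t) \<longrightarrow>
                 g t \<in> filippov_set v_of (vfield al mu de ep 1) (vfield al mu de ep (-1)) (x t)))}"
    using sol unfolding local_solution_def by blast
  have "negligible {t \<in> {0..L}. g t \<notin> filippov_set v_of (vfield al mu de ep 1) (vfield al mu de ep (-1)) (x t)}"
    by (rule negligible_subset[OF neg]) (use V in blast)
  then show ?thesis using g x0 unfolding forward_solution_def filippov_solution_def by blast
qed

section \<open>The truncated vector field\<close>

definition clip :: "real \<Rightarrow> real \<Rightarrow> real" where "clip M a = max (- M) (min M a)"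

lemma clip_bounds: "0 \<le> M \<Longrightarrow> \<bar>clip M a\<bar> \<le> M" by (auto simp: clip_def)

lemma clip_id: "\<bar>a\<bar> \<le> M \<Longrightarrow> clip M a = a" by (auto simp: clip_def)

lemma continuous_on_clip [continuous_intros]: "continuous_on A f \<Longrightarrow> continuous_on A (\<lambda>x. clip M (f x))"
  unfolding clip_def by (intro continuous_intros)

text \<open>The part of the field that switches with the sign of \<open>v\<close> is a nonnegative multiple of the vector
  \<open>friction_dir \<theta>\<close>, whose \<open>v\<close>-component is \<open>1\<close>.\<close>

definition friction_dir :: "real \<Rightarrow> real \<Rightarrow> state" where
  "friction_dir al th = (0, al * sin th * cos th / (1 + al * (sin th)^2), 0, - (al * sin th) / (1 + al * (sin th)^2), 1)"

definition trunc_contact :: "real \<Rightarrow> real \<Rightarrow> real \<Rightarrow> state \<Rightarrow> real" where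
  "trunc_contact de ep M2 x = (1 / ep) * min M2 (contact de ep x)"

definition trunc_field :: "real \<Rightarrow> real \<Rightarrow> real \<Rightarrow> real \<Rightarrow> real \<Rightarrow> real \<Rightarrow> real \<Rightarrow> state \<Rightarrow> state" where
  "trunc_field al de ep ph0 M0 M1 M2 x =
     (clip M1 (w_of x),
      coef_b (theta_of x) (ph0 + clip M0 (phi_of x - ph0)) + (1 + al * (cos (theta_of x))^2) * trunc_contact de ep M2 x,
      ph0 + clip M0 (phi_of x - ph0),
      - (al * cos (theta_of x)) * trunc_contact de ep M2 x,
      coef_a (theta_of x) (ph0 + clip M0 (phi_of x - ph0)) + al * sin (theta_of x) * cos (theta_of x) * trunc_contact de ep M2 x)"

definition trunc_friction :: "real \<Rightarrow> real \<Rightarrow> real \<Rightarrow> real \<Rightarrow> real \<Rightarrow> state \<Rightarrow> real" where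
  "trunc_friction al mu de ep M2 x = mu * (1 + al * (sin (theta_of x))^2) * trunc_contact de ep M2 x"

lemma norm_state_le:
  fixes a b c d e :: real
  shows "norm (a, b, c, d, e) \<le> \<bar>a\<bar> + (\<bar>b\<bar> + (\<bar>c\<bar> + (\<bar>d\<bar> + \<bar>e\<bar>)))"
  using norm_Pair_le[of a "(b, c, d, e)"] norm_Pair_le[of b "(c, d, e)"] norm_Pair_le[of c "(d, e)"] norm_Pair_le[of d e]
  by simp

text \<open>Inside the box clips and minimum are inactive. The s-dependent part of (p, c, q) is - s
  mu (1 + al sin^2) times the corresponding components of \<open>friction_dir\<close>, which is how
  that direction was chosen.\<close>

lemma trunc_field_eq:
  assumes par: "0 < al" "0 < mu" "0 < de" "0 < ep" and box: "in_box de ep ph0 M0 M1 M2 x" and s: "s = 1 \<or> s = - 1"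
  shows "trunc_field al de ep ph0 M0 M1 M2 x - (s * trunc_friction al mu de ep M2 x) *\<^sub>R friction_dir al (theta_of x)
    = (w_of x, coef_b (theta_of x) (phi_of x) + coef_p al mu s (theta_of x) * ((1 / ep) * contact de ep x), phi_of x,
       coef_c al mu s (theta_of x) * ((1 / ep) * contact de ep x),
       coef_a (theta_of x) (phi_of x) + coef_q al mu s (theta_of x) * ((1 / ep) * contact de ep x))"
proof -
  define F where "F = (1 / ep) * contact de ep x"
  define B where "B = 1 + al * (sin (theta_of x))^2"
  have t: "trunc_contact de ep M2 x = F" using box by (simp add: trunc_contact_def in_box_def F_def min_def)
  have B: "B \<noteq> 0" using one_plus_pos[OF par(1), of "theta_of x"] by (simp add: B_def)
  have h: "s * (mu * B * F) * (z / B) = s * mu * F * z" for z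
    using B by simp
  have cl: "clip M1 (w_of x) = w_of x" "ph0 + clip M0 (phi_of x - ph0) = phi_of x"
    using box by (simp_all add: in_box_def clip_id)
  have c: "coef_p al mu s a * F = (1 + al * (cos a)^2) * F - s * mu * F * (al * sin a * cos a)"
    "coef_c al mu s a * F = - (al * cos a) * F - s * mu * F * - (al * sin a)"
    "coef_q al mu s a * F = al * sin a * cos a * F - s * (mu * (1 + al * (sin a)^2) * F) * 1" for a
    unfolding coef_p_def coef_q_def coef_c_def by algebra+
  show ?thesis
    unfolding trunc_field_def trunc_friction_def friction_dir_def t F_def[symmetric] cl c B_def[symmetric]
      scaleR_Pair real_scaleR_def h minus_prod_def
    by simp
qed

lemma friction_dir_has_derivative:
  assumes "0 < al"
  shows "\<exists>n'. (\<forall>a. (friction_dir al has_vector_derivative n' a) (at a)) \<and> continuous_on UNIV n'"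
proof -
  define B where "B a = 1 + al * (sin a)^2" for a
  have B: "B a \<noteq> 0" for a using one_plus_pos[OF assms, of a] by (simp add: B_def)
  have B': "(B has_real_derivative al * (2 * sin a * cos a)) (at a)" for a
    unfolding B_def[abs_def] by (auto intro!: derivative_eq_intros)
  have 1: "((\<lambda>a. al * sin a * cos a / B a) has_real_derivative
      ((al * cos a * cos a - al * sin a * sin a) * B a - al * sin a * cos a * (al * (2 * sin a * cos a))) / (B a * B a)) (at a)" for a
    using B by (auto intro!: derivative_eq_intros B')
  have 2: "((\<lambda>a. - (al * sin a) / B a) has_real_derivative
      (- (al * cos a) * B a - - (al * sin a) * (al * (2 * sin a * cos a))) / (B a * B a)) (at a)" for a
    by (rule DERIV_divide[OF _ B' B]) (auto intro!: derivative_eq_intros)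
  define n' where "n' a = ((0::real), ((al * cos a * cos a - al * sin a * sin a) * B a - al * sin a * cos a * (al * (2 * sin a * cos a))) / (B a * B a),
      (0::real), (- (al * cos a) * B a - - (al * sin a) * (al * (2 * sin a * cos a))) / (B a * B a), (0::real))" for a
  have "(friction_dir al has_vector_derivative n' a) (at a)" for a
    unfolding friction_dir_def[abs_def] n'_def B_def[symmetric]
    using 1[of a] 2[of a]
    by (intro has_vector_derivative_Pair has_vector_derivative_const) (simp_all add: has_real_derivative_iff_has_vector_derivative)
  moreover have "continuous_on UNIV n'" unfolding n'_def
    using B by (intro continuous_intros) (auto simp: B_def intro!: continuous_intros)
  ultimately show ?thesis by blast
qed

lemma local_solution_exists:
  assumes par: "0 < al" "0 < mu" "0 < de" "0 < ep" and M: "0 \<le> M0" "0 \<le> M1" "0 \<le> M2" and L: "0 \<le> L"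
  shows "\<exists>x. local_solution al mu de ep ph0 M0 M1 M2 x0 L x"
proof -
  obtain n' where n': "\<And>a. (friction_dir al has_vector_derivative n' a) (at a)" "continuous_on UNIV n'"
    using friction_dir_has_derivative[OF par(1)] by blast
  let ?f0 = "trunc_field al de ep ph0 M0 M1 M2" and ?h = "trunc_friction al mu de ep M2"
  define Fm where "Fm = (1 / ep) * M2"
  define Ph where "Ph = \<bar>ph0\<bar> + M0"
  \<comment> \<open>The sum of crude bounds for the field, the size of the jump and its direction,
    so that each of them lies below one constant.\<close>
  define C where "C = (M1 + ((1 + Ph^2 + (1 + al) * Fm) + (Ph + (al * Fm + (Ph^2 + al * Fm))))) + mu * (1 + al) * Fm + (al + (al + 1))"
  have Fm: "0 \<le> Fm" using M par by (simp add: Fm_def)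
  have tc: "0 \<le> trunc_contact de ep M2 x \<and> trunc_contact de ep M2 x \<le> Fm" for x
    using par M contact_nonneg[of de ep x] by (auto simp: trunc_contact_def Fm_def intro!: divide_right_mono)
  have tcc: "continuous_on UNIV (trunc_contact de ep M2)"
    unfolding trunc_contact_def[abs_def] contact_def[abs_def] by (intro continuous_intros)
  have sc: "0 \<le> (sin a)^2 \<and> (sin a)^2 \<le> 1" "0 \<le> (cos a)^2 \<and> (cos a)^2 \<le> 1" "\<bar>sin a\<bar> \<le> 1" "\<bar>cos a\<bar> \<le> 1" for a :: real
    by (simp_all add: abs_square_le_1)
  have Cp: "0 \<le> mu * (1 + al) * Fm" "0 \<le> Ph" using par Fm M by (auto simp: Ph_def)
  have C1: "M1 + ((1 + Ph^2 + (1 + al) * Fm) + (Ph + (al * Fm + (Ph^2 + al * Fm)))) \<le> C"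
    and C2: "mu * (1 + al) * Fm \<le> C" and C3: "al + (al + 1) \<le> C"
    unfolding C_def using Cp par Fm M by (auto intro!: add_nonneg_nonneg mult_nonneg_nonneg)
  interpret friction_field ?f0 ?h "friction_dir al" n' v_of theta_of C
  proof (rule friction_field.intro)
    show "continuous_on UNIV ?f0"
      unfolding trunc_field_def[abs_def] coef_a_def coef_b_def
      by (intro continuous_intros continuous_on_compose2[OF tcc]) auto
    show "continuous_on UNIV ?h"
      unfolding trunc_friction_def[abs_def] by (intro continuous_intros continuous_on_compose2[OF tcc]) auto
    show "(friction_dir al has_vector_derivative n' a) (at a)" for a by (rule n')
    show "continuous_on UNIV n'" by (rule n')
    show "bounded_linear v_of" "bounded_linear theta_of" by (simp_all add: bounded_linear_of)
    show "v_of (friction_dir al a) = 1" "theta_of (friction_dir al a) = 0" for a by (simp_all add: friction_dir_def)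
    show "0 \<le> ?h z" for z unfolding trunc_friction_def using par tc by (intro mult_nonneg_nonneg) auto
    show "?h z \<le> C" for z
    proof -
      have "1 + al * (sin (theta_of z))^2 \<le> 1 + al" using sc(1)[of "theta_of z"] par by (simp add: mult_left_le)
      then have "?h z \<le> mu * (1 + al) * Fm"
        unfolding trunc_friction_def using par tc[of z] by (intro mult_mono mult_left_mono) (auto intro!: add_nonneg_nonneg)
      then show ?thesis using C2 by linarith
    qed
    show "norm (friction_dir al a) \<le> C" for a
    proof -
      let ?B = "1 + al * (sin a)^2"
      have B: "1 \<le> ?B" using par sc(1)[of a] by simp
      have q: "\<bar>x / ?B\<bar> \<le> al" if "\<bar>x\<bar> \<le> al" for x
      proof -
        have "\<bar>x\<bar> \<le> al * ?B" using that mult_left_mono[OF B, of al] par by linarith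
        then show ?thesis using B by (simp add: abs_divide divide_le_eq)
      qed
      have "\<bar>al * sin a * cos a\<bar> \<le> al * 1 * 1" unfolding abs_mult using par sc by (intro mult_mono) auto
      moreover have "\<bar>- (al * sin a)\<bar> \<le> al * 1" unfolding abs_minus_cancel abs_mult using par sc by (intro mult_mono) auto
      ultimately show ?thesis
        unfolding friction_dir_def using q[of "al * sin a * cos a"] q[of "- (al * sin a)"] C3
        by (intro order_trans[OF norm_state_le]) simp
    qed
    show "norm (?f0 z) \<le> C" for z
    proof -
      let ?p = "ph0 + clip M0 (phi_of z - ph0)" and ?t = "theta_of z" and ?F = "trunc_contact de ep M2 z"
      have p: "\<bar>?p\<bar> \<le> Ph" using clip_bounds[OF M(1), of "phi_of z - ph0"] unfolding Ph_def by linarith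
      then have p2: "\<bar>?p\<bar>^2 \<le> Ph^2" by (intro power_mono) auto
      have "\<bar>coef_b ?t ?p\<bar> \<le> 1 + Ph^2"
      proof -
        have "\<bar>?p^2 * sin ?t\<bar> \<le> Ph^2 * 1" unfolding abs_mult using p2 sc by (intro mult_mono) auto
        then show ?thesis unfolding coef_b_def by linarith
      qed
      moreover have "\<bar>coef_a ?t ?p\<bar> \<le> Ph^2"
      proof -
        have "\<bar>?p^2 * cos ?t\<bar> \<le> Ph^2 * 1" unfolding abs_mult using p2 sc by (intro mult_mono) auto
        then show ?thesis unfolding coef_a_def by simp
      qed
      moreover have "\<bar>(1 + al * (cos ?t)^2) * ?F\<bar> \<le> (1 + al) * Fm"
      proof -
        have "\<bar>1 + al * (cos ?t)^2\<bar> \<le> 1 + al" using sc(2)[of ?t] par by (simp add: mult_left_le)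
        then show ?thesis unfolding abs_mult[of _ ?F] using tc[of z] par by (intro mult_mono) auto
      qed
      moreover have "\<bar>- (al * cos ?t) * ?F\<bar> \<le> (al * 1) * Fm"
        unfolding abs_mult abs_minus_cancel using tc[of z] par sc by (intro mult_mono) auto
      moreover have "\<bar>al * sin ?t * cos ?t * ?F\<bar> \<le> (al * 1 * 1) * Fm"
        unfolding abs_mult using tc[of z] par sc by (intro mult_mono mult_nonneg_nonneg) auto
      moreover note clip_bounds[OF M(2), of "w_of z"] p
      ultimately have "\<bar>clip M1 (w_of z)\<bar> + (\<bar>coef_b ?t ?p + (1 + al * (cos ?t)^2) * ?F\<bar> + (\<bar>?p\<bar> + (\<bar>- (al * cos ?t) * ?F\<bar>
          + \<bar>coef_a ?t ?p + al * sin ?t * cos ?t * ?F\<bar>))) \<le> C"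
        using C1 abs_triangle_ineq[of "coef_b ?t ?p" "(1 + al * (cos ?t)^2) * ?F"]
          abs_triangle_ineq[of "coef_a ?t ?p" "al * sin ?t * cos ?t * ?F"] unfolding mult_1_right by linarith
      then show ?thesis unfolding trunc_field_def by (rule order_trans[OF norm_state_le])
    qed
  qed
  obtain x where x: "x 0 = x0"
    "filippov_solution v_of (\<lambda>z. ?f0 z - ?h z *\<^sub>R friction_dir al (theta_of z)) (\<lambda>z. ?f0 z + ?h z *\<^sub>R friction_dir al (theta_of z)) L x"
    using filippov_existence[OF L] by blast
  then obtain g where g: "g absolutely_integrable_on {0..L}" "\<forall>t\<in>{0..L}. x t = x 0 + integral {0..t} g"
    and neg: "negligible {t \<in> {0..L}. g t \<notin> filippov_set v_of (\<lambda>z. ?f0 z - ?h z *\<^sub>R friction_dir al (theta_of z)) (\<lambda>z. ?f0 z + ?h z *\<^sub>R friction_dir al (theta_of z)) (x t)}"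
    unfolding filippov_solution_def by blast
  have *: "y_of u = w_of z
             \<and> coef_b (theta_of z) (phi_of z) - bound_p al mu * ((1 / ep) * contact de ep z) \<le> w_of u
             \<and> (admissible z \<longrightarrow>
                 u \<in> filippov_set v_of (vfield al mu de ep 1) (vfield al mu de ep (-1)) z)"
    if box: "in_box de ep ph0 M0 M1 M2 z"
      and u: "u \<in> filippov_set v_of (\<lambda>z. ?f0 z - ?h z *\<^sub>R friction_dir al (theta_of z)) (\<lambda>z. ?f0 z + ?h z *\<^sub>R friction_dir al (theta_of z)) z"
    for u z
  proof -
    define X where "X s = (w_of z, coef_b (theta_of z) (phi_of z) + coef_p al mu s (theta_of z) * ((1 / ep) * contact de ep z), phi_of z,
       coef_c al mu s (theta_of z) * ((1 / ep) * contact de ep z),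
       coef_a (theta_of z) (phi_of z) + coef_q al mu s (theta_of z) * ((1 / ep) * contact de ep z))" for s
    have e: "?f0 z - ?h z *\<^sub>R friction_dir al (theta_of z) = X 1" "?f0 z + ?h z *\<^sub>R friction_dir al (theta_of z) = X (- 1)"
      using trunc_field_eq[OF par box, of 1] trunc_field_eq[OF par box, of "- 1"] by (simp_all add: X_def)
    have u': "u \<in> (if v_of z > 0 then {X 1} else if v_of z < 0 then {X (- 1)} else closed_segment (X 1) (X (- 1)))"
      using u unfolding filippov_set_def e .
    then have uc: "u \<in> closed_segment (X 1) (X (- 1))" by (auto split: if_splits)
    obtain r where r: "0 \<le> r" "r \<le> 1" "u = (1 - r) *\<^sub>R X 1 + r *\<^sub>R X (- 1)"
      using uc unfolding closed_segment_def by blast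
    have "u = X (1 - 2 * r)"
    proof -
      define F where "F = (1 / ep) * contact de ep z"
      show ?thesis
        unfolding r(3) X_def F_def[symmetric] by (simp add: coef_p_def coef_q_def coef_c_def algebra_simps)
    qed
    then have y: "y_of u = w_of z" and w: "w_of u = coef_b (theta_of z) (phi_of z) + coef_p al mu (1 - 2 * r) (theta_of z) * ((1 / ep) * contact de ep z)"
      by (simp_all add: X_def)
    have "- coef_p al mu (1 - 2 * r) (theta_of z) * ((1 / ep) * contact de ep z) \<le> bound_p al mu * ((1 / ep) * contact de ep z)"
      using abs_coef_p_le[OF par(1,2), of "1 - 2 * r" "theta_of z"] r par contact_nonneg[of de ep z]
      by (intro mult_right_mono) (auto simp: abs_le_iff)
    moreover have "u \<in> filippov_set v_of (vfield al mu de ep 1) (vfield al mu de ep (-1)) z" if adm: "admissible z"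
    proof -
      have "vfield al mu de ep s z = X s" for s
        unfolding X_def vfield_eq F_N_eq_contact[OF par(4,3) adm] ..
      then show ?thesis using u' unfolding filippov_set_def by (simp only:)
    qed
    ultimately show ?thesis using y w by simp
  qed
  have "negligible {t\<in>{0..L}. in_box de ep ph0 M0 M1 M2 (x t) \<and>
          \<not> (y_of (g t) = w_of (x t)
             \<and> coef_b (theta_of (x t)) (phi_of (x t)) - bound_p al mu * ((1 / ep) * contact de ep (x t)) \<le> w_of (g t)
             \<and> (admissible (x t) \<longrightarrow>
                 g t \<in> filippov_set v_of (vfield al mu de ep 1) (vfield al mu de ep (-1)) (x t)))}"
    by (rule negligible_subset[OF neg]) (use * in blast)
  then show ?thesis using g x(1) unfolding local_solution_def by blast
qed

section \<open>The system in fast time\<close>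

lemma has_integral_affine_real:
  fixes f :: "real \<Rightarrow> real"
  assumes "(f has_integral i) {m * a + c..m * b + c}" "0 < m"
  shows "((\<lambda>x. f (m * x + c)) has_integral i / m) {a..b}"
proof -
  have e: "(m * x + c - c) /\<^sub>R m = x" for x using assms(2) by simp
  show ?thesis
    using has_integral_affinity'[of f i "m * a + c" "m * b + c" m c] assms unfolding e
    by (simp add: divide_inverse mult.commute)
qed

definition scaled_contact :: "real \<Rightarrow> (real \<Rightarrow> real) \<Rightarrow> (real \<Rightarrow> real) \<Rightarrow> real \<Rightarrow> real" where
  "scaled_contact de Y W t = max (- Y t - de * W t) 0"

text \<open>The system in the fast time \<open>t / \<epsilon>\<close>, with \<open>Y = y / \<epsilon>\<close>; \<open>s\<close> is the weight of the Filippov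
  combination.\<close>

definition rescaled ::
    "real \<Rightarrow> real \<Rightarrow> real \<Rightarrow> real \<Rightarrow> real \<Rightarrow> (real \<Rightarrow> real) \<Rightarrow> (real \<Rightarrow> real) \<Rightarrow> (real \<Rightarrow> real) \<Rightarrow> (real \<Rightarrow> real) \<Rightarrow>
     (real \<Rightarrow> real) \<Rightarrow> (real \<Rightarrow> real) \<Rightarrow> bool" where
  "rescaled al mu de ep La Y W th ph v s \<longleftrightarrow>
     continuous_on {0..La} Y \<and> continuous_on {0..La} W \<and> continuous_on {0..La} th \<and> continuous_on {0..La} ph
     \<and> continuous_on {0..La} v
     \<and> (\<forall>t\<in>{0..La}. \<bar>s t\<bar> \<le> 1 \<and> (0 < v t \<longrightarrow> s t = 1) \<and> (v t < 0 \<longrightarrow> s t = - 1))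
     \<and> (\<forall>r t. 0 \<le> r \<longrightarrow> r \<le> t \<longrightarrow> t \<le> La \<longrightarrow>
          (W has_integral (Y t - Y r)) {r..t}
          \<and> ((\<lambda>u. ep * coef_b (th u) (ph u) + coef_p al mu (s u) (th u) * scaled_contact de Y W u) has_integral (W t - W r)) {r..t}
          \<and> ((\<lambda>u. ep * ph u) has_integral (th t - th r)) {r..t}
          \<and> ((\<lambda>u. coef_c al mu (s u) (th u) * scaled_contact de Y W u) has_integral (ph t - ph r)) {r..t}
          \<and> ((\<lambda>u. ep * coef_a (th u) (ph u) + coef_q al mu (s u) (th u) * scaled_contact de Y W u) has_integral (v t - v r)) {r..t})"

lemma continuous_on_indefinite:
  fixes g :: "real \<Rightarrow> 'a::euclidean_space"
  assumes "g absolutely_integrable_on {0..L}" "\<forall>t\<in>{0..L}. x t = x 0 + integral {0..t} g"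
  shows "continuous_on {0..L} x"
proof -
  have "g integrable_on {0..L}" using assms(1) set_lebesgue_integral_eq_integral(1) by blast
  then have "continuous_on {0..L} (\<lambda>t. x 0 + integral {0..t} g)"
    by (intro continuous_intros indefinite_integral_continuous_1)
  then show ?thesis by (rule continuous_on_eq) (rule assms(2)[rule_format, symmetric])
qed

lemma local_solution_continuous:
  "local_solution al mu de ep ph0 M0 M1 M2 x0 L x \<Longrightarrow> continuous_on {0..L} x"
  unfolding local_solution_def by (elim conjE exE) (rule continuous_on_indefinite)

lemma rescaled_local_solution:
  assumes sol: "local_solution al mu de ep ph0 M0 M1 M2 x0 L x" and par: "0 < ep" "0 < de" and sg: "0 \<le> sg" "sg \<le> L"
    and V: "\<And>t. t \<in> {0..sg} \<Longrightarrow> in_box de ep ph0 M0 M1 M2 (x t) \<and> admissible (x t)"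
  shows "\<exists>s. rescaled al mu de ep (sg / ep) (\<lambda>t. y_of (x (ep * t)) / ep) (\<lambda>t. w_of (x (ep * t)))
     (\<lambda>t. theta_of (x (ep * t))) (\<lambda>t. phi_of (x (ep * t))) (\<lambda>t. v_of (x (ep * t))) s"
proof -
  let ?S = "\<lambda>z. filippov_set v_of (vfield al mu de ep 1) (vfield al mu de ep (-1)) z"
  obtain g where g: "g absolutely_integrable_on {0..L}" "\<forall>t\<in>{0..L}. x t = x 0 + integral {0..t} g"
    and neg: "negligible {t\<in>{0..L}. in_box de ep ph0 M0 M1 M2 (x t) \<and>
          \<not> (y_of (g t) = w_of (x t)
             \<and> coef_b (theta_of (x t)) (phi_of (x t)) - bound_p al mu * ((1 / ep) * contact de ep (x t)) \<le> w_of (g t)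
             \<and> (admissible (x t) \<longrightarrow> g t \<in> ?S (x t)))}" (is "negligible ?N")
    using sol unfolding local_solution_def by blast
  have gi: "g integrable_on {0..L}" using g(1) set_lebesgue_integral_eq_integral(1) by blast
  have "\<exists>s. \<bar>s\<bar> \<le> 1 \<and> (0 < v_of (x t) \<longrightarrow> s = 1) \<and> (v_of (x t) < 0 \<longrightarrow> s = - 1)
      \<and> (g t \<in> ?S (x t) \<longrightarrow> g t = vfield al mu de ep s (x t))" for t
  proof (cases "g t \<in> ?S (x t)")
    case False
    \<comment> \<open>On the exceptional set any weight compatible with the sign of v will do, so
      the sign conditions hold at every time and not only almost everywhere.\<close>
    then show ?thesis by (intro exI[of _ "if 0 < v_of (x t) then 1 else - 1"]) auto
  qed (use vfield_segment in blast)
  then obtain s where s: "\<And>t. \<bar>s t\<bar> \<le> 1 \<and> (0 < v_of (x t) \<longrightarrow> s t = 1) \<and> (v_of (x t) < 0 \<longrightarrow> s t = - 1)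
      \<and> (g t \<in> ?S (x t) \<longrightarrow> g t = vfield al mu de ep (s t) (x t))" by metis
  have *: "((\<lambda>u. vfield al mu de ep (s u) (x u)) has_integral (x t - x r)) {r..t}" if "0 \<le> r" "r \<le> t" "t \<le> sg" for r t
  proof (rule has_integral_spike[OF neg])
    show "(g has_integral (x t - x r)) {r..t}"
      by (rule has_integral_increment[OF gi g(2)[rule_format] that(1,2) order_trans[OF that(3) sg(2)]])
    fix u assume "u \<in> {r..t} - ?N"
    then have "g u \<in> ?S (x u)" using that V[of u] sg by auto
    then show "vfield al mu de ep (s u) (x u) = g u" using s[of u] by simp
  qed
  define F where "F u = (1 / ep) * max (- (1 / ep) * y_of (x u) - de * w_of (x u)) 0" for u
  have F: "F_N ep de (y_of (x u)) (w_of (x u)) = F u" if "u \<in> {0..sg}" for u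
    using F_N_eq_contact[OF par(1,2), of "x u"] V[OF that] unfolding F_def contact_def by simp
  let ?th = "\<lambda>u. theta_of (x u)" and ?ph = "\<lambda>u. phi_of (x u)"
  have int: "((\<lambda>u. w_of (x u)) has_integral y_of (x t) - y_of (x r)) {r..t}"
    "((\<lambda>u. coef_b (?th u) (?ph u) + coef_p al mu (s u) (?th u) * F u) has_integral w_of (x t) - w_of (x r)) {r..t}"
    "((\<lambda>u. ?ph u) has_integral ?th t - ?th r) {r..t}"
    "((\<lambda>u. coef_c al mu (s u) (?th u) * F u) has_integral ?ph t - ?ph r) {r..t}"
    "((\<lambda>u. coef_a (?th u) (?ph u) + coef_q al mu (s u) (?th u) * F u) has_integral v_of (x t) - v_of (x r)) {r..t}"
    if "0 \<le> r" "r \<le> t" "t \<le> sg" for r t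
  proof -
    have h: "((\<lambda>u. f (vfield al mu de ep (s u) (x u))) has_integral f (x t) - f (x r)) {r..t}"
      if "bounded_linear f" for f :: "state \<Rightarrow> real"
      using has_integral_linear[OF *[OF \<open>0 \<le> r\<close> \<open>r \<le> t\<close> \<open>t \<le> sg\<close>] that] that
      by (simp add: o_def bounded_linear.linear linear_diff)
    have e: "F_N ep de (y_of (x u)) (w_of (x u)) = F u" if "u \<in> {r..t}" for u
      using F[of u] that \<open>0 \<le> r\<close> \<open>t \<le> sg\<close> by auto
    show "((\<lambda>u. w_of (x u)) has_integral y_of (x t) - y_of (x r)) {r..t}"
      using h[OF bounded_linear_of(1)] unfolding vfield_eq by simp
    show "((\<lambda>u. coef_b (?th u) (?ph u) + coef_p al mu (s u) (?th u) * F u) has_integral w_of (x t) - w_of (x r)) {r..t}"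
      by (rule has_integral_eq[OF _ h[OF bounded_linear_of(2)]]) (simp add: vfield_eq e)
    show "((\<lambda>u. ?ph u) has_integral ?th t - ?th r) {r..t}"
      using h[OF bounded_linear_of(3)] unfolding vfield_eq by simp
    show "((\<lambda>u. coef_c al mu (s u) (?th u) * F u) has_integral ?ph t - ?ph r) {r..t}"
      by (rule has_integral_eq[OF _ h[OF bounded_linear_of(4)]]) (simp add: vfield_eq e)
    show "((\<lambda>u. coef_a (?th u) (?ph u) + coef_q al mu (s u) (?th u) * F u) has_integral v_of (x t) - v_of (x r)) {r..t}"
      by (rule has_integral_eq[OF _ h[OF bounded_linear_of(5)]]) (simp add: vfield_eq e)
  qed
  let ?Y = "\<lambda>t. y_of (x (ep * t)) / ep" and ?W = "\<lambda>t. w_of (x (ep * t))"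
  have F': "scaled_contact de ?Y ?W u = ep * F (ep * u)" for u
    using par by (simp add: scaled_contact_def F_def)
  have sc: "((\<lambda>u. ep * f (ep * u)) has_integral i) {r..t}" if "(f has_integral i) {ep * r..ep * t}" for f :: "real \<Rightarrow> real" and i r t
    using has_integral_mult_right[OF has_integral_affine_real[of f i ep r 0 t], of ep] that par by simp
  have ran: "0 \<le> ep * r" "ep * r \<le> ep * t" "ep * t \<le> sg" if "0 \<le> r" "r \<le> t" "t \<le> sg / ep" for r t
    using that par by (simp_all add: pos_le_divide_eq mult.commute)
  have cx: "continuous_on {0..sg / ep} (\<lambda>t. x (ep * t))"
    by (rule continuous_on_compose2[OF local_solution_continuous[OF sol]])
      (use sg par in \<open>auto intro!: continuous_intros simp: pos_le_divide_eq mult.commute\<close>)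
  show ?thesis unfolding rescaled_def
  proof (intro exI[of _ "\<lambda>t. s (ep * t)"] conjI allI impI ballI)
    fix r t assume rt: "0 \<le> r" "r \<le> t" "t \<le> sg / ep"
    note I = int[OF ran[OF rt]]
    show "(?W has_integral (?Y t - ?Y r)) {r..t}"
      using has_integral_affine_real[of "\<lambda>u. w_of (x u)" "y_of (x (ep * t)) - y_of (x (ep * r))" ep r 0 t] I(1) par(1)
      unfolding diff_divide_distrib[symmetric] by simp
    show "((\<lambda>u. ep * coef_b (?th (ep * u)) (?ph (ep * u)) + coef_p al mu (s (ep * u)) (?th (ep * u)) * scaled_contact de ?Y ?W u)
        has_integral (?W t - ?W r)) {r..t}"
      using sc[OF I(2)] unfolding F' by (simp add: algebra_simps)
    show "((\<lambda>u. ep * ?ph (ep * u)) has_integral (?th (ep * t) - ?th (ep * r))) {r..t}"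
      using sc[OF I(3)] .
    show "((\<lambda>u. coef_c al mu (s (ep * u)) (?th (ep * u)) * scaled_contact de ?Y ?W u)
        has_integral (?ph (ep * t) - ?ph (ep * r))) {r..t}"
      using sc[OF I(4)] unfolding F' by (simp add: algebra_simps)
    show "((\<lambda>u. ep * coef_a (?th (ep * u)) (?ph (ep * u)) + coef_q al mu (s (ep * u)) (?th (ep * u)) * scaled_contact de ?Y ?W u)
        has_integral (v_of (x (ep * t)) - v_of (x (ep * r)))) {r..t}"
      using sc[OF I(5)] unfolding F' by (simp add: algebra_simps)
  next
    show "continuous_on {0..sg / ep} ?Y" by (intro continuous_intros cx) (use par in auto)
  next
    fix t show "\<bar>s (ep * t)\<bar> \<le> 1" "0 < v_of (x (ep * t)) \<Longrightarrow> s (ep * t) = 1" "v_of (x (ep * t)) < 0 \<Longrightarrow> s (ep * t) = - 1"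
      using s by blast+
  qed (intro continuous_intros cx)+
qed

section \<open>Continuation inside the box\<close>

lemma positive_right_neighbourhood:
  fixes f :: "real \<Rightarrow> real"
  assumes f: "continuous_on {0..L} f" and t: "0 \<le> t" "t < L" "0 < f t"
  shows "\<exists>e>0. \<forall>s. t \<le> s \<and> s < t + e \<and> s \<le> L \<longrightarrow> 0 < f s"
proof -
  obtain d where d: "0 < d" "\<And>s. s \<in> {0..L} \<Longrightarrow> dist s t < d \<Longrightarrow> dist (f s) (f t) < f t"
    using f t unfolding continuous_on_iff by (metis atLeastAtMost_iff less_imp_le)
  show ?thesis
  proof (intro exI[of _ d] conjI allI impI)
    fix s assume "t \<le> s \<and> s < t + d \<and> s \<le> L"
    then have "dist (f s) (f t) < f t" using t by (intro d(2)) (auto simp: dist_real_def)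
    then show "0 < f s" by (auto simp: dist_real_def)
  qed (rule d)
qed

definition strictly_in_box :: "real \<Rightarrow> real \<Rightarrow> real \<Rightarrow> real \<Rightarrow> real \<Rightarrow> real \<Rightarrow> state \<Rightarrow> bool" where
  "strictly_in_box de ep ph0 M0 M1 M2 x \<longleftrightarrow> \<bar>phi_of x - ph0\<bar> < M0 \<and> \<bar>w_of x\<bar> < M1 \<and> contact de ep x < M2"

text \<open>The alternatives are the ways in which admissibility persists for a short time. In the
  last one, rest on y = 0, it is the positive coefficient b that pushes w upwards.\<close>

definition outgoing :: "state \<Rightarrow> bool" where
  "outgoing x \<longleftrightarrow> y_of x < 0 \<or> 0 < w_of x \<or> (y_of x \<le> 0 \<and> w_of x < 0)
     \<or> (y_of x = 0 \<and> w_of x = 0 \<and> 0 < coef_b (theta_of x) (phi_of x))"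

lemma continuous_on_contact [continuous_intros]:
  "continuous_on A f \<Longrightarrow> continuous_on A (\<lambda>t. contact de ep (f t))"
  unfolding contact_def by (intro continuous_intros)

text \<open>Just after t admissibility is not known yet, so the true field cannot be used. The last
  two cases rely on what \<open>local_solution\<close> demands in the whole box: y' = w keeps y
  nonpositive in the third, and the lower bound on w' keeps w nonnegative in the fourth.\<close>

lemma local_solution_extends:
  assumes sol: "local_solution al mu de ep ph0 M0 M1 M2 x0 L x" and t: "0 \<le> t" "t < L"
    and st: "strictly_in_box de ep ph0 M0 M1 M2 (x t)" "outgoing (x t)"
  shows "\<exists>e>0. \<forall>s. t < s \<and> s < t + e \<and> s \<le> L \<longrightarrow> in_box de ep ph0 M0 M1 M2 (x s) \<and> admissible (x s)"
proof -
  obtain g where g: "g absolutely_integrable_on {0..L}" "\<forall>t\<in>{0..L}. x t = x 0 + integral {0..t} g"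
    and neg: "negligible {t\<in>{0..L}. in_box de ep ph0 M0 M1 M2 (x t) \<and>
          \<not> (y_of (g t) = w_of (x t)
             \<and> coef_b (theta_of (x t)) (phi_of (x t)) - bound_p al mu * ((1 / ep) * contact de ep (x t)) \<le> w_of (g t)
             \<and> (admissible (x t) \<longrightarrow> g t \<in> filippov_set v_of (vfield al mu de ep 1) (vfield al mu de ep (-1)) (x t)))}"
    (is "negligible ?N")
    using sol unfolding local_solution_def by blast
  have gi: "g integrable_on {0..L}" using g(1) set_lebesgue_integral_eq_integral(1) by blast
  note cx = local_solution_continuous[OF sol]
  have inc: "(g has_integral (x u - x r)) {r..u}" if "0 \<le> r" "r \<le> u" "u \<le> L" for r u
    by (rule has_integral_increment[OF gi g(2)[rule_format] that])
  note near = positive_right_neighbourhood[OF _ t]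
  have "\<exists>e>0. \<forall>s. t \<le> s \<and> s < t + e \<and> s \<le> L \<longrightarrow>
      0 < min (M0 - \<bar>phi_of (x s) - ph0\<bar>) (min (M1 - \<bar>w_of (x s)\<bar>) (M2 - contact de ep (x s)))"
  proof (rule near)
    show "0 < min (M0 - \<bar>phi_of (x t) - ph0\<bar>) (min (M1 - \<bar>w_of (x t)\<bar>) (M2 - contact de ep (x t)))"
      using st(1) by (simp add: strictly_in_box_def)
  qed (intro continuous_intros cx)
  then obtain e1 where e1: "0 < e1" and e1': "\<And>s. t \<le> s \<and> s < t + e1 \<and> s \<le> L \<Longrightarrow>
      0 < min (M0 - \<bar>phi_of (x s) - ph0\<bar>) (min (M1 - \<bar>w_of (x s)\<bar>) (M2 - contact de ep (x s)))" by blast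
  have box: "in_box de ep ph0 M0 M1 M2 (x s)" if "t \<le> s" "s < t + e1" "s \<le> L" for s
    using e1'[of s] that by (simp add: in_box_def)
  have fin: ?thesis if "0 < e2" "\<And>s. t < s \<Longrightarrow> s < t + e1 \<Longrightarrow> s < t + e2 \<Longrightarrow> s \<le> L \<Longrightarrow> admissible (x s)" for e2
    using that box e1 by (intro exI[of _ "min e1 e2"]) auto
  have cf: "continuous_on {0..L} (\<lambda>s. y_of (x s))" "continuous_on {0..L} (\<lambda>s. w_of (x s))"
    by (intro continuous_intros cx)+
  consider "y_of (x t) < 0" | "0 < w_of (x t)" | "y_of (x t) \<le> 0" "w_of (x t) < 0"
    | "y_of (x t) = 0" "w_of (x t) = 0" "0 < coef_b (theta_of (x t)) (phi_of (x t))"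
    using st(2) unfolding outgoing_def by blast
  then show ?thesis
  proof cases
    case 1
    then obtain e2 where "0 < e2" "\<forall>s. t \<le> s \<and> s < t + e2 \<and> s \<le> L \<longrightarrow> 0 < - y_of (x s)"
      using near[OF continuous_on_minus[OF cf(1)]] by auto
    then show ?thesis by (intro fin[of e2]) (auto simp: admissible_def intro!: less_imp_le)
  next
    case 2
    then obtain e2 where "0 < e2" "\<forall>s. t \<le> s \<and> s < t + e2 \<and> s \<le> L \<longrightarrow> 0 < w_of (x s)"
      using near[OF cf(2)] by auto
    then show ?thesis by (intro fin[of e2]) (auto simp: admissible_def intro!: less_imp_le)
  next
    case 3
    then obtain e2 where e2: "0 < e2" "\<forall>s. t \<le> s \<and> s < t + e2 \<and> s \<le> L \<longrightarrow> 0 < - w_of (x s)"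
      using near[OF continuous_on_minus[OF cf(2)]] by auto
    show ?thesis
    proof (rule fin[OF e2(1)])
      fix s assume s: "t < s" "s < t + e1" "s < t + e2" "s \<le> L"
      have "((\<lambda>u. y_of (g u)) has_integral y_of (x s) - y_of (x t)) {t..s}"
        using has_integral_linear[OF inc[of t s] bounded_linear_of(1)] s t
        by (simp add: o_def bounded_linear_of bounded_linear.linear linear_diff)
      then have "((\<lambda>u. w_of (x u)) has_integral y_of (x s) - y_of (x t)) {t..s}"
        by (rule has_integral_spike[OF neg, rotated]) (use box s t in auto)
      moreover have "w_of (x u) \<le> 0" if "u \<in> {t..s}" for u using e2(2)[rule_format, of u] s that by auto
      ultimately have "y_of (x s) - y_of (x t) \<le> 0"
        using has_integral_le[OF _ has_integral_0] by blast
      then show "admissible (x s)" using 3 by (auto simp: admissible_def)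
    qed
  next
    case 4
    let ?f = "\<lambda>s. coef_b (theta_of (x s)) (phi_of (x s)) - bound_p al mu * ((1 / ep) * contact de ep (x s))"
    have "\<exists>e>0. \<forall>s. t \<le> s \<and> s < t + e \<and> s \<le> L \<longrightarrow> 0 < ?f s"
    proof (rule near)
      show "0 < ?f t" using 4 by (simp add: contact_def)
    qed (unfold coef_b_def, intro continuous_intros cx)
    then obtain e2 where e2: "0 < e2" "\<forall>s. t \<le> s \<and> s < t + e2 \<and> s \<le> L \<longrightarrow> 0 < ?f s" by blast
    show ?thesis
    proof (rule fin[OF e2(1)])
      fix s assume s: "t < s" "s < t + e1" "s < t + e2" "s \<le> L"
      have "((\<lambda>u. w_of (g u)) has_integral w_of (x s) - w_of (x t)) {t..s}"
        using has_integral_linear[OF inc[of t s] bounded_linear_of(2)] s t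
        by (simp add: o_def bounded_linear_of bounded_linear.linear linear_diff)
      then have "((\<lambda>u. max 0 (w_of (g u))) has_integral w_of (x s) - w_of (x t)) {t..s}"
      proof (rule has_integral_spike[OF neg, rotated])
        fix u assume u: "u \<in> {t..s} - ?N"
        then have "0 < ?f u" "?f u \<le> w_of (g u)" using e2(2)[rule_format, of u] s box[of u] t by auto
        then show "max 0 (w_of (g u)) = w_of (g u)" by simp
      qed
      then have "0 \<le> w_of (x s) - w_of (x t)" by (rule has_integral_nonneg) simp
      then show "admissible (x s)" using 4 by (auto simp: admissible_def)
    qed
  qed
qed

text \<open>Continuity gives closedness and \<open>local_solution_extends\<close> openness to the
  right. The assumption \<open>inv\<close> upgrades weak bounds to strict ones, which resolves the
  circularity between the box and the estimates made in it.\<close>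

lemma local_solution_stays_in_box:
  assumes sol: "local_solution al mu de ep ph0 M0 M1 M2 x0 L x"
    and x0: "in_box de ep ph0 M0 M1 M2 x0" "admissible x0"
    and inv: "\<And>sg. 0 \<le> sg \<Longrightarrow> sg \<le> L \<Longrightarrow> (\<And>t. t \<in> {0..sg} \<Longrightarrow> in_box de ep ph0 M0 M1 M2 (x t) \<and> admissible (x t)) \<Longrightarrow>
        strictly_in_box de ep ph0 M0 M1 M2 (x sg) \<and> outgoing (x sg)"
    and t: "t \<in> {0..L}"
  shows "in_box de ep ph0 M0 M1 M2 (x t) \<and> admissible (x t)"
proof (rule interval_continuation[where P = "\<lambda>t. in_box de ep ph0 M0 M1 M2 (x t) \<and> admissible (x t)" and T = L])
  have "x 0 = x0" using sol by (simp add: local_solution_def)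
  then show "in_box de ep ph0 M0 M1 M2 (x 0) \<and> admissible (x 0)" using x0 by simp
next
  fix t assume t: "0 < t" "t \<le> L" and P: "\<And>s. 0 \<le> s \<Longrightarrow> s < t \<Longrightarrow> in_box de ep ph0 M0 M1 M2 (x s) \<and> admissible (x s)"
  \<comment> \<open>One continuous function whose nonpositivity encodes all conditions; min y (- w)
    \<le> 0 is the disjunction in \<open>admissible\<close>.\<close>
  define h where "h s = max (max (\<bar>phi_of (x s) - ph0\<bar> - M0) (\<bar>w_of (x s)\<bar> - M1)) (max (contact de ep (x s) - M2) (min (y_of (x s)) (- w_of (x s))))" for s
  have hP: "h s \<le> 0 \<longleftrightarrow> in_box de ep ph0 M0 M1 M2 (x s) \<and> admissible (x s)" for s
    unfolding h_def in_box_def admissible_def by (auto simp: min_le_iff_disj)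
  have "continuous_on {0..t} h"
    unfolding h_def by (intro continuous_intros continuous_on_subset[OF local_solution_continuous[OF sol]]) (use t in auto)
  then have "(h \<longlongrightarrow> h t) (at_left t)"
    using continuous_on_Icc_at_leftD t(1) by blast
  moreover have "eventually (\<lambda>s. h s \<le> 0) (at_left t)"
    using eventually_at_left_real[OF t(1)] by eventually_elim (use P hP in auto)
  ultimately have "h t \<le> 0" by (rule tendsto_upperbound) simp
  then show "in_box de ep ph0 M0 M1 M2 (x t) \<and> admissible (x t)" using hP by blast
next
  fix t assume "0 \<le> t" "t < L" and P: "\<And>s. 0 \<le> s \<Longrightarrow> s \<le> t \<Longrightarrow> in_box de ep ph0 M0 M1 M2 (x s) \<and> admissible (x s)"
  then show "\<exists>e>0. \<forall>s. t < s \<and> s < t + e \<and> s \<le> L \<longrightarrow> in_box de ep ph0 M0 M1 M2 (x s) \<and> admissible (x s)"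
    using inv[of t] by (intro local_solution_extends[OF sol]) auto
qed (use t in auto)

lemma rescaled_int:
  assumes "rescaled al mu de ep La Y W th ph v s" "0 \<le> r" "r \<le> t" "t \<le> La"
  shows "(W has_integral (Y t - Y r)) {r..t}"
    and "((\<lambda>u. ep * coef_b (th u) (ph u) + coef_p al mu (s u) (th u) * scaled_contact de Y W u) has_integral (W t - W r)) {r..t}"
    and "((\<lambda>u. ep * ph u) has_integral (th t - th r)) {r..t}"
    and "((\<lambda>u. coef_c al mu (s u) (th u) * scaled_contact de Y W u) has_integral (ph t - ph r)) {r..t}"
    and "((\<lambda>u. ep * coef_a (th u) (ph u) + coef_q al mu (s u) (th u) * scaled_contact de Y W u) has_integral (v t - v r)) {r..t}"
  using assms unfolding rescaled_def by blast+

lemma rescaled_cont: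
  assumes "rescaled al mu de ep La Y W th ph v s"
  shows "continuous_on {0..La} Y" "continuous_on {0..La} W" "continuous_on {0..La} th" "continuous_on {0..La} ph"
    "continuous_on {0..La} v"
  using assms unfolding rescaled_def by blast+

lemma rescaled_sign:
  assumes "rescaled al mu de ep La Y W th ph v s" "0 \<le> t" "t \<le> La"
  shows "\<bar>s t\<bar> \<le> 1" "0 < v t \<Longrightarrow> s t = 1" "v t < 0 \<Longrightarrow> s t = - 1"
  using assms unfolding rescaled_def by auto

lemma scaled_contact_nonneg: "0 \<le> scaled_contact de Y W t"
  by (simp add: scaled_contact_def)

lemma scaled_contact_le:
  assumes "\<bar>Y t\<bar> \<le> a" "\<bar>W t\<bar> \<le> b" "0 \<le> de"
  shows "scaled_contact de Y W t \<le> a + de * b"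
proof -
  have "- W t \<le> b" "0 \<le> b" using assms by auto
  then have "de * (- W t) \<le> de * b" "0 \<le> de * b" using assms by (intro mult_left_mono mult_nonneg_nonneg; simp)+
  moreover have "- Y t \<le> a" "0 \<le> a" using assms by auto
  ultimately show ?thesis unfolding scaled_contact_def by simp
qed

lemma has_derivative_of_increments:
  fixes f X :: "real \<Rightarrow> real"
  assumes int: "\<And>r t. 0 \<le> r \<Longrightarrow> r \<le> t \<Longrightarrow> t < T \<Longrightarrow> (f has_integral (X t - X r)) {r..t}"
    and f: "continuous_on {0<..<T} f" and t: "0 < t" "t < T"
  shows "(X has_real_derivative f t) (at t)"
proof -
  define a b where "a = t / 2" and "b = (t + T) / 2"
  have ab: "0 < a" "a < t" "t < b" "b < T" using t by (auto simp: a_def b_def)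
  have "((\<lambda>u. integral {a..u} f) has_real_derivative f t) (at t within {a..b})"
    by (rule integral_has_real_derivative) (use ab in \<open>auto intro: continuous_on_subset[OF f]\<close>)
  then have "((\<lambda>u. X a + integral {a..u} f) has_real_derivative f t) (at t within {a..b})"
    by (auto intro!: derivative_eq_intros)
  then have "((\<lambda>u. X a + integral {a..u} f) has_real_derivative f t) (at t within {a<..<b})"
    by (rule DERIV_subset) auto
  then have "((\<lambda>u. X a + integral {a..u} f) has_real_derivative f t) (at t)"
    using ab at_within_open[of t "{a<..<b}"] by simp
  then show ?thesis
  proof (rule has_field_derivative_transform_within_open[of _ _ _ "{a<..<b}"])
    fix u assume u: "u \<in> {a<..<b}"
    then have "integral {a..u} f = X u - X a" using ab by (intro integral_unique int) auto
    then show "X a + integral {a..u} f = X u" by simp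
  qed (use ab in auto)
qed

lemma rescaled_shift:
  assumes R: "rescaled al mu de ep La Y W th ph v s" and d: "0 \<le> d" "d \<le> La"
  shows "rescaled al mu de ep (La - d) (\<lambda>t. Y (t + d)) (\<lambda>t. W (t + d)) (\<lambda>t. th (t + d)) (\<lambda>t. ph (t + d)) (\<lambda>t. v (t + d)) (\<lambda>t. s (t + d))"
proof -
  have sh: "((\<lambda>u. f (u + d)) has_integral i) {r..t}" if "(f has_integral i) {r + d..t + d}" for f :: "real \<Rightarrow> real" and i r t
    using has_integral_affine_real[of f i 1 r d t] that by simp
  have co: "continuous_on {0..La - d} (\<lambda>t. f (t + d))" if "continuous_on {0..La} f" for f :: "real \<Rightarrow> real"
    by (rule continuous_on_compose2[OF that]) (use d in \<open>auto intro!: continuous_intros\<close>)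
  have sc: "scaled_contact de (\<lambda>t. Y (t + d)) (\<lambda>t. W (t + d)) u = scaled_contact de Y W (u + d)" for u
    by (simp add: scaled_contact_def)
  show ?thesis unfolding rescaled_def sc
  proof (intro conjI allI impI ballI)
    fix r t assume rt: "0 \<le> r" "r \<le> t" "t \<le> La - d"
    then have "0 \<le> r + d" "r + d \<le> t + d" "t + d \<le> La" using d by auto
    note I = rescaled_int[OF R this]
    show "((\<lambda>t. W (t + d)) has_integral (Y (t + d) - Y (r + d))) {r..t}" by (rule sh[OF I(1)])
    show "((\<lambda>u. ep * coef_b (th (u + d)) (ph (u + d)) + coef_p al mu (s (u + d)) (th (u + d)) * scaled_contact de Y W (u + d))
        has_integral (W (t + d) - W (r + d))) {r..t}" by (rule sh[OF I(2)])
    show "((\<lambda>u. ep * ph (u + d)) has_integral (th (t + d) - th (r + d))) {r..t}" by (rule sh[OF I(3)])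
    show "((\<lambda>u. coef_c al mu (s (u + d)) (th (u + d)) * scaled_contact de Y W (u + d))
        has_integral (ph (t + d) - ph (r + d))) {r..t}" by (rule sh[OF I(4)])
    show "((\<lambda>u. ep * coef_a (th (u + d)) (ph (u + d)) + coef_q al mu (s (u + d)) (th (u + d)) * scaled_contact de Y W (u + d))
        has_integral (v (t + d) - v (r + d))) {r..t}" by (rule sh[OF I(5)])
  next
    fix t assume "t \<in> {0..La - d}"
    then have "0 \<le> t + d" "t + d \<le> La" using d by auto
    note S = rescaled_sign[OF R this]
    show "\<bar>s (t + d)\<bar> \<le> 1" "0 < v (t + d) \<Longrightarrow> s (t + d) = 1" "v (t + d) < 0 \<Longrightarrow> s (t + d) = - 1"
      using S by auto
  qed (intro co rescaled_cont[OF R])+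
qed

text \<open>With Y \<ge> 0 and W > 0 the contact vanishes, so W is changed by the forcing alone,
  which over the whole interval is too weak to use up more than half of W a.\<close>

lemma flight:
  fixes Y W be P :: "real \<Rightarrow> real"
  assumes W: "continuous_on {a..b} W"
    and intY: "\<And>r t. a \<le> r \<Longrightarrow> r \<le> t \<Longrightarrow> t \<le> b \<Longrightarrow> (W has_integral (Y t - Y r)) {r..t}"
    and intW: "\<And>r t. a \<le> r \<Longrightarrow> r \<le> t \<Longrightarrow> t \<le> b \<Longrightarrow>
        ((\<lambda>u. be u + P u * scaled_contact de Y W u) has_integral (W t - W r)) {r..t}"
    and be: "\<And>u. a \<le> u \<Longrightarrow> u \<le> b \<Longrightarrow> - E \<le> be u" and E: "0 \<le> E" "E * (b - a) \<le> W a / 2"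
    and init: "0 < W a" "0 \<le> Y a" "0 < de" and t: "a \<le> t" "t \<le> b"
  shows "W a / 2 \<le> W t \<and> Y a + W a / 2 * (t - a) \<le> Y t \<and> scaled_contact de Y W t = 0"
proof -
  have step: "W a / 2 \<le> W t \<and> scaled_contact de Y W t = 0"
    if t: "a \<le> t" "t \<le> b" and pos: "\<And>r. a \<le> r \<Longrightarrow> r \<le> t \<Longrightarrow> 0 \<le> W r" for t
  proof -
    have c0: "scaled_contact de Y W r = 0" if r: "a \<le> r" "r \<le> t" for r
    proof -
      have "0 \<le> Y r - Y a" by (rule has_integral_nonneg[OF intY]) (use r t pos in auto)
      moreover have "0 \<le> de * W r" using pos[OF r] init by simp
      ultimately show ?thesis using init unfolding scaled_contact_def by simp
    qed
    have "(be has_integral (W t - W a)) {a..t}"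
      by (rule has_integral_eq[OF _ intW]) (use c0 t in auto)
    then have "(t - a) *\<^sub>R (- E) \<le> W t - W a"
      using has_integral_le[OF has_integral_const_real[of "- E" a t], of be "W t - W a"] be t by simp
    moreover have "(t - a) * E \<le> (b - a) * E" using t E by (intro mult_right_mono) auto
    ultimately have "W a / 2 \<le> W t" using E by (simp add: mult.commute)
    then show ?thesis using c0 t by simp
  qed
  \<comment> \<open>The threshold W a / 4 leaves room for the bootstrap: as long as it holds, W is
    nonnegative and \<open>step\<close> improves it to W a / 2.\<close>
  have pos: "W a / 4 \<le> W (a + u)" if u: "0 \<le> u" "u \<le> b - a" for u
  proof (rule interval_continuation[where P = "\<lambda>u. W a / 4 \<le> W (a + u)" and T = "b - a"])
    fix u assume u: "0 < u" "u \<le> b - a" and P: "\<And>s. 0 \<le> s \<Longrightarrow> s < u \<Longrightarrow> W a / 4 \<le> W (a + s)"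
    have "continuous_on {0..u} (\<lambda>s. W (a + s))"
      by (rule continuous_on_compose2[OF W]) (use u in \<open>auto intro!: continuous_intros\<close>)
    then have "((\<lambda>s. W (a + s)) \<longlongrightarrow> W (a + u)) (at_left u)"
      using continuous_on_Icc_at_leftD u(1) by blast
    moreover have "eventually (\<lambda>s. W a / 4 \<le> W (a + s)) (at_left u)"
      using eventually_at_left_real[OF u(1)] by eventually_elim (use P in auto)
    ultimately show "W a / 4 \<le> W (a + u)" by (rule tendsto_lowerbound) simp
  next
    fix u assume u: "0 \<le> u" "u < b - a" and P: "\<And>s. 0 \<le> s \<Longrightarrow> s \<le> u \<Longrightarrow> W a / 4 \<le> W (a + s)"
    have "W a / 2 \<le> W (a + u)"
    proof -
      have "0 \<le> W r" if "a \<le> r" "r \<le> a + u" for r using P[of "r - a"] that init by auto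
      then show ?thesis using step[of "a + u"] u by auto
    qed
    then have "0 < W (a + u) - W a / 4" using init by simp
    moreover have "continuous_on {0..b - a} (\<lambda>s. W (a + s) - W a / 4)"
      by (intro continuous_intros continuous_on_compose2[OF W]) (use u in \<open>auto intro!: continuous_intros\<close>)
    ultimately obtain e where "0 < e" "\<forall>s. u \<le> s \<and> s < u + e \<and> s \<le> b - a \<longrightarrow> 0 < W (a + s) - W a / 4"
      using positive_right_neighbourhood[of "b - a" "\<lambda>s. W (a + s) - W a / 4" u] u by blast
    then show "\<exists>e>0. \<forall>s. u < s \<and> s < u + e \<and> s \<le> b - a \<longrightarrow> W a / 4 \<le> W (a + s)"
      by (intro exI[of _ e]) (auto intro!: less_imp_le)
  qed (use u init in auto)
  have pos': "0 \<le> W r" if "a \<le> r" "r \<le> b" for r using pos[of "r - a"] that init by auto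
  have all: "W a / 2 \<le> W r \<and> scaled_contact de Y W r = 0" if "a \<le> r" "r \<le> b" for r
    using step[OF that] pos' that by auto
  have "(t - a) *\<^sub>R (W a / 2) \<le> Y t - Y a"
    using has_integral_le[OF has_integral_const_real[of "W a / 2" a t] intY[of a t]] all t by simp
  then show ?thesis using all[OF t] by (simp add: mult.commute)
qed

lemma first_zero:
  fixes f :: "real \<Rightarrow> real"
  assumes f: "continuous_on {a..b} f" and ab: "a \<le> b" "f a < 0" "0 \<le> f b"
  shows "\<exists>z. a < z \<and> z \<le> b \<and> f z = 0 \<and> (\<forall>t. a \<le> t \<and> t < z \<longrightarrow> f t < 0)"
proof -
  define Z where "Z = {t \<in> {a..b}. 0 \<le> f t}"
  have "compact Z"
  proof -
    have "closed Z" unfolding Z_def by (rule continuous_on_closed_Collect_le) (use f in auto)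
    moreover have "bounded Z" by (rule bounded_subset[of "{a..b}"]) (auto simp: Z_def)
    ultimately show ?thesis using compact_eq_bounded_closed by blast
  qed
  moreover have "Z \<noteq> {}" using ab by (auto simp: Z_def)
  ultimately obtain z where z: "z \<in> Z" "\<And>t. t \<in> Z \<Longrightarrow> z \<le> t" using compact_attains_inf by metis
  have neg: "f t < 0" if "a \<le> t" "t < z" for t using z(2)[of t] that z(1) by (force simp: Z_def)
  have az: "a < z" using z(1) ab by (cases "a = z") (auto simp: Z_def)
  have "f z \<le> 0"
  proof (rule tendsto_upperbound)
    show "(f \<longlongrightarrow> f z) (at_left z)"
      using continuous_on_Icc_at_leftD[of a z f] continuous_on_subset[OF f, of "{a..z}"] z(1) az by (auto simp: Z_def)
    show "eventually (\<lambda>t. f t \<le> 0) (at_left z)"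
      using eventually_at_left_real[OF az] by eventually_elim (use neg in \<open>force intro: less_imp_le\<close>)
  qed simp
  then show ?thesis using az neg z(1) by (intro exI[of _ z]) (auto simp: Z_def)
qed

section \<open>Bounds and Lipschitz constants of the coefficients\<close>

lemma abs_sin_diff: "\<bar>sin a - sin b\<bar> \<le> \<bar>a - b\<bar>" for a b :: real
  using field_differentiable_bound[of UNIV sin cos 1 a b] by (auto intro: DERIV_sin)

lemma abs_cos_diff: "\<bar>cos a - cos b\<bar> \<le> \<bar>a - b\<bar>" for a b :: real
  using field_differentiable_bound[of UNIV cos "\<lambda>x. - sin x" 1 a b] by (auto intro: DERIV_cos)

lemma coef_lipschitz:
  assumes par: "0 < al" "0 < mu" and s: "\<bar>s\<bar> \<le> 1"
  shows "\<bar>coef_p al mu s a - coef_p al mu s b\<bar> \<le> al * (1 + mu) * \<bar>a - b\<bar>"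
    and "\<bar>coef_q al mu s a - coef_q al mu s b\<bar> \<le> al * (1 + mu) * \<bar>a - b\<bar>"
    and "\<bar>coef_c al mu s a - coef_c al mu s b\<bar> \<le> al * (1 + mu) * \<bar>a - b\<bar>"
proof -
  \<comment> \<open>Double angles give Lipschitz constant 1: each quadratic expression is half a
    sine or cosine of 2 x, up to a constant.\<close>
  have sc: "sin x * cos x = sin (2 * x) / 2" for x :: real by (simp add: sin_double)
  have cc: "(cos x)^2 = (1 + cos (2 * x)) / 2" for x :: real by (simp add: cos_double_cos)
  have ss: "(sin x)^2 = (1 - cos (2 * x)) / 2" for x :: real by (simp add: cos_double_sin)
  have B: "\<bar>sin a * cos a - sin b * cos b\<bar> \<le> \<bar>a - b\<bar>" "\<bar>(cos a)^2 - (cos b)^2\<bar> \<le> \<bar>a - b\<bar>" "\<bar>(sin a)^2 - (sin b)^2\<bar> \<le> \<bar>a - b\<bar>"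
    unfolding sc cc ss add_divide_distrib diff_divide_distrib
    using abs_sin_diff[of "2 * a" "2 * b"] abs_cos_diff[of "2 * a" "2 * b"] by linarith+
  have comb: "\<bar>al * x - s * (mu * (al * y))\<bar> \<le> al * (1 + mu) * \<bar>a - b\<bar>" if "\<bar>x\<bar> \<le> \<bar>a - b\<bar>" "\<bar>y\<bar> \<le> \<bar>a - b\<bar>" for x y
  proof -
    have "\<bar>al * x\<bar> \<le> al * \<bar>a - b\<bar>" unfolding abs_mult using par that by (intro mult_mono) auto
    moreover have "\<bar>s * (mu * (al * y))\<bar> \<le> 1 * (mu * (al * \<bar>a - b\<bar>))"
      unfolding abs_mult using par that s by (intro mult_mono) auto
    ultimately have "\<bar>al * x - s * (mu * (al * y))\<bar> \<le> al * \<bar>a - b\<bar> + mu * (al * \<bar>a - b\<bar>)" by linarith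
    then show ?thesis by (simp add: algebra_simps)
  qed
  have "coef_p al mu s a - coef_p al mu s b = al * ((cos a)^2 - (cos b)^2) - s * (mu * (al * (sin a * cos a - sin b * cos b)))"
    unfolding coef_p_def by (simp add: algebra_simps)
  then show "\<bar>coef_p al mu s a - coef_p al mu s b\<bar> \<le> al * (1 + mu) * \<bar>a - b\<bar>" using comb[OF B(2,1)] by simp
  have "coef_q al mu s a - coef_q al mu s b = al * (sin a * cos a - sin b * cos b) - s * (mu * (al * ((sin a)^2 - (sin b)^2)))"
    unfolding coef_q_def by (simp add: algebra_simps)
  then show "\<bar>coef_q al mu s a - coef_q al mu s b\<bar> \<le> al * (1 + mu) * \<bar>a - b\<bar>" using comb[OF B(1,3)] by simp
  have "coef_c al mu s a - coef_c al mu s b = al * (- (cos a - cos b)) - s * (mu * (al * (- (sin a - sin b))))"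
    unfolding coef_c_def by (simp add: algebra_simps)
  then show "\<bar>coef_c al mu s a - coef_c al mu s b\<bar> \<le> al * (1 + mu) * \<bar>a - b\<bar>"
    using comb[of "- (cos a - cos b)" "- (sin a - sin b)"] abs_sin_diff[of a b] abs_cos_diff[of a b] by simp
qed

lemma abs_coef_ab_le:
  assumes "\<bar>ph - ph0\<bar> \<le> M0"
  shows "\<bar>coef_a th ph\<bar> \<le> 1 + (\<bar>ph0\<bar> + M0)^2" "\<bar>coef_b th ph\<bar> \<le> 1 + (\<bar>ph0\<bar> + M0)^2" "\<bar>ph\<bar> \<le> 1 + (\<bar>ph0\<bar> + M0)^2"
proof -
  have ph: "\<bar>ph\<bar> \<le> \<bar>ph0\<bar> + M0" using assms by linarith
  then have "\<bar>ph\<bar>^2 \<le> (\<bar>ph0\<bar> + M0)^2" by (intro power_mono) auto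
  then have p2: "ph^2 \<le> (\<bar>ph0\<bar> + M0)^2" by simp
  have "\<bar>ph^2 * x\<bar> \<le> (\<bar>ph0\<bar> + M0)^2 * 1" if "\<bar>x\<bar> \<le> 1" for x
    unfolding abs_mult using p2 that by (intro mult_mono) auto
  from this[of "cos th"] this[of "sin th"]
  have "\<bar>ph^2 * cos th\<bar> \<le> (\<bar>ph0\<bar> + M0)^2" "\<bar>ph^2 * sin th\<bar> \<le> (\<bar>ph0\<bar> + M0)^2" by simp_all
  then show "\<bar>coef_a th ph\<bar> \<le> 1 + (\<bar>ph0\<bar> + M0)^2" "\<bar>coef_b th ph\<bar> \<le> 1 + (\<bar>ph0\<bar> + M0)^2"
    unfolding coef_a_def coef_b_def by linarith+
  have "0 \<le> (\<bar>ph\<bar> - 1)^2" by simp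
  then have "2 * \<bar>ph\<bar> \<le> 1 + ph^2" by (simp add: power2_diff)
  then show "\<bar>ph\<bar> \<le> 1 + (\<bar>ph0\<bar> + M0)^2" using p2 by linarith
qed

locale impact =
  fixes al mu de th0 ph0 v0 :: real
  assumes par: "0 < al" "0 < mu" "0 < de" "0 < v0"
    and signs: "coef_p al mu 1 th0 < 0" "0 < coef_b th0 ph0" "coef_q al mu 1 th0 < 0" "0 < coef_q al mu (-1) th0"
begin

abbreviation "p \<equiv> coef_p al mu 1 th0"
abbreviation "q \<equiv> coef_q al mu 1 th0"
abbreviation "c \<equiv> coef_c al mu 1 th0"
abbreviation "b0 \<equiv> coef_b th0 ph0"
abbreviation "l \<equiv> eigval al mu de 1 th0"
abbreviation "S \<equiv> S_w al mu th0"
abbreviation "Sph \<equiv> S_phi al mu th0"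

text \<open>Minus the stable eigenvalue, since the two eigenvalues have product p.\<close>

definition "lm = - p / l"

text \<open>\<open>ka\<close> and \<open>kph\<close> are the w- and phi-components of the friction
  direction at \<open>th0\<close>; subtracting these multiples of v from w and phi removes the
  friction.\<close>

definition "ka = al * sin th0 * cos th0 / (1 + al * (sin th0)^2)"

definition "kph = - (al * sin th0) / (1 + al * (sin th0)^2)"

text \<open>The factors account for the combinations with ka and kph, for the Lipschitz constants in
  theta, and for the size of a, b and phi while phi stays within M0 of ph0.\<close>

definition gain :: "real \<Rightarrow> real" where
  "gain M0 = (1 + \<bar>ka\<bar> + \<bar>kph\<bar>) * (1 + al * (1 + mu)) * (1 + (\<bar>ph0\<bar> + M0)^2)"

lemma l_pos: "0 < l" using eigval_pos[OF par(3) signs(1)] .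

lemma roots: "0 < lm" "l * lm = - p" "l - lm = - de * p"
proof -
  show "0 < lm" unfolding lm_def using l_pos signs(1) by (intro divide_pos_pos) auto
  show "l * lm = - p" using l_pos by (simp add: lm_def)
  have "l^2 = - p * (1 + de * l)" using eigval_square[of al mu th0 de] signs(1) by simp
  then have "l * (l - lm) = l * (- de * p)" using \<open>l * lm = - p\<close> by (simp add: power2_eq_square algebra_simps)
  then show "l - lm = - de * p" using l_pos mult_left_cancel[of l "l - lm" "- de * p"] by linarith
qed

text \<open>As the eigenvalues have product p, the quotient - lambda_- / p is - 1 / l. In this form
  the threshold compares b0 with the growth rate l of the unstable coordinate.\<close>

lemma w1_star_eq: "w1_star al mu de th0 ph0 = - b0 / l"
proof -
  have "eigval al mu de (-1) th0 = - de * p - l" unfolding eigval_def by (simp add: field_simps)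
  then have "eigval al mu de (-1) th0 = - lm" using roots(3) by simp
  then show ?thesis unfolding w1_star_def lm_def using signs(1) by simp
qed

text \<open>True for every weight s: it enters p, q and c only through a multiple of the friction
  direction, which these combinations annihilate. So the value of the Filippov weight drops out of
  the sticking motion.\<close>

lemma stick_coefs:
  "coef_p al mu s th0 - ka * coef_q al mu s th0 = S" "coef_c al mu s th0 - kph * coef_q al mu s th0 = Sph"
proof -
  define sn cn where "sn = sin th0" and "cn = cos th0"
  define B where "B = 1 + al * sn^2"
  have B: "0 < B" using one_plus_pos[OF par(1), of th0] by (simp add: B_def sn_def)
  have 1: "cn * cn = 1 - sn * sn" using sin_cos_squared_add[of th0] by (simp add: sn_def cn_def power2_eq_square)
  have kB: "ka * B = al * sn * cn" "kph * B = - (al * sn)" using B by (simp_all add: ka_def kph_def B_def sn_def cn_def)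
  have S: "S * B = 1 + al" "Sph * B = - (al * cn)"
    using B S_w_eq[OF par(1,2), of th0] S_phi_eq[OF par(1,2), of th0] by (simp_all add: B_def sn_def cn_def)
  have pe: "coef_p al mu s th0 = 1 + al * (cn * cn) - s * mu * al * sn * cn" and qe: "coef_q al mu s th0 = al * sn * cn - s * mu * B"
    and ce: "coef_c al mu s th0 = - al * (cn - s * mu * sn)"
    by (simp_all add: coef_p_def coef_q_def coef_c_def B_def sn_def cn_def power2_eq_square)
  have "(coef_p al mu s th0 - ka * coef_q al mu s th0) * B = (1 + al * (cn * cn)) * B - s * mu * al * sn * cn * B - (ka * B) * (al * sn * cn - s * mu * B)"
    unfolding pe qe by (simp add: algebra_simps)
  also have "\<dots> = (1 + al * (cn * cn)) * B - al * al * (sn * sn) * (cn * cn)"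
    unfolding kB by (simp add: algebra_simps)
  also have "\<dots> = 1 + al" unfolding 1 B_def power2_eq_square by (simp add: algebra_simps)
  finally show "coef_p al mu s th0 - ka * coef_q al mu s th0 = S" using S B by (metis mult_right_cancel order_less_irrefl)
  have "(coef_c al mu s th0 - kph * coef_q al mu s th0) * B = - al * (cn - s * mu * sn) * B - (kph * B) * (al * sn * cn - s * mu * B)"
    unfolding ce qe by (simp add: algebra_simps)
  also have "\<dots> = - al * (cn - s * mu * sn) * B + al * sn * (al * sn * cn - s * mu * B)"
    unfolding kB by simp
  also have "\<dots> = - (al * cn)" unfolding B_def power2_eq_square by (simp add: algebra_simps)
  finally show "coef_c al mu s th0 - kph * coef_q al mu s th0 = Sph" using S B by (metis mult_right_cancel order_less_irrefl)
qed

lemma gain_pos: "0 < gain M0"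
  unfolding gain_def using par by (intro mult_pos_pos add_pos_nonneg) auto

lemma rescaled_estimates:
  assumes R: "rescaled al mu de ep La Y W th ph v s" and init: "th 0 = th0"
    and M0: "0 \<le> M0" "\<forall>t. 0 \<le> t \<and> t \<le> La \<longrightarrow> \<bar>ph t - ph0\<bar> \<le> M0"
    and ep: "0 < ep" "0 \<le> La" "gain M0 * (ep * (La + 1)) \<le> et"
  defines "E \<equiv> ep * (1 + (\<bar>ph0\<bar> + M0)^2)"
  shows "0 \<le> E" "E \<le> et" "E * La \<le> et" "ep \<le> et"
    and "\<And>t. 0 \<le> t \<Longrightarrow> t \<le> La \<Longrightarrow> \<bar>th t - th0\<bar> \<le> et"
    and "\<And>t. 0 \<le> t \<Longrightarrow> t \<le> La \<Longrightarrow> \<bar>ep * coef_b (th t) (ph t)\<bar> \<le> E \<and> \<bar>ep * coef_a (th t) (ph t)\<bar> \<le> E"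
    and "\<And>t sg. 0 \<le> t \<Longrightarrow> t \<le> La \<Longrightarrow> \<bar>sg\<bar> \<le> 1 \<Longrightarrow> \<bar>coef_p al mu sg (th t) - coef_p al mu sg th0\<bar> \<le> et
        \<and> \<bar>coef_q al mu sg (th t) - coef_q al mu sg th0\<bar> \<le> et \<and> \<bar>coef_c al mu sg (th t) - coef_c al mu sg th0\<bar> \<le> et
        \<and> \<bar>coef_p al mu sg (th t) - ka * coef_q al mu sg (th t) - S\<bar> \<le> et
        \<and> \<bar>coef_c al mu sg (th t) - kph * coef_q al mu sg (th t) - Sph\<bar> \<le> et"
proof -
  define Ph where "Ph = 1 + (\<bar>ph0\<bar> + M0)^2"
  define A where "A = 1 + \<bar>ka\<bar> + \<bar>kph\<bar>"
  define Lc where "Lc = al * (1 + mu)"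
  have pos: "1 \<le> Ph" "1 \<le> A" "0 \<le> Lc" using par by (auto simp: Ph_def A_def Lc_def)
  have E: "E = ep * Ph" by (simp add: E_def Ph_def)
  have g: "A * (1 + Lc) * Ph * (ep * (La + 1)) \<le> et" using ep(3) by (simp add: gain_def A_def Lc_def Ph_def)
  \<comment> \<open>The factor La + 1 instead of La makes \<open>X\<close> a bound for E as well as
    for E La, the largest possible drift of theta.\<close>
  define X where "X = E * (La + 1)"
  have E0: "0 \<le> E" using pos ep by (simp add: E)
  then have X: "0 \<le> X" "E \<le> X" "E * La \<le> X" using ep(2) by (simp_all add: X_def distrib_left)
  have gX: "A * ((1 + Lc) * X) \<le> et" using g by (simp add: X_def E mult.assoc mult.left_commute)
  have "1 * ((1 + Lc) * X) \<le> A * ((1 + Lc) * X)" using pos X by (intro mult_right_mono) auto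
  then have LX: "(1 + Lc) * X \<le> et" using gX by simp
  have "1 * X \<le> (1 + Lc) * X" using pos X by (intro mult_right_mono) auto
  then have Xet: "X \<le> et" using LX by simp
  show "0 \<le> E" "E \<le> et" "E * La \<le> et" using E0 X Xet by linarith+
  have "ep * 1 \<le> ep * Ph" using ep pos by (intro mult_left_mono) auto
  then show "ep \<le> et" using \<open>E \<le> et\<close> E by simp
  have th: "\<bar>th t - th0\<bar> \<le> X" if t: "0 \<le> t" "t \<le> La" for t
  proof -
    have "\<bar>ep * ph u\<bar> \<le> E" if "u \<in> {0..t}" for u
    proof -
      have "\<bar>ph u\<bar> \<le> Ph" unfolding Ph_def by (rule abs_coef_ab_le(3)[OF M0(2)[rule_format]]) (use that t in auto)
      then show ?thesis unfolding E abs_mult using ep by (intro mult_mono) auto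
    qed
    then have "\<bar>th t - th 0\<bar> \<le> integral {0..t} (\<lambda>_. E)"
      by (intro has_integral_abs_le[OF rescaled_int(3)[OF R]]) (use t in auto)
    also have "\<dots> = E * t" using t by (simp add: mult.commute)
    also have "\<dots> \<le> E * La" using t E0 by (intro mult_left_mono) auto
    finally show ?thesis using X(3) init by simp
  qed
  then show "\<bar>th t - th0\<bar> \<le> et" if "0 \<le> t" "t \<le> La" for t using th[OF that] Xet by linarith
  show "\<bar>ep * coef_b (th t) (ph t)\<bar> \<le> E \<and> \<bar>ep * coef_a (th t) (ph t)\<bar> \<le> E" if "0 \<le> t" "t \<le> La" for t
    unfolding E Ph_def abs_mult using abs_coef_ab_le(1,2)[OF M0(2)[rule_format, OF conjI[OF that]]] ep by (auto intro!: mult_mono)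
  fix t sg :: real assume t: "0 \<le> t" "t \<le> La" and sg: "\<bar>sg\<bar> \<le> 1"
  have "Lc * \<bar>th t - th0\<bar> \<le> (1 + Lc) * X" using th[OF t] pos by (intro mult_mono) auto
  note L = order_trans[OF _ this]
  have cl: "\<bar>coef_p al mu sg (th t) - coef_p al mu sg th0\<bar> \<le> (1 + Lc) * X" (is "\<bar>?dp\<bar> \<le> _")
     "\<bar>coef_q al mu sg (th t) - coef_q al mu sg th0\<bar> \<le> (1 + Lc) * X" (is "\<bar>?dq\<bar> \<le> _")
     "\<bar>coef_c al mu sg (th t) - coef_c al mu sg th0\<bar> \<le> (1 + Lc) * X" (is "\<bar>?dc\<bar> \<le> _")
    by (rule L; unfold Lc_def; rule coef_lipschitz[OF par(1,2) sg])+
  have comb: "\<bar>d - k * e\<bar> \<le> et" if "\<bar>d\<bar> \<le> (1 + Lc) * X" "\<bar>e\<bar> \<le> (1 + Lc) * X" "1 + \<bar>k\<bar> \<le> A" for d e k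
  proof -
    have "\<bar>k * e\<bar> \<le> \<bar>k\<bar> * ((1 + Lc) * X)" unfolding abs_mult using that by (intro mult_left_mono) auto
    then have "\<bar>d - k * e\<bar> \<le> (1 + \<bar>k\<bar>) * ((1 + Lc) * X)" using that(1) distrib_right[of 1 "\<bar>k\<bar>" "(1 + Lc) * X"] by linarith
    also have "\<dots> \<le> A * ((1 + Lc) * X)" using that pos X by (intro mult_right_mono) auto
    finally show ?thesis using gX by linarith
  qed
  have e: "coef_p al mu sg (th t) - ka * coef_q al mu sg (th t) - S = ?dp - ka * ?dq"
    "coef_c al mu sg (th t) - kph * coef_q al mu sg (th t) - Sph = ?dc - kph * ?dq"
    using stick_coefs[of sg] unfolding right_diff_distrib by linarith+
  have d: "\<bar>?dp - ka * ?dq\<bar> \<le> et" "\<bar>?dc - kph * ?dq\<bar> \<le> et" by (intro comb cl; simp add: A_def)+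
  show "\<bar>?dp\<bar> \<le> et \<and> \<bar>?dq\<bar> \<le> et \<and> \<bar>?dc\<bar> \<le> et
        \<and> \<bar>coef_p al mu sg (th t) - ka * coef_q al mu sg (th t) - S\<bar> \<le> et
        \<and> \<bar>coef_c al mu sg (th t) - kph * coef_q al mu sg (th t) - Sph\<bar> \<le> et"
    unfolding e using cl LX d by (intro conjI) linarith+
qed

text \<open>While v > 0 the weight is 1 and all integrands are continuous, so the integral equations
  turn into classical derivatives.\<close>

lemma rescaled_derivatives:
  assumes R: "rescaled al mu de ep La Y W th ph v s" and T: "T \<le> La" and v: "\<forall>t. 0 \<le> t \<and> t < T \<longrightarrow> 0 < v t"
    and t: "0 < t" "t < T"
  shows "(Y has_real_derivative W t) (at t)"
    and "(W has_real_derivative ep * coef_b (th t) (ph t) + coef_p al mu 1 (th t) * scaled_contact de Y W t) (at t)"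
    and "(ph has_real_derivative coef_c al mu 1 (th t) * scaled_contact de Y W t) (at t)"
    and "(v has_real_derivative ep * coef_a (th t) (ph t) + coef_q al mu 1 (th t) * scaled_contact de Y W t) (at t)"
proof -
  note C = rescaled_cont[OF R, THEN continuous_on_subset, of "{0<..<T}"]
  have sub: "{0<..<T} \<subseteq> {0..La}" using T by auto
  note C = C[OF sub]
  have F: "continuous_on {0<..<T} (scaled_contact de Y W)"
    unfolding scaled_contact_def[abs_def] by (intro continuous_intros C)
  have s1: "s u = 1" if "u \<in> {r..t}" "0 \<le> r" "t < T" for u r t
    using rescaled_sign(2)[OF R] v[rule_format, of u] that T by auto
  show "(Y has_real_derivative W t) (at t)"
    by (rule has_derivative_of_increments[of T, OF _ C(2) t]) (use rescaled_int(1)[OF R] T in auto)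
  show "(W has_real_derivative ep * coef_b (th t) (ph t) + coef_p al mu 1 (th t) * scaled_contact de Y W t) (at t)"
  proof (rule has_derivative_of_increments[of T, OF _ _ t])
    fix r t assume "0 \<le> r" "r \<le> t" "t < T"
    then show "((\<lambda>t. ep * coef_b (th t) (ph t) + coef_p al mu 1 (th t) * scaled_contact de Y W t) has_integral W t - W r) {r..t}"
      by (intro has_integral_eq[OF _ rescaled_int(2)[OF R]]) (use s1 T in auto)
  qed (unfold coef_b_def coef_p_def, intro continuous_intros C F)
  show "(ph has_real_derivative coef_c al mu 1 (th t) * scaled_contact de Y W t) (at t)"
  proof (rule has_derivative_of_increments[of T, OF _ _ t])
    fix r t assume "0 \<le> r" "r \<le> t" "t < T"
    then show "((\<lambda>t. coef_c al mu 1 (th t) * scaled_contact de Y W t) has_integral ph t - ph r) {r..t}"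
      by (intro has_integral_eq[OF _ rescaled_int(4)[OF R]]) (use s1 T in auto)
  qed (unfold coef_c_def, intro continuous_intros C F)
  show "(v has_real_derivative ep * coef_a (th t) (ph t) + coef_q al mu 1 (th t) * scaled_contact de Y W t) (at t)"
  proof (rule has_derivative_of_increments[of T, OF _ _ t])
    fix r t assume "0 \<le> r" "r \<le> t" "t < T"
    then show "((\<lambda>t. ep * coef_a (th t) (ph t) + coef_q al mu 1 (th t) * scaled_contact de Y W t) has_integral v t - v r) {r..t}"
      by (intro has_integral_eq[OF _ rescaled_int(5)[OF R]]) (use s1 T in auto)
  qed (unfold coef_a_def coef_q_def, intro continuous_intros C F)
qed

lemma rescaled_slip:
  assumes R: "rescaled al mu de ep La Y W th ph v s"
    and init: "Y 0 = 0" "W 0 = - (ep * n0)" "th 0 = th0" "ph 0 = ph0" "v 0 = v0"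
    and M0: "0 \<le> M0" "\<forall>t. 0 \<le> t \<and> t \<le> La \<longrightarrow> \<bar>ph t - ph0\<bar> \<le> M0"
    and ep: "0 < ep" "0 \<le> La" "gain M0 * (ep * (La + 1)) \<le> et"
    and rh: "et \<le> rh" "\<forall>th ph. \<bar>th - th0\<bar> \<le> rh \<and> \<bar>ph - ph0\<bar> \<le> rh \<longrightarrow> coef_b th ph \<le> b0 + sg0"
    and T: "0 \<le> T" "T \<le> La" "\<forall>t. 0 \<le> t \<and> t < T \<longrightarrow> 0 < v t" "0 \<le> v T"
  shows "slip_traj p q c de b0 sg0 n0 rh v0 et ep T Y W ph v"
proof -
  note est = rescaled_estimates[OF R init(3) M0 ep]
  note C = rescaled_cont[OF R, THEN continuous_on_subset, of "{0..T}"]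
  let ?E = "ep * (1 + (\<bar>ph0\<bar> + M0)^2)"
  have "?E * T \<le> ?E * La" using est(1) T by (intro mult_left_mono) auto
  then have ET: "?E * T \<le> et" using est(3) by linarith
  have vT: "0 \<le> v t" if "0 \<le> t" "t \<le> T" for t using T that by (cases "t = T") (auto intro: less_imp_le)
  show ?thesis unfolding slip_traj_def scaled_contact_def[symmetric]
  proof (rule exI[of _ ?E], rule exI[of _ "\<lambda>t. ep * coef_b (th t) (ph t)"], rule exI[of _ "\<lambda>t. ep * coef_a (th t) (ph t)"],
      rule exI[of _ "\<lambda>t. coef_p al mu 1 (th t)"], rule exI[of _ "\<lambda>t. coef_q al mu 1 (th t)"],
      rule exI[of _ "\<lambda>t. coef_c al mu 1 (th t)"], intro conjI allI impI)
    fix t assume t: "0 < t \<and> t < T"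
    then have tl: "0 \<le> t" "t \<le> La" using T by auto
    note D = rescaled_derivatives[OF R T(2,3) conjunct1[OF t] conjunct2[OF t]]
    show "(Y has_real_derivative W t) (at t)"
      "(W has_real_derivative ep * coef_b (th t) (ph t) + coef_p al mu 1 (th t) * scaled_contact de Y W t) (at t)"
      "(ph has_real_derivative coef_c al mu 1 (th t) * scaled_contact de Y W t) (at t)"
      "(v has_real_derivative ep * coef_a (th t) (ph t) + coef_q al mu 1 (th t) * scaled_contact de Y W t) (at t)"
      by (rule D)+
    show "\<bar>coef_p al mu 1 (th t) - p\<bar> \<le> et" "\<bar>coef_q al mu 1 (th t) - q\<bar> \<le> et" "\<bar>coef_c al mu 1 (th t) - c\<bar> \<le> et"
      using est(7)[OF tl, of 1] by simp_all
    show "\<bar>ep * coef_b (th t) (ph t)\<bar> \<le> ?E" "\<bar>ep * coef_a (th t) (ph t)\<bar> \<le> ?E"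
      using est(6)[OF tl] by simp_all
    assume "\<bar>ph t - ph 0\<bar> \<le> rh"
    then have "coef_b (th t) (ph t) \<le> b0 + sg0" using est(5)[OF tl] rh(1) rh(2)[rule_format, of "th t" "ph t"] init(4) by linarith
    then show "ep * coef_b (th t) (ph t) \<le> ep * (b0 + sg0)" using ep by (intro mult_left_mono) auto
  next
    fix t assume "0 \<le> t \<and> t \<le> T" then show "0 \<le> v t" using vT by blast
  next
    show "continuous_on {0..T} Y" "continuous_on {0..T} W" "continuous_on {0..T} ph" "continuous_on {0..T} v"
      using C T by auto
  qed (fact est(1,2,4) ET T ep init)+
qed

text \<open>The shift places a zero of v at time 0. With \<open>et\<close> below both |q_+| and q_-,
  the drift of theta cannot change the sign of q on either side, and this sign is what traps
  v.\<close>

lemma rescaled_stick: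
  assumes R: "rescaled al mu de ep La Y W th ph v s" and init: "th 0 = th0"
    and M0: "0 \<le> M0" "\<forall>t. 0 \<le> t \<and> t \<le> La \<longrightarrow> \<bar>ph t - ph0\<bar> \<le> M0"
    and ep: "0 < ep" "0 \<le> La" "gain M0 * (ep * (La + 1)) \<le> et" and et: "et \<le> - q" "et \<le> coef_q al mu (-1) th0"
    and d: "0 \<le> d" "v d = 0" and T: "0 \<le> T" "T + d \<le> La"
  shows "stick_traj S ka kph Sph de et T (\<lambda>t. Y (t + d)) (\<lambda>t. W (t + d)) (\<lambda>t. ph (t + d)) (\<lambda>t. v (t + d))"
proof -
  note est = rescaled_estimates[OF R init M0 ep]
  have dl: "d \<le> La" using T by simp
  note Rd = rescaled_shift[OF R d(1) dl]
  have sub: "{0..T} \<subseteq> {0..La - d}" using T by auto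
  note C = rescaled_cont[OF Rd, THEN continuous_on_subset, OF sub]
  let ?E = "ep * (1 + (\<bar>ph0\<bar> + M0)^2)"
  have "?E * T \<le> ?E * La" using est(1) T d by (intro mult_left_mono) auto
  then have ET: "?E * T \<le> et" using est(3) by linarith
  show ?thesis unfolding stick_traj_def
  proof (rule exI[of _ ?E], rule exI[of _ "\<lambda>t. ep * coef_b (th (t + d)) (ph (t + d))"],
      rule exI[of _ "\<lambda>t. ep * coef_a (th (t + d)) (ph (t + d))"],
      rule exI[of _ "\<lambda>t. coef_p al mu (s (t + d)) (th (t + d))"], rule exI[of _ "\<lambda>t. coef_q al mu (s (t + d)) (th (t + d))"],
      rule exI[of _ "\<lambda>t. coef_c al mu (s (t + d)) (th (t + d))"], intro conjI)
    show "\<forall>r t. 0 \<le> r \<and> r \<le> t \<and> t \<le> T \<longrightarrow>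
       ((\<lambda>t. W (t + d)) has_integral Y (t + d) - Y (r + d)) {r..t} \<and>
       ((\<lambda>u. ep * coef_b (th (u + d)) (ph (u + d)) + coef_p al mu (s (u + d)) (th (u + d)) * max (- Y (u + d) - de * W (u + d)) 0)
          has_integral W (t + d) - W (r + d)) {r..t} \<and>
       ((\<lambda>u. coef_c al mu (s (u + d)) (th (u + d)) * max (- Y (u + d) - de * W (u + d)) 0) has_integral ph (t + d) - ph (r + d)) {r..t} \<and>
       ((\<lambda>u. ep * coef_a (th (u + d)) (ph (u + d)) + coef_q al mu (s (u + d)) (th (u + d)) * max (- Y (u + d) - de * W (u + d)) 0)
          has_integral v (t + d) - v (r + d)) {r..t}"
    proof (intro allI impI)
      fix r t assume "0 \<le> r \<and> r \<le> t \<and> t \<le> T"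
      then have "0 \<le> r" "r \<le> t" "t \<le> La - d" using T by auto
      note I = rescaled_int[OF Rd this, unfolded scaled_contact_def]
      show "((\<lambda>t. W (t + d)) has_integral Y (t + d) - Y (r + d)) {r..t} \<and>
       ((\<lambda>u. ep * coef_b (th (u + d)) (ph (u + d)) + coef_p al mu (s (u + d)) (th (u + d)) * max (- Y (u + d) - de * W (u + d)) 0)
          has_integral W (t + d) - W (r + d)) {r..t} \<and>
       ((\<lambda>u. coef_c al mu (s (u + d)) (th (u + d)) * max (- Y (u + d) - de * W (u + d)) 0) has_integral ph (t + d) - ph (r + d)) {r..t} \<and>
       ((\<lambda>u. ep * coef_a (th (u + d)) (ph (u + d)) + coef_q al mu (s (u + d)) (th (u + d)) * max (- Y (u + d) - de * W (u + d)) 0)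
          has_integral v (t + d) - v (r + d)) {r..t}"
        by (intro conjI I(1,2,4,5))
    qed
    show "\<forall>t. 0 \<le> t \<and> t \<le> T \<longrightarrow>
       \<bar>coef_p al mu (s (t + d)) (th (t + d)) - ka * coef_q al mu (s (t + d)) (th (t + d)) - S\<bar> \<le> et
       \<and> \<bar>coef_c al mu (s (t + d)) (th (t + d)) - kph * coef_q al mu (s (t + d)) (th (t + d)) - Sph\<bar> \<le> et
       \<and> \<bar>ep * coef_b (th (t + d)) (ph (t + d))\<bar> \<le> ?E \<and> \<bar>ep * coef_a (th (t + d)) (ph (t + d))\<bar> \<le> ?E
       \<and> (0 < v (t + d) \<longrightarrow> coef_q al mu (s (t + d)) (th (t + d)) \<le> 0)
       \<and> (v (t + d) < 0 \<longrightarrow> 0 \<le> coef_q al mu (s (t + d)) (th (t + d)))"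
    proof (intro allI impI)
      fix t assume "0 \<le> t \<and> t \<le> T"
      then have tl: "0 \<le> t + d" "t + d \<le> La" using T d by auto
      note sg = rescaled_sign[OF R tl]
      have pos: "coef_q al mu (s (t + d)) (th (t + d)) \<le> 0" if "0 < v (t + d)"
        using est(7)[OF tl, of 1] sg(2)[OF that] et by (simp add: abs_le_iff)
      have neg: "0 \<le> coef_q al mu (s (t + d)) (th (t + d))" if "v (t + d) < 0"
        using est(7)[OF tl, of "-1"] sg(3)[OF that] et by (simp add: abs_le_iff)
      show "\<bar>coef_p al mu (s (t + d)) (th (t + d)) - ka * coef_q al mu (s (t + d)) (th (t + d)) - S\<bar> \<le> et
       \<and> \<bar>coef_c al mu (s (t + d)) (th (t + d)) - kph * coef_q al mu (s (t + d)) (th (t + d)) - Sph\<bar> \<le> et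
       \<and> \<bar>ep * coef_b (th (t + d)) (ph (t + d))\<bar> \<le> ?E \<and> \<bar>ep * coef_a (th (t + d)) (ph (t + d))\<bar> \<le> ?E
       \<and> (0 < v (t + d) \<longrightarrow> coef_q al mu (s (t + d)) (th (t + d)) \<le> 0)
       \<and> (v (t + d) < 0 \<longrightarrow> 0 \<le> coef_q al mu (s (t + d)) (th (t + d)))"
        using est(7)[OF tl sg(1)] est(6)[OF tl] pos neg by blast
    qed
  qed (use est(1,2) ET T C d in simp_all)
qed

end

section \<open>Impact and return\<close>

context impact
begin

text \<open>Of the box only the bound on phi is carried over, because the coefficients a, b and
  theta' depend on it. The bounds on W and on the contact come out through
  \<open>inside\<close>.\<close>

definition fast_flow where
  "fast_flow w10 M0 ep La Y W th ph v s \<longleftrightarrow> 0 < ep \<and> 0 \<le> La \<and> rescaled al mu de ep La Y W th ph v s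
     \<and> Y 0 = 0 \<and> W 0 = ep * w10 \<and> th 0 = th0 \<and> ph 0 = ph0 \<and> v 0 = v0
     \<and> (\<forall>t. 0 \<le> t \<and> t \<le> La \<longrightarrow> \<bar>ph t - ph0\<bar> \<le> M0)"

definition inside where
  "inside M0 M1 M2 La Y W th ph \<longleftrightarrow> \<bar>ph La - ph0\<bar> < M0 \<and> \<bar>W La\<bar> < M1 \<and> scaled_contact de Y W La < M2
     \<and> (Y La < 0 \<or> 0 < W La \<or> (Y La \<le> 0 \<and> W La < 0) \<or> (Y La = 0 \<and> W La = 0 \<and> 0 < coef_b (th La) (ph La)))"

definition fast_return where
  "fast_return C et La Y W th ph v T \<longleftrightarrow> 0 < T \<and> T \<le> La \<and> Y T = 0 \<and> (\<forall>t. 0 < t \<and> t < T \<longrightarrow> Y t < 0)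
     \<and> \<bar>W T - e_fun al mu de th0 * v0\<bar> \<le> et \<and> \<bar>th T - th0\<bar> \<le> et
     \<and> \<bar>ph T - (ph0 + (- (c / q) + Sph / S * (e_fun al mu de th0 + p / q)) * v0)\<bar> \<le> et \<and> \<bar>v T\<bar> \<le> et
     \<and> (\<forall>t. 0 \<le> t \<and> t \<le> T \<longrightarrow> \<bar>Y t\<bar> \<le> C \<and> \<bar>W t\<bar> \<le> C \<and> scaled_contact de Y W t \<le> C)"

definition fast_lift_off where
  "fast_lift_off C ep La Y W T T' \<longleftrightarrow> 0 \<le> T \<and> T < T' \<and> T' \<le> La \<and> Y T = 0 \<and> (\<forall>t. 0 \<le> t \<and> t \<le> T \<longrightarrow> Y t \<le> 0)
     \<and> (\<forall>t. T < t \<and> t \<le> T' \<longrightarrow> 0 < Y t)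
     \<and> (\<forall>t. 0 \<le> t \<and> t \<le> T \<longrightarrow> \<bar>Y t\<bar> \<le> C * ep \<and> \<bar>W t\<bar> \<le> C * ep \<and> scaled_contact de Y W t \<le> C * ep)"

lemma coef_b_near:
  assumes "0 < sg"
  shows "\<exists>rh>0. \<forall>th ph. \<bar>th - th0\<bar> \<le> rh \<and> \<bar>ph - ph0\<bar> \<le> rh \<longrightarrow> \<bar>coef_b th ph - b0\<bar> \<le> sg"
proof -
  have "continuous_on UNIV (\<lambda>z::real \<times> real. coef_b (fst z) (snd z))"
    unfolding coef_b_def by (intro continuous_intros)
  then obtain d where d: "0 < d" "\<And>z. dist z (th0, ph0) < d \<Longrightarrow> dist (coef_b (fst z) (snd z)) (coef_b (fst (th0, ph0)) (snd (th0, ph0))) < sg"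
    using assms unfolding continuous_on_iff by (metis UNIV_I)
  show ?thesis
  proof (intro exI[of _ "d / 4"] conjI allI impI)
    fix th ph assume "\<bar>th - th0\<bar> \<le> d / 4 \<and> \<bar>ph - ph0\<bar> \<le> d / 4"
    then have "dist (th, ph) (th0, ph0) < d"
      using sqrt_sum_squares_le_sum_abs[of "th - th0" "ph - ph0"] d(1) by (auto simp: dist_Pair_Pair dist_real_def)
    from d(2)[OF this] show "\<bar>coef_b th ph - b0\<bar> \<le> sg" by (simp add: dist_real_def)
  qed (use d in auto)
qed

text \<open>K, the box and C are fixed before the tolerance; only the threshold for epsilon depends
  on it. \<open>inside\<close> is asserted for every La up to the horizon, in whichever phase it
  falls, because the continuation argument uses it at all intermediate times.\<close>

lemma impact_trajectory:
  assumes w10: "w10 < - b0 / l"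
  shows "\<exists>K>0. \<exists>M0>0. \<exists>M1>0. \<exists>M2>0. \<exists>C. \<forall>et>0. \<exists>ep0>0. \<forall>ep La Y W th ph v s.
     ep < ep0 \<and> La \<le> K * ln (1 / ep) \<and> fast_flow w10 M0 ep La Y W th ph v s \<longrightarrow>
       inside M0 M1 M2 La Y W th ph \<and> (La = K * ln (1 / ep) \<longrightarrow> (\<exists>T. fast_return C et La Y W th ph v T))"
proof -
  define n0 where "n0 = - w10"
  have n0: "0 < n0" "b0 < l * n0"
  proof -
    have "b0 / l < n0" using w10 by (simp add: n0_def)
    then show "b0 < l * n0" using l_pos by (simp add: divide_less_eq mult.commute)
    then show "0 < n0" using signs(2) l_pos by (smt (verit) mult_nonneg_nonpos)
  qed
  \<comment> \<open>A quarter of the margin below the threshold, spent on the variation of b, the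
    slack in the lower bound for N, the coefficient errors, and the exponential growth of N.\<close>
  define sg0 where "sg0 = (l * n0 - b0) / 4"
  have sg0: "0 < sg0" "l * n0 = b0 + 4 * sg0" using n0 by (auto simp: sg0_def field_simps)
  obtain rh where rh: "0 < rh" "\<forall>th ph. \<bar>th - th0\<bar> \<le> rh \<and> \<bar>ph - ph0\<bar> \<le> rh \<longrightarrow> \<bar>coef_b th ph - b0\<bar> \<le> sg0"
    using coef_b_near[OF sg0(1)] by blast
  then have rh': "\<forall>th ph. \<bar>th - th0\<bar> \<le> rh \<and> \<bar>ph - ph0\<bar> \<le> rh \<longrightarrow> coef_b th ph \<le> b0 + sg0"
    by (force simp: abs_le_iff)
  obtain g etA CA where g: "0 < g" and etA: "0 < etA" and CA: "0 < CA"
    and slip: "\<forall>et ep T Y W ph v. et \<le> etA \<longrightarrow> slip_traj p q c de b0 sg0 n0 rh v0 et ep T Y W ph v \<longrightarrow>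
    (\<forall>t\<in>{0..T}. W t < 0 \<and> Y t \<le> 0 \<and> (0 < t \<longrightarrow> Y t < 0) \<and> \<bar>Y t\<bar> \<le> CA \<and> \<bar>W t\<bar> \<le> CA
      \<and> \<bar>W t - p / q * (v t - v0)\<bar> \<le> CA * et \<and> \<bar>ph t - ph 0 - c / q * (v t - v0)\<bar> \<le> CA * et
      \<and> \<bar>W t - l * Y t\<bar> \<le> CA * et \<and> ep * exp (g * t) \<le> CA)"
    using slip_phase[OF signs(1,3) par(3) l_pos roots signs(2) sg0(1) n0(1) sg0(2) rh(1) par(4), of c] by blast
  \<comment> \<open>The limit of W when v reaches 0: W - (p / q) v is nearly conserved, and
    initially W is O(epsilon) and v = v0.\<close>
  define W1 where "W1 = - (p / q) * v0"
  have pq: "0 < p / q" using signs by (simp add: divide_neg_neg)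
  have W1: "W1 < 0" using mult_pos_pos[OF pq par(4)] unfolding W1_def mult_minus_left by linarith
  have S0: "0 < S" using S_w_pos par by blast
  define ta where "ta = stick_clock S de l (1 / de)"
  define We where "We = e_fun al mu de th0 * v0"
  have We_eq: "- W1 / l * sqrt (quad S de (- l)) * exp (- (de * S / 2) * ta) = We"
  proof -
    have "sqrt (quad S de (- l)) = l * sqrt ((S - p) / (- p))"
      unfolding quad_neg_root[OF eigval_square[OF signs(1)] signs(1)] real_sqrt_mult
      using l_pos by (simp only: real_sqrt_abs abs_of_pos mult.commute)
    then have "- W1 / l * sqrt (quad S de (- l)) * exp (- (de * S / 2) * ta)
        = (p / q * sqrt ((S - p) / (- p)) * exp (- (S / 2) * (de * ta))) * v0"
      using l_pos by (simp add: W1_def mult_ac)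
    then show ?thesis unfolding We_def e_fun_eq[OF par(1,2,3) signs(1)] e_real_def ta_def .
  qed
  obtain Yb Wb where lim: "stick_limit S de (W1 / l) W1 We ta Yb Wb"
    using stick_limit_exists[OF S0 par(3) l_pos W1] unfolding ta_def[symmetric] We_eq by blast
  then have ta: "0 < ta" and We: "0 < We" and Yb0: "\<And>R. continuous_on {0..R} Yb" "\<And>R. continuous_on {0..R} Wb"
    and Yneg: "\<And>t. 0 \<le> t \<Longrightarrow> t \<le> ta \<Longrightarrow> Yb t < 0" and late: "\<And>t. ta \<le> t \<Longrightarrow> Wb t = We \<and> Yb t = We * (t - ta - de)"
    unfolding stick_limit_def by blast+
  \<comment> \<open>The limit motion reaches Y = 0 at ta + de. One more unit of time gives Yb = We >
    0, which forces a zero of the true Y.\<close>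
  define R where "R = ta + de + 1"
  have R: "0 < R" "ta < R" using ta par by (auto simp: R_def)
  \<comment> \<open>At the end of slip W is off by at most CA h; solving W - l Y = O(h) for Y costs
    at most 2 CA h / l.\<close>
  define KB where "KB = CA + 2 * CA / l"
  have KB: "0 \<le> KB" "CA \<le> KB" "2 * CA / l \<le> KB" using CA l_pos by (auto simp: KB_def)
  obtain CB where CB: "0 < CB" and stick: "\<forall>et T Y W ph v. 0 \<le> et \<and> et \<le> 1 \<and> T \<le> R \<and> \<bar>Y 0 - W1 / l\<bar> \<le> KB * et \<and> \<bar>W 0 - W1\<bar> \<le> KB * et \<longrightarrow>
    stick_traj S ka kph Sph de et T Y W ph v \<longrightarrow>
    (\<forall>t\<in>{0..T}. \<bar>v t\<bar> \<le> et \<and> \<bar>Y t - Yb t\<bar> \<le> CB * et \<and> \<bar>W t - Wb t\<bar> \<le> CB * et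
      \<and> \<bar>ph t - ph 0 - Sph / S * (W t - W 0)\<bar> \<le> CB * et)"
    using stick_phase[OF S0 par(3) KB(1) less_imp_le[OF R(1)] lim, of ka kph Sph] by blast
  obtain BM where BM: "\<And>t. 0 \<le> t \<Longrightarrow> t \<le> R \<Longrightarrow> \<bar>Yb t\<bar> \<le> BM \<and> \<bar>Wb t\<bar> \<le> BM"
  proof -
    have "bounded (Yb ` {0..R})" "bounded (Wb ` {0..R})"
      by (intro compact_imp_bounded compact_continuous_image Yb0 compact_Icc)+
    then obtain a b where ab: "\<forall>x\<in>Yb ` {0..R}. norm x \<le> a" "\<forall>x\<in>Wb ` {0..R}. norm x \<le> b"
      unfolding bounded_iff by blast
    show thesis by (rule that[of "max a b"]) (use ab in \<open>auto simp: le_max_iff_disj\<close>)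
  qed
  \<comment> \<open>A uniform gap between the limit orbit and Y = 0 up to \<open>ta\<close>, so that
    the true Y cannot vanish before the end of contact of the limit.\<close>
  obtain m where m: "0 < m" "\<And>t. 0 \<le> t \<Longrightarrow> t \<le> ta \<Longrightarrow> Yb t \<le> - m"
  proof -
    have "\<exists>t\<in>{0..ta}. \<forall>u\<in>{0..ta}. Yb u \<le> Yb t"
      by (rule continuous_attains_sup) (use ta Yb0 in auto)
    then obtain t0 where "t0 \<in> {0..ta}" "\<forall>u\<in>{0..ta}. Yb u \<le> Yb t0" by blast
    then show thesis by (intro that[of "- Yb t0"]) (use Yneg[of t0] in auto)
  qed
  \<comment> \<open>Slip lasts at most (ln CA + ln (1 / ep)) / g. The additional ln (1 / ep)
    eventually exceeds ln CA / g + R and leaves time for sticking and return.\<close>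
  define K where "K = 1 / g + 1"
  define PhA where "PhA = CA + \<bar>c / q\<bar> * (\<bar>q / p\<bar> * (2 * CA))"
  define CM where "CM = CA + BM + CB"
  define kS where "kS = \<bar>Sph / S\<bar>"
  \<comment> \<open>The drift of phi while slipping, then while sticking, and 1 more to make the
    bound strict. In flight phi is constant.\<close>
  define M0 where "M0 = PhA + CB + kS * (BM + CB + CA) + 1"
  define M1 where "M1 = CM + 2"
  define M2 where "M2 = CM + de * CM + 1"
  define C where "C = M2 + CM"
  have BM0: "0 \<le> BM" using BM[of 0] R by auto
  have pos: "0 < K" "0 \<le> PhA" "0 \<le> kS" "0 < CM"
    using divide_pos_pos[OF zero_less_one g] CA CB BM0 by (auto simp: K_def PhA_def kS_def CM_def simp del: zero_less_divide_1_iff)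
  have "0 \<le> kS * (BM + CB + CA)" using pos BM0 CA CB by (intro mult_nonneg_nonneg) auto
  then have Mpos: "0 < M0" "0 < M1" "0 < M2" "PhA < M0" "PhA + CB + kS * (BM + CB + CA) < M0"
    using pos CB par by (auto simp: M0_def M1_def M2_def intro!: add_pos_pos)
  define D where "D = 1 + CA + CB + kS * (CA + CB)"
  have "0 \<le> kS * (CA + CB)" using pos CA CB by (intro mult_nonneg_nonneg) auto
  then have D: "1 \<le> D" "CB \<le> D" "CA + CB + kS * (CA + CB) \<le> D" "0 < D" using CA CB by (auto simp: D_def)
  have end_eq: "ph0 - c / q * v0 + Sph / S * (We - W1) = ph0 + (- (c / q) + Sph / S * (e_fun al mu de th0 + p / q)) * v0"
    unfolding We_def W1_def by (simp add: algebra_simps)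
  have main: "\<exists>ep0>0. \<forall>ep La Y W th ph v s.
     ep < ep0 \<and> La \<le> K * ln (1 / ep) \<and> fast_flow w10 M0 ep La Y W th ph v s \<longrightarrow>
       inside M0 M1 M2 La Y W th ph \<and> (La = K * ln (1 / ep) \<longrightarrow> (\<exists>T. fast_return C et La Y W th ph v T))"
    if et: "0 < et" for et
  proof -
    \<comment> \<open>\<open>h\<close> takes the role of \<open>et\<close> in the phase lemmas. The
      conditions with m and We protect the sign of Y up to ta and of W afterwards; D h \<le> et
      gives the requested accuracy.\<close>
    obtain h where h: "0 < h" "h \<le> etA" "h \<le> 1" "h \<le> rh" "h \<le> - q" "h \<le> coef_q al mu (-1) th0" "CB * h \<le> m / 2" "CB * h \<le> We / 2"
      "h \<le> We / 4" "D * h \<le> et"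
    proof -
      let ?f = "\<lambda>h. \<forall>a\<in>{etA, 1, rh, - q, coef_q al mu (-1) th0, m / 2 / CB, We / 2 / CB, We / 4, et / D}. h \<le> a"
      have "finite {etA, 1, rh, - q, coef_q al mu (-1) th0, m / 2 / CB, We / 2 / CB, We / 4, et / D}" by simp
      moreover have "\<forall>a\<in>{etA, 1, rh, - q, coef_q al mu (-1) th0, m / 2 / CB, We / 2 / CB, We / 4, et / D}. 0 < a"
        using etA rh(1) signs(3,4) m(1) CB We et D(4) by (simp add: divide_pos_pos)
      ultimately obtain h where "0 < h" "?f h"
        using Min_in[of "{etA, 1, rh, - q, coef_q al mu (-1) th0, m / 2 / CB, We / 2 / CB, We / 4, et / D}"] Min_le by (metis empty_not_insert)
      then have h: "0 < h" "h \<le> etA" "h \<le> 1" "h \<le> rh" "h \<le> - q" "h \<le> coef_q al mu (-1) th0" "h \<le> m / 2 / CB" "h \<le> We / 2 / CB"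
        "h \<le> We / 4" "h \<le> et / D" by (simp_all only: ball_simps)
      have "CB * h \<le> m / 2" "CB * h \<le> We / 2" "D * h \<le> et"
        using mult_left_mono[OF h(7), of CB] mult_left_mono[OF h(8), of CB] mult_left_mono[OF h(10), of D] CB D(4) by simp_all
      then show thesis using that[of h] h by blast
    qed
    let ?G = "gain M0"
    have "((\<lambda>ep::real. ep * ln (1 / ep)) \<longlongrightarrow> 0) (at_right 0)" by real_asymp
    then have "((\<lambda>ep. ?G * (K * (ep * ln (1 / ep)) + ep)) \<longlongrightarrow> ?G * (K * 0 + 0)) (at_right 0)"
      by (intro tendsto_intros)
    then have ev1: "eventually (\<lambda>ep. ?G * (K * (ep * ln (1 / ep)) + ep) < h) (at_right 0)"
      using h(1) by (intro order_tendstoD(2)[of _ 0]) auto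
    have "filterlim (\<lambda>ep::real. ln (1 / ep)) at_top (at_right 0)" by real_asymp
    then have ev2: "eventually (\<lambda>ep. ln CA / g + R \<le> ln (1 / ep)) (at_right (0::real))"
      unfolding filterlim_at_top by blast
    obtain ep0 where ep0: "0 < ep0" "\<And>ep. 0 < ep \<Longrightarrow> ep < ep0 \<Longrightarrow> ?G * (K * (ep * ln (1 / ep)) + ep) < h \<and> ln CA / g + R \<le> ln (1 / ep)"
      using eventually_conj[OF ev1 ev2] unfolding eventually_at_right_field by blast
    show ?thesis
    proof (intro exI[of _ ep0] conjI[OF ep0(1)] allI impI)
      fix ep La :: real and Y W th ph v s :: "real \<Rightarrow> real"
      assume "ep < ep0 \<and> La \<le> K * ln (1 / ep) \<and> fast_flow w10 M0 ep La Y W th ph v s"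
      then have ep: "0 < ep" "ep < ep0" and La: "0 \<le> La" "La \<le> K * ln (1 / ep)" and Rs: "rescaled al mu de ep La Y W th ph v s"
        and init: "Y 0 = 0" "W 0 = - (ep * n0)" "th 0 = th0" "ph 0 = ph0" "v 0 = v0"
        and bd: "\<forall>t. 0 \<le> t \<and> t \<le> La \<longrightarrow> \<bar>ph t - ph0\<bar> \<le> M0" by (simp_all add: fast_flow_def n0_def)
      have small: "?G * (ep * (La + 1)) \<le> h"
      proof -
        have "ep * La \<le> ep * (K * ln (1 / ep))" using ep La by (intro mult_left_mono) auto
        then have "ep * (La + 1) \<le> K * (ep * ln (1 / ep)) + ep" unfolding distrib_left by (simp only: mult.left_commute mult_1_right)
        then have "?G * (ep * (La + 1)) \<le> ?G * (K * (ep * ln (1 / ep)) + ep)" using gain_pos[of M0] by (intro mult_left_mono) auto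
        then show ?thesis using ep0(2)[OF ep] by linarith
      qed
      note est = rescaled_estimates[OF Rs init(3) less_imp_le[OF Mpos(1)] bd ep(1) La(1) small]
      note cont = rescaled_cont[OF Rs]
      \<comment> \<open>The first zero of v, or La when v stays positive so long; the second case
        cannot be excluded for short La.\<close>
      obtain T1 where T1: "0 \<le> T1" "T1 \<le> La" "\<forall>t. 0 \<le> t \<and> t < T1 \<longrightarrow> 0 < v t" "0 \<le> v T1" "v T1 = 0 \<or> T1 = La"
      proof (cases "\<exists>t. 0 \<le> t \<and> t \<le> La \<and> v t \<le> 0")
        case True
        then obtain t where t: "0 \<le> t" "t \<le> La" "v t \<le> 0" by blast
        have "continuous_on {0..t} (\<lambda>u. - v u)" by (intro continuous_intros continuous_on_subset[OF cont(5)]) (use t in auto)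
        then obtain z where "0 < z" "z \<le> t" "- v z = 0" "\<forall>u. 0 \<le> u \<and> u < z \<longrightarrow> - v u < 0"
          using first_zero[of 0 t "\<lambda>u. - v u"] t init(5) par(4) by auto
        then show thesis using t by (intro that[of z]) auto
      next
        case False
        then have "0 < v t" if "0 \<le> t" "t \<le> La" for t using that by (meson not_le)
        then show thesis using La(1) by (intro that[of La]) (auto intro: less_imp_le)
      qed
      have A: "W t < 0 \<and> Y t \<le> 0 \<and> (0 < t \<longrightarrow> Y t < 0) \<and> \<bar>Y t\<bar> \<le> CA \<and> \<bar>W t\<bar> \<le> CA
        \<and> \<bar>W t - p / q * (v t - v0)\<bar> \<le> CA * h \<and> \<bar>ph t - ph0 - c / q * (v t - v0)\<bar> \<le> CA * h
        \<and> \<bar>W t - l * Y t\<bar> \<le> CA * h \<and> ep * exp (g * t) \<le> CA" if "0 \<le> t" "t \<le> T1" for t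
      proof -
        have "t \<in> {0..T1}" using that by simp
        from slip[rule_format, OF h(2) rescaled_slip[OF Rs init less_imp_le[OF Mpos(1)] bd ep(1) La(1) small h(4) rh' T1(1-4)] this]
        show ?thesis unfolding init(4) .
      qed
      have CAh: "CA * h \<le> CA" "CB * h \<le> CB" using CA CB h by (simp_all add: mult_left_le)
      have PhA: "\<bar>ph t - ph0\<bar> \<le> PhA" if "0 \<le> t" "t \<le> T1" for t
      proof -
        note A = A[OF that]
        have "\<bar>p / q * (v t - v0)\<bar> \<le> 2 * CA" using A CAh by linarith
        then have "\<bar>q / p\<bar> * \<bar>p / q * (v t - v0)\<bar> \<le> \<bar>q / p\<bar> * (2 * CA)" by (rule mult_left_mono) simp
        moreover have "\<bar>q / p\<bar> * \<bar>p / q * (v t - v0)\<bar> = \<bar>v t - v0\<bar>" unfolding abs_mult[symmetric] using signs(1,3) by simp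
        ultimately have "\<bar>v t - v0\<bar> \<le> \<bar>q / p\<bar> * (2 * CA)" by simp
        then have "\<bar>c / q\<bar> * \<bar>v t - v0\<bar> \<le> \<bar>c / q\<bar> * (\<bar>q / p\<bar> * (2 * CA))" by (rule mult_left_mono) simp
        then have "\<bar>c / q * (v t - v0)\<bar> \<le> \<bar>c / q\<bar> * (\<bar>q / p\<bar> * (2 * CA))" by (simp only: abs_mult)
        then show ?thesis unfolding PhA_def using A CAh by linarith
      qed
      have cA: "scaled_contact de Y W t \<le> CM + de * CM \<and> \<bar>Y t\<bar> \<le> CM \<and> \<bar>W t\<bar> \<le> CM" if "0 \<le> t" "t \<le> T1" for t
      proof -
        have "\<bar>Y t\<bar> \<le> CM" "\<bar>W t\<bar> \<le> CM" using A[OF that] BM0 CB by (auto simp: CM_def)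
        then show ?thesis using scaled_contact_le[of Y t CM W CM de] par by simp
      qed
      have T1R: "T1 + R \<le> K * ln (1 / ep)"
      proof -
        have "exp (g * T1) \<le> CA / ep" using A[of T1] T1 ep by (simp add: pos_le_divide_eq mult.commute)
        then have "g * T1 \<le> ln (CA / ep)" using CA ep by (simp add: ln_ge_iff)
        also have "ln (CA / ep) = ln CA + ln (1 / ep)" using CA ep by (simp add: ln_div)
        finally have "T1 \<le> (ln CA + ln (1 / ep)) / g" using g by (simp add: pos_le_divide_eq mult.commute)
        also have "\<dots> = ln CA / g + 1 / g * ln (1 / ep)" by (simp add: add_divide_distrib)
        finally show ?thesis using ep0(2)[OF ep] distrib_right[of "1 / g" 1 "ln (1 / ep)"] unfolding K_def by linarith
      qed
      have B: "\<bar>v (u + T1)\<bar> \<le> h \<and> \<bar>Y (u + T1) - Yb u\<bar> \<le> CB * h \<and> \<bar>W (u + T1) - Wb u\<bar> \<le> CB * h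
        \<and> \<bar>ph (u + T1) - ph T1 - Sph / S * (W (u + T1) - W T1)\<bar> \<le> CB * h \<and> \<bar>W T1 - W1\<bar> \<le> CA * h
        \<and> \<bar>ph T1 - ph0 + c / q * v0\<bar> \<le> CA * h"
        if vT: "v T1 = 0" and u: "0 \<le> u" "u \<le> R" "u + T1 \<le> La" for u
      proof -
        note A = A[OF T1(1) order_refl, unfolded vT]
        have a: "\<bar>W T1 - W1\<bar> \<le> CA * h" using A by (simp add: W1_def)
        moreover have b: "\<bar>ph T1 - ph0 + c / q * v0\<bar> \<le> CA * h" using A by simp
        moreover have "\<bar>Y T1 - W1 / l\<bar> \<le> KB * h"
        proof -
          have "l * (Y T1 - W1 / l) = l * Y T1 - W1" using l_pos by (simp add: right_diff_distrib)
          then have "\<bar>l * (Y T1 - W1 / l)\<bar> \<le> 2 * (CA * h)" using A a by linarith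
          then have "l * \<bar>Y T1 - W1 / l\<bar> \<le> 2 * (CA * h)" using l_pos by (simp add: abs_mult)
          then have "\<bar>Y T1 - W1 / l\<bar> \<le> 2 * (CA * h) / l" using l_pos by (simp only: pos_le_divide_eq mult.commute)
          then have "\<bar>Y T1 - W1 / l\<bar> \<le> 2 * CA / l * h" by simp
          also have "\<dots> \<le> KB * h" using KB h by (intro mult_right_mono) auto
          finally show ?thesis .
        qed
        moreover have "\<bar>W T1 - W1\<bar> \<le> KB * h"
        proof -
          have "CA * h \<le> KB * h" using KB h by (intro mult_right_mono) auto
          then show ?thesis using a by linarith
        qed
        ultimately show ?thesis
          using stick[rule_format, OF _ rescaled_stick[OF Rs init(3) less_imp_le[OF Mpos(1)] bd ep(1) La(1) small h(5,6) T1(1) vT u(1,3)], of u] h u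
          by simp
      qed
      have Bb: "\<bar>Y (u + T1)\<bar> \<le> CM \<and> \<bar>W (u + T1)\<bar> \<le> CM \<and> scaled_contact de Y W (u + T1) \<le> CM + de * CM \<and> \<bar>ph (u + T1) - ph0\<bar> < M0
         \<and> (Y (u + T1) < 0 \<or> 0 < W (u + T1)) \<and> (u \<le> ta \<longrightarrow> Y (u + T1) < 0)"
        if vT: "v T1 = 0" and u: "0 \<le> u" "u \<le> R" "u + T1 \<le> La" for u
      proof -
        note B = B[OF that]
        have Y: "\<bar>Y (u + T1)\<bar> \<le> CM" and W: "\<bar>W (u + T1)\<bar> \<le> BM + CB" using B BM[OF u(1,2)] CAh CA by (auto simp: CM_def)
        have W': "\<bar>W (u + T1)\<bar> \<le> CM" using W CA by (simp add: CM_def)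
        have "\<bar>W (u + T1) - W T1\<bar> \<le> BM + CB + CA" using W A[of T1] T1 by auto
        then have "kS * \<bar>W (u + T1) - W T1\<bar> \<le> kS * (BM + CB + CA)" using pos by (intro mult_left_mono)
        then have "\<bar>Sph / S * (W (u + T1) - W T1)\<bar> \<le> kS * (BM + CB + CA)" unfolding kS_def by (simp only: abs_mult)
        then have "\<bar>ph (u + T1) - ph0\<bar> < M0" using B PhA[OF T1(1) order_refl] CAh Mpos(5) by linarith
        moreover have n: "Y (u + T1) < 0" if "u \<le> ta" using B m(2)[OF u(1) that] h(7) m(1) by linarith
        moreover have "0 < W (u + T1)" if "ta \<le> u" using B late[OF that] h(8) We by linarith
        ultimately show ?thesis using Y W' scaled_contact_le[of Y "u + T1" CM W CM de, OF Y W'] par by (cases "u \<le> ta") (simp_all add: less_imp_le)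
      qed
      \<comment> \<open>Y and W are at least We / 2 at R + T1, so \<open>flight\<close> takes over:
        without contact phi does not change and W changes by at most h.\<close>
      have Fl: "0 < W t \<and> \<bar>W t\<bar> \<le> CM + 1 \<and> scaled_contact de Y W t = 0 \<and> \<bar>ph t - ph0\<bar> < M0"
        if vT: "v T1 = 0" and t: "R + T1 \<le> t" "t \<le> La" for t
      proof -
        have RT: "R + T1 \<le> La" "0 \<le> R + T1" using t R T1 by auto
        note B = B[OF vT less_imp_le[OF R(1)] order_refl RT(1)]
        note Bb = Bb[OF vT less_imp_le[OF R(1)] order_refl RT(1)]
        have lR: "Wb R = We" "Yb R = We" using late[of R] R by (auto simp: R_def)
        have WR: "We / 2 \<le> W (R + T1)" "We / 2 \<le> Y (R + T1)" using B lR h(8) by linarith+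
        let ?E = "ep * (1 + (\<bar>ph0\<bar> + M0)^2)"
        have E1: "?E * (t - (R + T1)) \<le> h"
        proof -
          have "?E * (t - (R + T1)) \<le> ?E * La" using est(1) t RT by (intro mult_left_mono) auto
          then show ?thesis using est(3) by linarith
        qed
        have fl: "W (R + T1) / 2 \<le> W u \<and> Y (R + T1) + W (R + T1) / 2 * (u - (R + T1)) \<le> Y u \<and> scaled_contact de Y W u = 0"
          if u: "R + T1 \<le> u" "u \<le> t" for u
        proof (rule flight[where b = t and E = ?E and be = "\<lambda>u. ep * coef_b (th u) (ph u)" and P = "\<lambda>u. coef_p al mu (s u) (th u)"])
          show "continuous_on {R + T1..t} W" by (rule continuous_on_subset[OF cont(2)]) (use RT t in auto)
          show "- ?E \<le> ep * coef_b (th u) (ph u)" if "R + T1 \<le> u" "u \<le> t" for u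
            using est(6)[of u] that RT t by (auto simp: abs_le_iff)
          show "?E * (t - (R + T1)) \<le> W (R + T1) / 2" using E1 WR h(9) by linarith
          show "0 < W (R + T1)" "0 \<le> Y (R + T1)" using WR We by linarith+
        qed (use est(1) RT t par u rescaled_int(1,2)[OF Rs] in auto)
        have "ph t - ph (R + T1) = 0"
        proof -
          have "((\<lambda>_. 0) has_integral ph t - ph (R + T1)) {R + T1..t}"
            by (rule has_integral_eq[OF _ rescaled_int(4)[OF Rs RT(2) t]]) (use fl in auto)
          then show ?thesis by (rule has_integral_unique) (rule has_integral_0)
        qed
        moreover have "\<bar>W t - W (R + T1)\<bar> \<le> h"
        proof -
          have "((\<lambda>u. ep * coef_b (th u) (ph u)) has_integral W t - W (R + T1)) {R + T1..t}"
            by (rule has_integral_eq[OF _ rescaled_int(2)[OF Rs RT(2) t]]) (use fl in auto)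
          then have "\<bar>W t - W (R + T1)\<bar> \<le> integral {R + T1..t} (\<lambda>_. ?E)"
            by (rule has_integral_abs_le) (use est(6) RT t in auto)
          also have "\<dots> = ?E * (t - (R + T1))" using t by simp
          also have "\<dots> \<le> h" by (rule E1)
          finally show ?thesis .
        qed
        ultimately show ?thesis using fl[of t] t WR We Bb h(3) by auto
      qed
      have at_end: "inside M0 M1 M2 La Y W th ph"
      proof -
        consider "T1 = La" | "v T1 = 0" "La \<le> R + T1" | "v T1 = 0" "R + T1 \<le> La" using T1(5) by linarith
        then show ?thesis
        proof cases
          case 1
          then show ?thesis using A[of La] PhA[of La] cA[of La] La Mpos(4) unfolding inside_def M1_def M2_def by auto
        next
          case 2
          then show ?thesis using Bb[of "La - T1"] T1 unfolding inside_def M1_def M2_def by auto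
        next
          case 3
          then show ?thesis using Fl[of La] Mpos(3) unfolding inside_def M1_def by auto
        qed
      qed
      show "inside M0 M1 M2 La Y W th ph \<and> (La = K * ln (1 / ep) \<longrightarrow> (\<exists>T. fast_return C et La Y W th ph v T))"
      proof (rule conjI[OF at_end], rule impI)
        assume Laeq: "La = K * ln (1 / ep)"
        then have RT: "T1 + R \<le> La" using T1R by simp
        then have vT: "v T1 = 0" using T1(5) R by auto
        have le: "u + T1 \<le> La" if "u \<le> R" for u using that RT by simp
        \<comment> \<open>The return falls after \<open>ta\<close>, where the limit velocity is
          already constant. Hence Wb z = We, although z itself is not computed.\<close>
        have "\<exists>z. ta < z \<and> z \<le> R \<and> Y (z + T1) = 0 \<and> (\<forall>u. ta \<le> u \<and> u < z \<longrightarrow> Y (u + T1) < 0)"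
        proof (rule first_zero[of ta R "\<lambda>u. Y (u + T1)"])
          show "continuous_on {ta..R} (\<lambda>u. Y (u + T1))"
            by (rule continuous_on_compose2[OF cont(1)]) (use RT ta T1 in \<open>auto intro!: continuous_intros\<close>)
          show "Y (ta + T1) < 0" using Bb[OF vT _ _ le, of ta] ta R by auto
          have "Yb R = We" using late[of R] R by (auto simp: R_def)
          then show "0 \<le> Y (R + T1)" using B[OF vT _ _ le, of R] R h(8) We by auto
        qed (use R in auto)
        then obtain z where z: "ta < z" "z \<le> R" "Y (z + T1) = 0" "\<And>u. ta \<le> u \<Longrightarrow> u < z \<Longrightarrow> Y (u + T1) < 0" by blast
        have z0: "0 \<le> z" using z ta by simp
        note Bz = B[OF vT z0 z(2) le[OF z(2)]]
        have Wbz: "Wb z = We" using late[of z] z by simp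
        have hD: "h \<le> et" "CB * h \<le> et" "CA * h + CB * h + kS * (CA * h + CB * h) \<le> et"
        proof -
          have "1 * h \<le> D * h" "CB * h \<le> D * h" "(CA + CB + kS * (CA + CB)) * h \<le> D * h"
            using D h(1) by (intro mult_right_mono; simp)+
          then show "h \<le> et" "CB * h \<le> et" "CA * h + CB * h + kS * (CA * h + CB * h) \<le> et" using h(10) by (simp_all add: algebra_simps)
        qed
        show "\<exists>T. fast_return C et La Y W th ph v T" unfolding fast_return_def We_def[symmetric] end_eq[symmetric]
        proof (intro exI[of _ "z + T1"] conjI allI impI)
          show "0 < z + T1" "z + T1 \<le> La" "Y (z + T1) = 0" using z T1 ta le[OF z(2)] by auto
          show "\<bar>W (z + T1) - We\<bar> \<le> et" using Bz hD(2) unfolding Wbz by linarith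
          show "\<bar>th (z + T1) - th0\<bar> \<le> et" using est(5)[of "z + T1"] z0 T1 le[OF z(2)] hD(1) by linarith
          show "\<bar>v (z + T1)\<bar> \<le> et" using Bz hD(1) by linarith
          show "\<bar>ph (z + T1) - (ph0 - c / q * v0 + Sph / S * (We - W1))\<bar> \<le> et"
          proof -
            have "\<bar>(W (z + T1) - W T1) - (We - W1)\<bar> \<le> CA * h + CB * h" using Bz unfolding Wbz by linarith
            then have "kS * \<bar>(W (z + T1) - W T1) - (We - W1)\<bar> \<le> kS * (CA * h + CB * h)" using pos by (intro mult_left_mono)
            then have "\<bar>Sph / S * ((W (z + T1) - W T1) - (We - W1))\<bar> \<le> kS * (CA * h + CB * h)" unfolding kS_def by (simp only: abs_mult)
            then have "\<bar>Sph / S * (W (z + T1) - W T1) - Sph / S * (We - W1)\<bar> \<le> kS * (CA * h + CB * h)" by (simp only: right_diff_distrib)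
            then show ?thesis using Bz hD(3) by linarith
          qed
        next
          fix t assume t: "0 < t \<and> t < z + T1"
          show "Y t < 0"
          proof (cases "t \<le> T1")
            case True
            then show ?thesis using A[of t] t by auto
          next
            case False
            show ?thesis
            proof (cases "t - T1 \<le> ta")
              case True
              then show ?thesis using Bb[OF vT _ _ le, of "t - T1"] False R by auto
            next
              case F2: False
              then show ?thesis using z(4)[of "t - T1"] t by auto
            qed
          qed
        next
          fix t assume t: "0 \<le> t \<and> t \<le> z + T1"
          have "0 \<le> de * CM" using par pos by simp
          then have C: "CM \<le> C" "CM + de * CM \<le> C" using pos by (auto simp: C_def M2_def)
          have b: "\<bar>Y t\<bar> \<le> CM \<and> \<bar>W t\<bar> \<le> CM \<and> scaled_contact de Y W t \<le> CM + de * CM"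
          proof (cases "t \<le> T1")
            case True
            then show ?thesis using cA[of t] t by auto
          next
            case False
            then show ?thesis using Bb[OF vT _ _ le, of "t - T1"] z(2) t by auto
          qed
          show "\<bar>Y t\<bar> \<le> C" "\<bar>W t\<bar> \<le> C" "scaled_contact de Y W t \<le> C" using b C by linarith+
        qed
      qed
    qed
  qed
  show ?thesis
    by (rule exI[of _ K], rule conjI[OF pos(1)], rule exI[of _ M0], rule conjI[OF Mpos(1)], rule exI[of _ M1], rule conjI[OF Mpos(2)],
      rule exI[of _ M2], rule conjI[OF Mpos(3)], rule exI[of _ C], rule allI, rule impI, rule main, assumption)
qed

end

section \<open>Lift-off\<close>

text \<open>U = w + lm y is the expanding coordinate, and w \<ge> U while y \<le> 0. It grows at
  least at the rate C0: in contact U' = l U + be, and without contact w \<ge> 0 leaves U' \<ge> be.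
  Integrating twice gives the parabola.\<close>

lemma lift_off:
  fixes y w be :: "real \<Rightarrow> real"
  assumes par: "p < 0" "0 < l" "0 < lm" "l * lm = - p" "l - lm = - de * p" "0 < de"
    and b1: "0 < b1" "0 < l * w0 + b1" and T: "0 < T"
    and cont: "continuous_on {0..T} y" "continuous_on {0..T} w" and init: "y 0 = 0" "w 0 = w0"
    and y': "\<And>t. 0 < t \<Longrightarrow> t < T \<Longrightarrow> (y has_real_derivative w t) (at t)"
    and w': "\<And>t. 0 < t \<Longrightarrow> t < T \<Longrightarrow> (w has_real_derivative be t + p * max (- y t - de * w t) 0) (at t)"
    and be: "\<And>t. 0 < t \<Longrightarrow> t < T \<Longrightarrow> b1 \<le> be t" and neg: "\<And>t. 0 \<le> t \<Longrightarrow> t \<le> T \<Longrightarrow> y t \<le> 0"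
  defines "C0 \<equiv> min b1 (l * w0 + b1)"
  shows "w0 * T + C0 * T^2 / 2 \<le> y T" and "y T = 0 \<Longrightarrow> 0 < w T"
proof -
  define U where "U t = w t + lm * y t" for t
  define U' where "U' t = be t + p * max (- y t - de * w t) 0 + lm * w t" for t
  have C0: "0 < C0" "C0 \<le> b1" "C0 \<le> l * w0 + b1" using b1 by (auto simp: C0_def)
  have U0: "U 0 = w0" by (simp add: U_def init)
  have DU: "(U has_real_derivative U' t) (at t)" if "0 < t" "t < T" for t
    unfolding U_def[abs_def] U'_def using y'[OF that] w'[OF that] by (auto intro!: derivative_eq_intros)
  have cU: "continuous_on {0..T} U" unfolding U_def[abs_def] by (intro continuous_intros cont)
  \<comment> \<open>For y \<le> 0 a vanishing contact force means w \<ge> 0, so the term lm w in U'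
    can only help.\<close>
  have U'_cases: "U' t = l * U t + be t \<or> b1 \<le> U' t" if t: "0 < t" "t < T" for t
  proof (cases "0 < - y t - de * w t")
    case True
    have "p * (- y t - de * w t) + lm * w t = (- p) * y t + (- de * p + lm) * w t" by (simp add: algebra_simps)
    also have "- de * p + lm = l" using par(5) by simp
    also have "- p = l * lm" using par(4) by simp
    finally show ?thesis unfolding U'_def U_def using True by (simp add: algebra_simps)
  next
    case False
    then have "0 \<le> de * w t" using neg[of t] t by simp
    then have "0 \<le> w t" using par(6) by (simp add: zero_le_mult_iff)
    then have "0 \<le> lm * w t" using par by simp
    then show ?thesis using False be[OF t] by (auto simp: U'_def)
  qed
  \<comment> \<open>U does not fall below its initial value, even a negative one, because l U + b1
    is positive there. This is the position above the stable manifold.\<close>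
  have Uw: "w0 \<le> U t" if t: "0 \<le> t" "t \<le> T" for t
  proof (rule interval_continuation[where P = "\<lambda>t. w0 \<le> U t" and T = T])
    fix t assume t: "0 < t" "t \<le> T" and P: "\<And>s. 0 \<le> s \<Longrightarrow> s < t \<Longrightarrow> w0 \<le> U s"
    have "(U \<longlongrightarrow> U t) (at_left t)"
      using continuous_on_Icc_at_leftD[OF continuous_on_subset[OF cU]] t by auto
    moreover have "eventually (\<lambda>s. w0 \<le> U s) (at_left t)"
      using eventually_at_left_real[OF t(1)] by eventually_elim (use P in auto)
    ultimately show "w0 \<le> U t" by (rule tendsto_lowerbound) simp
  next
    fix t assume t: "0 \<le> t" "t < T" and P: "\<And>s. 0 \<le> s \<Longrightarrow> s \<le> t \<Longrightarrow> w0 \<le> U s"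
    have "l * w0 \<le> l * U t" using P[of t] t par by (intro mult_left_mono) auto
    then have "0 < l * U t + b1" using b1 by simp
    moreover have "continuous_on {0..T} (\<lambda>s. l * U s + b1)" by (intro continuous_intros cU)
    ultimately obtain e where e: "0 < e" "\<forall>s. t \<le> s \<and> s < t + e \<and> s \<le> T \<longrightarrow> 0 < l * U s + b1"
      using positive_right_neighbourhood t by blast
    have "w0 \<le> U s" if s: "t < s" "s < t + e" "s \<le> T" for s
    proof -
      have "0 - 0 \<le> U s - U t"
      proof (rule deriv_le_increment[where f = "\<lambda>_. 0" and g = U and a = t and b = s and f' = "\<lambda>_. 0" and g' = U'])
        fix x assume x: "t < x" "x < s"
        then have x': "0 < x" "x < T" using t s by auto
        show "(U has_real_derivative U' x) (at x)" by (rule DU[OF x'])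
        show "0 \<le> U' x" using U'_cases[OF x'] be[OF x'] e(2)[rule_format, of x] x s b1 by auto
      qed (use s t in \<open>auto intro: continuous_on_subset[OF cU]\<close>)
      then show ?thesis using P[of t] t by simp
    qed
    then show "\<exists>e>0. \<forall>s. t < s \<and> s < t + e \<and> s \<le> T \<longrightarrow> w0 \<le> U s" using e(1) by blast
  qed (use t U0 in auto)
  have U'C: "C0 \<le> U' t" if t: "0 < t" "t < T" for t
  proof -
    have "l * w0 \<le> l * U t" using Uw[of t] t par by (intro mult_left_mono) auto
    then show ?thesis using U'_cases[OF t] be[OF t] C0 by auto
  qed
  have Uinc: "C0 * t - C0 * r \<le> U t - U r" if "0 \<le> r" "r \<le> t" "t \<le> T" for r t
    by (rule deriv_le_increment[where f' = "\<lambda>_. C0" and g' = U' and f = "\<lambda>t. C0 * t" and g = U and a = r and b = t])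
      (use that U'C DU in \<open>auto intro!: continuous_intros continuous_on_subset[OF cU] derivative_eq_intros\<close>)
  have "(w0 * T + C0 * T^2 / 2) - (w0 * 0 + C0 * 0^2 / 2) \<le> y T - y 0"
  proof (rule deriv_le_increment[where f = "\<lambda>t. w0 * t + C0 * t^2 / 2" and f' = "\<lambda>t. w0 + C0 * t" and g = y and g' = w and a = 0 and b = T])
    fix x assume x: "0 < x" "x < T"
    show "((\<lambda>t. w0 * t + C0 * t^2 / 2) has_real_derivative w0 + C0 * x) (at x)" by (auto intro!: derivative_eq_intros)
    show "(y has_real_derivative w x) (at x)" by (rule y'[OF x])
    have "lm * y x \<le> 0" using neg[of x] x par by (simp add: mult_nonneg_nonpos)
    then show "w0 + C0 * x \<le> w x" using Uinc[of 0 x] x U0 by (simp add: U_def)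
  qed (use T cont in \<open>auto intro!: continuous_intros\<close>)
  then show "w0 * T + C0 * T^2 / 2 \<le> y T" using init by simp
  assume yT: "y T = 0"
  show "0 < w T"
  proof (rule ccontr)
    assume "\<not> 0 < w T"
    then have UT: "U T \<le> 0" by (simp add: U_def yT)
    \<comment> \<open>If w T were nonpositive, U would be negative before T by its strict growth,
      and (exp (lm t) y)' = exp (lm t) U would give y T < 0.\<close>
    have "exp (lm * T) * y T < exp (lm * 0) * y 0"
    proof (rule DERIV_neg_imp_decreasing_open[OF T])
      fix x assume x: "0 < x" "x < T"
      have "((\<lambda>t. exp (lm * t) * y t) has_real_derivative exp (lm * x) * U x) (at x)"
        using y'[OF x] by (auto intro!: derivative_eq_intros simp: U_def algebra_simps)
      moreover have "U x < 0"
      proof -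
        have "C0 * x < C0 * T" using x C0 by simp
        then show ?thesis using Uinc[of x T] x UT by simp
      qed
      then have "exp (lm * x) * U x < 0" by (simp add: mult_pos_neg)
      ultimately show "\<exists>z. ((\<lambda>t. exp (lm * t) * y t) has_real_derivative z) (at x) \<and> z < 0" by blast
    qed (intro continuous_intros cont)
    then show False by (simp add: yT init)
  qed
qed

text \<open>The cone w \<ge> b1 t / 4 is propagated. Inside it y and w are nonnegative, so the
  contact vanishes, and by continuity it stays weak enough a little longer to have w' \<ge> b1 /
  4.\<close>

lemma lift_off_from_rest:
  fixes y w be :: "real \<Rightarrow> real"
  assumes par: "0 < de" and b1: "0 < b1"
    and cont: "continuous_on {0..T} y" "continuous_on {0..T} w" and init: "y 0 = 0" "w 0 = 0"
    and y': "\<And>t. 0 < t \<Longrightarrow> t < T \<Longrightarrow> (y has_real_derivative w t) (at t)"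
    and w': "\<And>t. 0 < t \<Longrightarrow> t < T \<Longrightarrow> (w has_real_derivative be t + p * max (- y t - de * w t) 0) (at t)"
    and be: "\<And>t. 0 < t \<Longrightarrow> t < T \<Longrightarrow> b1 \<le> be t" and t: "0 \<le> t" "t \<le> T"
  shows "b1 / 4 * t \<le> w t" and "b1 / 8 * t^2 \<le> y t"
proof -
  have ylow: "b1 / 8 * t^2 \<le> y t" if t: "0 \<le> t" "t \<le> T" and P: "\<And>s. 0 \<le> s \<Longrightarrow> s \<le> t \<Longrightarrow> b1 / 4 * s \<le> w s" for t
  proof -
    have "b1 / 8 * t^2 - b1 / 8 * 0^2 \<le> y t - y 0"
    proof (rule deriv_le_increment[where f = "\<lambda>t. b1 / 8 * t^2" and f' = "\<lambda>t. b1 / 4 * t" and g = y and g' = w and a = 0 and b = t])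
      fix x assume x: "0 < x" "x < t"
      show "((\<lambda>t. b1 / 8 * t^2) has_real_derivative b1 / 4 * x) (at x)" by (auto intro!: derivative_eq_intros)
      show "(y has_real_derivative w x) (at x)" by (rule y') (use x t in auto)
      show "b1 / 4 * x \<le> w x" using P[of x] x by auto
    qed (use t in \<open>auto intro!: continuous_intros continuous_on_subset[OF cont(1)]\<close>)
    then show ?thesis by (simp add: init)
  qed
  define F where "F t = max (- y t - de * w t) 0" for t
  have cF: "continuous_on {0..T} F" unfolding F_def[abs_def] by (intro continuous_intros cont)
  have P: "b1 / 4 * t \<le> w t" if t: "0 \<le> t" "t \<le> T" for t
  proof (rule interval_continuation[where P = "\<lambda>t. b1 / 4 * t \<le> w t" and T = T])
    fix t assume t: "0 < t" "t \<le> T" and P: "\<And>s. 0 \<le> s \<Longrightarrow> s < t \<Longrightarrow> b1 / 4 * s \<le> w s"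
    have "continuous_on {0..t} (\<lambda>s. w s - b1 / 4 * s)" by (intro continuous_intros continuous_on_subset[OF cont(2)]) (use t in auto)
    then have "((\<lambda>s. w s - b1 / 4 * s) \<longlongrightarrow> w t - b1 / 4 * t) (at_left t)"
      using continuous_on_Icc_at_leftD t(1) by blast
    moreover have "eventually (\<lambda>s. 0 \<le> w s - b1 / 4 * s) (at_left t)"
      using eventually_at_left_real[OF t(1)] by eventually_elim (use P in auto)
    ultimately have "0 \<le> w t - b1 / 4 * t" by (rule tendsto_lowerbound) simp
    then show "b1 / 4 * t \<le> w t" by simp
  next
    fix t assume t: "0 \<le> t" "t < T" and P: "\<And>s. 0 \<le> s \<Longrightarrow> s \<le> t \<Longrightarrow> b1 / 4 * s \<le> w s"
    have "0 \<le> b1 / 8 * t^2" "0 \<le> b1 / 4 * t" using b1 t by simp_all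
    then have "0 \<le> y t" "0 \<le> w t" using ylow[OF t(1) less_imp_le[OF t(2)] P] P[OF t(1) order_refl] by linarith+
    moreover from this have "0 \<le> de * w t" using par by simp
    ultimately have "F t = 0" by (simp add: F_def)
    \<comment> \<open>Where this expression stays positive, the contact takes away less than three
      quarters of b1, and w' keeps at least b1 / 4.\<close>
    then have "0 < 3 / 4 * b1 + p * F t" using b1 by simp
    moreover have "continuous_on {0..T} (\<lambda>s. 3 / 4 * b1 + p * F s)" by (intro continuous_intros cF)
    ultimately obtain e where e: "0 < e" "\<forall>s. t \<le> s \<and> s < t + e \<and> s \<le> T \<longrightarrow> 0 < 3 / 4 * b1 + p * F s"
      using positive_right_neighbourhood t by blast
    have "b1 / 4 * s \<le> w s" if s: "t < s" "s < t + e" "s \<le> T" for s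
    proof -
      have "b1 / 4 * s - b1 / 4 * t \<le> w s - w t"
      proof (rule deriv_le_increment[where f = "\<lambda>t. b1 / 4 * t" and f' = "\<lambda>_. b1 / 4" and g = w and g' = "\<lambda>t. be t + p * F t" and a = t and b = s])
        fix x assume x: "t < x" "x < s"
        then have x': "0 < x" "x < T" using t s by auto
        show "(w has_real_derivative be x + p * F x) (at x)" unfolding F_def by (rule w'[OF x'])
        show "b1 / 4 \<le> be x + p * F x" using be[OF x'] e(2)[rule_format, of x] x s by auto
      qed (use s t in \<open>auto intro!: continuous_intros continuous_on_subset[OF cont(2)] derivative_eq_intros\<close>)
      then show ?thesis using P[of t] t by simp
    qed
    then show "\<exists>e>0. \<forall>s. t < s \<and> s < t + e \<and> s \<le> T \<longrightarrow> b1 / 4 * s \<le> w s" using e(1) by blast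
  qed (use t init in auto)
  show "b1 / 4 * t \<le> w t" by (rule P[OF t])
  show "b1 / 8 * t^2 \<le> y t" by (rule ylow[OF t]) (use P t in auto)
qed

lemma abs_coef_qc_le:
  assumes "0 < al" "0 < mu" "\<bar>s\<bar> \<le> 1"
  shows "\<bar>coef_q al mu s th\<bar> \<le> al + mu * (1 + al)" and "\<bar>coef_c al mu s th\<bar> \<le> al * (1 + mu)"
proof -
  have "\<bar>al * sin th * cos th\<bar> \<le> al * 1 * 1" unfolding abs_mult using assms by (intro mult_mono) auto
  moreover have "\<bar>s * mu * (1 + al * (sin th)^2)\<bar> \<le> 1 * mu * (1 + al)"
    unfolding abs_mult using assms by (intro mult_mono) (auto simp: abs_square_le_1)
  ultimately show "\<bar>coef_q al mu s th\<bar> \<le> al + mu * (1 + al)" unfolding coef_q_def by linarith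
  have "\<bar>s * mu * sin th\<bar> \<le> 1 * mu * 1" unfolding abs_mult using assms by (intro mult_mono) auto
  then have "\<bar>cos th - s * mu * sin th\<bar> \<le> 1 + mu" using abs_cos_le_one[of th] by linarith
  then show "\<bar>coef_c al mu s th\<bar> \<le> al * (1 + mu)" unfolding coef_c_def abs_mult using assms by simp
qed

context impact
begin

text \<open>On a fast time of fixed length the crude estimate is enough: initial data and forcing
  are O(epsilon), and Gronwall costs a constant factor. The logarithmic duration of the slip phase
  would turn that factor into a power of 1 / epsilon.\<close>

lemma rescaled_gronwall:
  assumes R: "rescaled al mu de ep La Y W th ph v s" and init: "Y 0 = 0" "\<bar>W 0\<bar> \<le> ep * k0"
    and M0: "0 \<le> M0" "\<forall>t. 0 \<le> t \<and> t \<le> La \<longrightarrow> \<bar>ph t - ph0\<bar> \<le> M0" and ep: "0 < ep" and La: "La \<le> K" and t: "0 \<le> t" "t \<le> La"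
  shows "\<bar>Y t\<bar> + \<bar>W t\<bar> \<le> ep * ((k0 + (1 + (\<bar>ph0\<bar> + M0)^2) * K) * exp ((1 + bound_p al mu * (1 + de)) * K))"
proof -
  define Ph where "Ph = 1 + (\<bar>ph0\<bar> + M0)^2"
  define cg where "cg = 1 + bound_p al mu * (1 + de)"
  define Z where "Z t = \<bar>Y t\<bar> + \<bar>W t\<bar>" for t
  note cont = rescaled_cont[OF R]
  have bp: "0 \<le> bound_p al mu" using par by (simp add: bound_p_def)
  have pos: "1 \<le> Ph" "0 \<le> cg" using bp par by (auto simp: Ph_def cg_def)
  have cZ: "continuous_on {0..La} Z" unfolding Z_def[abs_def] by (intro continuous_intros cont)
  have F: "scaled_contact de Y W u \<le> (1 + de) * Z u" for u
    using scaled_contact_le[of Y u "Z u" W "Z u" de] par by (simp add: Z_def distrib_right)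
  have "Z t \<le> (ep * (k0 + Ph * K)) * exp (cg * t)"
  proof (rule gronwall_integral[OF cZ pos(2)])
    fix t assume "t \<in> {0..La}"
    then have t: "0 \<le> t" "t \<le> La" by auto
    have sub: "{0..t} \<subseteq> {0..La}" using t by auto
    note c = cont[THEN continuous_on_subset, OF sub] and cZ' = continuous_on_subset[OF cZ sub]
    have iZ: "Z integrable_on {0..t}" by (rule integrable_continuous_real[OF cZ'])
    have "\<bar>Y t - Y 0\<bar> \<le> integral {0..t} Z"
      by (rule has_integral_abs_le[OF rescaled_int(1)[OF R _ t] cZ']) (auto simp: Z_def)
    moreover have "\<bar>W t - W 0\<bar> \<le> integral {0..t} (\<lambda>u. ep * Ph + (bound_p al mu * (1 + de)) * Z u)"
    proof (rule has_integral_abs_le[OF rescaled_int(2)[OF R order_refl t]])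
      fix u assume u: "u \<in> {0..t}"
      then have u': "0 \<le> u" "u \<le> La" using t by auto
      have "\<bar>ep * coef_b (th u) (ph u)\<bar> \<le> ep * Ph"
        unfolding abs_mult Ph_def using abs_coef_ab_le(2)[OF M0(2)[rule_format, OF conjI[OF u']]] ep by (intro mult_mono) auto
      moreover have "\<bar>coef_p al mu (s u) (th u) * scaled_contact de Y W u\<bar> \<le> bound_p al mu * ((1 + de) * Z u)"
        unfolding abs_mult using abs_coef_p_le[OF par(1,2) rescaled_sign(1)[OF R u']] F[of u] scaled_contact_nonneg[of de Y W u] bp
        by (intro mult_mono) auto
      ultimately show "\<bar>ep * coef_b (th u) (ph u) + coef_p al mu (s u) (th u) * scaled_contact de Y W u\<bar>
          \<le> ep * Ph + (bound_p al mu * (1 + de)) * Z u" by (simp add: mult.assoc)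
    qed (intro continuous_intros cZ')
    moreover have "integral {0..t} (\<lambda>u. ep * Ph + (bound_p al mu * (1 + de)) * Z u) = ep * Ph * t + (bound_p al mu * (1 + de)) * integral {0..t} Z"
    proof -
      have "((\<lambda>u. ep * Ph + (bound_p al mu * (1 + de)) * Z u) has_integral (t - 0) *\<^sub>R (ep * Ph) + (bound_p al mu * (1 + de)) * integral {0..t} Z) {0..t}"
        using t has_integral_const_real[of "ep * Ph" 0 t]
        by (intro has_integral_add has_integral_mult_right integrable_integral iZ) simp
      then show ?thesis by (simp add: integral_unique mult.commute)
    qed
    moreover have "ep * Ph * t \<le> ep * Ph * K" using ep pos t La by (intro mult_left_mono) auto
    moreover have "cg * integral {0..t} Z = integral {0..t} Z + (bound_p al mu * (1 + de)) * integral {0..t} Z"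
      unfolding cg_def distrib_right by simp
    moreover have "ep * (k0 + Ph * K) = ep * k0 + ep * Ph * K" by (simp add: algebra_simps)
    ultimately show "Z t \<le> ep * (k0 + Ph * K) + cg * integral {0..t} Z" unfolding Z_def using init by linarith
  qed (use t in auto)
  also have "\<dots> \<le> (ep * (k0 + Ph * K)) * exp (cg * K)"
  proof (rule mult_left_mono)
    show "exp (cg * t) \<le> exp (cg * K)" using pos t La by (simp add: mult_left_mono)
    have "0 \<le> ep * k0" using init(2) by linarith
    then have "0 \<le> k0" using ep by (simp add: zero_le_mult_iff)
    then show "0 \<le> ep * (k0 + Ph * K)" using ep pos t La by (intro mult_nonneg_nonneg add_nonneg_nonneg) auto
  qed
  finally show ?thesis by (simp add: Z_def Ph_def cg_def mult.assoc)
qed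

end

context impact
begin

text \<open>All deviations are O(epsilon) on a bounded fast time, so v stays positive, and division
  by epsilon gives a problem with forcing at least b1. The sign of \<open>w10\<close> decides
  whether lift-off is immediate or follows an excursion into y < 0.\<close>

lemma lift_off_trajectory:
  assumes w10: "- b0 / l < w10"
  shows "\<exists>K>0. \<exists>M0>0. \<exists>M1>0. \<exists>M2>0. \<exists>C>0. \<exists>ep0>0. \<forall>ep La Y W th ph v s.
     ep < ep0 \<and> La \<le> K \<and> fast_flow w10 M0 ep La Y W th ph v s \<longrightarrow>
       inside M0 M1 M2 La Y W th ph \<and> (La = K \<longrightarrow> (\<exists>T T'. fast_lift_off C ep La Y W T T'))"
proof -
  \<comment> \<open>The midpoint between max 0 (- l w10) and b0. It keeps b1 below b0, to absorb
    perturbations, and l w10 + b1 positive, to stay above the stable manifold.\<close>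
  define b1 where "b1 = max (b0 / 2) ((b0 - l * w10) / 2)"
  have lw: "0 < l * w10 + b0"
  proof -
    have "l * (- b0 / l) < l * w10" using w10 l_pos by (intro mult_strict_left_mono) auto
    then show ?thesis using l_pos by simp
  qed
  have b1: "0 < b1" "b1 < b0" "0 < l * w10 + b1" using lw signs(2) by (auto simp: b1_def max_def field_simps)
  define C0 where "C0 = min b1 (l * w10 + b1)"
  have C0: "0 < C0" using b1 by (simp add: C0_def)
  \<comment> \<open>The parabola w10 T + C0 T^2 / 2 has its positive root at 2 |w10| / C0 when w10 <
    0. One unit later it is positive, which contradicts y \<le> 0 up to then.\<close>
  define K where "K = 2 * (\<bar>w10\<bar> / C0) + 1"
  have K: "0 < K" "1 \<le> K" using C0 by (auto simp: K_def add_nonneg_pos)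
  define sg where "sg = (b0 - b1) / 2"
  have sg: "0 < sg" "b0 - 2 * sg = b1" using b1 by (auto simp: sg_def field_simps)
  obtain rh where rh: "0 < rh" "\<forall>th ph. \<bar>th - th0\<bar> \<le> rh \<and> \<bar>ph - ph0\<bar> \<le> rh \<longrightarrow> \<bar>coef_b th ph - b0\<bar> \<le> sg"
    using coef_b_near[OF sg(1)] by blast
  define Ph where "Ph = 1 + (\<bar>ph0\<bar> + rh)^2"
  have Ph: "0 < Ph" by (simp add: Ph_def add_pos_nonneg)
  define C1 where "C1 = (\<bar>w10\<bar> + Ph * K) * exp ((1 + bound_p al mu * (1 + de)) * K)"
  have C1: "0 < C1" unfolding C1_def using Ph K by (intro mult_pos_pos add_nonneg_pos) auto
  define C2 where "C2 = C1 + de * C1"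
  have C2: "0 < C2" "C1 \<le> C2" using C1 par by (auto simp: C2_def add_pos_pos)
  define bc bq where "bc = al * (1 + mu)" and "bq = al + mu * (1 + al)"
  have bc: "0 < bc" "0 < bq" using par by (auto simp: bc_def bq_def add_pos_pos)
  \<comment> \<open>The second entry lets the drift of p, multiplied by the scaled contact force of
    size C2, use only one share \<open>sg\<close> of the gap between b0 and b1.\<close>
  define et where "et = min rh (sg / C2)"
  have et: "0 < et" "et \<le> rh" "et * C2 \<le> sg"
  proof -
    show "0 < et" "et \<le> rh" using rh(1) sg(1) C2 by (auto simp: et_def)
    have "et * C2 \<le> sg / C2 * C2" using C2 by (intro mult_right_mono) (auto simp: et_def)
    then show "et * C2 \<le> sg" using C2 by simp
  qed
  define D where "D = gain rh * (K + 1) / et + C2 + bc * C2 * K / rh + (Ph + bq * C2) * K / v0 + 1"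
  have t: "0 \<le> gain rh * (K + 1) / et" "0 \<le> bc * C2 * K / rh" "0 \<le> (Ph + bq * C2) * K / v0"
    using gain_pos[of rh] K et C2 bc rh(1) Ph par by (auto intro!: divide_nonneg_pos mult_nonneg_nonneg add_nonneg_nonneg less_imp_le)
  have D: "0 < D" "gain rh * (K + 1) / et < D" "C2 < D" "bc * C2 * K / rh < D" "(Ph + bq * C2) * K / v0 < D"
    using t C2 unfolding D_def by linarith+
  have main: "inside rh 1 1 La Y W th ph \<and> (La = K \<longrightarrow> (\<exists>T T'. fast_lift_off C2 ep La Y W T T'))"
    if H: "ep < 1 / D \<and> La \<le> K \<and> fast_flow w10 rh ep La Y W th ph v s" for ep La Y W th ph v s
  proof -
    from H have ep: "0 < ep" "ep < 1 / D" and La: "0 \<le> La" "La \<le> K" and Rs: "rescaled al mu de ep La Y W th ph v s"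
      and init: "Y 0 = 0" "W 0 = ep * w10" "th 0 = th0" "ph 0 = ph0" "v 0 = v0"
      and bd: "\<forall>t. 0 \<le> t \<and> t \<le> La \<longrightarrow> \<bar>ph t - ph0\<bar> \<le> rh" by (simp_all add: fast_flow_def)
    have epD: "ep * D < 1" using ep D(1) by (simp add: less_divide_eq)
    have lt: "ep * x < z" if "x / z < D" "0 < z" for x z
    proof -
      have "ep * (x / z) < 1" using mult_strict_left_mono[OF that(1) ep(1)] epD by simp
      then show ?thesis using that(2) by (simp add: divide_less_eq)
    qed
    have "ep * (gain rh * (K + 1)) < et" by (rule lt[OF D(2) et(1)])
    moreover have "gain rh * (ep * (La + 1)) \<le> gain rh * (ep * (K + 1))"
      using gain_pos[of rh] ep La by (intro mult_left_mono) auto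
    ultimately have small: "gain rh * (ep * (La + 1)) \<le> et" by (simp add: mult.left_commute)
    have epC2: "ep * C2 < 1" by (rule lt) (use D(3) in auto)
    note est = rescaled_estimates[OF Rs init(3) less_imp_le[OF rh(1)] bd ep(1) La(1) small]
    note cont = rescaled_cont[OF Rs]
    have W0: "\<bar>W 0\<bar> \<le> ep * \<bar>w10\<bar>" using ep by (simp add: init(2) abs_mult)
    have YW: "\<bar>Y t\<bar> \<le> ep * C1 \<and> \<bar>W t\<bar> \<le> ep * C1" if "0 \<le> t" "t \<le> La" for t
      using rescaled_gronwall[OF Rs init(1) W0 less_imp_le[OF rh(1)] bd ep(1) La(2) that]
        abs_ge_zero[of "Y t"] abs_ge_zero[of "W t"] unfolding C1_def Ph_def by linarith
    have F: "scaled_contact de Y W t \<le> ep * C2" if "0 \<le> t" "t \<le> La" for t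
      using scaled_contact_le[of Y t "ep * C1" W "ep * C1" de] YW[OF that] par by (simp add: C2_def algebra_simps)
    have C12: "ep * C1 \<le> ep * C2" using C2 ep by simp
    have dev: "\<bar>X\<bar> \<le> B * La" if "(f has_integral X) {0..t}" "0 \<le> t" "t \<le> La" "0 \<le> B" "\<And>u. 0 \<le> u \<Longrightarrow> u \<le> La \<Longrightarrow> \<bar>f u\<bar> \<le> B" for f X t B
    proof -
      have "\<bar>X\<bar> \<le> integral {0..t} (\<lambda>_. B)" by (rule has_integral_abs_le[OF that(1)]) (use that in auto)
      also have "\<dots> = B * t" using that by simp
      also have "\<dots> \<le> B * La" using that by (intro mult_left_mono) auto
      finally show ?thesis .
    qed
    have cF: "\<bar>coef_c al mu (s u) (th u) * scaled_contact de Y W u\<bar> \<le> bc * (ep * C2)"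
      "\<bar>coef_q al mu (s u) (th u) * scaled_contact de Y W u\<bar> \<le> bq * (ep * C2)" if u: "0 \<le> u" "u \<le> La" for u
      unfolding abs_mult bc_def bq_def
      using abs_coef_qc_le[OF par(1,2) rescaled_sign(1)[OF Rs u], of "th u"] F[OF u] scaled_contact_nonneg[of de Y W u] par
      by (auto intro!: mult_mono add_nonneg_nonneg)
    have ph: "\<bar>ph t - ph0\<bar> < rh" if t: "0 \<le> t" "t \<le> La" for t
    proof -
      have "\<bar>ph t - ph 0\<bar> \<le> bc * (ep * C2) * La"
        by (rule dev[OF rescaled_int(4)[OF Rs order_refl t] t]) (use cF bc ep C2 in auto)
      also have "\<dots> \<le> bc * (ep * C2) * K" using bc ep C2 La by (intro mult_left_mono) auto
      also have "\<dots> = ep * (bc * C2 * K)" by simp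
      also have "\<dots> < rh" by (rule lt[OF D(4) rh(1)])
      finally show ?thesis by (simp add: init)
    qed
    have v: "0 < v t" if t: "0 \<le> t" "t \<le> La" for t
    proof -
      have "\<bar>v t - v 0\<bar> \<le> (ep * Ph + bq * (ep * C2)) * La"
      proof (rule dev[OF rescaled_int(5)[OF Rs order_refl t] t])
        fix u assume u: "0 \<le> u" "u \<le> La"
        show "\<bar>ep * coef_a (th u) (ph u) + coef_q al mu (s u) (th u) * scaled_contact de Y W u\<bar> \<le> ep * Ph + bq * (ep * C2)"
          using est(6)[OF u] cF(2)[OF u] unfolding Ph_def by linarith
      qed (use bc ep C2 Ph in auto)
      also have "\<dots> \<le> (ep * Ph + bq * (ep * C2)) * K" using bc ep C2 La Ph by (intro mult_left_mono add_nonneg_nonneg) auto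
      also have "\<dots> = ep * ((Ph + bq * C2) * K)" by (simp add: algebra_simps)
      also have "\<dots> < v0" by (rule lt[OF D(5) par(4)])
      finally show ?thesis by (simp add: init)
    qed
    define y w where "y t = Y t / ep" and "w t = W t / ep" for t
    \<comment> \<open>The deviation of p from its frozen value is moved into the forcing, so that
      \<open>lift_off\<close> sees a constant coefficient.\<close>
    define be where "be t = coef_b (th t) (ph t) + (coef_p al mu 1 (th t) - p) * (scaled_contact de Y W t / ep)" for t
    have b0': "\<bar>coef_b (th t) (ph t) - b0\<bar> \<le> sg" if t: "0 \<le> t" "t \<le> La" for t
      using rh(2)[rule_format, of "th t" "ph t"] est(5)[OF t] et(2) ph[OF t] by linarith
    have bpos: "0 < coef_b (th t) (ph t)" if t: "0 \<le> t" "t \<le> La" for t using b0'[OF t] sg b1 by (simp add: abs_le_iff)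
    have be: "b1 \<le> be t" if t: "0 \<le> t" "t \<le> La" for t
    proof -
      have "scaled_contact de Y W t / ep \<le> C2" using F[OF t] ep by (simp add: divide_le_eq mult.commute)
      then have "\<bar>(coef_p al mu 1 (th t) - p) * (scaled_contact de Y W t / ep)\<bar> \<le> et * C2"
        unfolding abs_mult using est(7)[OF t, of 1] scaled_contact_nonneg[of de Y W t] ep et by (intro mult_mono) auto
      then show ?thesis unfolding be_def using b0'[OF t] et(3) sg(2) by linarith
    qed
    have sc: "max (- y t - de * w t) 0 = scaled_contact de Y W t / ep" for t
      using ep by (simp add: y_def w_def scaled_contact_def max_divide_distrib_right diff_divide_distrib)
    have Dy: "(y has_real_derivative w t) (at t)"
      and Dw: "(w has_real_derivative be t + p * max (- y t - de * w t) 0) (at t)" if t: "0 < t" "t < La" for t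
    proof -
      have vv: "\<forall>t. 0 \<le> t \<and> t < La \<longrightarrow> 0 < v t" using v by auto
      note D = rescaled_derivatives[OF Rs order_refl vv t]
      show "(y has_real_derivative w t) (at t)" unfolding y_def[abs_def] w_def by (rule DERIV_cdivide[OF D(1)])
      have e: "(ep * coef_b (th t) (ph t) + coef_p al mu 1 (th t) * scaled_contact de Y W t) / ep = be t + p * max (- y t - de * w t) 0"
        unfolding sc be_def using ep by (simp add: field_simps)
      show "(w has_real_derivative be t + p * max (- y t - de * w t) 0) (at t)"
        unfolding e[symmetric] unfolding w_def[abs_def] by (rule DERIV_cdivide[OF D(2)])
    qed
    have cy: "continuous_on {0..La} y" "continuous_on {0..La} w"
      unfolding y_def[abs_def] w_def[abs_def] using ep by (intro continuous_intros cont; simp)+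
    have y0: "y 0 = 0" "w 0 = w10" using ep init by (simp_all add: y_def w_def)
    have yY: "y t < 0 \<longleftrightarrow> Y t < 0" "y t \<le> 0 \<longleftrightarrow> Y t \<le> 0" "0 < w t \<longleftrightarrow> 0 < W t" "y t = 0 \<longleftrightarrow> Y t = 0" "0 < y t \<longleftrightarrow> 0 < Y t" for t
      using ep by (simp_all add: y_def w_def divide_less_0_iff divide_le_0_iff zero_less_divide_iff)
    have fly: "0 < W t \<and> (T < t \<longrightarrow> 0 < Y t)" if T: "0 \<le> T" "Y T = 0" "0 < W T" and t: "T \<le> t" "t \<le> La" for T t
    proof -
      have "W T / 2 \<le> W t \<and> Y T + W T / 2 * (t - T) \<le> Y t \<and> scaled_contact de Y W t = 0"
      proof (rule flight[where b = La and E = 0 and be = "\<lambda>u. ep * coef_b (th u) (ph u)" and P = "\<lambda>u. coef_p al mu (s u) (th u)"])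
        show "continuous_on {T..La} W" by (rule continuous_on_subset[OF cont(2)]) (use T in auto)
        show "- 0 \<le> ep * coef_b (th u) (ph u)" if "T \<le> u" "u \<le> La" for u using bpos[of u] that T ep by simp
      qed (use T t par rescaled_int(1,2)[OF Rs] in auto)
      moreover have "0 < W T / 2 * (t - T)" if "T < t" using that T by simp
      ultimately have "0 < Y t" if "T < t" using that T(2) by linarith
      then show ?thesis using \<open>W T / 2 \<le> W t \<and> _\<close> T by auto
    qed
    have bounds: "\<forall>t. 0 \<le> t \<and> t \<le> T \<longrightarrow> \<bar>Y t\<bar> \<le> C2 * ep \<and> \<bar>W t\<bar> \<le> C2 * ep \<and> scaled_contact de Y W t \<le> C2 * ep" if "T \<le> La" for T
      using YW F C12 that by (fastforce simp: mult.commute)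
    have box: "\<bar>ph La - ph0\<bar> < rh" "\<bar>W La\<bar> < 1" "scaled_contact de Y W La < 1"
      using ph[of La] YW[of La] F[of La] La C12 epC2 by auto
    consider "w10 < 0" | "w10 = 0" | "0 < w10" by linarith
    then show ?thesis
    proof cases
      case 3
      then have "0 < W 0" using ep init by simp
      note fl = fly[OF order_refl init(1) this]
      have "\<exists>T T'. fast_lift_off C2 ep La Y W T T'" if "La = K"
        using fl bounds[of 0] La K that init(1) unfolding fast_lift_off_def by (intro exI[of _ 0] exI[of _ La]) auto
      then show ?thesis using box fl[of La] La unfolding inside_def by blast
    next
      case 2
      have low: "b1 / 4 * t \<le> w t \<and> b1 / 8 * t^2 \<le> y t" if "0 \<le> t" "t \<le> La" for t
        using lift_off_from_rest[OF par(3) b1(1) cy y0(1) y0(2)[unfolded 2] Dy Dw be that] by auto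
      have posY: "0 < Y t \<and> 0 < W t" if "0 < t" "t \<le> La" for t
      proof -
        have "0 < b1 / 4 * t" "0 < b1 / 8 * t^2" using b1 that by simp_all
        then have "0 < w t" "0 < y t" using low[of t] that by linarith+
        then show ?thesis using yY by simp
      qed
      have "Y La < 0 \<or> 0 < W La \<or> (Y La \<le> 0 \<and> W La < 0) \<or> (Y La = 0 \<and> W La = 0 \<and> 0 < coef_b (th La) (ph La))"
        using posY[of La] La init 2 bpos[of La] by (cases "La = 0") auto
      moreover have "\<exists>T T'. fast_lift_off C2 ep La Y W T T'" if "La = K"
        using posY bounds[of 0] La K that init(1) unfolding fast_lift_off_def by (intro exI[of _ 0] exI[of _ La]) auto
      ultimately show ?thesis using box unfolding inside_def by blast
    next
      case 1
      have lift: "w10 * T + C0 * T^2 / 2 \<le> y T \<and> (y T = 0 \<longrightarrow> 0 < w T)" if T: "0 < T" "T \<le> La" and neg: "\<And>t. 0 \<le> t \<Longrightarrow> t \<le> T \<Longrightarrow> Y t \<le> 0" for T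
      proof -
        have sub: "{0..T} \<subseteq> {0..La}" using T by auto
        note lo = lift_off[OF signs(1) l_pos roots par(3) b1(1,3) T(1) continuous_on_subset[OF cy(1) sub] continuous_on_subset[OF cy(2) sub] y0]
        show ?thesis unfolding C0_def
          using lo(1)[of be] lo(2)[of be] Dy Dw be neg yY T by auto
      qed
      have lowK: "0 < w10 * K + C0 * K^2 / 2"
      proof -
        have "C0 * K = 2 * (- w10) + C0" using C0 1 by (simp add: K_def field_simps)
        then have "0 < w10 + C0 * K / 2" using C0 by linarith
        then have "0 < K * (w10 + C0 * K / 2)" using K by simp
        then show ?thesis by (simp add: power2_eq_square algebra_simps)
      qed
      show ?thesis
      proof (cases "\<forall>t. 0 < t \<and> t \<le> La \<longrightarrow> Y t < 0")
        case True
        have W0: "W 0 < 0" using 1 ep init by (simp add: mult_pos_neg)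
        have "La \<noteq> K"
        proof
          assume eq: "La = K"
          have "Y t \<le> 0" if "0 \<le> t" "t \<le> K" for t using True init that eq by (cases "t = 0") (auto intro: less_imp_le)
          then have "0 < y K" using lift[of K] K eq lowK by auto
          then show False using True[rule_format, of K] K eq yY(5)[of K] by auto
        qed
        moreover have "Y La < 0 \<or> (Y La \<le> 0 \<and> W La < 0)" using True init W0 La by (cases "La = 0") auto
        ultimately show ?thesis using box unfolding inside_def by blast
      next
        case False
        then obtain t1 where t1: "0 < t1" "t1 \<le> La" "0 \<le> Y t1" by force
        have "0 < - w 0" using 1 y0 by simp
        then obtain e where e: "0 < e" "\<forall>s. 0 \<le> s \<and> s < 0 + e \<and> s \<le> La \<longrightarrow> 0 < - w s"
          using positive_right_neighbourhood[OF continuous_on_minus[OF cy(2)], of 0] t1 by auto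
        have near: "Y t < 0" if t: "0 < t" "t < e" "t \<le> La" for t
        proof -
          have "y t < y 0"
          proof (rule DERIV_neg_imp_decreasing_open[OF t(1)])
            fix x assume "0 < x" "x < t"
            then show "\<exists>z. (y has_real_derivative z) (at x) \<and> z < 0" using Dy[of x] e(2)[rule_format, of x] t by auto
          qed (rule continuous_on_subset[OF cy(1)], use t in auto)
          then show ?thesis using yY y0 by simp
        qed
        \<comment> \<open>Y vanishes at 0 itself, so the search for the first return starts at a
          later time where Y is already negative.\<close>
        define a where "a = min (e / 2) (t1 / 2)"
        have a: "0 < a" "a < e" "a < t1" using e t1 by (auto simp: a_def)
        have "\<exists>z. a < z \<and> z \<le> t1 \<and> Y z = 0 \<and> (\<forall>t. a \<le> t \<and> t < z \<longrightarrow> Y t < 0)"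
          by (rule first_zero) (use a t1 near[of a] in \<open>auto intro: continuous_on_subset[OF cont(1)]\<close>)
        then obtain z where z: "a < z" "z \<le> t1" "Y z = 0" "\<forall>t. a \<le> t \<and> t < z \<longrightarrow> Y t < 0" by blast
        have zl: "0 < z" "z \<le> La" using z a t1 by auto
        have Yn: "Y t \<le> 0" if "0 \<le> t" "t \<le> z" for t
        proof -
          consider "t = 0" | "0 < t" "t < a" | "a \<le> t" "t < z" | "t = z" using \<open>0 \<le> t\<close> \<open>t \<le> z\<close> by linarith
          then show ?thesis using init(1) near[of t] z a zl that by cases (auto intro: less_imp_le)
        qed
        have "0 < w z" using lift[OF zl Yn] z(3) yY(4)[of z] by blast
        then have Wz: "0 < W z" using yY by simp
        note fl = fly[OF less_imp_le[OF zl(1)] z(3) Wz]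
        have "z < La" if "La = K"
        proof (rule ccontr)
          assume "\<not> z < La"
          then have zK: "z = K" using zl that by simp
          have "0 < y z" using lift[OF zl Yn] lowK unfolding zK by linarith
          then show False using z(3) yY(5)[of z] by simp
        qed
        then have "\<exists>T T'. fast_lift_off C2 ep La Y W T T'" if "La = K"
          using fl bounds[OF zl(2)] zl Yn that z(3) unfolding fast_lift_off_def by (intro exI[of _ z] exI[of _ La]) auto
        then show ?thesis using box fl[OF zl(2) order_refl] unfolding inside_def by blast
      qed
    qed
  qed
  show ?thesis
    by (rule exI[of _ K], rule conjI[OF K(1)], rule exI[of _ rh], rule conjI[OF rh(1)], rule exI[of _ 1], rule conjI[OF zero_less_one],
      rule exI[of _ 1], rule conjI[OF zero_less_one], rule exI[of _ C2], rule conjI[OF C2(1)], rule exI[of _ "1 / D"], rule conjI)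
      (use D(1) in simp, intro allI, rule impI, rule main)
qed

end

section \<open>Back to the original time\<close>

definition start :: "real \<Rightarrow> real \<Rightarrow> real \<Rightarrow> real \<Rightarrow> real \<Rightarrow> state" where
  "start ep w10 th0 ph0 v0 = (0, ep * w10, th0, ph0, v0)"

lemma eventually_small_start:
  assumes "0 < M1" "0 < M2"
  shows "eventually (\<lambda>ep. ep * a \<le> M1 \<and> ep * b \<le> M2) (at_right (0::real))"
proof -
  have "((\<lambda>ep::real. ep * a) \<longlongrightarrow> 0 * a) (at_right 0)" "((\<lambda>ep::real. ep * b) \<longlongrightarrow> 0 * b) (at_right 0)"
    by (intro tendsto_intros)+
  then have "eventually (\<lambda>ep. ep * a < M1) (at_right (0::real))" "eventually (\<lambda>ep. ep * b < M2) (at_right (0::real))"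
    using assms by (auto dest: order_tendstoD(2))
  then show ?thesis by eventually_elim auto
qed

lemma eventually_at_right_0: "0 < ep0 \<Longrightarrow> eventually (\<lambda>ep. 0 < ep \<and> ep < ep0) (at_right (0::real))"
  using eventually_at_right_real[of 0 ep0] by simp

context impact
begin

text \<open>The estimate \<open>inv\<close> is wanted for every La up to L / ep, because it is
  applied at each time up to which the orbit is known to lie in the box, before this is known on all
  of [0, L].\<close>

lemma local_solution_rescaled:
  fixes x :: "real \<Rightarrow> state"
  assumes ep: "0 < ep" and L: "0 \<le> L"
    and box: "ep * \<bar>w10\<bar> \<le> M1" "ep * (de * \<bar>w10\<bar>) \<le> M2" "0 \<le> M0"
    and sol: "local_solution al mu de ep ph0 M0 M1 M2 (start ep w10 th0 ph0 v0) L x"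
    and inv: "\<And>La Y W th ph v s. La \<le> L / ep \<Longrightarrow> fast_flow w10 M0 ep La Y W th ph v s \<Longrightarrow> inside M0 M1 M2 La Y W th ph"
  shows "\<forall>t\<in>{0..L}. in_box de ep ph0 M0 M1 M2 (x t) \<and> admissible (x t)"
    and "\<exists>s. fast_flow w10 M0 ep (L / ep) (\<lambda>t. y_of (x (ep * t)) / ep) (\<lambda>t. w_of (x (ep * t)))
      (\<lambda>t. theta_of (x (ep * t))) (\<lambda>t. phi_of (x (ep * t))) (\<lambda>t. v_of (x (ep * t))) s"
proof -
  note par = ep par(3)
  have x0: "x 0 = (0, ep * w10, th0, ph0, v0)" using sol by (simp add: local_solution_def start_def)
  have ct: "scaled_contact de (\<lambda>t. y_of (x (ep * t)) / ep) (\<lambda>t. w_of (x (ep * t))) (t / ep) = contact de ep (x t)" for t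
    using par by (simp add: scaled_contact_def contact_def)
  have flow: "\<exists>s. fast_flow w10 M0 ep (sg / ep) (\<lambda>t. y_of (x (ep * t)) / ep) (\<lambda>t. w_of (x (ep * t)))
      (\<lambda>t. theta_of (x (ep * t))) (\<lambda>t. phi_of (x (ep * t))) (\<lambda>t. v_of (x (ep * t))) s"
    if sg: "0 \<le> sg" "sg \<le> L" and V: "\<And>t. t \<in> {0..sg} \<Longrightarrow> in_box de ep ph0 M0 M1 M2 (x t) \<and> admissible (x t)" for sg
  proof -
    have "\<bar>phi_of (x (ep * t)) - ph0\<bar> \<le> M0" if "0 \<le> t \<and> t \<le> sg / ep" for t
      using V[of "ep * t"] that par by (simp add: in_box_def pos_le_divide_eq mult.commute)
    then show ?thesis using rescaled_local_solution[OF sol par sg V] x0 sg par unfolding fast_flow_def by simp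
  qed
  have P: "in_box de ep ph0 M0 M1 M2 (x t) \<and> admissible (x t)" if "t \<in> {0..L}" for t
  proof (rule local_solution_stays_in_box[OF sol _ _ _ that])
    have "- (de * (ep * w10)) \<le> ep * (de * \<bar>w10\<bar>)"
    proof -
      have "(de * ep) * (- w10) \<le> (de * ep) * \<bar>w10\<bar>" using par by (intro mult_left_mono) auto
      then show ?thesis by (simp add: mult_ac)
    qed
    moreover have "0 \<le> ep * (de * \<bar>w10\<bar>)" using par by simp
    moreover from this have "0 \<le> M2" using box(2) by linarith
    ultimately show "in_box de ep ph0 M0 M1 M2 (start ep w10 th0 ph0 v0)"
      using box par by (simp add: in_box_def start_def contact_def abs_mult)
    show "admissible (start ep w10 th0 ph0 v0)" by (simp add: admissible_def start_def)
  next
    fix sg assume sg: "0 \<le> sg" "sg \<le> L" and V: "\<And>t. t \<in> {0..sg} \<Longrightarrow> in_box de ep ph0 M0 M1 M2 (x t) \<and> admissible (x t)"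
    have "sg / ep \<le> L / ep" using sg par by (simp add: divide_right_mono)
    then have I: "inside M0 M1 M2 (sg / ep) (\<lambda>t. y_of (x (ep * t)) / ep) (\<lambda>t. w_of (x (ep * t))) (\<lambda>t. theta_of (x (ep * t))) (\<lambda>t. phi_of (x (ep * t)))"
      using inv flow[OF sg V] by blast
    have e: "ep * (sg / ep) = sg" using par by simp
    have "y_of (x sg) / ep < 0 \<longleftrightarrow> y_of (x sg) < 0" "y_of (x sg) / ep \<le> 0 \<longleftrightarrow> y_of (x sg) \<le> 0" "y_of (x sg) / ep = 0 \<longleftrightarrow> y_of (x sg) = 0"
      using par by (simp_all add: divide_less_0_iff divide_le_0_iff)
    then show "strictly_in_box de ep ph0 M0 M1 M2 (x sg) \<and> outgoing (x sg)"
      using I unfolding inside_def e ct strictly_in_box_def outgoing_def by simp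
  qed
  then show "\<forall>t\<in>{0..L}. in_box de ep ph0 M0 M1 M2 (x t) \<and> admissible (x t)" by blast
  show "\<exists>s. fast_flow w10 M0 ep (L / ep) (\<lambda>t. y_of (x (ep * t)) / ep) (\<lambda>t. w_of (x (ep * t)))
      (\<lambda>t. theta_of (x (ep * t))) (\<lambda>t. phi_of (x (ep * t))) (\<lambda>t. v_of (x (ep * t))) s"
    by (rule flow[OF L order_refl P])
qed

definition returned where
  "returned C et ep L x T \<longleftrightarrow> returns_at L x T \<and> \<bar>w_of (x T) - e_fun al mu de th0 * v0\<bar> \<le> et \<and> \<bar>theta_of (x T) - th0\<bar> \<le> et
     \<and> \<bar>phi_of (x T) - (ph0 + (- (c / q) + Sph / S * (e_fun al mu de th0 + p / q)) * v0)\<bar> \<le> et \<and> \<bar>v_of (x T)\<bar> \<le> et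
     \<and> (\<forall>t\<in>{0..T}. \<bar>y_of (x t)\<bar> \<le> C * ep \<and> \<bar>w_of (x t)\<bar> \<le> C
          \<and> \<bar>F_N ep de (y_of (x t)) (w_of (x t))\<bar> \<le> C * (1 / ep))"

definition lifted where
  "lifted C ep L x T \<longleftrightarrow> lifts_off_at L x T \<and> \<bar>w_of (x T)\<bar> \<le> C * ep
     \<and> (\<forall>t\<in>{0..T}. \<bar>y_of (x t)\<bar> \<le> C * ep^2 \<and> \<bar>F_N ep de (y_of (x t)) (w_of (x t))\<bar> \<le> C)"

text \<open>Both halves come from one statement about local solutions. Those that exist by
  truncation are genuine, which gives existence; and every forward solution is a local one, which
  gives the behaviour of all of them.\<close>

lemma impact_return:
  assumes w10: "w10 < - b0 / l"
  shows "\<exists>K>0. (\<forall>\<^sub>F ep in at_right 0. \<exists>x. forward_solution al mu de ep (start ep w10 th0 ph0 v0) (K * (ep * ln (1 / ep))) x)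
    \<and> (\<exists>C. \<forall>et>0. \<forall>\<^sub>F ep in at_right 0. \<forall>x. forward_solution al mu de ep (start ep w10 th0 ph0 v0) (K * (ep * ln (1 / ep))) x \<longrightarrow>
        (\<exists>T. returned C et ep (K * (ep * ln (1 / ep))) x T))"
proof -
  let ?we = "e_fun al mu de th0 * v0" and ?fe = "ph0 + (- (c / q) + Sph / S * (e_fun al mu de th0 + p / q)) * v0"
  obtain K M0 M1 M2 C where pos: "0 < K" "0 < M0" "0 < M1" "0 < M2" and main: "\<forall>et>0. \<exists>ep0>0. \<forall>ep La Y W th ph v s.
     ep < ep0 \<and> La \<le> K * ln (1 / ep) \<and> fast_flow w10 M0 ep La Y W th ph v s \<longrightarrow>
       inside M0 M1 M2 La Y W th ph \<and> (La = K * ln (1 / ep) \<longrightarrow> (\<exists>T. fast_return C et La Y W th ph v T))"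
    using impact_trajectory[OF w10] by (elim exE conjE) (rule that)
  let ?L = "\<lambda>ep::real. K * (ep * ln (1 / ep))"
  have ln0: "eventually (\<lambda>ep. 0 \<le> ln (1 / ep)) (at_right (0::real))" by real_asymp
  have step: "\<forall>\<^sub>F ep in at_right 0. 0 < ep \<and> 0 \<le> ?L ep \<and>
     (\<forall>x. local_solution al mu de ep ph0 M0 M1 M2 (start ep w10 th0 ph0 v0) (?L ep) x \<longrightarrow>
        (\<forall>t\<in>{0..?L ep}. in_box de ep ph0 M0 M1 M2 (x t) \<and> admissible (x t))
        \<and> (\<exists>T. returned C et ep (?L ep) x T))" if et: "0 < et" for et
  proof -
    obtain ep0 where ep0: "0 < ep0" "\<forall>ep La Y W th ph v s.
     ep < ep0 \<and> La \<le> K * ln (1 / ep) \<and> fast_flow w10 M0 ep La Y W th ph v s \<longrightarrow>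
       inside M0 M1 M2 La Y W th ph \<and> (La = K * ln (1 / ep) \<longrightarrow> (\<exists>T. fast_return C et La Y W th ph v T))"
      using main[THEN spec, THEN mp, OF et] by (elim exE conjE) (rule that)
    show ?thesis
      using eventually_at_right_0[OF ep0(1)] ln0 eventually_small_start[OF pos(3,4), of "\<bar>w10\<bar>" "de * \<bar>w10\<bar>"]
    proof eventually_elim
      case (elim ep)
      then have ep: "0 < ep" "ep < ep0" and ln: "0 \<le> ln (1 / ep)" and st: "ep * \<bar>w10\<bar> \<le> M1" "ep * (de * \<bar>w10\<bar>) \<le> M2" by auto
      have L: "0 \<le> ?L ep" using ep ln pos by (intro mult_nonneg_nonneg) auto
      have Le: "?L ep / ep = K * ln (1 / ep)" using ep by simp
      show ?case
      proof (intro conjI allI impI)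
        show "0 < ep" "0 \<le> ?L ep" using ep L by auto
        fix x assume sol: "local_solution al mu de ep ph0 M0 M1 M2 (start ep w10 th0 ph0 v0) (?L ep) x"
        let ?Y = "\<lambda>t. y_of (x (ep * t)) / ep" and ?W = "\<lambda>t. w_of (x (ep * t))" and ?t = "\<lambda>t. theta_of (x (ep * t))"
          and ?f = "\<lambda>t. phi_of (x (ep * t))" and ?v = "\<lambda>t. v_of (x (ep * t))"
        note tr = local_solution_rescaled[OF ep(1) L st less_imp_le[OF pos(2)] sol]
        have inv: "inside M0 M1 M2 La Y W th ph" if "La \<le> ?L ep / ep" "fast_flow w10 M0 ep La Y W th ph v s" for La Y W th ph v s
          using ep0(2)[rule_format, of ep La Y W th ph v s] that ep unfolding Le by blast
        have P: "\<forall>t\<in>{0..?L ep}. in_box de ep ph0 M0 M1 M2 (x t) \<and> admissible (x t)" by (rule tr(1)) (rule inv)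
        then show "\<forall>t\<in>{0..?L ep}. in_box de ep ph0 M0 M1 M2 (x t) \<and> admissible (x t)" .
        have "\<exists>s. fast_flow w10 M0 ep (?L ep / ep) ?Y ?W ?t ?f ?v s" by (rule tr(2)) (rule inv)
        then obtain s where R: "fast_flow w10 M0 ep (K * ln (1 / ep)) ?Y ?W ?t ?f ?v s" unfolding Le by blast
        have in_L: "ep * t \<in> {0..?L ep}" if "0 \<le> t" "t \<le> K * ln (1 / ep)" for t
          using that ep mult_left_mono[OF that(2), of ep] by (simp add: mult.left_commute)
        obtain T where T: "0 < T" "T \<le> K * ln (1 / ep)" "?Y T = 0" "\<forall>t. 0 < t \<and> t < T \<longrightarrow> ?Y t < 0"
          "\<bar>?W T - ?we\<bar> \<le> et" "\<bar>?t T - th0\<bar> \<le> et" "\<bar>?f T - ?fe\<bar> \<le> et" "\<bar>?v T\<bar> \<le> et"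
          "\<forall>t. 0 \<le> t \<and> t \<le> T \<longrightarrow> \<bar>?Y t\<bar> \<le> C \<and> \<bar>?W t\<bar> \<le> C \<and> scaled_contact de ?Y ?W t \<le> C"
          using ep0(2)[rule_format, of ep "K * ln (1 / ep)" ?Y ?W ?t ?f ?v s] R ep unfolding fast_return_def by auto
        show "\<exists>T. returned C et ep (?L ep) x T"
          unfolding returned_def
        proof (intro exI[of _ "ep * T"] conjI T(5-8) ballI)
          show "returns_at (?L ep) x (ep * T)" unfolding returns_at_def
          proof (intro conjI ballI)
            show "0 < ep * T" "ep * T \<le> ?L ep" using T(1,2) ep in_L[of T] by auto
            show "y_of (x (ep * T)) = 0" using T(3) ep by simp
            fix t assume "t \<in> {0<..<ep * T}"
            then have "?Y (t / ep) < 0" using T(4)[rule_format, of "t / ep"] ep by (simp add: divide_less_eq mult.commute)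
            then show "y_of (x t) < 0" using ep by (simp add: divide_less_0_iff)
          qed
          fix t assume t: "t \<in> {0..ep * T}"
          then have "0 \<le> t / ep" "t / ep \<le> T" using ep by (simp_all add: divide_le_eq mult.commute)
          then have bb: "\<bar>?Y (t / ep)\<bar> \<le> C" "\<bar>?W (t / ep)\<bar> \<le> C" "scaled_contact de ?Y ?W (t / ep) \<le> C" using T(9) by blast+
          then show "\<bar>y_of (x t)\<bar> \<le> C * ep" "\<bar>w_of (x t)\<bar> \<le> C" using ep by (simp_all add: abs_divide divide_le_eq)
          have "contact de ep (x t) \<le> C" using bb(3) ep by (simp add: scaled_contact_def contact_def)
          moreover have "admissible (x t)" using P t in_L[of T] T(1,2) by auto
          ultimately show "\<bar>F_N ep de (y_of (x t)) (w_of (x t))\<bar> \<le> C * (1 / ep)"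
            using F_N_eq_contact[OF ep(1) par(3)] contact_nonneg[of de ep "x t"] ep by (simp add: abs_mult divide_right_mono)
        qed
      qed
    qed
  qed
  \<comment> \<open>The tolerance is irrelevant here; the value 1 is taken to extract that local
    solutions never leave the box and stay admissible.\<close>
  have ex: "\<forall>\<^sub>F ep in at_right 0. \<exists>x. forward_solution al mu de ep (start ep w10 th0 ph0 v0) (?L ep) x"
    using step[OF zero_less_one]
  proof eventually_elim
    case (elim ep)
    then obtain x where x: "local_solution al mu de ep ph0 M0 M1 M2 (start ep w10 th0 ph0 v0) (?L ep) x"
      using local_solution_exists[OF par(1-3), of ep M0 M1 M2 "?L ep" ph0 "start ep w10 th0 ph0 v0"] pos less_imp_le by blast
    have "forward_solution al mu de ep (start ep w10 th0 ph0 v0) (?L ep) x"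
      by (rule local_imp_forward_solution[OF x]) (use elim x in blast)
    then show ?case by blast
  qed
  have ret: "\<forall>\<^sub>F ep in at_right 0. \<forall>x. forward_solution al mu de ep (start ep w10 th0 ph0 v0) (?L ep) x \<longrightarrow>
        (\<exists>T. returned C et ep (?L ep) x T)" if "0 < et" for et
    using step[OF that]
  proof eventually_elim
    case (elim ep)
    show ?case
    proof (intro allI impI)
      fix x assume f: "forward_solution al mu de ep (start ep w10 th0 ph0 v0) (?L ep) x"
      show "\<exists>T. returned C et ep (?L ep) x T" using elim forward_imp_local_solution[OF par(1-3) conjunct1[OF elim] f] by blast
    qed
  qed
  show ?thesis using pos(1) ex ret by blast
qed

lemma impact_lift_off:
  assumes w10: "- b0 / l < w10"
  shows "\<exists>K>0. (\<forall>\<^sub>F ep in at_right 0. \<exists>x. forward_solution al mu de ep (start ep w10 th0 ph0 v0) (K * ep) x)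
    \<and> (\<exists>C. \<forall>\<^sub>F ep in at_right 0. \<forall>x. forward_solution al mu de ep (start ep w10 th0 ph0 v0) (K * ep) x \<longrightarrow>
        (\<exists>T. lifted C ep (K * ep) x T))"
proof -
  obtain K M0 M1 M2 C ep0 where pos: "0 < K" "0 < M0" "0 < M1" "0 < M2" "0 < C" "0 < ep0" and main: "\<forall>ep La Y W th ph v s.
     ep < ep0 \<and> La \<le> K \<and> fast_flow w10 M0 ep La Y W th ph v s \<longrightarrow>
       inside M0 M1 M2 La Y W th ph \<and> (La = K \<longrightarrow> (\<exists>T T'. fast_lift_off C ep La Y W T T'))"
    using lift_off_trajectory[OF w10] by (elim exE conjE) (rule that)
  have step: "\<forall>\<^sub>F ep in at_right 0. 0 < ep \<and>
     (\<forall>x. local_solution al mu de ep ph0 M0 M1 M2 (start ep w10 th0 ph0 v0) (K * ep) x \<longrightarrow>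
        (\<forall>t\<in>{0..K * ep}. in_box de ep ph0 M0 M1 M2 (x t) \<and> admissible (x t))
        \<and> (\<exists>T. lifted C ep (K * ep) x T))"
    using eventually_at_right_0[OF pos(6)] eventually_small_start[OF pos(3,4), of "\<bar>w10\<bar>" "de * \<bar>w10\<bar>"]
  proof eventually_elim
    case (elim ep)
    then have ep: "0 < ep" "ep < ep0" and st: "ep * \<bar>w10\<bar> \<le> M1" "ep * (de * \<bar>w10\<bar>) \<le> M2" by auto
    have L: "0 \<le> K * ep" using ep pos by simp
    have Le: "K * ep / ep = K" using ep by simp
    show ?case
    proof (intro conjI allI impI)
      show "0 < ep" using ep by auto
      fix x assume sol: "local_solution al mu de ep ph0 M0 M1 M2 (start ep w10 th0 ph0 v0) (K * ep) x"
      let ?Y = "\<lambda>t. y_of (x (ep * t)) / ep" and ?W = "\<lambda>t. w_of (x (ep * t))" and ?t = "\<lambda>t. theta_of (x (ep * t))"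
        and ?f = "\<lambda>t. phi_of (x (ep * t))" and ?v = "\<lambda>t. v_of (x (ep * t))"
      note tr = local_solution_rescaled[OF ep(1) L st less_imp_le[OF pos(2)] sol]
      have inv: "inside M0 M1 M2 La Y W th ph" if "La \<le> K * ep / ep" "fast_flow w10 M0 ep La Y W th ph v s" for La Y W th ph v s
        using main[rule_format, of ep La Y W th ph v s] that ep unfolding Le by blast
      have P: "\<forall>t\<in>{0..K * ep}. in_box de ep ph0 M0 M1 M2 (x t) \<and> admissible (x t)" by (rule tr(1)) (rule inv)
      then show "\<forall>t\<in>{0..K * ep}. in_box de ep ph0 M0 M1 M2 (x t) \<and> admissible (x t)" .
      have "\<exists>s. fast_flow w10 M0 ep (K * ep / ep) ?Y ?W ?t ?f ?v s" by (rule tr(2)) (rule inv)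
      then obtain s where R: "fast_flow w10 M0 ep (K) ?Y ?W ?t ?f ?v s" unfolding Le by blast
      have in_L: "ep * t \<in> {0..K * ep}" if "0 \<le> t" "t \<le> K" for t
        using that ep mult_left_mono[OF that(2), of ep] by (simp add: mult.commute)
      obtain T T' where T: "0 \<le> T" "T < T'" "T' \<le> K" "?Y T = 0" "\<forall>t. 0 \<le> t \<and> t \<le> T \<longrightarrow> ?Y t \<le> 0"
        "\<forall>t. T < t \<and> t \<le> T' \<longrightarrow> 0 < ?Y t"
        "\<forall>t. 0 \<le> t \<and> t \<le> T \<longrightarrow> \<bar>?Y t\<bar> \<le> C * ep \<and> \<bar>?W t\<bar> \<le> C * ep \<and> scaled_contact de ?Y ?W t \<le> C * ep"
        using main[rule_format, of ep K ?Y ?W ?t ?f ?v s] R ep unfolding fast_lift_off_def by auto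
      have dv: "0 \<le> t / ep \<and> t / ep \<le> z" if "0 \<le> t" "t \<le> ep * z" for t z using that ep by (simp add: divide_le_eq mult.commute)
      show "\<exists>T. lifted C ep (K * ep) x T"
        unfolding lifted_def
      proof (intro exI[of _ "ep * T"] conjI ballI)
        show "lifts_off_at (K * ep) x (ep * T)" unfolding lifts_off_at_def
        proof (intro conjI ballI bexI[of _ "ep * T'"])
          have "ep * T < ep * T'" using T(2) ep by simp
          then show "0 \<le> ep * T" "ep * T < K * ep" "ep * T' \<in> {ep * T<..K * ep}" using T(1,2,3) ep in_L[of T'] by auto
          show "y_of (x (ep * T)) = 0" using T(4) ep by simp
        next
          fix t assume "t \<in> {0..ep * T}"
          then have "?Y (t / ep) \<le> 0" using T(5)[rule_format, of "t / ep"] dv[of t T] by simp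
          then show "y_of (x t) \<le> 0" using ep by (simp add: divide_le_0_iff)
        next
          fix t assume t: "t \<in> {ep * T<..ep * T'}"
          then have "T < t / ep" "t / ep \<le> T'" using ep by (simp_all add: less_divide_eq divide_le_eq mult.commute)
          then have "0 < ?Y (t / ep)" using T(6) by blast
          then show "0 < y_of (x t)" using ep by (simp add: zero_less_divide_iff)
        qed
        show "\<bar>w_of (x (ep * T))\<bar> \<le> C * ep" using T(1) T(7)[rule_format, of T] by simp
        fix t assume t: "t \<in> {0..ep * T}"
        then have bb: "\<bar>?Y (t / ep)\<bar> \<le> C * ep" "scaled_contact de ?Y ?W (t / ep) \<le> C * ep" using T(7)[rule_format, of "t / ep"] dv[of t T] by simp_all
        then show "\<bar>y_of (x t)\<bar> \<le> C * ep^2" using ep by (simp add: abs_divide divide_le_eq power2_eq_square)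
        have "contact de ep (x t) \<le> C * ep" using bb(2) ep by (simp add: scaled_contact_def contact_def)
        moreover have "admissible (x t)" using P t in_L[of T] T(1-3) by auto
        ultimately show "\<bar>F_N ep de (y_of (x t)) (w_of (x t))\<bar> \<le> C"
          using F_N_eq_contact[OF ep(1) par(3)] contact_nonneg[of de ep "x t"] ep by (simp add: abs_mult divide_le_eq)
      qed
    qed
  qed
  have ex: "\<forall>\<^sub>F ep in at_right 0. \<exists>x. forward_solution al mu de ep (start ep w10 th0 ph0 v0) (K * ep) x"
    using step
  proof eventually_elim
    case (elim ep)
    then obtain x where x: "local_solution al mu de ep ph0 M0 M1 M2 (start ep w10 th0 ph0 v0) (K * ep) x"
      using local_solution_exists[OF par(1-3), of ep M0 M1 M2 "K * ep" ph0 "start ep w10 th0 ph0 v0"] pos less_imp_le mult_pos_pos[OF pos(1)] by blast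
    have "forward_solution al mu de ep (start ep w10 th0 ph0 v0) (K * ep) x"
      by (rule local_imp_forward_solution[OF x]) (use elim x in blast)
    then show ?case by blast
  qed
  have ret: "\<forall>\<^sub>F ep in at_right 0. \<forall>x. forward_solution al mu de ep (start ep w10 th0 ph0 v0) (K * ep) x \<longrightarrow>
        (\<exists>T. lifted C ep (K * ep) x T)"
    using step
  proof eventually_elim
    case (elim ep)
    show ?case
    proof (intro allI impI)
      fix x assume f: "forward_solution al mu de ep (start ep w10 th0 ph0 v0) (K * ep) x"
      show "\<exists>T. lifted C ep (K * ep) x T" using elim forward_imp_local_solution[OF par(1-3) conjunct1[OF elim] f] by blast
    qed
  qed
  show ?thesis using pos(1) ex ret by blast
qed

end

text \<open>The estimates supply a return time for each tolerance separately. Uniqueness identifies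
  them, so one function T of epsilon serves all limits.\<close>

lemma returns_at_unique: "returns_at L x T \<Longrightarrow> returns_at L x T' \<Longrightarrow> T = T'"
proof (induction T T' rule: linorder_wlog)
  case (le a b)
  show ?case
  proof (rule ccontr)
    assume "a \<noteq> b"
    then have "a \<in> {0<..<b}" using le by (simp add: returns_at_def)
    moreover have "\<forall>t\<in>{0<..<b}. y_of (x t) < 0" "y_of (x a) = 0" using le by (simp_all add: returns_at_def)
    ultimately have "y_of (x a) < 0" by blast
    then show False using \<open>y_of (x a) = 0\<close> by linarith
  qed
qed auto

lemma tendsto_of_abs_le:
  fixes f :: "real \<Rightarrow> real"
  assumes "\<And>et. 0 < et \<Longrightarrow> eventually (\<lambda>ep. \<bar>f ep - a\<bar> \<le> et) F"
  shows "(f \<longlongrightarrow> a) F"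
proof (rule tendstoI)
  fix e :: real assume "0 < e"
  then have "eventually (\<lambda>ep. \<bar>f ep - a\<bar> \<le> e / 2) F" by (intro assms) simp
  then show "eventually (\<lambda>ep. dist (f ep) a < e) F" by eventually_elim (use \<open>0 < e\<close> in \<open>simp add: dist_real_def\<close>)
qed

theorem theorem2:
  fixes \<alpha> \<mu> \<delta> \<theta>0 \<phi>0 v0 w10 :: real
  assumes "\<alpha> > 0" and "\<mu> > 0" and "\<delta> > 0"
    and "coef_p \<alpha> \<mu> 1 \<theta>0 < 0"
    and "coef_b \<theta>0 \<phi>0 > 0"
    and "coef_q \<alpha> \<mu> 1 \<theta>0 < 0"
    and "coef_q \<alpha> \<mu> (-1) \<theta>0 > 0"
    and "coef_a \<theta>0 \<phi>0 \<noteq> 0"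
    and "v0 > 0"
  shows
    "w1_star \<alpha> \<mu> \<delta> \<theta>0 \<phi>0 < 0
     \<and> (w10 < w1_star \<alpha> \<mu> \<delta> \<theta>0 \<phi>0 \<longrightarrow>
        (\<exists>K>0.
          (\<forall>\<^sub>F \<epsilon> in at_right 0.
             \<exists>x. forward_solution \<alpha> \<mu> \<delta> \<epsilon> (0, \<epsilon> * w10, \<theta>0, \<phi>0, v0) (K * (\<epsilon> * ln (1 / \<epsilon>))) x)
          \<and> (\<forall>x. (\<forall>\<^sub>F \<epsilon> in at_right 0.
                     forward_solution \<alpha> \<mu> \<delta> \<epsilon> (0, \<epsilon> * w10, \<theta>0, \<phi>0, v0) (K * (\<epsilon> * ln (1 / \<epsilon>))) (x \<epsilon>)) \<longrightarrow>
              (\<exists>T.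
                (\<forall>\<^sub>F \<epsilon> in at_right 0. returns_at (K * (\<epsilon> * ln (1 / \<epsilon>))) (x \<epsilon>) (T \<epsilon>))
                \<and> T \<in> O[at_right 0](\<lambda>\<epsilon>. \<epsilon> * ln (1 / \<epsilon>))
                \<and> ((\<lambda>\<epsilon>. w_of (x \<epsilon> (T \<epsilon>))) \<longlongrightarrow> e_fun \<alpha> \<mu> \<delta> \<theta>0 * v0) (at_right 0)
                \<and> ((\<lambda>\<epsilon>. theta_of (x \<epsilon> (T \<epsilon>))) \<longlongrightarrow> \<theta>0) (at_right 0)
                \<and> ((\<lambda>\<epsilon>. phi_of (x \<epsilon> (T \<epsilon>))) \<longlongrightarrow>
                     \<phi>0 + (- (coef_c \<alpha> \<mu> 1 \<theta>0 / coef_q \<alpha> \<mu> 1 \<theta>0)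
                           + S_phi \<alpha> \<mu> \<theta>0 / S_w \<alpha> \<mu> \<theta>0
                             * (e_fun \<alpha> \<mu> \<delta> \<theta>0 + coef_p \<alpha> \<mu> 1 \<theta>0 / coef_q \<alpha> \<mu> 1 \<theta>0)) * v0)
                   (at_right 0)
                \<and> ((\<lambda>\<epsilon>. v_of (x \<epsilon> (T \<epsilon>))) \<longlongrightarrow> 0) (at_right 0)
                \<and> (\<exists>C. \<forall>\<^sub>F \<epsilon> in at_right 0. \<forall>t\<in>{0..T \<epsilon>}.
                      \<bar>y_of (x \<epsilon> t)\<bar> \<le> C * \<epsilon>
                      \<and> \<bar>w_of (x \<epsilon> t)\<bar> \<le> C
                      \<and> \<bar>F_N \<epsilon> \<delta> (y_of (x \<epsilon> t)) (w_of (x \<epsilon> t))\<bar> \<le> C * (1 / \<epsilon>))))))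
     \<and> smooth_on_open {0<..} (\<lambda>d. e_fun \<alpha> \<mu> d \<theta>0)
     \<and> (mono_on {0<..} (\<lambda>d. e_fun \<alpha> \<mu> d \<theta>0) \<or> antimono_on {0<..} (\<lambda>d. e_fun \<alpha> \<mu> d \<theta>0))
     \<and> (\<exists>r. r \<in> O[at_top](\<lambda>d. 1 / d\<^sup>2 * ln (1 / d\<^sup>2))
          \<and> (\<forall>d>0. e_fun \<alpha> \<mu> d \<theta>0 =
                (coef_p \<alpha> \<mu> (-1) \<theta>0 - coef_p \<alpha> \<mu> 1 \<theta>0)
                / (coef_q \<alpha> \<mu> (-1) \<theta>0 * coef_p \<alpha> \<mu> 1 \<theta>0 - coef_q \<alpha> \<mu> 1 \<theta>0 * coef_p \<alpha> \<mu> (-1) \<theta>0)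
                * (1 / d\<^sup>2) * (1 + r d)))
     \<and> (\<exists>r. r \<in> O[at_right 0](\<lambda>d. d\<^sup>2)
          \<and> (\<forall>d>0. e_fun \<alpha> \<mu> d \<theta>0 =
                sqrt (coef_p \<alpha> \<mu> 1 \<theta>0 * (coef_p \<alpha> \<mu> (-1) \<theta>0 - coef_p \<alpha> \<mu> 1 \<theta>0)
                      / (coef_q \<alpha> \<mu> 1 \<theta>0 * (coef_q \<alpha> \<mu> (-1) \<theta>0 - coef_q \<alpha> \<mu> 1 \<theta>0)))
                * (1 - sqrt (S_w \<alpha> \<mu> \<theta>0) / 2
                       * (pi - arctan (sqrt (- (S_w \<alpha> \<mu> \<theta>0 / coef_p \<alpha> \<mu> 1 \<theta>0)))) * d
                   + r d)))
     \<and> (w10 > w1_star \<alpha> \<mu> \<delta> \<theta>0 \<phi>0 \<longrightarrow>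
        (\<exists>K>0.
          (\<forall>\<^sub>F \<epsilon> in at_right 0. \<exists>x. forward_solution \<alpha> \<mu> \<delta> \<epsilon> (0, \<epsilon> * w10, \<theta>0, \<phi>0, v0) (K * \<epsilon>) x)
          \<and> (\<forall>x. (\<forall>\<^sub>F \<epsilon> in at_right 0. forward_solution \<alpha> \<mu> \<delta> \<epsilon> (0, \<epsilon> * w10, \<theta>0, \<phi>0, v0) (K * \<epsilon>) (x \<epsilon>)) \<longrightarrow>
              (\<exists>T.
                (\<forall>\<^sub>F \<epsilon> in at_right 0. lifts_off_at (K * \<epsilon>) (x \<epsilon>) (T \<epsilon>))
                \<and> T \<in> O[at_right 0](\<lambda>\<epsilon>. \<epsilon>)
                \<and> (\<lambda>\<epsilon>. w_of (x \<epsilon> (T \<epsilon>))) \<in> O[at_right 0](\<lambda>\<epsilon>. \<epsilon>)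
                \<and> (\<exists>C. \<forall>\<^sub>F \<epsilon> in at_right 0. \<forall>t\<in>{0..T \<epsilon>}.
                      \<bar>y_of (x \<epsilon> t)\<bar> \<le> C * \<epsilon>\<^sup>2
                      \<and> \<bar>F_N \<epsilon> \<delta> (y_of (x \<epsilon> t)) (w_of (x \<epsilon> t))\<bar> \<le> C)))))"
proof -
  interpret impact \<alpha> \<mu> \<delta> \<theta>0 \<phi>0 v0 by unfold_locales (use assms in auto)
  note st = start_def[symmetric]
  let ?L = "\<lambda>K \<epsilon>::real. K * (\<epsilon> * ln (1 / \<epsilon>))"
  have star: "w1_star \<alpha> \<mu> \<delta> \<theta>0 \<phi>0 < 0" unfolding w1_star_eq using signs(2) l_pos by simp
  have I: "\<exists>K>0.
          (\<forall>\<^sub>F \<epsilon> in at_right 0.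
             \<exists>x. forward_solution \<alpha> \<mu> \<delta> \<epsilon> (start \<epsilon> w10 \<theta>0 \<phi>0 v0) (K * (\<epsilon> * ln (1 / \<epsilon>))) x)
          \<and> (\<forall>x. (\<forall>\<^sub>F \<epsilon> in at_right 0.
                     forward_solution \<alpha> \<mu> \<delta> \<epsilon> (start \<epsilon> w10 \<theta>0 \<phi>0 v0) (K * (\<epsilon> * ln (1 / \<epsilon>))) (x \<epsilon>)) \<longrightarrow>
              (\<exists>T.
                (\<forall>\<^sub>F \<epsilon> in at_right 0. returns_at (K * (\<epsilon> * ln (1 / \<epsilon>))) (x \<epsilon>) (T \<epsilon>))
                \<and> T \<in> O[at_right 0](\<lambda>\<epsilon>. \<epsilon> * ln (1 / \<epsilon>))
                \<and> ((\<lambda>\<epsilon>. w_of (x \<epsilon> (T \<epsilon>))) \<longlongrightarrow> e_fun \<alpha> \<mu> \<delta> \<theta>0 * v0) (at_right 0)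
                \<and> ((\<lambda>\<epsilon>. theta_of (x \<epsilon> (T \<epsilon>))) \<longlongrightarrow> \<theta>0) (at_right 0)
                \<and> ((\<lambda>\<epsilon>. phi_of (x \<epsilon> (T \<epsilon>))) \<longlongrightarrow>
                     \<phi>0 + (- (coef_c \<alpha> \<mu> 1 \<theta>0 / coef_q \<alpha> \<mu> 1 \<theta>0)
                           + S_phi \<alpha> \<mu> \<theta>0 / S_w \<alpha> \<mu> \<theta>0
                             * (e_fun \<alpha> \<mu> \<delta> \<theta>0 + coef_p \<alpha> \<mu> 1 \<theta>0 / coef_q \<alpha> \<mu> 1 \<theta>0)) * v0)
                   (at_right 0)
                \<and> ((\<lambda>\<epsilon>. v_of (x \<epsilon> (T \<epsilon>))) \<longlongrightarrow> 0) (at_right 0)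
                \<and> (\<exists>C. \<forall>\<^sub>F \<epsilon> in at_right 0. \<forall>t\<in>{0..T \<epsilon>}.
                      \<bar>y_of (x \<epsilon> t)\<bar> \<le> C * \<epsilon>
                      \<and> \<bar>w_of (x \<epsilon> t)\<bar> \<le> C
                      \<and> \<bar>F_N \<epsilon> \<delta> (y_of (x \<epsilon> t)) (w_of (x \<epsilon> t))\<bar> \<le> C * (1 / \<epsilon>))))"
    if w: "w10 < w1_star \<alpha> \<mu> \<delta> \<theta>0 \<phi>0"
  proof -
    let ?fe = "\<phi>0 + (- (c / q) + Sph / S * (e_fun \<alpha> \<mu> \<delta> \<theta>0 + p / q)) * v0"
    obtain K C where K: "0 < K" and ex: "\<forall>\<^sub>F \<epsilon> in at_right 0. \<exists>x. forward_solution \<alpha> \<mu> \<delta> \<epsilon> (start \<epsilon> w10 \<theta>0 \<phi>0 v0) (?L K \<epsilon>) x"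
      and ret: "\<forall>\<eta>>0. \<forall>\<^sub>F \<epsilon> in at_right 0. \<forall>x. forward_solution \<alpha> \<mu> \<delta> \<epsilon> (start \<epsilon> w10 \<theta>0 \<phi>0 v0) (?L K \<epsilon>) x \<longrightarrow>
        (\<exists>T. returned C \<eta> \<epsilon> (?L K \<epsilon>) x T)"
      using impact_return[OF w[unfolded w1_star_eq]] by (elim exE conjE) (rule that)
    show ?thesis
    proof (intro exI[of _ K] conjI K ex allI impI)
      fix x assume fs: "\<forall>\<^sub>F \<epsilon> in at_right 0. forward_solution \<alpha> \<mu> \<delta> \<epsilon> (start \<epsilon> w10 \<theta>0 \<phi>0 v0) (?L K \<epsilon>) (x \<epsilon>)"
      \<comment> \<open>Chosen by the return property alone, without a tolerance, so that the same T
        can be used for every accuracy.\<close>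
      define T where "T \<epsilon> = (SOME T. returns_at (?L K \<epsilon>) (x \<epsilon>) T)" for \<epsilon>
      have props: "\<forall>\<^sub>F \<epsilon> in at_right 0. returned C \<eta> \<epsilon> (?L K \<epsilon>) (x \<epsilon>) (T \<epsilon>)" if "0 < \<eta>" for \<eta>
        using ret[THEN spec, THEN mp, OF that] fs
      proof eventually_elim
        case (elim \<epsilon>)
        obtain T' where T': "returned C \<eta> \<epsilon> (?L K \<epsilon>) (x \<epsilon>) T'" using elim by blast
        then have r: "returns_at (?L K \<epsilon>) (x \<epsilon>) T'" by (simp add: returned_def)
        have "T \<epsilon> = T'"
          unfolding T_def by (rule some_equality, rule r, erule returns_at_unique[OF _ r])
        then show ?case using T' by simp
      qed
      show "\<exists>T. (\<forall>\<^sub>F \<epsilon> in at_right 0. returns_at (?L K \<epsilon>) (x \<epsilon>) (T \<epsilon>))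
                \<and> T \<in> O[at_right 0](\<lambda>\<epsilon>. \<epsilon> * ln (1 / \<epsilon>))
                \<and> ((\<lambda>\<epsilon>. w_of (x \<epsilon> (T \<epsilon>))) \<longlongrightarrow> e_fun \<alpha> \<mu> \<delta> \<theta>0 * v0) (at_right 0)
                \<and> ((\<lambda>\<epsilon>. theta_of (x \<epsilon> (T \<epsilon>))) \<longlongrightarrow> \<theta>0) (at_right 0)
                \<and> ((\<lambda>\<epsilon>. phi_of (x \<epsilon> (T \<epsilon>))) \<longlongrightarrow> ?fe) (at_right 0)
                \<and> ((\<lambda>\<epsilon>. v_of (x \<epsilon> (T \<epsilon>))) \<longlongrightarrow> 0) (at_right 0)
                \<and> (\<exists>C. \<forall>\<^sub>F \<epsilon> in at_right 0. \<forall>t\<in>{0..T \<epsilon>}.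
                      \<bar>y_of (x \<epsilon> t)\<bar> \<le> C * \<epsilon>
                      \<and> \<bar>w_of (x \<epsilon> t)\<bar> \<le> C
                      \<and> \<bar>F_N \<epsilon> \<delta> (y_of (x \<epsilon> t)) (w_of (x \<epsilon> t))\<bar> \<le> C * (1 / \<epsilon>))"
      proof (rule exI[of _ T], intro conjI)
        note props = props[unfolded returned_def]
        note p1 = props[OF zero_less_one]
        show ev: "\<forall>\<^sub>F \<epsilon> in at_right 0. returns_at (?L K \<epsilon>) (x \<epsilon>) (T \<epsilon>)" using p1 by eventually_elim blast
        show "T \<in> O[at_right 0](\<lambda>\<epsilon>. \<epsilon> * ln (1 / \<epsilon>))"
        proof (rule bigoI[of _ K], use ev in eventually_elim)
          case (elim \<epsilon>)
          then have "0 < T \<epsilon>" "T \<epsilon> \<le> ?L K \<epsilon>" by (auto simp: returns_at_def)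
          moreover have "?L K \<epsilon> \<le> K * \<bar>\<epsilon> * ln (1 / \<epsilon>)\<bar>" using K by (intro mult_left_mono abs_ge_self) auto
          ultimately show ?case by simp
        qed
        show "((\<lambda>\<epsilon>. w_of (x \<epsilon> (T \<epsilon>))) \<longlongrightarrow> e_fun \<alpha> \<mu> \<delta> \<theta>0 * v0) (at_right 0)"
          by (rule tendsto_of_abs_le, drule props, erule eventually_mono, elim conjE, assumption)
        show "((\<lambda>\<epsilon>. theta_of (x \<epsilon> (T \<epsilon>))) \<longlongrightarrow> \<theta>0) (at_right 0)"
          by (rule tendsto_of_abs_le, drule props, erule eventually_mono, elim conjE, assumption)
        show "((\<lambda>\<epsilon>. phi_of (x \<epsilon> (T \<epsilon>))) \<longlongrightarrow> ?fe) (at_right 0)"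
          by (rule tendsto_of_abs_le, drule props, erule eventually_mono, elim conjE, assumption)
        show "((\<lambda>\<epsilon>. v_of (x \<epsilon> (T \<epsilon>))) \<longlongrightarrow> 0) (at_right 0)"
          by (rule tendsto_of_abs_le, drule props, erule eventually_mono, simp)
        show "\<exists>C. \<forall>\<^sub>F \<epsilon> in at_right 0. \<forall>t\<in>{0..T \<epsilon>}. \<bar>y_of (x \<epsilon> t)\<bar> \<le> C * \<epsilon> \<and> \<bar>w_of (x \<epsilon> t)\<bar> \<le> C
                      \<and> \<bar>F_N \<epsilon> \<delta> (y_of (x \<epsilon> t)) (w_of (x \<epsilon> t))\<bar> \<le> C * (1 / \<epsilon>)"
          by (rule exI[of _ C]) (use p1 in \<open>eventually_elim, blast\<close>)
      qed
    qed
  qed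
  have II: "\<exists>K>0.
          (\<forall>\<^sub>F \<epsilon> in at_right 0. \<exists>x. forward_solution \<alpha> \<mu> \<delta> \<epsilon> (start \<epsilon> w10 \<theta>0 \<phi>0 v0) (K * \<epsilon>) x)
          \<and> (\<forall>x. (\<forall>\<^sub>F \<epsilon> in at_right 0. forward_solution \<alpha> \<mu> \<delta> \<epsilon> (start \<epsilon> w10 \<theta>0 \<phi>0 v0) (K * \<epsilon>) (x \<epsilon>)) \<longrightarrow>
              (\<exists>T.
                (\<forall>\<^sub>F \<epsilon> in at_right 0. lifts_off_at (K * \<epsilon>) (x \<epsilon>) (T \<epsilon>))
                \<and> T \<in> O[at_right 0](\<lambda>\<epsilon>. \<epsilon>)
                \<and> (\<lambda>\<epsilon>. w_of (x \<epsilon> (T \<epsilon>))) \<in> O[at_right 0](\<lambda>\<epsilon>. \<epsilon>)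
                \<and> (\<exists>C. \<forall>\<^sub>F \<epsilon> in at_right 0. \<forall>t\<in>{0..T \<epsilon>}.
                      \<bar>y_of (x \<epsilon> t)\<bar> \<le> C * \<epsilon>\<^sup>2
                      \<and> \<bar>F_N \<epsilon> \<delta> (y_of (x \<epsilon> t)) (w_of (x \<epsilon> t))\<bar> \<le> C)))"
    if w: "w10 > w1_star \<alpha> \<mu> \<delta> \<theta>0 \<phi>0"
  proof -
    obtain K C where K: "0 < K" and ex: "\<forall>\<^sub>F \<epsilon> in at_right 0. \<exists>x. forward_solution \<alpha> \<mu> \<delta> \<epsilon> (start \<epsilon> w10 \<theta>0 \<phi>0 v0) (K * \<epsilon>) x"
      and ret: "\<forall>\<^sub>F \<epsilon> in at_right 0. \<forall>x. forward_solution \<alpha> \<mu> \<delta> \<epsilon> (start \<epsilon> w10 \<theta>0 \<phi>0 v0) (K * \<epsilon>) x \<longrightarrow>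
        (\<exists>T. lifted C \<epsilon> (K * \<epsilon>) x T)"
      using impact_lift_off[OF w[unfolded w1_star_eq]] by (elim exE conjE) (rule that)
    show ?thesis
    proof (intro exI[of _ K] conjI K ex allI impI)
      fix x assume fs: "\<forall>\<^sub>F \<epsilon> in at_right 0. forward_solution \<alpha> \<mu> \<delta> \<epsilon> (start \<epsilon> w10 \<theta>0 \<phi>0 v0) (K * \<epsilon>) (x \<epsilon>)"
      let ?P = "\<lambda>\<epsilon>. lifted C \<epsilon> (K * \<epsilon>) (x \<epsilon>)"
      \<comment> \<open>Only O-bounds with a fixed constant are claimed here, so T may be chosen by
        the complete property and no uniqueness is required.\<close>
      define T where "T \<epsilon> = (SOME T. ?P \<epsilon> T)" for \<epsilon>
      have props: "\<forall>\<^sub>F \<epsilon> in at_right 0. 0 < \<epsilon> \<and> ?P \<epsilon> (T \<epsilon>)"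
        using ret fs eventually_at_right_0[OF zero_less_one]
      proof eventually_elim
        case (elim \<epsilon>)
        have "?P \<epsilon> (T \<epsilon>)" unfolding T_def by (rule someI_ex) (rule elim(1)[THEN spec, THEN mp, OF elim(2)])
        then show ?case using elim(3) by blast
      qed
      show "\<exists>T. (\<forall>\<^sub>F \<epsilon> in at_right 0. lifts_off_at (K * \<epsilon>) (x \<epsilon>) (T \<epsilon>))
                \<and> T \<in> O[at_right 0](\<lambda>\<epsilon>. \<epsilon>)
                \<and> (\<lambda>\<epsilon>. w_of (x \<epsilon> (T \<epsilon>))) \<in> O[at_right 0](\<lambda>\<epsilon>. \<epsilon>)
                \<and> (\<exists>C. \<forall>\<^sub>F \<epsilon> in at_right 0. \<forall>t\<in>{0..T \<epsilon>}.
                      \<bar>y_of (x \<epsilon> t)\<bar> \<le> C * \<epsilon>\<^sup>2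
                      \<and> \<bar>F_N \<epsilon> \<delta> (y_of (x \<epsilon> t)) (w_of (x \<epsilon> t))\<bar> \<le> C)"
      proof (rule exI[of _ T], intro conjI)
        note props = props[unfolded lifted_def]
        show "\<forall>\<^sub>F \<epsilon> in at_right 0. lifts_off_at (K * \<epsilon>) (x \<epsilon>) (T \<epsilon>)" using props by eventually_elim blast
        show "T \<in> O[at_right 0](\<lambda>\<epsilon>. \<epsilon>)"
          by (rule bigoI[of _ K]) (use props in \<open>eventually_elim, simp add: lifts_off_at_def\<close>)
        show "(\<lambda>\<epsilon>. w_of (x \<epsilon> (T \<epsilon>))) \<in> O[at_right 0](\<lambda>\<epsilon>. \<epsilon>)"
          by (rule bigoI[of _ C]) (use props in \<open>eventually_elim, simp\<close>)
        show "\<exists>C. \<forall>\<^sub>F \<epsilon> in at_right 0. \<forall>t\<in>{0..T \<epsilon>}. \<bar>y_of (x \<epsilon> t)\<bar> \<le> C * \<epsilon>\<^sup>2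
            \<and> \<bar>F_N \<epsilon> \<delta> (y_of (x \<epsilon> t)) (w_of (x \<epsilon> t))\<bar> \<le> C"
          by (rule exI[of _ C]) (use props in \<open>eventually_elim, blast\<close>)
      qed
    qed
  qed
  show ?thesis unfolding st
    by (intro conjI impI star I II e_fun_smooth[OF par(1,2) signs(1)] disjI2 e_fun_antimono[OF par(1,2) signs(1,3)]
      e_fun_large[OF par(1,2) signs(1,3), unfolded coef_ratio_large[OF par(1,2) signs(3,4)]]
      e_fun_small[OF par(1,2) signs(1,3), unfolded coef_ratio_small[OF par(1,2) signs(1,3,4)]])
qed

end
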